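(* Let $\ell>0$ and $t_1,\dots,t_\ell$ be variables, and apply $\mathcal F_{\mathrm{Sur}}^{-1}$ coefficientwise to elements of $\Lambda[[t_1,\dots,t_\ell]]$. (a) For a word $w=i_1\cdots i_n$ over $[\ell]=\{1,\dots,\ell\}$ let $t^w=t_{i_1}\cdots t_{i_n}$. Then \[\mathcal F_{\mathrm{Sur}}^{-1}\Bigl\{\frac1{\prod_{i=1}^\ell H(t_i)}\Bigr\}=\frac1{\prod_{w\in\mathrm{Lyndon}([\ell])}H(t^w)}.\] (b) For a word $w=(i_1,j_1)\cdots(i_n,j_n)$ over $[\ell]^2$ (ordered lexicographically) let $t^w=(t_{i_1}t_{j_1})\cdots(t_{i_n}t_{j_n})$. Then \[\mathcal F_{\mathrm{Sur}}^{-1}\Bigl\{\prod_{i=1}^\ell H(t_i)\Bigr\}=\frac{\prod_{w\in\mathrm{Lyndon}([\ell])}H(t^w)}{\prod_{w\in\mathrm{Lyndon}([\ell]^2)}H(t^w)}.\]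
   Context: $\Lambda$ is the ring of symmetric functions over $\mathbb Z$, $\overline\Lambda$ the ring of symmetric power series. $r_\lambda^\mu=\dim\operatorname{Hom}_{\mathfrak S_n}(V_\mu,\mathbb{S}^\lambda\mathbb{C}^n)$ with $n=|\mu|$ ($V_\mu$ Specht module, $\mathbb{S}^\lambda$ Schur functor, $\mathfrak S_n$ acting by permutation matrices); $\mathcal F\colon\Lambda\to\overline\Lambda$ is the additive map with $\mathcal{F}\{s_\lambda\}=\sum_\mu r_\lambda^\mu s_\mu$. With $H=1+h_1+h_2+\cdots$, $\mathcal F_{\mathrm{Sur}}\{f\}\in\Lambda$ is the unique element with $\mathcal F\{f\}=\mathcal F_{\mathrm{Sur}}\{f\}\cdot H$; $\mathcal F_{\mathrm{Sur}}\colon\Lambda\to\Lambda$ is bijective with inverse $\mathcal F_{\mathrm{Sur}}^{-1}$. $H(t)=\sum_{n\ge0}h_nt^n$. For a totally ordered set $A$, a Lyndon word is a nonempty word $w_1\cdots w_n$ over $A$ that is lexicographically strictly smaller than each proper suffix $w_i\cdots w_n$ ($i\ge2$); $\mathrm{Lyndon}(A)$ is the set of Lyndon words over $A$. *)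

theory Defs
  imports Complex_Main "HOL-Library.Function_Algebras" "HOL-Combinatorics.Permutations"
begin

text \<open>A monomial is an exponent vector; only finitely supported ones are genuine monomials.\<close>
type_synonym mono = "nat \<Rightarrow> nat"

definition fin_mono :: "mono \<Rightarrow> bool" where
  "fin_mono \<alpha> \<longleftrightarrow> finite {i. \<alpha> i \<noteq> 0}"

definition deg :: "mono \<Rightarrow> nat" where
  "deg \<alpha> = sum \<alpha> {i. \<alpha> i \<noteq> 0}"

definition conv :: "('a \<Rightarrow> 'b \<Rightarrow> 'c::comm_monoid_add) \<Rightarrow> (mono \<Rightarrow> 'a) \<Rightarrow> (mono \<Rightarrow> 'b) \<Rightarrow> mono \<Rightarrow> 'c" where
  "conv m f g \<alpha> = (if fin_mono \<alpha> then (\<Sum>\<beta>\<in>{\<beta>. \<beta> \<le> \<alpha>}. m (f \<beta>) (g (\<alpha> - \<beta>))) else 0)"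

text \<open>Integer power series in x_0, x_1, ... (ambient ring of symmetric functions).\<close>
type_synonym sym = "mono \<Rightarrow> int"

definition smult_s :: "sym \<Rightarrow> sym \<Rightarrow> sym" where
  "smult_s = conv (*)"

definition one_s :: sym where
  "one_s = (\<lambda>\<beta>. if \<beta> = 0 then 1 else 0)"

definition is_symmetric :: "sym \<Rightarrow> bool" where
  "is_symmetric f \<longleftrightarrow> (\<forall>\<alpha>. \<not> fin_mono \<alpha> \<longrightarrow> f \<alpha> = 0) \<and> (\<forall>\<alpha> \<sigma>. bij \<sigma> \<longrightarrow> f (\<alpha> \<circ> \<sigma>) = f \<alpha>)"

definition Lambda_bar :: "sym set" where
  "Lambda_bar = {f. is_symmetric f}"

definition Lambda :: "sym set" where
  "Lambda = {f. is_symmetric f \<and> (\<exists>d. \<forall>\<alpha>. f \<alpha> \<noteq> 0 \<longrightarrow> deg \<alpha> \<le> d)}"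

definition hfun :: "nat \<Rightarrow> sym" where
  "hfun n = (\<lambda>\<beta>. if fin_mono \<beta> \<and> deg \<beta> = n then 1 else 0)"

definition Hsym :: sym where
  "Hsym = (\<lambda>\<beta>. hfun (deg \<beta>) \<beta>)"

definition is_partition :: "nat list \<Rightarrow> bool" where
  "is_partition la \<longleftrightarrow> sorted_wrt (\<ge>) la \<and> 0 \<notin> set la"

definition cells :: "nat list \<Rightarrow> (nat \<times> nat) set" where
  "cells la = {(i, j). i < length la \<and> j < la ! i}"

definition ssyt :: "nat list \<Rightarrow> (nat \<times> nat \<Rightarrow> nat) \<Rightarrow> bool" where
  "ssyt la T \<longleftrightarrow>
     (\<forall>i j. (i, j) \<in> cells la \<longrightarrow> (i, Suc j) \<in> cells la \<longrightarrow> T (i, j) \<le> T (i, Suc j)) \<and>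
     (\<forall>i j. (i, j) \<in> cells la \<longrightarrow> (Suc i, j) \<in> cells la \<longrightarrow> T (i, j) < T (Suc i, j)) \<and>
     (\<forall>c. c \<notin> cells la \<longrightarrow> T c = 0)"

definition schur :: "nat list \<Rightarrow> sym" where
  "schur la = (\<lambda>\<alpha>. if fin_mono \<alpha> then
      int (card {T. ssyt la T \<and> (\<forall>k. card {c \<in> cells la. T c = k} = \<alpha> k)}) else 0)"

definition Sym_grp :: "nat \<Rightarrow> (nat \<Rightarrow> nat) set" where
  "Sym_grp n = {\<sigma>. \<sigma> permutes {0..<n}}"

text \<open>Cells of lambda are filled with 0, ..., |lambda|-1 row by row.\<close>
definition pos :: "nat list \<Rightarrow> nat \<times> nat \<Rightarrow> nat" where
  "pos la c = sum_list (take (fst c) la) + snd c"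

definition row_grp :: "nat list \<Rightarrow> (nat \<Rightarrow> nat) set" where
  "row_grp la = {p. p permutes {0..<sum_list la} \<and>
     (\<forall>c\<in>cells la. \<exists>j. (fst c, j) \<in> cells la \<and> p (pos la c) = pos la (fst c, j))}"

definition col_grp :: "nat list \<Rightarrow> (nat \<Rightarrow> nat) set" where
  "col_grp la = {q. q permutes {0..<sum_list la} \<and>
     (\<forall>c\<in>cells la. \<exists>i. (i, snd c) \<in> cells la \<and> q (pos la c) = pos la (i, snd c))}"

text \<open>Group algebra C[S_n] (functions on S_n), left regular action, and the Specht module
  V_mu = C[S_n] c_mu with Young symmetrizer c_mu = (sum_p p)(sum_q sgn(q) q).\<close>
definition regact :: "(nat \<Rightarrow> nat) \<Rightarrow> ((nat \<Rightarrow> nat) \<Rightarrow> complex) \<Rightarrow> ((nat \<Rightarrow> nat) \<Rightarrow> complex)" where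
  "regact \<sigma> x = (\<lambda>\<tau>. x (inv \<sigma> \<circ> \<tau>))"

definition specht :: "nat list \<Rightarrow> ((nat \<Rightarrow> nat) \<Rightarrow> complex) set" where
  "specht mu = {(\<lambda>\<rho>. \<Sum>p\<in>row_grp mu. \<Sum>q\<in>col_grp mu. of_int (sign q) * x (\<rho> \<circ> inv q \<circ> inv p)) | x.
                 \<forall>\<tau>. \<tau> \<notin> Sym_grp (sum_list mu) \<longrightarrow> x \<tau> = 0}"

text \<open>Tensor power (C^n)^{\<otimes>k}: coefficient functions on words of length k over {0..<n};
  S_n acts by permutation matrices on every tensor factor.\<close>
definition tensors :: "nat \<Rightarrow> nat \<Rightarrow> (nat list \<Rightarrow> complex) set" where
  "tensors k n = {v. \<forall>w. \<not> (length w = k \<and> set w \<subseteq> {0..<n}) \<longrightarrow> v w = 0}"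

definition tensact :: "(nat \<Rightarrow> nat) \<Rightarrow> (nat list \<Rightarrow> complex) \<Rightarrow> (nat list \<Rightarrow> complex)" where
  "tensact \<sigma> v = (\<lambda>w. v (map (inv \<sigma>) w))"

text \<open>Schur functor S^lambda C^n: image of the Young symmetrizer of lambda acting on
  (C^n)^{\<otimes>|lambda|} by place permutations.\<close>
definition schur_module :: "nat list \<Rightarrow> nat \<Rightarrow> (nat list \<Rightarrow> complex) set" where
  "schur_module la n = {(\<lambda>w. \<Sum>q\<in>col_grp la. \<Sum>p\<in>row_grp la. of_int (sign q) * v (permute_list (q \<circ> p) w)) | v.
                          v \<in> tensors (sum_list la) n}"

text \<open>The complex vector space Hom_G(V, W) of G-equivariant linear maps V \<rightarrow> W
  (maps are normalised to be 0 outside V) and its dimension.\<close>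
definition hom_space :: "'g set \<Rightarrow> ('g \<Rightarrow> ('x \<Rightarrow> complex) \<Rightarrow> ('x \<Rightarrow> complex)) \<Rightarrow> ('x \<Rightarrow> complex) set
    \<Rightarrow> ('g \<Rightarrow> ('y \<Rightarrow> complex) \<Rightarrow> ('y \<Rightarrow> complex)) \<Rightarrow> ('y \<Rightarrow> complex) set
    \<Rightarrow> (('x \<Rightarrow> complex) \<Rightarrow> ('y \<Rightarrow> complex)) set" where
  "hom_space G a V b W = {f.
      (\<forall>x\<in>V. f x \<in> W) \<and>
      (\<forall>x\<in>V. \<forall>y\<in>V. f (x + y) = f x + f y) \<and>
      (\<forall>c. \<forall>x\<in>V. f (\<lambda>i. c * x i) = (\<lambda>j. c * f x j)) \<and>
      (\<forall>x. x \<notin> V \<longrightarrow> f x = 0) \<and>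
      (\<forall>g\<in>G. \<forall>x\<in>V. f (a g x) = b g (f x))}"

definition hom_dim :: "'g set \<Rightarrow> ('g \<Rightarrow> ('x \<Rightarrow> complex) \<Rightarrow> ('x \<Rightarrow> complex)) \<Rightarrow> ('x \<Rightarrow> complex) set
    \<Rightarrow> ('g \<Rightarrow> ('y \<Rightarrow> complex) \<Rightarrow> ('y \<Rightarrow> complex)) \<Rightarrow> ('y \<Rightarrow> complex) set \<Rightarrow> nat" where
  "hom_dim G a V b W = vector_space.dim (\<lambda>c f. \<lambda>x y. c * f x y) (hom_space G a V b W)"

definition rcoef :: "nat list \<Rightarrow> nat list \<Rightarrow> nat" where
  "rcoef la mu = hom_dim (Sym_grp (sum_list mu)) regact (specht mu)
                        tensact (schur_module la (sum_list mu))"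

definition Fs :: "nat list \<Rightarrow> sym" where
  "Fs la = (\<lambda>\<alpha>. \<Sum>mu\<in>{mu. is_partition mu \<and> sum_list mu = deg \<alpha>}. int (rcoef la mu) * schur mu \<alpha>)"

text \<open>F: the additive map Lambda \<rightarrow> Lambda bar determined by its values on Schur functions
  (normalised to 0 outside Lambda).\<close>
definition Fmap :: "sym \<Rightarrow> sym" where
  "Fmap = (THE \<Phi>. (\<forall>f\<in>Lambda. \<forall>g\<in>Lambda. \<Phi> (f + g) = \<Phi> f + \<Phi> g) \<and>
                  (\<forall>la. is_partition la \<longrightarrow> \<Phi> (schur la) = Fs la) \<and>
                  (\<forall>f. f \<notin> Lambda \<longrightarrow> \<Phi> f = 0))"

definition FSur :: "sym \<Rightarrow> sym" where
  "FSur f = (THE g. g \<in> Lambda \<and> Fmap f = smult_s g Hsym)"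

definition FSur_inv :: "sym \<Rightarrow> sym" where
  "FSur_inv = inv_into Lambda FSur"

type_synonym tser = "mono \<Rightarrow> sym"

definition tmult :: "tser \<Rightarrow> tser \<Rightarrow> tser" where
  "tmult = conv smult_s"

definition tone :: tser where
  "tone = (\<lambda>\<alpha>. if \<alpha> = 0 then one_s else 0)"

definition wf_t :: "tser \<Rightarrow> bool" where
  "wf_t X \<longleftrightarrow> (\<forall>\<alpha>. (\<not> fin_mono \<alpha> \<longrightarrow> X \<alpha> = 0) \<and> (\<forall>\<beta>. \<not> fin_mono \<beta> \<longrightarrow> X \<alpha> \<beta> = 0))"

definition tinv :: "tser \<Rightarrow> tser" where
  "tinv X = (THE Y. wf_t Y \<and> tmult X Y = tone)"

definition tdiv :: "tser \<Rightarrow> tser \<Rightarrow> tser" where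
  "tdiv X Y = tmult X (tinv Y)"

text \<open>H(t^c) = sum_n h_n (t^c)^n for a nonzero monomial t^c.\<close>
definition Ht :: "mono \<Rightarrow> tser" where
  "Ht c = (\<lambda>\<alpha>. if (\<exists>n. \<alpha> = (\<lambda>i. n * c i)) then hfun (SOME n. \<alpha> = (\<lambda>i. n * c i)) else 0)"

definition tvar :: "nat \<Rightarrow> mono" where
  "tvar i = (\<lambda>j. if j = i then 1 else 0)"

definition tprod_set :: "'w set \<Rightarrow> ('w \<Rightarrow> tser) \<Rightarrow> tser" where
  "tprod_set S F = Finite_Set.fold (\<lambda>w acc. tmult (F w) acc) tone S"

text \<open>Infinite product of H(t^w) over a set of (nonempty) words: its coefficient at t^alpha
  is that of the finite partial product over words of length at most deg alpha.\<close>
definition tprod_inf :: "'a list set \<Rightarrow> ('a list \<Rightarrow> mono) \<Rightarrow> tser" where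
  "tprod_inf W m = (\<lambda>\<alpha>. tprod_set {w \<in> W. length w \<le> deg \<alpha>} (\<lambda>w. Ht (m w)) \<alpha>)"

text \<open>Words over A, totally ordered by the strict order r; lexicographic order with
  proper prefixes smaller (lexord).\<close>
definition Lyndon :: "('a \<times> 'a) set \<Rightarrow> 'a set \<Rightarrow> 'a list set" where
  "Lyndon r A = {w. w \<noteq> [] \<and> set w \<subseteq> A \<and>
                  (\<forall>i. 0 < i \<and> i < length w \<longrightarrow> (w, drop i w) \<in> lexord r)}"

definition nat_less :: "(nat \<times> nat) set" where
  "nat_less = {(a, b). a < b}"

definition lexpair_less :: "((nat \<times> nat) \<times> (nat \<times> nat)) set" where
  "lexpair_less = {((a, b), (c, d)). a < c \<or> (a = c \<and> b < d)}"

definition tmon :: "nat list \<Rightarrow> mono" where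
  "tmon w = (\<lambda>i. count_list w i)"

definition tmon2 :: "(nat \<times> nat) list \<Rightarrow> mono" where
  "tmon2 w = (\<lambda>i. count_list (concat (map (\<lambda>(a, b). [a, b]) w)) i)"

end

(* Evaluating a symmetric function f at the permutation tau of n letters, by letting tau act on the
Schur functor of f at C^n, is a ring homomorphism psi, and by Young's rule the coefficient of x^alpha
in F f is the average of psi f over the Young subgroup of alpha. On series in t with
psi(Z) = prod_o U(|o|), o running over the cycles of tau, these averages form a series G_U which is
multiplicative: G_(U+V) = G_U G_V. Here psi(H(t^c)) = prod_o 1/(1 - t^(|o| c)), G_1 = H, and G_p is
the product Q of the H(t_i), where p(k) = sum_i t_i^k. The unique factorisation of words into
nonincreasing Lyndon words makes the product of 1 - t^(k w) over Lyndon words w equal to 1 - p(k),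
or 1 - p(k)^2 for the alphabet of pairs. So the right hand side of (a) has U = 1 - p and that of (b)
has U = (1 - p^2)/(1 - p) = 1 + p; hence F maps them to H/Q and H Q. Finally F/H is well defined and
injective because it fixes the part of highest degree. *)
theory Submission
  imports Defs "HOL-Library.FuncSet" "HOL-Library.Multiset" "HOL-Library.List_Lexorder" "HOL-Library.Product_Lexorder"
    "HOL-Combinatorics.Orbits"
begin

section \<open>Power series in infinitely many variables\<close>

text \<open>The numbers \<open>rcoef\<close> are dimensions of Hom spaces, whereas the series only
  see counts. A Hom space out of V_mu is the common image of two commuting idempotents on a tensor
  power, and its dimension is the trace of a matrix built from permutations of words; so
  \<open>rcoef\<close> becomes a sum of fixed-point counts weighted by two Young symmetrizers.
  Young's rule is then proved without irreducible characters. The form taking x and y to the trace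
  of z -> x z y* on the group algebra makes the normalised Young symmetrizers orthonormal; the
  pairing of two Young subgroups counts double cosets and is therefore a sum of products of Kostka
  numbers; triangularity leaves the Kostka numbers as the only possible coordinates. The rule is
  used twice: for S_n on letters to express F, and for S_k on places to evaluate products of
  complete functions. The evaluation is prescribed on Schur functions, as F is, but its
  multiplicativity shows only on products of complete functions, so the integral passage between
  both bases is essential. Infinite products are treated modulo each total degree.\<close>

lemma fin_mono_zero [simp]: "fin_mono 0"
  by (simp add: fin_mono_def)

lemma fin_mono_le: "fin_mono b \<Longrightarrow> a \<le> b \<Longrightarrow> fin_mono a"
  unfolding fin_mono_def le_fun_def by (erule finite_subset[rotated], rule Collect_mono) (metis le_zero_eq)

lemma fin_mono_add [simp]: "fin_mono (a + b) \<longleftrightarrow> fin_mono a \<and> fin_mono b"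
proof -
  have "{i. (a + b) i \<noteq> 0} = {i. a i \<noteq> 0} \<union> {i. b i \<noteq> 0}" by auto
  then show ?thesis by (simp add: fin_mono_def)
qed

lemma mono_diff_le: "(a::mono) - b \<le> a"
  by (simp add: le_fun_def)

lemma fin_mono_diff: "fin_mono a \<Longrightarrow> fin_mono (a - b)"
  using fin_mono_le mono_diff_le by blast

lemma mono_add_diff: "(b::mono) \<le> a \<Longrightarrow> b + (a - b) = a"
  by (simp add: le_fun_def fun_eq_iff)

lemma mono_diff_diff: "\<forall>x. b x \<le> a x \<Longrightarrow> (a::mono) - (a - b) = b"
  by (simp add: fun_eq_iff)

lemma mono_diff_chain:
  "\<forall>x. b x \<le> a x \<Longrightarrow> \<forall>x. c x \<le> b x \<Longrightarrow> (a::mono) - c - (b - c) = a - b"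
  by (simp add: fun_eq_iff)

lemma mono_trans: "\<forall>x. b x \<le> a x \<Longrightarrow> \<forall>x. c x \<le> b x \<Longrightarrow> c x \<le> (a::mono) x"
  using order_trans by blast

lemma mono_sum_le:
  fixes a b c :: mono
  assumes "\<forall>x. b x \<le> a x" "\<forall>x. c x \<le> a x - b x"
  shows "b x + c x \<le> a x"
  using assms(1)[rule_format, of x] assms(2)[rule_format, of x] by linarith

lemma mono_sum_diff: "(b + c) - b = (c::mono)"
  by (simp add: fun_eq_iff)

lemma mono_diff_sum: "\<forall>x. b x \<le> a x \<Longrightarrow> b + (a - b) = (a::mono)"
  by (simp add: fun_eq_iff)

lemma finite_mono_le: "fin_mono a \<Longrightarrow> finite {b. b \<le> a}"
proof -
  assume a: "fin_mono a"
  let ?S = "{i. a i \<noteq> 0}"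
  have S: "finite ?S" using a by (simp add: fin_mono_def)
  have "finite {f. \<forall>x. (x \<in> ?S \<longrightarrow> f x \<in> {..Max (a ` ?S)}) \<and> (x \<notin> ?S \<longrightarrow> f x = (0::nat))}"
    by (rule finite_set_of_finite_funs) (use S in auto)
  moreover have "{b. b \<le> a} \<subseteq> {f. \<forall>x. (x \<in> ?S \<longrightarrow> f x \<in> {..Max (a ` ?S)}) \<and> (x \<notin> ?S \<longrightarrow> f x = (0::nat))}"
  proof (intro subsetI CollectI allI conjI impI)
    fix b x assume b: "b \<in> {b. b \<le> a}"
    show "b x \<in> {..Max (a ` ?S)}" if x: "x \<in> ?S"
    proof -
      have "b x \<le> a x" using b by (simp add: le_fun_def)
      also have "a x \<le> Max (a ` ?S)" by (rule Max_ge) (use S x in auto)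
      finally show ?thesis by simp
    qed
    show "b x = 0" if "x \<notin> ?S"
      using b that by (simp add: le_fun_def) (metis le_zero_eq)
  qed
  ultimately show ?thesis by (rule finite_subset[rotated])
qed

lemma deg_eq_sum: "finite S \<Longrightarrow> {i. a i \<noteq> 0} \<subseteq> S \<Longrightarrow> deg a = sum a S"
  unfolding deg_def by (rule sum.mono_neutral_left) auto

lemma deg_add: "fin_mono a \<Longrightarrow> fin_mono b \<Longrightarrow> deg (a + b) = deg a + deg b"
proof -
  assume *: "fin_mono a" "fin_mono b"
  let ?S = "{i. a i \<noteq> 0} \<union> {i. b i \<noteq> 0}"
  have S: "finite ?S" using * by (simp add: fin_mono_def)
  have "deg (a + b) = sum (a + b) ?S" "deg a = sum a ?S" "deg b = sum b ?S"
    by (rule deg_eq_sum; use S in auto)+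
  then show ?thesis by (simp add: sum.distrib)
qed

lemma deg_zero [simp]: "deg 0 = 0"
  by (simp add: deg_def)

lemma deg_eq_0_iff: "fin_mono a \<Longrightarrow> deg a = 0 \<longleftrightarrow> a = 0"
  by (auto simp: deg_def fin_mono_def fun_eq_iff)

lemma deg_diff: "fin_mono a \<Longrightarrow> b \<le> a \<Longrightarrow> deg b + deg (a - b) = deg a"
  using deg_add[of b "a - b"] mono_add_diff[of b a] fin_mono_le[of a b] fin_mono_diff[of a b] by simp

lemma deg_mono: "fin_mono a \<Longrightarrow> b \<le> a \<Longrightarrow> deg b \<le> deg a"
  using deg_diff[of a b] by simp

text \<open>Vanishing at exponents of infinite support makes equality of series the same as equality
  of coefficients at genuine monomials. The coefficient type stays open so that series can be
  nested: in \<open>int mps mps\<close> the outer exponents belong to t and the inner ones to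
  x.\<close>

typedef (overloaded) 'a mps = "{f :: mono \<Rightarrow> 'a::zero. \<forall>\<alpha>. \<not> fin_mono \<alpha> \<longrightarrow> f \<alpha> = 0}"
  morphisms cf Abs_mps
  by auto

definition mk :: "(mono \<Rightarrow> 'a::zero) \<Rightarrow> 'a mps" where
  "mk f = Abs_mps (\<lambda>\<alpha>. if fin_mono \<alpha> then f \<alpha> else 0)"

lemma cf_mk [simp]: "cf (mk f) = (\<lambda>\<alpha>. if fin_mono \<alpha> then f \<alpha> else 0)"
  unfolding mk_def by (subst Abs_mps_inverse) auto

lemma cf_nonfin: "\<not> fin_mono \<alpha> \<Longrightarrow> cf f \<alpha> = 0"
  using cf[of f] by auto

lemma mps_eqI: "(\<And>\<alpha>. fin_mono \<alpha> \<Longrightarrow> cf f \<alpha> = cf g \<alpha>) \<Longrightarrow> f = g"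
  by (metis (no_types, lifting) cf_inject cf_nonfin ext)

lemma mk_cf [simp]: "mk (cf f) = f"
  by (rule mps_eqI) simp

instantiation mps :: (comm_ring_1) comm_ring_1
begin

definition "0 = mk (\<lambda>_. 0::'a)"
definition "1 = mk (\<lambda>\<alpha>. if \<alpha> = 0 then 1 else 0::'a)"
definition "f + g = mk (\<lambda>\<alpha>. cf f \<alpha> + cf g \<alpha> :: 'a)"
definition "f - g = mk (\<lambda>\<alpha>. cf f \<alpha> - cf g \<alpha> :: 'a)"
definition "- f = mk (\<lambda>\<alpha>. - cf f \<alpha> :: 'a)"
definition "f * g = mk (\<lambda>\<alpha>. \<Sum>\<beta>\<in>{\<beta>. \<beta> \<le> \<alpha>}. cf f \<beta> * cf g (\<alpha> - \<beta>) :: 'a)"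

instance
proof
  fix f g h :: "'a mps"
  show "f * g * h = f * (g * h)"
  proof (rule mps_eqI)
    fix \<alpha> assume \<alpha>: "fin_mono \<alpha>"
    have F: "finite {\<beta>. \<beta> \<le> \<gamma>}" if "\<gamma> \<le> \<alpha>" for \<gamma>
      using finite_mono_le fin_mono_le[OF \<alpha> that] by blast
    have "cf (f * g * h) \<alpha> = (\<Sum>\<beta>\<in>{\<beta>. \<beta> \<le> \<alpha>}. \<Sum>\<gamma>\<in>{\<gamma>. \<gamma> \<le> \<beta>}. cf f \<gamma> * cf g (\<beta> - \<gamma>) * cf h (\<alpha> - \<beta>))"
      using \<alpha> by (simp add: times_mps_def fin_mono_le[OF \<alpha>] sum_distrib_right)
    also have "\<dots> = (\<Sum>(\<beta>,\<gamma>)\<in>(SIGMA \<beta>:{\<beta>. \<beta> \<le> \<alpha>}. {\<gamma>. \<gamma> \<le> \<beta>}). cf f \<gamma> * cf g (\<beta> - \<gamma>) * cf h (\<alpha> - \<beta>))"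
      by (rule sum.Sigma) (use F in auto)
    also have "\<dots> = (\<Sum>(\<gamma>,\<delta>)\<in>(SIGMA \<gamma>:{\<gamma>. \<gamma> \<le> \<alpha>}. {\<delta>. \<delta> \<le> \<alpha> - \<gamma>}). cf f \<gamma> * (cf g \<delta> * cf h (\<alpha> - \<gamma> - \<delta>)))"
      by (rule sum.reindex_bij_witness[where i="\<lambda>(\<gamma>,\<delta>). (\<gamma>+\<delta>,\<gamma>)" and j="\<lambda>(\<beta>,\<gamma>). (\<gamma>, \<beta>-\<gamma>)"])
        (auto simp: le_fun_def mono_diff_chain mono_sum_le mono_sum_diff mono_diff_sum mult.assoc
          mono_trans diff_le_mono)
    also have "\<dots> = (\<Sum>\<gamma>\<in>{\<gamma>. \<gamma> \<le> \<alpha>}. \<Sum>\<delta>\<in>{\<delta>. \<delta> \<le> \<alpha> - \<gamma>}. cf f \<gamma> * (cf g \<delta> * cf h (\<alpha> - \<gamma> - \<delta>)))"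
      by (rule sum.Sigma[symmetric]) (use F mono_diff_le in auto)
    also have "\<dots> = cf (f * (g * h)) \<alpha>"
      using \<alpha> by (simp add: times_mps_def fin_mono_diff sum_distrib_left)
    finally show "cf (f * g * h) \<alpha> = cf (f * (g * h)) \<alpha>" .
  qed
  show "f * g = g * f"
  proof (rule mps_eqI)
    fix \<alpha> assume \<alpha>: "fin_mono \<alpha>"
    have "(\<Sum>\<beta>\<in>{\<beta>. \<beta> \<le> \<alpha>}. cf f \<beta> * cf g (\<alpha> - \<beta>)) = (\<Sum>\<beta>\<in>{\<beta>. \<beta> \<le> \<alpha>}. cf g \<beta> * cf f (\<alpha> - \<beta>))"
      by (rule sum.reindex_bij_witness[where i="\<lambda>\<beta>. \<alpha> - \<beta>" and j="\<lambda>\<beta>. \<alpha> - \<beta>"])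
        (auto simp: le_fun_def mono_diff_diff mult.commute)
    then show "cf (f * g) \<alpha> = cf (g * f) \<alpha>" using \<alpha> by (simp add: times_mps_def)
  qed
  show "1 * f = f"
  proof (rule mps_eqI)
    fix \<alpha> assume \<alpha>: "fin_mono \<alpha>"
    have "cf (1 * f) \<alpha> = (\<Sum>\<beta>\<in>{\<beta>. \<beta> \<le> \<alpha>}. if \<beta> = 0 then cf f (\<alpha> - \<beta>) else 0)"
      using \<alpha> by (auto simp: times_mps_def one_mps_def fin_mono_le intro!: sum.cong)
    also have "\<dots> = cf f (\<alpha> - 0)"
      using finite_mono_le[OF \<alpha>] by (subst sum.delta) (auto simp: le_fun_def)
    finally show "cf (1 * f) \<alpha> = cf f \<alpha>" by (simp add: fun_diff_def)
  qed
  show "(f + g) * h = f * h + g * h"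
    by (rule mps_eqI) (simp add: times_mps_def plus_mps_def fin_mono_le distrib_right sum.distrib)
  have "cf (1::'a mps) 0 \<noteq> cf 0 0" by (simp add: one_mps_def zero_mps_def)
  then show "(0::'a mps) \<noteq> 1" by metis
qed (auto intro!: mps_eqI simp: zero_mps_def plus_mps_def minus_mps_def uminus_mps_def algebra_simps)

end

lemma cf_0 [simp]: "cf 0 \<alpha> = 0"
  by (simp add: zero_mps_def)

lemma cf_1: "cf 1 \<alpha> = (if \<alpha> = 0 then 1 else 0)"
  by (simp add: one_mps_def)

lemma cf_add [simp]: "cf (f + g) \<alpha> = cf f \<alpha> + cf g \<alpha>"
  by (simp add: plus_mps_def cf_nonfin)

lemma cf_diff [simp]: "cf (f - g) \<alpha> = cf f \<alpha> - cf g \<alpha>"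
  by (simp add: minus_mps_def cf_nonfin)

lemma cf_uminus [simp]: "cf (- f) \<alpha> = - cf f \<alpha>"
  by (simp add: uminus_mps_def cf_nonfin)

lemma cf_mult: "fin_mono \<alpha> \<Longrightarrow> cf (f * g) \<alpha> = (\<Sum>\<beta>\<in>{\<beta>. \<beta> \<le> \<alpha>}. cf f \<beta> * cf g (\<alpha> - \<beta>))"
  by (simp add: times_mps_def)

lemma cf_sum [simp]: "cf (sum F S) \<alpha> = (\<Sum>x\<in>S. cf (F x) \<alpha>)"
  by (induction S rule: infinite_finite_induct) auto

definition mon :: "mono \<Rightarrow> 'a::zero \<Rightarrow> 'a mps" where
  "mon c a = mk (\<lambda>\<alpha>. if \<alpha> = c then a else 0)"

lemma cf_mon: "fin_mono c \<Longrightarrow> cf (mon c a) \<alpha> = (if \<alpha> = c then a else 0)"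
  by (auto simp: mon_def)

lemma cf_mon_mult:
  assumes "fin_mono c"
  shows "cf (mon c a * f) \<alpha> = (if c \<le> \<alpha> then a * cf f (\<alpha> - c) else 0)"
proof (cases "fin_mono \<alpha>")
  case True
  have "cf (mon c a * f) \<alpha> = (\<Sum>\<beta>\<in>{\<beta>. \<beta> \<le> \<alpha>}. if \<beta> = c then a * cf f (\<alpha> - c) else 0)"
    unfolding cf_mult[OF True] by (rule sum.cong) (auto simp: cf_mon[OF assms])
  then show ?thesis using finite_mono_le[OF True] by (simp add: sum.delta)
next
  case False
  have "\<not> fin_mono (\<alpha> - c)" if "c \<le> \<alpha>"
    using False assms mono_add_diff[OF that] by (metis fin_mono_add)
  then show ?thesis using False by (simp add: cf_nonfin)
qed

lemma mon_mult_mon: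
  assumes "fin_mono c" "fin_mono d"
  shows "mon c a * mon d b = mon (c + d) (a * b :: 'a::comm_ring_1)"
proof (rule mps_eqI)
  fix \<alpha>
  have "c \<le> \<alpha> \<and> \<alpha> - c = d \<longleftrightarrow> \<alpha> = c + d"
    using mono_add_diff[of c \<alpha>] by (auto simp: le_fun_def mono_sum_diff)
  then show "cf (mon c a * mon d b) \<alpha> = cf (mon (c + d) (a * b)) \<alpha>"
    using assms by (auto simp: cf_mon_mult cf_mon)
qed

lemma mon_0_1: "mon 0 1 = 1"
  by (rule mps_eqI) (simp add: cf_mon cf_1)

text \<open>The exponent of the power (t^c)^k: this is where H(t^c) has its coefficients, and what a
  cycle of length k contributes.\<close>

definition msc :: "nat \<Rightarrow> mono \<Rightarrow> mono" where
  "msc k c = (\<lambda>i. k * c i)"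

lemma fin_mono_msc [simp]: "fin_mono c \<Longrightarrow> fin_mono (msc k c)"
  unfolding fin_mono_def msc_def by (erule finite_subset[rotated]) auto

lemma mon_power: "fin_mono c \<Longrightarrow> mon c 1 ^ k = (mon (msc k c) 1 :: 'a::comm_ring_1 mps)"
proof (induction k)
  case 0
  have "msc 0 c = 0" by (simp add: msc_def fun_eq_iff)
  then show ?case by (simp only: mon_0_1 power_0)
next
  case (Suc k)
  have "c + msc k c = msc (Suc k) c" by (simp add: msc_def fun_eq_iff)
  then show ?case using Suc by (simp add: mon_mult_mon)
qed

lemma deg_msc: "fin_mono c \<Longrightarrow> deg (msc k c) = k * deg c"
proof (induction k)
  case 0
  have "msc 0 c = 0" by (simp add: msc_def fun_eq_iff)
  then show ?case by (simp only: deg_zero mult_0)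
next
  case (Suc k)
  have "c + msc k c = msc (Suc k) c" by (simp add: msc_def fun_eq_iff)
  then show ?case using Suc deg_add[of c "msc k c"] by simp
qed

subsection \<open>Order of vanishing\<close>

definition ord_ge :: "nat \<Rightarrow> 'a::comm_ring_1 mps \<Rightarrow> bool" where
  "ord_ge n f \<longleftrightarrow> (\<forall>\<alpha>. fin_mono \<alpha> \<longrightarrow> deg \<alpha> < n \<longrightarrow> cf f \<alpha> = 0)"

lemma ord_ge_0 [simp]: "ord_ge 0 f" by (simp add: ord_ge_def)
lemma ord_ge_zero [simp]: "ord_ge n 0" by (simp add: ord_ge_def)
lemma ord_ge_mono: "ord_ge n f \<Longrightarrow> m \<le> n \<Longrightarrow> ord_ge m f" by (auto simp: ord_ge_def)
lemma ord_ge_add: "ord_ge n f \<Longrightarrow> ord_ge n g \<Longrightarrow> ord_ge n (f + g)" by (simp add: ord_ge_def)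
lemma ord_ge_uminus: "ord_ge n f \<Longrightarrow> ord_ge n (- f)" by (simp add: ord_ge_def)
lemma ord_ge_sum: "(\<And>x. x \<in> S \<Longrightarrow> ord_ge n (F x)) \<Longrightarrow> ord_ge n (sum F S)"
  by (simp add: ord_ge_def)

lemma ord_ge_mult:
  assumes "ord_ge m f" "ord_ge n g"
  shows "ord_ge (m + n) (f * g)"
  unfolding ord_ge_def
proof (intro allI impI)
  fix \<alpha> assume \<alpha>: "fin_mono \<alpha>" and d: "deg \<alpha> < m + n"
  show "cf (f * g) \<alpha> = 0"
    unfolding cf_mult[OF \<alpha>]
  proof (rule sum.neutral, rule ballI)
    fix \<beta> assume "\<beta> \<in> {\<beta>. \<beta> \<le> \<alpha>}"
    then have \<beta>: "\<beta> \<le> \<alpha>" by simp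
    have "deg \<beta> < m \<or> deg (\<alpha> - \<beta>) < n" using deg_diff[OF \<alpha> \<beta>] d by linarith
    then show "cf f \<beta> * cf g (\<alpha> - \<beta>) = 0"
      using assms fin_mono_le[OF \<alpha> \<beta>] fin_mono_diff[OF \<alpha>] by (auto simp: ord_ge_def)
  qed
qed

lemma ord_ge_mult_left: "ord_ge n g \<Longrightarrow> ord_ge n (f * g)"
  using ord_ge_mult[of 0 f n g] by simp

lemma ord_ge_mult_right: "ord_ge n f \<Longrightarrow> ord_ge n (f * g)"
  using ord_ge_mult[of n f 0 g] by simp

lemma ord_ge_prod:
  "(\<And>x. x \<in> S \<Longrightarrow> ord_ge (d x) (F x)) \<Longrightarrow> ord_ge (sum d S) (prod F S)"
  by (induction S rule: infinite_finite_induct) (auto intro: ord_ge_mult)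

lemma ord_ge_power: "ord_ge m f \<Longrightarrow> ord_ge (m * k) (f ^ k)"
  by (induction k) (auto intro: ord_ge_mult)

lemma ord_ge_mon: "fin_mono c \<Longrightarrow> n \<le> deg c \<Longrightarrow> ord_ge n (mon c a)"
  by (auto simp: ord_ge_def cf_mon)

lemma ord_ge_all: "(\<And>n. ord_ge n f) \<Longrightarrow> f = 0"
  by (rule mps_eqI) (auto simp: ord_ge_def)

text \<open>Congruence modulo total degree n takes the place of a topology: identities between
  infinite products are checked for finite truncations modulo every n and concluded by
  \<open>eqv_all\<close>.\<close>

definition eqv :: "nat \<Rightarrow> 'a::comm_ring_1 mps \<Rightarrow> 'a mps \<Rightarrow> bool" where
  "eqv n f g \<longleftrightarrow> ord_ge n (f - g)"

lemma eqv_cf: "eqv n f g \<longleftrightarrow> (\<forall>\<alpha>. fin_mono \<alpha> \<longrightarrow> deg \<alpha> < n \<longrightarrow> cf f \<alpha> = cf g \<alpha>)"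
  by (simp add: eqv_def ord_ge_def)

lemma eqv_refl [simp]: "eqv n f f" by (simp add: eqv_def)
lemma eqv_sym: "eqv n f g \<Longrightarrow> eqv n g f" by (simp add: eqv_cf)
lemma eqv_trans [trans]: "eqv n f g \<Longrightarrow> eqv n g h \<Longrightarrow> eqv n f h" by (simp add: eqv_cf)
lemma eqv_mono: "eqv n f g \<Longrightarrow> m \<le> n \<Longrightarrow> eqv m f g" by (simp add: eqv_cf)

lemma eqv_mult: "eqv n f g \<Longrightarrow> eqv n f' g' \<Longrightarrow> eqv n (f * f') (g * g')"
proof -
  assume "eqv n f g" "eqv n f' g'"
  then have "ord_ge n ((f - g) * f' + g * (f' - g'))"
    unfolding eqv_def by (intro ord_ge_add ord_ge_mult_left ord_ge_mult_right)
  then show ?thesis by (simp add: eqv_def algebra_simps)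
qed

lemma eqv_prod: "(\<And>x. x \<in> S \<Longrightarrow> eqv n (F x) (G x)) \<Longrightarrow> eqv n (prod F S) (prod G S)"
  by (induction S rule: infinite_finite_induct) (auto intro: eqv_mult)

lemma eqv_all: "(\<And>n. eqv n f g) \<Longrightarrow> f = g"
  using ord_ge_all[of "f - g"] by (simp add: eqv_def)

lemma ord_ge_1_iff: "ord_ge 1 f \<longleftrightarrow> cf f 0 = 0"
  by (auto simp: ord_ge_def deg_eq_0_iff)

lemma geometric_eqv:
  assumes "ord_ge 1 (u :: 'a::comm_ring_1 mps)" "n \<le> N"
  shows "eqv n ((1 - u) * (\<Sum>k<N. u ^ k)) 1"
proof -
  have "(1 - u) * (\<Sum>k<N. u ^ k) = 1 - u ^ N"
    using one_diff_power_eq[of u N] by (simp add: mult.commute)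
  then show ?thesis using ord_ge_uminus[OF ord_ge_mono[OF ord_ge_power[OF assms(1), of N]]] assms(2)
    by (simp add: eqv_def)
qed

text \<open>The geometric series converges because 1 - f has no constant term. The second conjunct
  records the inverse as a limit of polynomials in \<open>f\<close>; from it one reads off later
  that inversion stays inside \<open>LamT\<close>.\<close>

lemma mps_inverse_exists:
  assumes "cf f 0 = (1::'a::comm_ring_1)"
  shows "\<exists>g. f * g = 1 \<and> (\<forall>n. eqv n g (\<Sum>k<n. (1 - f) ^ k))"
proof -
  define u where "u = 1 - f"
  have u: "ord_ge 1 u" unfolding ord_ge_1_iff u_def by (simp add: cf_1 assms)
  \<comment> \<open>Powers \<open>u ^ k\<close> with k > deg \<alpha> have no term at \<alpha>, so
    \<open>Suc (deg \<alpha>)\<close> summands already give the limiting coefficient.\<close>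
  define g where "g = mk (\<lambda>\<alpha>. cf (\<Sum>k<Suc (deg \<alpha>). u ^ k) \<alpha>)"
  have g: "eqv n g (\<Sum>k<n. u ^ k)" for n
    unfolding eqv_cf
  proof (intro allI impI)
    fix \<alpha> assume \<alpha>: "fin_mono \<alpha>" "deg \<alpha> < n"
    have "(\<Sum>k<n. cf (u ^ k) \<alpha>) = (\<Sum>k<Suc (deg \<alpha>). cf (u ^ k) \<alpha>)"
    proof (rule sum.mono_neutral_right)
      show "\<forall>i\<in>{..<n} - {..<Suc (deg \<alpha>)}. cf (u ^ i) \<alpha> = 0"
        using ord_ge_power[OF u] \<alpha> by (auto simp: ord_ge_def)
    qed (use \<alpha> in auto)
    then show "cf g \<alpha> = cf (\<Sum>k<n. u ^ k) \<alpha>" using \<alpha> by (simp add: g_def)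
  qed
  have "f * g = 1"
  proof (rule eqv_all)
    fix n
    have "eqv n (f * g) (f * (\<Sum>k<n. u ^ k))" by (intro eqv_mult g eqv_refl)
    also have "eqv n (f * (\<Sum>k<n. u ^ k)) 1" using geometric_eqv[OF u, of n n] by (simp add: u_def)
    finally show "eqv n (f * g) 1" .
  qed
  then show ?thesis using g unfolding u_def by blast
qed

lemma mps_inverse_unique: "f * g = 1 \<Longrightarrow> f * g' = (1::'a::comm_ring_1) \<Longrightarrow> g = g'"
proof -
  assume *: "f * g = 1" "f * g' = 1"
  have "g = (f * g') * g" using * by simp
  also have "\<dots> = (f * g) * g'" by (simp only: ac_simps)
  also have "\<dots> = g'" using * by simp
  finally show ?thesis .
qed

subsection \<open>The ambient rings of the statement\<close>

lemma smult_s_cf: "smult_s f g = cf (mk f * mk g)"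
proof
  fix \<alpha>
  show "smult_s f g \<alpha> = cf (mk f * mk g) \<alpha>"
  proof (cases "fin_mono \<alpha>")
    case True
    then show ?thesis unfolding smult_s_def conv_def cf_mult[OF True]
      by (auto simp: fin_mono_le fin_mono_diff intro!: sum.cong)
  qed (simp add: smult_s_def conv_def cf_nonfin)
qed

lemma one_s_cf: "one_s = cf 1"
  by (simp add: one_s_def fun_eq_iff cf_1)

text \<open>Raw double series of the statement and the ring \<open>int mps mps\<close> correspond
  through \<open>mkt\<close> and \<open>unt\<close>; the round trip \<open>unt (mkt X) = X\<close>
  holds exactly on the well-formed series, those among which \<open>tinv\<close> looks for an
  inverse.\<close>

definition mkt :: "tser \<Rightarrow> int mps mps" where
  "mkt X = mk (\<lambda>\<alpha>. mk (X \<alpha>))"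

definition unt :: "int mps mps \<Rightarrow> tser" where
  "unt Z = (\<lambda>\<alpha>. cf (cf Z \<alpha>))"

lemma mkt_unt [simp]: "mkt (unt Z) = Z"
  by (rule mps_eqI) (simp add: mkt_def unt_def)

lemma unt_mkt: "wf_t X \<Longrightarrow> unt (mkt X) = X"
  by (auto simp: unt_def mkt_def wf_t_def fun_eq_iff)

lemma wf_unt: "wf_t (unt Z)"
  by (simp add: wf_t_def unt_def cf_nonfin fun_eq_iff)

lemma sum_fun_apply: "(sum F S :: 'b \<Rightarrow> 'c::comm_monoid_add) x = (\<Sum>a\<in>S. F a x)"
  by (induction S rule: infinite_finite_induct) auto

lemma tmult_unt: "tmult X Y = unt (mkt X * mkt Y)"
proof (intro ext)
  fix \<alpha> \<beta>
  show "tmult X Y \<alpha> \<beta> = unt (mkt X * mkt Y) \<alpha> \<beta>"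
  proof (cases "fin_mono \<alpha>")
    case True
    then show ?thesis unfolding tmult_def conv_def unt_def cf_mult[OF True]
      by (auto simp: fin_mono_le fin_mono_diff sum_fun_apply smult_s_cf mkt_def intro!: sum.cong)
  qed (simp add: tmult_def conv_def unt_def cf_nonfin)
qed

lemma tone_unt: "tone = unt 1"
  by (auto simp: tone_def unt_def cf_1 fun_eq_iff one_s_cf)

text \<open>Well-formed series are the images under \<open>unt\<close>, and inverses in a
  commutative ring are unique, so the definite description is met by any inverse exhibited in the
  typed ring.\<close>

lemma tinv_unt:
  assumes "mkt X * Z = 1"
  shows "tinv X = unt Z"
  unfolding tinv_def
proof (rule the_equality)
  show "wf_t (unt Z) \<and> tmult X (unt Z) = tone"
    using assms by (simp add: wf_unt tmult_unt tone_unt)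
  fix Y assume Y: "wf_t Y \<and> tmult X Y = tone"
  then have "mkt (unt (mkt X * mkt Y)) = mkt (unt 1)" by (simp add: tmult_unt tone_unt)
  then have "mkt X * mkt Y = 1" by simp
  then have "mkt Y = Z" using mps_inverse_unique assms by blast
  then show "Y = unt Z" using Y unt_mkt by metis
qed

lemma tprod_set_unt:
  assumes "finite S"
  shows "tprod_set S F = unt (\<Prod>w\<in>S. mkt (F w))"
proof -
  interpret comp_fun_commute "\<lambda>w acc. tmult (F w) acc"
    by unfold_locales (simp add: fun_eq_iff tmult_unt mult.left_commute)
  show ?thesis using assms
  proof (induction S)
    case (insert x S)
    then have "tprod_set (insert x S) F = tmult (F x) (unt (\<Prod>w\<in>S. mkt (F w)))"
      by (simp add: tprod_set_def)
    then show ?case using insert by (simp add: tmult_unt)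
  qed (simp add: tprod_set_def tone_unt)
qed

declare split_paired_All [simp del] split_paired_Ex [simp del]

section \<open>Kostka numbers and Pieri's rule\<close>

text \<open>Partitions are handled as weakly decreasing exponent vectors.\<close>

definition pf :: "nat list \<Rightarrow> mono" where
  "pf la = (\<lambda>i. if i < length la then la ! i else 0)"

definition is_pf :: "mono \<Rightarrow> bool" where
  "is_pf p \<longleftrightarrow> (\<forall>i. p (Suc i) \<le> p i) \<and> fin_mono p"

definition dg :: "mono \<Rightarrow> (nat \<times> nat) set" where
  "dg p = {(i, j). j < p i}"

definition sst :: "mono \<Rightarrow> mono \<Rightarrow> (nat \<times> nat \<Rightarrow> nat) set" where
  "sst p \<alpha> = {T.
     (\<forall>i j. Suc j < p i \<longrightarrow> T (i, j) \<le> T (i, Suc j)) \<and>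
     (\<forall>i j. j < p i \<longrightarrow> j < p (Suc i) \<longrightarrow> T (i, j) < T (Suc i, j)) \<and>
     (\<forall>c. c \<notin> dg p \<longrightarrow> T c = 0) \<and>
     (\<forall>k. card {c \<in> dg p. T c = k} = \<alpha> k)}"

definition kost :: "mono \<Rightarrow> mono \<Rightarrow> nat" where
  "kost p \<alpha> = card (sst p \<alpha>)"

text \<open>\<xi>/\<mu> is a horizontal strip: interlacing of the rows says that no column gains two
  cells. The chain \<xi> (i+1) \<le> \<mu> i \<le> \<xi> i and its analogue for \<mu> make both
  vectors weakly decreasing.\<close>

definition hs :: "mono \<Rightarrow> mono \<Rightarrow> bool" where
  "hs \<mu> \<xi> \<longleftrightarrow> (\<forall>i. \<mu> i \<le> \<xi> i \<and> \<xi> (Suc i) \<le> \<mu> i)"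

lemma fin_mono_pf [simp]: "fin_mono (pf la)"
  unfolding fin_mono_def pf_def by (rule finite_subset[of _ "{..<length la}"]) auto

lemma deg_pf: "deg (pf la) = sum_list la"
proof -
  have "deg (pf la) = sum (pf la) {..<length la}"
    by (rule deg_eq_sum) (auto simp: pf_def)
  also have "\<dots> = sum_list la"
    by (simp add: pf_def sum_list_sum_nth atLeast0LessThan)
  finally show ?thesis .
qed

lemma schur_kost: "fin_mono \<alpha> \<Longrightarrow> schur la \<alpha> = int (kost (pf la) \<alpha>)"
proof -
  have c: "cells la = dg (pf la)" by (auto simp: cells_def dg_def pf_def split: if_splits)
  have "{T. ssyt la T \<and> (\<forall>k. card {c \<in> cells la. T c = k} = \<alpha> k)} = sst (pf la) \<alpha>"
    unfolding ssyt_def sst_def c by (auto simp: dg_def)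
  then show "fin_mono \<alpha> \<Longrightarrow> ?thesis" by (simp add: schur_def kost_def)
qed

lemma dg_Sigma: "dg p = Sigma {i. p i \<noteq> 0} (\<lambda>i. {..<p i})"
  by (auto simp: dg_def)

lemma finite_dg: "fin_mono p \<Longrightarrow> finite (dg p)"
  unfolding dg_Sigma fin_mono_def by auto

lemma card_dg: "fin_mono p \<Longrightarrow> card (dg p) = deg p"
  unfolding dg_Sigma fin_mono_def deg_def by (subst card_SigmaI) auto

lemma sst_pos:
  assumes "fin_mono p" "T \<in> sst p \<alpha>" "c \<in> dg p"
  shows "\<alpha> (T c) \<noteq> 0"
proof -
  have "card {d \<in> dg p. T d = T c} = \<alpha> (T c)" using assms by (simp add: sst_def)
  moreover have "card {d \<in> dg p. T d = T c} > 0"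
    unfolding card_gt_0_iff using assms(3) finite_dg[OF assms(1)] by auto
  ultimately show ?thesis by linarith
qed

lemma finite_sst:
  assumes "fin_mono p" "fin_mono \<alpha>"
  shows "finite (sst p \<alpha>)"
proof -
  let ?F = "{T. \<forall>c. (c \<in> dg p \<longrightarrow> T c \<in> {k. \<alpha> k \<noteq> 0}) \<and> (c \<notin> dg p \<longrightarrow> T c = (0::nat))}"
  have "finite ?F"
    by (rule finite_set_of_finite_funs) (use assms finite_dg in \<open>auto simp: fin_mono_def\<close>)
  moreover have "sst p \<alpha> \<subseteq> ?F"
  proof (intro subsetI CollectI allI conjI impI)
    fix T c assume T: "T \<in> sst p \<alpha>"
    have "\<forall>c. c \<notin> dg p \<longrightarrow> T c = 0" using T unfolding sst_def by blast
    then show "T c = 0" if "c \<notin> dg p" using that by blast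
    show "\<alpha> (T c) \<noteq> 0" if c: "c \<in> dg p"
      using sst_pos[OF assms(1) T c] .
  qed
  ultimately show ?thesis by (rule finite_subset[rotated])
qed

lemma sst_row:
  assumes "T \<in> sst p \<alpha>" "j \<le> j'" "j' < p i"
  shows "T (i, j) \<le> T (i, j')"
  using assms(2,3)
proof (induction j' rule: dec_induct)
  case (step n)
  then have "T (i, n) \<le> T (i, Suc n)" using assms(1) by (simp add: sst_def)
  then show ?case using step by simp
qed simp

text \<open>Columns start at row 0 and increase strictly, so an entry is at least its row index. The
  dominance statements about Kostka numbers come from this bound.\<close>

lemma sst_col:
  assumes "is_pf p" "T \<in> sst p \<alpha>" "j < p i"
  shows "i \<le> T (i, j)"
  using assms(3)
proof (induction i)
  case (Suc i)
  have "j < p i" using Suc.prems assms(1) by (meson is_pf_def le_trans not_le)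
  then have "i \<le> T (i, j)" "T (i, j) < T (Suc i, j)"
    using Suc assms(2) by (auto simp: sst_def)
  then show ?case by simp
qed simp

lemma sst_sum_lt:
  assumes "fin_mono p" "T \<in> sst p \<alpha>"
  shows "(\<Sum>k<N. \<alpha> k) = card {c \<in> dg p. T c < N}"
proof -
  have "{c \<in> dg p. T c < N} = (\<Union>k<N. {c \<in> dg p. T c = k})" by auto
  then have "card {c \<in> dg p. T c < N} = (\<Sum>k<N. card {c \<in> dg p. T c = k})"
    using finite_dg[OF assms(1)] by (simp, subst card_UN_disjoint) auto
  then show ?thesis using assms(2) by (simp add: sst_def)
qed

lemma card_dg_rows: "card {c \<in> dg p. fst c < N} = (\<Sum>i<N. p i)"
proof -
  have "{c \<in> dg p. fst c < N} = Sigma {..<N} (\<lambda>i. {..<p i})" by (auto simp: dg_def)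
  then show ?thesis by simp
qed

lemma fin_mono_bound: "fin_mono a \<Longrightarrow> \<exists>N. \<forall>i\<ge>N. a i = 0"
proof -
  assume "fin_mono a"
  then obtain N where "\<forall>i\<in>{i. a i \<noteq> 0}. i < N"
    unfolding fin_mono_def finite_nat_set_iff_bounded by auto
  then show ?thesis by (intro exI[of _ N]) (metis mem_Collect_eq not_le)
qed

lemma supp_lessThan: "\<forall>i\<ge>(N::nat). a i = 0 \<Longrightarrow> {i. a i \<noteq> (0::nat)} \<subseteq> {..<N}"
  by (rule subsetI, rule ccontr) simp

lemma deg_eq_lessThan: "\<forall>i\<ge>N. a i = 0 \<Longrightarrow> deg a = (\<Sum>i<N. a i)"
  by (rule deg_eq_sum) (auto dest: supp_lessThan)

lemma sst_deg:
  assumes "fin_mono p" "fin_mono \<alpha>" "T \<in> sst p \<alpha>"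
  shows "deg \<alpha> = deg p"
proof -
  obtain N where N: "\<forall>i\<ge>N. \<alpha> i = 0" using fin_mono_bound[OF assms(2)] by auto
  have "T c < N" if "c \<in> dg p" for c
    using sst_pos[OF assms(1,3) that] N by (metis not_le)
  then have "{c \<in> dg p. T c < N} = dg p" by auto
  then show ?thesis using deg_eq_lessThan[OF N] sst_sum_lt[OF assms(1,3), of N] card_dg[OF assms(1)]
    by simp
qed

lemma kost_deg: "fin_mono p \<Longrightarrow> fin_mono \<alpha> \<Longrightarrow> kost p \<alpha> \<noteq> 0 \<Longrightarrow> deg \<alpha> = deg p"
  by (metis card.empty kost_def sst_deg ex_in_conv)

text \<open>By \<open>sst_col\<close> the cells with entries below N lie in the first N rows;
  comparing cardinalities is the dominance inequality.\<close>

lemma kost_dominance: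
  assumes "is_pf p" "kost p \<alpha> \<noteq> 0"
  shows "(\<Sum>k<N. \<alpha> k) \<le> (\<Sum>k<N. p k)"
proof -
  have p: "fin_mono p" using assms(1) by (simp add: is_pf_def)
  obtain T where T: "T \<in> sst p \<alpha>" using assms(2) by (metis card.empty kost_def ex_in_conv)
  have "{c \<in> dg p. T c < N} \<subseteq> {c \<in> dg p. fst c < N}"
    using sst_col[OF assms(1) T] by (force simp: dg_def)
  then have "card {c \<in> dg p. T c < N} \<le> card {c \<in> dg p. fst c < N}"
    by (rule card_mono[rotated]) (use finite_dg[OF p] in auto)
  then show ?thesis unfolding card_dg_rows using sst_sum_lt[OF p T] by simp
qed

text \<open>With content equal to shape, the inclusions behind dominance are inclusions between sets
  of the same size, hence equalities for every N, and they pin each entry to its row index.\<close>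

lemma kost_self:
  assumes "is_pf p"
  shows "kost p p = 1"
proof -
  have p: "fin_mono p" using assms by (simp add: is_pf_def)
  define T0 where "T0 = (\<lambda>c. if c \<in> dg p then fst c else 0)"
  have "sst p p = {T0}"
  proof (intro equalityI subsetI)
    fix T assume T: "T \<in> sst p p"
    have eq: "{c \<in> dg p. T c < N} = {c \<in> dg p. fst c < N}" for N
    proof (rule card_subset_eq)
      show "{c \<in> dg p. T c < N} \<subseteq> {c \<in> dg p. fst c < N}"
        using sst_col[OF assms T] by (force simp: dg_def)
      show "card {c \<in> dg p. T c < N} = card {c \<in> dg p. fst c < N}"
        unfolding card_dg_rows using sst_sum_lt[OF p T] by simp
    qed (use finite_dg[OF p] in auto)
    have "T c = T0 c" for c
    proof (cases "c \<in> dg p")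
      case True
      then have "T c < N \<longleftrightarrow> fst c < N" for N using eq[of N] by blast
      then show ?thesis using True by (metis T0_def nat_neq_iff)
    qed (use T in \<open>simp add: sst_def T0_def\<close>)
    then show "T \<in> {T0}" by auto
  next
    fix T assume "T \<in> {T0}"
    have "{c \<in> dg p. T0 c = k} = {k} \<times> {..<p k}" for k by (auto simp: T0_def dg_def)
    then show "T \<in> sst p p" using \<open>T \<in> {T0}\<close> assms
      by (auto simp: sst_def T0_def dg_def is_pf_def)
  qed
  then show ?thesis by (simp add: kost_def)
qed

lemma kost_zero: "is_pf p \<Longrightarrow> kost p 0 = (if p = 0 then 1 else 0)"
  using kost_self[of 0] kost_deg[of p 0] deg_eq_0_iff[of p] by (auto simp: is_pf_def)

lemma hs_le: "hs \<mu> \<xi> \<Longrightarrow> \<mu> \<le> \<xi>"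
  by (simp add: hs_def le_fun_def)

lemma hs_fin: "hs \<mu> \<xi> \<Longrightarrow> fin_mono \<mu> \<longleftrightarrow> fin_mono \<xi>"
proof
  assume h: "hs \<mu> \<xi>" and "fin_mono \<mu>"
  then obtain N where N: "\<forall>i\<ge>N. \<mu> i = 0" using fin_mono_bound by blast
  have "\<xi> i = 0" if "i \<ge> Suc N" for i
    using that h N by (cases i) (auto simp: hs_def, metis le_zero_eq)
  then have "{i. \<xi> i \<noteq> 0} \<subseteq> {..<Suc N}" by (intro supp_lessThan) auto
  then show "fin_mono \<xi>" unfolding fin_mono_def by (rule finite_subset) simp
qed (auto dest: hs_le fin_mono_le)

lemma hs_pf1: "hs \<mu> \<xi> \<Longrightarrow> fin_mono \<mu> \<Longrightarrow> is_pf \<xi>"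
  using hs_fin[of \<mu> \<xi>] by (auto simp: is_pf_def) (meson hs_def le_trans)

lemma hs_pf2: "hs \<mu> \<xi> \<Longrightarrow> fin_mono \<xi> \<Longrightarrow> is_pf \<mu>"
  using hs_fin[of \<mu> \<xi>] by (auto simp: is_pf_def) (meson hs_def le_trans)

definition hsd :: "mono \<Rightarrow> nat \<Rightarrow> mono set" where
  "hsd \<xi> a = {\<mu>. hs \<mu> \<xi> \<and> deg \<xi> = deg \<mu> + a}"

definition hsu :: "mono \<Rightarrow> nat \<Rightarrow> mono set" where
  "hsu \<mu> k = {\<xi>. hs \<mu> \<xi> \<and> deg \<xi> = deg \<mu> + k}"

lemma finite_hsd: "fin_mono \<xi> \<Longrightarrow> finite (hsd \<xi> a)"
  by (rule finite_subset[OF _ finite_mono_le[of \<xi>]]) (auto simp: hsd_def hs_le)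

lemma le_deg: "fin_mono a \<Longrightarrow> a i \<le> deg a"
  unfolding deg_def fin_mono_def by (cases "a i = 0") (auto intro: member_le_sum)

lemma finite_hsu: "fin_mono \<mu> \<Longrightarrow> finite (hsu \<mu> k)"
proof -
  assume \<mu>: "fin_mono \<mu>"
  \<comment> \<open>Row 0 of \<xi> is bounded only by its degree; row i + 1 is bounded by row i of
    \<mu> through interlacing.\<close>
  define D where "D = (\<lambda>i. case i of 0 \<Rightarrow> deg \<mu> + k | Suc i \<Rightarrow> \<mu> i)"
  obtain N where N: "\<forall>i\<ge>N. \<mu> i = 0" using fin_mono_bound[OF \<mu>] by blast
  have "{i. D i \<noteq> 0} \<subseteq> {..<Suc N}"
    using N by (intro supp_lessThan) (auto simp: D_def split: nat.splits)
  then have "fin_mono D" unfolding fin_mono_def by (rule finite_subset) simp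
  moreover have "hsu \<mu> k \<subseteq> {b. b \<le> D}"
  proof
    fix \<xi> assume \<xi>: "\<xi> \<in> hsu \<mu> k"
    then have "fin_mono \<xi>" using hs_fin \<mu> by (auto simp: hsu_def)
    then show "\<xi> \<in> {b. b \<le> D}" using \<xi> le_deg[of \<xi> 0]
      by (auto simp: hsu_def hs_def le_fun_def D_def split: nat.splits)
  qed
  ultimately show ?thesis using finite_mono_le finite_subset by blast
qed

subsection \<open>Removing the largest letter of a tableau\<close>

text \<open>Row lengths of the region with entries below m. Rows increase weakly, so this region is
  a left part of each row and its length is the first failing position.\<close>

definition cutt :: "mono \<Rightarrow> nat \<Rightarrow> (nat \<times> nat \<Rightarrow> nat) \<Rightarrow> mono" where
  "cutt \<xi> m T = (\<lambda>i. LEAST j. \<not> (j < \<xi> i \<and> T (i, j) < m))"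

lemma cutt_iff:
  assumes "T \<in> sst \<xi> \<alpha>"
  shows "j < cutt \<xi> m T i \<longleftrightarrow> j < \<xi> i \<and> T (i, j) < m"
proof
  assume "j < cutt \<xi> m T i"
  then show "j < \<xi> i \<and> T (i, j) < m" unfolding cutt_def using not_less_Least by blast
next
  assume *: "j < \<xi> i \<and> T (i, j) < m"
  show "j < cutt \<xi> m T i"
  proof (rule ccontr)
    assume "\<not> j < cutt \<xi> m T i"
    moreover have "\<not> (cutt \<xi> m T i < \<xi> i \<and> T (i, cutt \<xi> m T i) < m)"
      unfolding cutt_def by (rule LeastI[of _ "\<xi> i"]) simp
    ultimately show False using * sst_row[OF assms, of "cutt \<xi> m T i" j i] by auto
  qed
qed

text \<open>Two copies of the largest letter in one column would break strictness, so the cells with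
  the letter m form a horizontal strip; deleting them and refilling a strip with m are inverse
  operations.\<close>

lemma kost_rec:
  assumes pf: "is_pf \<xi>" and \<alpha>: "\<forall>k>m. \<alpha> k = 0"
  shows "kost \<xi> \<alpha> = (\<Sum>\<mu>\<in>hsd \<xi> (\<alpha> m). kost \<mu> (\<alpha>(m := 0)))"
proof -
  have fl: "fin_mono \<xi>" using pf by (simp add: is_pf_def)
  let ?\<alpha> = "\<alpha>(m := 0)"
  have "?\<alpha> k = 0" if "k \<ge> m" for k using \<alpha> that by (cases "k = m") auto
  then have "{i. ?\<alpha> i \<noteq> 0} \<subseteq> {..<m}" by (intro supp_lessThan) blast
  then have f\<alpha>: "fin_mono ?\<alpha>" unfolding fin_mono_def by (rule finite_subset) simp
  define \<phi> where "\<phi> T = (cutt \<xi> m T, \<lambda>c. if c \<in> dg (cutt \<xi> m T) then T c else (0::nat))" for T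
  define \<psi> where "\<psi> = (\<lambda>(\<mu>, T) c. if c \<in> dg \<mu> then T c else if c \<in> dg \<xi> then m else (0::nat))"
  have fw: "\<phi> T \<in> Sigma (hsd \<xi> (\<alpha> m)) (\<lambda>\<mu>. sst \<mu> ?\<alpha>) \<and> \<psi> (\<phi> T) = T" if T: "T \<in> sst \<xi> \<alpha>" for T
  proof -
    define \<mu> where "\<mu> = cutt \<xi> m T"
    define T' where "T' c = (if c \<in> dg \<mu> then T c else 0)" for c
    have \<mu>: "j < \<mu> i \<longleftrightarrow> j < \<xi> i \<and> T (i, j) < m" for i j
      using cutt_iff[OF T] by (simp add: \<mu>_def)
    have Tm: "T c \<le> m" if "c \<in> dg \<xi>" for c
      using sst_pos[OF fl T that] \<alpha> by (meson not_le)
    have Tm': "T (i, j) \<le> m" if "j < \<xi> i" for i j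
      using Tm[of "(i,j)"] that by (simp add: dg_def)
    have col: "T (i, j) < T (Suc i, j)" if "j < \<xi> i" "j < \<xi> (Suc i)" for i j
      using T that by (simp add: sst_def)
    have row: "T (i, j) \<le> T (i, Suc j)" if "Suc j < \<xi> i" for i j
      using T that by (simp add: sst_def)
    have anti: "j < \<xi> i" if "j < \<xi> (Suc i)" for i j
      using pf that by (meson is_pf_def le_trans not_le)
    have h: "hs \<mu> \<xi>"
      unfolding hs_def
    proof (intro allI conjI)
      fix i
      show "\<mu> i \<le> \<xi> i" using \<mu>[of "\<xi> i" i] by simp
      \<comment> \<open>The cell below (i, j) has an entry at most m, so strictness puts the entry
        at (i, j) below m.\<close>
      have "j < \<mu> i" if "j < \<xi> (Suc i)" for j
        using \<mu>[of j i] anti[OF that] col[of j i] Tm'[of j "Suc i"] that by auto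
      from this[of "\<mu> i"] show "\<xi> (Suc i) \<le> \<mu> i" by (metis less_irrefl not_le)
    qed
    have f\<mu>: "fin_mono \<mu>" using hs_fin[OF h] fl by simp
    have dgm: "dg \<xi> - dg \<mu> = {c \<in> dg \<xi>. T c = m}"
      using Tm \<mu> by (force simp: dg_def)
    have sub: "dg \<mu> \<subseteq> dg \<xi>" using \<mu> by (auto simp: dg_def)
    have "card (dg \<xi> - dg \<mu>) = \<alpha> m" unfolding dgm using T by (simp add: sst_def)
    moreover have "card (dg \<xi>) = card (dg \<mu>) + card (dg \<xi> - dg \<mu>)"
      using sub finite_dg[OF fl] by (metis card_Diff_subset card_mono finite_subset le_add_diff_inverse)
    ultimately have d: "deg \<xi> = deg \<mu> + \<alpha> m" using card_dg fl f\<mu> by simp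
    have "T' \<in> sst \<mu> ?\<alpha>"
      unfolding sst_def
    proof (intro CollectI conjI allI impI)
      fix i j assume "Suc j < \<mu> i"
      then show "T' (i, j) \<le> T' (i, Suc j)" using row[of j i] \<mu>[of "Suc j" i]
        by (auto simp: T'_def dg_def)
    next
      fix i j assume "j < \<mu> i" "j < \<mu> (Suc i)"
      then show "T' (i, j) < T' (Suc i, j)" using col[of j i] \<mu>[of j i] \<mu>[of j "Suc i"]
        by (auto simp: T'_def dg_def)
    next
      fix c assume "c \<notin> dg \<mu>" then show "T' c = 0" by (simp add: T'_def)
    next
      fix k
      show "card {c \<in> dg \<mu>. T' c = k} = ?\<alpha> k"
      proof (cases "k < m")
        case True
        have "{c \<in> dg \<mu>. T' c = k} = {c \<in> dg \<xi>. T c = k}"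
          using True \<mu> by (auto simp: dg_def T'_def)
        then show ?thesis using T True by (simp add: sst_def)
      next
        case False
        have "{c \<in> dg \<mu>. T' c = k} = {}"
          using False \<mu> by (auto simp: dg_def T'_def)
        then show ?thesis using \<alpha> False by (simp only: card.empty) auto
      qed
    qed
    moreover have "\<psi> (\<mu>, T') = T"
    proof
      fix c
      show "\<psi> (\<mu>, T') c = T c" using dgm sub T
        by (cases "c \<in> dg \<xi>") (auto simp: \<psi>_def T'_def sst_def)
    qed
    moreover have "\<phi> T = (\<mu>, T')" by (simp add: \<phi>_def \<mu>_def T'_def fun_eq_iff)
    ultimately show ?thesis using h d by (simp add: hsd_def)
  qed
  have bw: "\<psi> x \<in> sst \<xi> \<alpha> \<and> \<phi> (\<psi> x) = x" if x: "x \<in> Sigma (hsd \<xi> (\<alpha> m)) (\<lambda>\<mu>. sst \<mu> ?\<alpha>)" for x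
  proof -
    obtain \<mu> T where xe: "x = (\<mu>, T)" and h: "hs \<mu> \<xi>" and d: "deg \<xi> = deg \<mu> + \<alpha> m"
      and T: "T \<in> sst \<mu> ?\<alpha>" using x by (auto simp: hsd_def)
    have f\<mu>: "fin_mono \<mu>" using hs_fin[OF h] fl by simp
    define U where "U = \<psi> (\<mu>, T)"
    have Tm: "T c < m" if "c \<in> dg \<mu>" for c
      using sst_pos[OF f\<mu> T that] \<alpha> by (metis fun_upd_apply linorder_neqE_nat)
    have Tm': "T (i, j) < m" if "j < \<mu> i" for i j using Tm[of "(i,j)"] that by (simp add: dg_def)
    have sub: "dg \<mu> \<subseteq> dg \<xi>" using h by (auto simp: dg_def hs_def intro: less_le_trans)
    have U: "U (i, j) = (if j < \<mu> i then T (i, j) else if j < \<xi> i then m else 0)" for i j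
      by (simp add: U_def \<psi>_def dg_def)
    have col: "T (i, j) < T (Suc i, j)" if "j < \<mu> i" "j < \<mu> (Suc i)" for i j
      using T that by (simp add: sst_def)
    have row: "T (i, j) \<le> T (i, Suc j)" if "Suc j < \<mu> i" for i j
      using T that by (simp add: sst_def)
    have "U \<in> sst \<xi> \<alpha>"
      unfolding sst_def
    proof (intro CollectI conjI allI impI)
      fix i j assume "Suc j < \<xi> i"
      then show "U (i, j) \<le> U (i, Suc j)" using row[of j i] Tm'[of j i] by (auto simp: U)
    next
      fix i j assume *: "j < \<xi> i" "j < \<xi> (Suc i)"
      then have "j < \<mu> i" using h by (meson hs_def less_le_trans)
      then show "U (i, j) < U (Suc i, j)" using * col[of j i] Tm'[of j i] by (auto simp: U)
    next
      fix c assume "c \<notin> dg \<xi>" then show "U c = 0" using sub by (auto simp: U_def \<psi>_def)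
    next
      fix k
      show "card {c \<in> dg \<xi>. U c = k} = \<alpha> k"
      proof (cases "k = m")
        case True
        have "{c \<in> dg \<xi>. U c = k} = dg \<xi> - dg \<mu>" using True Tm by (force simp: U_def \<psi>_def)
        then show ?thesis using sub finite_dg[OF f\<mu>] card_dg fl f\<mu> d True
          by (simp add: card_Diff_subset)
      next
        case False
        then have "{c \<in> dg \<xi>. U c = k} = {c \<in> dg \<mu>. T c = k}" using sub by (auto simp: U_def \<psi>_def)
        then show ?thesis using T False by (simp add: sst_def)
      qed
    qed
    moreover have "cutt \<xi> m U = \<mu>"
    proof
      fix i
      have "j < cutt \<xi> m U i \<longleftrightarrow> j < \<mu> i" for j
        unfolding cutt_iff[OF \<open>U \<in> sst \<xi> \<alpha>\<close>] using Tm'[of j i] h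
        by (auto simp: U hs_def split: if_splits intro: less_le_trans)
      then show "cutt \<xi> m U i = \<mu> i" by (meson linorder_neqE_nat less_irrefl)
    qed
    moreover have "(\<lambda>c. if c \<in> dg \<mu> then U c else 0) = T"
      using T by (auto simp: U_def \<psi>_def sst_def fun_eq_iff)
    ultimately show ?thesis unfolding xe U_def[symmetric] by (simp add: \<phi>_def)
  qed
  have "bij_betw \<phi> (sst \<xi> \<alpha>) (Sigma (hsd \<xi> (\<alpha> m)) (\<lambda>\<mu>. sst \<mu> ?\<alpha>))"
    by (rule bij_betw_byWitness[where f'=\<psi>]; intro ballI image_subsetI)
      (rule fw[THEN conjunct2] bw[THEN conjunct2] fw[THEN conjunct1] bw[THEN conjunct1], assumption)+
  then have "kost \<xi> \<alpha> = card (Sigma (hsd \<xi> (\<alpha> m)) (\<lambda>\<mu>. sst \<mu> ?\<alpha>))"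
    unfolding kost_def by (rule bij_betw_same_card)
  also have "\<dots> = (\<Sum>\<mu>\<in>hsd \<xi> (\<alpha> m). kost \<mu> ?\<alpha>)"
    unfolding kost_def
    by (rule card_SigmaI) (use finite_hsd[OF fl] finite_sst f\<alpha> hs_fin fl in \<open>auto simp: hsd_def\<close>)
  finally show ?thesis .
qed

subsection \<open>The local commutation of horizontal strips\<close>

text \<open>Adding a horizontal strip to both \<open>\<mu>\<close> and \<open>\<nu>\<close> amounts, row by row, to choosing
  \<open>\<xi> (i + 1)\<close> in an interval; reflecting each of these intervals yields a common
  shape \<open>\<kappa>\<close> obtained by removing horizontal strips. The first row is free and
  contributes the excess \<open>j\<close>.\<close>

definition toggle :: "mono \<Rightarrow> mono \<Rightarrow> mono \<Rightarrow> mono" where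
  "toggle \<mu> \<nu> \<xi> = (\<lambda>i. max (\<mu> (Suc i)) (\<nu> (Suc i)) + min (\<mu> i) (\<nu> i) - \<xi> (Suc i))"

definition untoggle :: "mono \<Rightarrow> mono \<Rightarrow> nat \<Rightarrow> mono \<Rightarrow> mono" where
  "untoggle \<mu> \<nu> j \<kappa> = (\<lambda>i. case i of 0 \<Rightarrow> max (\<mu> 0) (\<nu> 0) + j
     | Suc i \<Rightarrow> max (\<mu> (Suc i)) (\<nu> (Suc i)) + min (\<mu> i) (\<nu> i) - \<kappa> i)"

lemma reflect_interval:
  fixes M m x :: nat
  assumes "M \<le> x" "x \<le> m"
  shows "M \<le> M + m - x" "M + m - x \<le> m" "M + m - (M + m - x) = x"
  using assms by linarith+

lemma toggle_hs:
  assumes "hs \<mu> \<xi>" "hs \<nu> \<xi>"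
  shows "hs (toggle \<mu> \<nu> \<xi>) \<mu>" "hs (toggle \<mu> \<nu> \<xi>) \<nu>"
    "untoggle \<mu> \<nu> (\<xi> 0 - max (\<mu> 0) (\<nu> 0)) (toggle \<mu> \<nu> \<xi>) = \<xi>"
proof -
  have *: "\<mu> i \<le> \<xi> i" "\<xi> (Suc i) \<le> \<mu> i" "\<nu> i \<le> \<xi> i" "\<xi> (Suc i) \<le> \<nu> i" for i
    using assms by (auto simp: hs_def)
  have **: "\<mu> (Suc i) \<le> \<xi> (Suc i)" "\<nu> (Suc i) \<le> \<xi> (Suc i)" for i
    using * by auto
  show "hs (toggle \<mu> \<nu> \<xi>) \<mu>" "hs (toggle \<mu> \<nu> \<xi>) \<nu>"
    unfolding hs_def toggle_def
    using reflect_interval(1,2)[of "max (\<mu> (Suc i)) (\<nu> (Suc i))" "\<xi> (Suc i)" "min (\<mu> i) (\<nu> i)" for i] * **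
    by (meson max.boundedI max.cobounded1 max.cobounded2 min.boundedI min.cobounded1 min.cobounded2 order_trans)+
  show "untoggle \<mu> \<nu> (\<xi> 0 - max (\<mu> 0) (\<nu> 0)) (toggle \<mu> \<nu> \<xi>) = \<xi>"
  proof
    fix i
    show "untoggle \<mu> \<nu> (\<xi> 0 - max (\<mu> 0) (\<nu> 0)) (toggle \<mu> \<nu> \<xi>) i = \<xi> i"
    proof (cases i)
      case 0
      then show ?thesis using *(1)[of 0] *(3)[of 0] by (simp add: untoggle_def)
    next
      case (Suc k)
      then show ?thesis using *(2)[of k] *(4)[of k] by (simp add: untoggle_def toggle_def)
    qed
  qed
qed

lemma untoggle_hs:
  assumes "hs \<kappa> \<mu>" "hs \<kappa> \<nu>"
  shows "hs \<mu> (untoggle \<mu> \<nu> j \<kappa>)" "hs \<nu> (untoggle \<mu> \<nu> j \<kappa>)"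
    "toggle \<mu> \<nu> (untoggle \<mu> \<nu> j \<kappa>) = \<kappa>"
    "untoggle \<mu> \<nu> j \<kappa> 0 - max (\<mu> 0) (\<nu> 0) = j"
    "max (\<mu> 0) (\<nu> 0) \<le> untoggle \<mu> \<nu> j \<kappa> 0"
proof -
  have *: "\<kappa> i \<le> \<mu> i" "\<mu> (Suc i) \<le> \<kappa> i" "\<kappa> i \<le> \<nu> i" "\<nu> (Suc i) \<le> \<kappa> i" for i
    using assms by (auto simp: hs_def)
  have s: "untoggle \<mu> \<nu> j \<kappa> (Suc i) = max (\<mu> (Suc i)) (\<nu> (Suc i)) + min (\<mu> i) (\<nu> i) - \<kappa> i" for i
    by (simp add: untoggle_def)
  have "\<mu> i \<le> untoggle \<mu> \<nu> j \<kappa> i \<and> \<nu> i \<le> untoggle \<mu> \<nu> j \<kappa> i" for i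
  proof (cases i)
    case (Suc k)
    have "max (\<mu> (Suc k)) (\<nu> (Suc k)) \<le> untoggle \<mu> \<nu> j \<kappa> (Suc k)"
      unfolding s by (rule reflect_interval(1)) (use *[of k] in auto)
    then show ?thesis using Suc by simp
  qed (simp add: untoggle_def max_def)
  moreover have "untoggle \<mu> \<nu> j \<kappa> (Suc i) \<le> \<mu> i \<and> untoggle \<mu> \<nu> j \<kappa> (Suc i) \<le> \<nu> i" for i
  proof -
    have "untoggle \<mu> \<nu> j \<kappa> (Suc i) \<le> min (\<mu> i) (\<nu> i)"
      unfolding s by (rule reflect_interval(2)) (use *[of i] in auto)
    then show ?thesis by simp
  qed
  ultimately show "hs \<mu> (untoggle \<mu> \<nu> j \<kappa>)" "hs \<nu> (untoggle \<mu> \<nu> j \<kappa>)"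
    by (auto simp: hs_def)
  show "toggle \<mu> \<nu> (untoggle \<mu> \<nu> j \<kappa>) = \<kappa>"
  proof
    fix i
    show "toggle \<mu> \<nu> (untoggle \<mu> \<nu> j \<kappa>) i = \<kappa> i"
      using *[of i] s[of i] by (simp add: toggle_def)
  qed
qed (simp_all add: untoggle_def)

lemma deg_shift:
  assumes "fin_mono p"
  shows "fin_mono (\<lambda>i. p (Suc i))" "deg p = p 0 + deg (\<lambda>i. p (Suc i))"
proof -
  obtain N where N: "\<forall>i\<ge>N. p i = 0" using fin_mono_bound[OF assms] by blast
  have N': "\<forall>i\<ge>N. p (Suc i) = 0" using N by simp
  show "fin_mono (\<lambda>i. p (Suc i))"
    unfolding fin_mono_def by (rule finite_subset[OF supp_lessThan[OF N']]) simp
  have "deg p = (\<Sum>i<Suc N. p i)" using N by (intro deg_eq_lessThan) auto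
  also have "\<dots> = p 0 + (\<Sum>i<N. p (Suc i))" by (rule sum.lessThan_Suc_shift)
  also have "(\<Sum>i<N. p (Suc i)) = deg (\<lambda>i. p (Suc i))" using deg_eq_lessThan[OF N'] by simp
  finally show "deg p = p 0 + deg (\<lambda>i. p (Suc i))" .
qed

text \<open>Reflection keeps the sum of the two numbers in each interval equal to max + min, and in
  every row max + min of \<mu> and \<nu> is their sum. The first row of \<xi> lies in no interval;
  what it has above the maximum is the excess.\<close>

lemma toggle_deg:
  assumes "hs \<mu> \<xi>" "hs \<nu> \<xi>" "fin_mono \<xi>"
  shows "deg \<xi> + deg (toggle \<mu> \<nu> \<xi>) = deg \<mu> + deg \<nu> + (\<xi> 0 - max (\<mu> 0) (\<nu> 0))"
proof -
  have f: "fin_mono \<mu>" "fin_mono \<nu>" using hs_fin assms by auto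
  have *: "\<mu> i \<le> \<xi> i" "\<xi> (Suc i) \<le> \<mu> i" "\<nu> i \<le> \<xi> i" "\<xi> (Suc i) \<le> \<nu> i" for i
    using assms by (auto simp: hs_def)
  have fk: "fin_mono (toggle \<mu> \<nu> \<xi>)" using hs_fin[OF toggle_hs(1)[OF assms(1,2)]] f by simp
  have "(\<lambda>i. \<xi> (Suc i)) + toggle \<mu> \<nu> \<xi> = (\<lambda>i. max (\<mu> (Suc i)) (\<nu> (Suc i))) + (\<lambda>i. min (\<mu> i) (\<nu> i))"
  proof
    fix i
    show "((\<lambda>i. \<xi> (Suc i)) + toggle \<mu> \<nu> \<xi>) i = ((\<lambda>i. max (\<mu> (Suc i)) (\<nu> (Suc i))) + (\<lambda>i. min (\<mu> i) (\<nu> i))) i"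
      using *(2)[of i] *(4)[of i] by (simp add: toggle_def)
  qed
  moreover have fm: "fin_mono (\<lambda>i. min (\<mu> i) (\<nu> i))" "fin_mono (\<lambda>i. max (\<mu> i) (\<nu> i))"
    using f fin_mono_le[of \<mu> "\<lambda>i. min (\<mu> i) (\<nu> i)"] fin_mono_le[of "\<mu> + \<nu>" "\<lambda>i. max (\<mu> i) (\<nu> i)"]
    by (auto simp: le_fun_def)
  ultimately have "deg (\<lambda>i. \<xi> (Suc i)) + deg (toggle \<mu> \<nu> \<xi>)
      = deg (\<lambda>i. max (\<mu> (Suc i)) (\<nu> (Suc i))) + deg (\<lambda>i. min (\<mu> i) (\<nu> i))"
    using deg_add[of "\<lambda>i. \<xi> (Suc i)" "toggle \<mu> \<nu> \<xi>"] deg_shift[OF assms(3)] fk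
      deg_add[of "\<lambda>i. max (\<mu> (Suc i)) (\<nu> (Suc i))" "\<lambda>i. min (\<mu> i) (\<nu> i)"] deg_shift[OF fm(2)] fm
    by simp
  moreover have "(\<lambda>i. max (\<mu> i) (\<nu> i)) + (\<lambda>i. min (\<mu> i) (\<nu> i)) = \<mu> + \<nu>"
    by (auto simp: fun_eq_iff max_def min_def)
  then have "deg (\<lambda>i. max (\<mu> i) (\<nu> i)) + deg (\<lambda>i. min (\<mu> i) (\<nu> i)) = deg \<mu> + deg \<nu>"
    using deg_add fm f by metis
  ultimately show ?thesis
    using deg_shift(2)[OF assms(3)] deg_shift(2)[OF fm(2)] *(1)[of 0] *(3)[of 0] by simp
qed

text \<open>The commutation D_a U_k = \<Sum>j. U_(k-j) D_(a-j) between adding and removing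
  horizontal strips, the local rule behind the Robinson-Schensted-Knuth correspondence. The
  reflection realises it by a bijection that keeps the final shape \<nu>.\<close>

lemma pieri_commute:
  fixes G :: "mono \<Rightarrow> nat"
  assumes "fin_mono \<mu>"
  shows "(\<Sum>\<xi>\<in>hsu \<mu> k. \<Sum>\<nu>\<in>hsd \<xi> a. G \<nu>)
    = (\<Sum>j\<le>min k a. \<Sum>\<kappa>\<in>hsd \<mu> (a - j). \<Sum>\<nu>\<in>hsu \<kappa> (k - j). G \<nu>)"
proof -
  have fu: "fin_mono \<xi>" if "\<xi> \<in> hsu \<mu> k" for \<xi> using that assms hs_fin by (auto simp: hsu_def)
  have fd: "fin_mono \<kappa>" if "\<kappa> \<in> hsd \<mu> b" for \<kappa> b using that assms hs_fin by (auto simp: hsd_def)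
  have "(\<Sum>\<xi>\<in>hsu \<mu> k. \<Sum>\<nu>\<in>hsd \<xi> a. G \<nu>) = (\<Sum>(\<xi>,\<nu>)\<in>Sigma (hsu \<mu> k) (\<lambda>\<xi>. hsd \<xi> a). G \<nu>)"
    by (rule sum.Sigma) (use finite_hsu assms finite_hsd fu in auto)
  also have "\<dots> = (\<Sum>(j,\<kappa>,\<nu>)\<in>Sigma {..min k a} (\<lambda>j. Sigma (hsd \<mu> (a - j)) (\<lambda>\<kappa>. hsu \<kappa> (k - j))). G \<nu>)"
  proof (rule sum.reindex_bij_witness[where
        i="\<lambda>(j,\<kappa>,\<nu>). (untoggle \<mu> \<nu> j \<kappa>, \<nu>)" and j="\<lambda>(\<xi>,\<nu>). (\<xi> 0 - max (\<mu> 0) (\<nu> 0), toggle \<mu> \<nu> \<xi>, \<nu>)"])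
    fix x assume "x \<in> Sigma (hsu \<mu> k) (\<lambda>\<xi>. hsd \<xi> a)"
    then obtain \<xi> \<nu> where x: "x = (\<xi>, \<nu>)" and h: "hs \<mu> \<xi>" "hs \<nu> \<xi>"
      and d: "deg \<xi> = deg \<mu> + k" "deg \<xi> = deg \<nu> + a" by (auto simp: hsu_def hsd_def)
    have f: "fin_mono \<xi>" "fin_mono \<nu>" using h assms hs_fin by auto
    note t = toggle_hs[OF h] and td = toggle_deg[OF h f(1)]
    have "deg (toggle \<mu> \<nu> \<xi>) \<le> deg \<mu>" "deg (toggle \<mu> \<nu> \<xi>) \<le> deg \<nu>"
      using deg_mono hs_le t assms f by auto
    then show "(case case x of (\<xi>,\<nu>) \<Rightarrow> (\<xi> 0 - max (\<mu> 0) (\<nu> 0), toggle \<mu> \<nu> \<xi>, \<nu>) of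
        (j,\<kappa>,\<nu>) \<Rightarrow> (untoggle \<mu> \<nu> j \<kappa>, \<nu>)) = x"
      "(case x of (\<xi>,\<nu>) \<Rightarrow> (\<xi> 0 - max (\<mu> 0) (\<nu> 0), toggle \<mu> \<nu> \<xi>, \<nu>))
        \<in> Sigma {..min k a} (\<lambda>j. Sigma (hsd \<mu> (a - j)) (\<lambda>\<kappa>. hsu \<kappa> (k - j)))"
      using t td d by (auto simp: x hsu_def hsd_def)
    show "(case case x of (\<xi>,\<nu>) \<Rightarrow> (\<xi> 0 - max (\<mu> 0) (\<nu> 0), toggle \<mu> \<nu> \<xi>, \<nu>) of (j,\<kappa>,\<nu>) \<Rightarrow> G \<nu>)
        = (case x of (\<xi>,\<nu>) \<Rightarrow> G \<nu>)" by (simp add: x)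
  next
    fix y assume "y \<in> Sigma {..min k a} (\<lambda>j. Sigma (hsd \<mu> (a - j)) (\<lambda>\<kappa>. hsu \<kappa> (k - j)))"
    then obtain j \<kappa> \<nu> where y: "y = (j, \<kappa>, \<nu>)" and j: "j \<le> k" "j \<le> a" and h: "hs \<kappa> \<mu>" "hs \<kappa> \<nu>"
      and d: "deg \<mu> = deg \<kappa> + (a - j)" "deg \<nu> = deg \<kappa> + (k - j)"
      by (auto simp: hsu_def hsd_def)
    note u = untoggle_hs[OF h, of j]
    have f: "fin_mono (untoggle \<mu> \<nu> j \<kappa>)" using u(1) assms hs_fin by auto
    note td = toggle_deg[OF u(1,2) f]
    show "(case case y of (j,\<kappa>,\<nu>) \<Rightarrow> (untoggle \<mu> \<nu> j \<kappa>, \<nu>) of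
        (\<xi>,\<nu>) \<Rightarrow> (\<xi> 0 - max (\<mu> 0) (\<nu> 0), toggle \<mu> \<nu> \<xi>, \<nu>)) = y"
      using u by (simp add: y)
    have "deg (untoggle \<mu> \<nu> j \<kappa>) = deg \<mu> + k" "deg (untoggle \<mu> \<nu> j \<kappa>) = deg \<nu> + a"
      using td d j unfolding u(3,4) by linarith+
    then show "(case y of (j,\<kappa>,\<nu>) \<Rightarrow> (untoggle \<mu> \<nu> j \<kappa>, \<nu>)) \<in> Sigma (hsu \<mu> k) (\<lambda>\<xi>. hsd \<xi> a)"
      using u by (simp add: y hsu_def hsd_def)
  qed
  also have "\<dots> = (\<Sum>j\<le>min k a. \<Sum>(\<kappa>,\<nu>)\<in>Sigma (hsd \<mu> (a - j)) (\<lambda>\<kappa>. hsu \<kappa> (k - j)). G \<nu>)"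
    by (rule sum.Sigma[symmetric]) (use finite_hsd finite_hsu assms fd in auto)
  also have "\<dots> = (\<Sum>j\<le>min k a. \<Sum>\<kappa>\<in>hsd \<mu> (a - j). \<Sum>\<nu>\<in>hsu \<kappa> (k - j). G \<nu>)"
    by (intro sum.cong refl sum.Sigma[symmetric]) (use finite_hsd finite_hsu assms fd in auto)
  finally show ?thesis .
qed

lemma deg_upd0: "fin_mono \<gamma> \<Longrightarrow> deg \<gamma> = deg (\<gamma>(m := 0)) + \<gamma> m"
proof -
  assume f: "fin_mono \<gamma>"
  have g: "fin_mono (\<gamma>(m := 0))" by (rule fin_mono_le[OF f]) (simp add: le_fun_def)
  have h: "fin_mono (\<lambda>i. if i = m then \<gamma> m else 0)" by (rule fin_mono_le[OF f]) (simp add: le_fun_def)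
  have "\<gamma> = \<gamma>(m := 0) + (\<lambda>i. if i = m then \<gamma> m else 0)" by (auto simp: fun_eq_iff)
  then have "deg \<gamma> = deg (\<gamma>(m := 0)) + deg (\<lambda>i. if i = m then \<gamma> m else 0)"
    using deg_add[OF g h] by metis
  also have "deg (\<lambda>i. if i = m then \<gamma> m else 0) = \<gamma> m"
    by (subst deg_eq_sum[of "{m}"]) auto
  finally show ?thesis .
qed

text \<open>Induction on the number of variables: strip the last letter from \<xi> by
  \<open>kost_rec\<close>, move its removal past the added strip by \<open>pieri_commute\<close>,
  and apply the hypothesis. The excess j becomes the exponent of the last variable in the factor
  h_k.\<close>

lemma pieri_kost:
  assumes "is_pf \<mu>" "\<forall>i\<ge>m. \<alpha> i = 0"
  shows "(\<Sum>\<xi>\<in>hsu \<mu> k. kost \<xi> \<alpha>) = (\<Sum>\<gamma>\<in>{\<gamma>. \<gamma> \<le> \<alpha> \<and> deg \<gamma> = k}. kost \<mu> (\<alpha> - \<gamma>))"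
  using assms
proof (induction m arbitrary: \<mu> \<alpha> k)
  case 0
  then have \<alpha>: "\<alpha> = 0" by (simp add: fun_eq_iff)
  have f: "fin_mono \<mu>" using 0 by (simp add: is_pf_def)
  have "(\<Sum>\<xi>\<in>hsu \<mu> k. kost \<xi> \<alpha>) = (\<Sum>\<xi>\<in>hsu \<mu> k. if \<xi> = 0 then 1 else 0)"
    unfolding \<alpha> by (rule sum.cong[OF refl], rule kost_zero) (use f hs_pf1 in \<open>auto simp: hsu_def\<close>)
  also have "\<dots> = (if 0 \<in> hsu \<mu> k then 1 else 0)"
    by (simp add: sum.delta finite_hsu[OF f])
  also have "0 \<in> hsu \<mu> k \<longleftrightarrow> \<mu> = 0 \<and> k = 0"
  proof
    assume "0 \<in> hsu \<mu> k"
    then have "\<mu> \<le> 0" "deg (0::mono) = deg \<mu> + k" by (auto simp: hsu_def dest: hs_le)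
    then show "\<mu> = 0 \<and> k = 0" using deg_eq_0_iff[OF f] unfolding deg_zero by linarith
  qed (simp add: hsu_def hs_def)
  also have "(if \<mu> = 0 \<and> k = 0 then 1 else 0) = (\<Sum>\<gamma>\<in>{\<gamma>. \<gamma> \<le> \<alpha> \<and> deg \<gamma> = k}. kost \<mu> (\<alpha> - \<gamma>))"
  proof -
    have le0: "\<gamma> \<le> 0 \<longleftrightarrow> \<gamma> = 0" for \<gamma> :: mono by (simp add: le_fun_def fun_eq_iff)
    have z0: "(0::mono) - 0 = 0" by (rule ext) simp
    show ?thesis
    proof (cases "k = 0")
      case True
      have "{\<gamma>. \<gamma> \<le> \<alpha> \<and> deg \<gamma> = k} = {0}"
        unfolding \<alpha> le0 True using deg_zero by blast
      then have "(\<Sum>\<gamma>\<in>{\<gamma>. \<gamma> \<le> \<alpha> \<and> deg \<gamma> = k}. kost \<mu> (\<alpha> - \<gamma>)) = kost \<mu> 0"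
        by (simp only: \<alpha> z0 sum.insert sum.empty finite.emptyI empty_iff) simp
      then show ?thesis using kost_zero[OF 0(1)] True by (simp only: simp_thms)
    next
      case False
      have e: "{\<gamma>. \<gamma> \<le> \<alpha> \<and> deg \<gamma> = k} = {}"
        unfolding \<alpha> le0 using deg_zero False by auto
      then show ?thesis unfolding e using False by simp
    qed
  qed
  finally show ?case .
next
  case (Suc m)
  have f: "fin_mono \<mu>" using Suc.prems by (simp add: is_pf_def)
  have f\<alpha>: "fin_mono \<alpha>" unfolding fin_mono_def by (rule finite_subset[OF supp_lessThan[OF Suc.prems(2)]]) simp
  have z: "\<forall>k>m. \<alpha> k = 0" using Suc.prems(2) by auto
  define a where "a = \<alpha> m"
  define \<alpha>' where "\<alpha>' = \<alpha>(m := 0)"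
  have \<alpha>': "\<forall>i\<ge>m. \<alpha>' i = 0" using Suc.prems(2) unfolding \<alpha>'_def by (metis Suc_leI fun_upd_apply le_neq_implies_less)
  have f\<alpha>': "fin_mono \<alpha>'" by (rule fin_mono_le[OF f\<alpha>]) (simp add: \<alpha>'_def le_fun_def)
  have "(\<Sum>\<xi>\<in>hsu \<mu> k. kost \<xi> \<alpha>) = (\<Sum>\<xi>\<in>hsu \<mu> k. \<Sum>\<nu>\<in>hsd \<xi> a. kost \<nu> \<alpha>')"
    unfolding a_def \<alpha>'_def by (rule sum.cong[OF refl], rule kost_rec[OF _ z]) (use f hs_pf1 in \<open>auto simp: hsu_def\<close>)
  also have "\<dots> = (\<Sum>j\<le>min k a. \<Sum>\<kappa>\<in>hsd \<mu> (a - j). \<Sum>\<nu>\<in>hsu \<kappa> (k - j). kost \<nu> \<alpha>')"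
    by (rule pieri_commute[OF f])
  also have "\<dots> = (\<Sum>j\<le>min k a. \<Sum>\<kappa>\<in>hsd \<mu> (a - j). \<Sum>\<gamma>\<in>{\<gamma>. \<gamma> \<le> \<alpha>' \<and> deg \<gamma> = k - j}. kost \<kappa> (\<alpha>' - \<gamma>))"
    by (rule sum.cong[OF refl], rule sum.cong[OF refl], rule Suc.IH[OF _ \<alpha>']) (use f hs_pf2 in \<open>auto simp: hsd_def\<close>)
  also have "\<dots> = (\<Sum>j\<le>min k a. \<Sum>\<gamma>\<in>{\<gamma>. \<gamma> \<le> \<alpha>' \<and> deg \<gamma> = k - j}. \<Sum>\<kappa>\<in>hsd \<mu> (a - j). kost \<kappa> (\<alpha>' - \<gamma>))"
    by (rule sum.cong[OF refl], rule sum.swap)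
  also have "\<dots> = (\<Sum>(j,\<gamma>)\<in>Sigma {..min k a} (\<lambda>j. {\<gamma>. \<gamma> \<le> \<alpha>' \<and> deg \<gamma> = k - j}). \<Sum>\<kappa>\<in>hsd \<mu> (a - j). kost \<kappa> (\<alpha>' - \<gamma>))"
    by (rule sum.Sigma) (use finite_subset[OF _ finite_mono_le[OF f\<alpha>']] in auto)
  also have "\<dots> = (\<Sum>\<gamma>\<in>{\<gamma>. \<gamma> \<le> \<alpha> \<and> deg \<gamma> = k}. \<Sum>\<kappa>\<in>hsd \<mu> ((\<alpha> - \<gamma>) m). kost \<kappa> ((\<alpha> - \<gamma>)(m := 0)))"
  proof (rule sum.reindex_bij_witness[where i="\<lambda>\<gamma>. (\<gamma> m, \<gamma>(m := 0))" and j="\<lambda>(j,\<gamma>). \<gamma>(m := j)"])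
    fix x assume "x \<in> Sigma {..min k a} (\<lambda>j. {\<gamma>. \<gamma> \<le> \<alpha>' \<and> deg \<gamma> = k - j})"
    then obtain j \<gamma> where x: "x = (j, \<gamma>)" "j \<le> k" "j \<le> a" "\<gamma> \<le> \<alpha>'" "deg \<gamma> = k - j" by auto
    have \<gamma>m: "\<gamma> m = 0" using x(4) \<alpha>' by (metis le_funD le_zero_eq order_refl)
    have u0: "\<gamma>(m := 0) = \<gamma>" using \<gamma>m by (simp add: fun_eq_iff)
    have le: "\<gamma>(m := j) \<le> \<alpha>"
    proof (rule le_funI)
      fix i
      show "(\<gamma>(m := j)) i \<le> \<alpha> i"
        using x(3) le_funD[OF x(4), of i] by (cases "i = m") (auto simp: \<alpha>'_def a_def)
    qed
    have "deg (\<gamma>(m := j)) = k" using deg_upd0[OF fin_mono_le[OF f\<alpha> le], of m] x u0 by simp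
    then show "(case x of (j, \<gamma>) \<Rightarrow> \<gamma>(m := j)) \<in> {\<gamma>. \<gamma> \<le> \<alpha> \<and> deg \<gamma> = k}" using le x by simp
    show "((case x of (j, \<gamma>) \<Rightarrow> \<gamma>(m := j)) m, (case x of (j, \<gamma>) \<Rightarrow> \<gamma>(m := j))(m := 0)) = x"
      using x u0 by simp
    have "(\<alpha> - \<gamma>(m := j)) m = a - j" by (simp add: a_def)
    moreover have "(\<alpha> - \<gamma>(m := j))(m := 0) = \<alpha>' - \<gamma>" using \<gamma>m by (auto simp: fun_eq_iff \<alpha>'_def)
    ultimately show "(\<Sum>\<kappa>\<in>hsd \<mu> ((\<alpha> - (case x of (j, \<gamma>) \<Rightarrow> \<gamma>(m := j))) m). kost \<kappa> ((\<alpha> - (case x of (j, \<gamma>) \<Rightarrow> \<gamma>(m := j)))(m := 0)))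
      = (case x of (j, \<gamma>) \<Rightarrow> \<Sum>\<kappa>\<in>hsd \<mu> (a - j). kost \<kappa> (\<alpha>' - \<gamma>))" using x by simp
  next
    fix \<gamma> assume \<gamma>: "\<gamma> \<in> {\<gamma>. \<gamma> \<le> \<alpha> \<and> deg \<gamma> = k}"
    then have d: "deg \<gamma> = deg (\<gamma>(m := 0)) + \<gamma> m" using deg_upd0 fin_mono_le[OF f\<alpha>] by blast
    have "\<gamma>(m := 0) \<le> \<alpha>'" "\<gamma> m \<le> a" using \<gamma> by (auto simp: \<alpha>'_def a_def le_fun_def)
    moreover have "deg \<gamma> = k" using \<gamma> by simp
    then have "deg (\<gamma>(m := 0)) = k - \<gamma> m" "\<gamma> m \<le> k" using d by linarith+
    ultimately show "(\<gamma> m, \<gamma>(m := 0)) \<in> Sigma {..min k a} (\<lambda>j. {\<gamma>. \<gamma> \<le> \<alpha>' \<and> deg \<gamma> = k - j})"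
      by simp
  qed simp
  also have "\<dots> = (\<Sum>\<gamma>\<in>{\<gamma>. \<gamma> \<le> \<alpha> \<and> deg \<gamma> = k}. kost \<mu> (\<alpha> - \<gamma>))"
    by (rule sum.cong[OF refl], rule kost_rec[symmetric]) (use Suc.prems z in auto)
  finally show ?case .
qed

section \<open>Products of complete functions in terms of Schur functions\<close>

definition hh :: "nat \<Rightarrow> int mps" where
  "hh n = mk (hfun n)"

definition ss :: "mono \<Rightarrow> int mps" where
  "ss p = mk (\<lambda>\<alpha>. int (kost p \<alpha>))"

definition hl :: "nat list \<Rightarrow> int mps" where
  "hl bs = prod_list (map hh bs)"

lemma cf_hh: "cf (hh n) \<alpha> = (if fin_mono \<alpha> \<and> deg \<alpha> = n then 1 else 0)"
  by (simp add: hh_def hfun_def)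

lemma cf_ss: "fin_mono \<alpha> \<Longrightarrow> cf (ss p) \<alpha> = int (kost p \<alpha>)"
  by (simp add: ss_def)

lemma ss_schur: "ss (pf la) = mk (schur la)"
  by (rule mps_eqI) (simp add: cf_ss schur_kost)

lemma pieri: "is_pf \<mu> \<Longrightarrow> hh k * ss \<mu> = (\<Sum>\<xi>\<in>hsu \<mu> k. ss \<xi>)"
proof (rule mps_eqI)
  fix \<alpha> assume \<mu>: "is_pf \<mu>" and \<alpha>: "fin_mono \<alpha>"
  obtain N where N: "\<forall>i\<ge>N. \<alpha> i = 0" using fin_mono_bound[OF \<alpha>] by blast
  have "cf (hh k * ss \<mu>) \<alpha> = (\<Sum>\<beta>\<in>{\<beta>. \<beta> \<le> \<alpha>}. if deg \<beta> = k then int (kost \<mu> (\<alpha> - \<beta>)) else 0)"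
    unfolding cf_mult[OF \<alpha>]
    by (rule sum.cong) (auto simp: cf_hh cf_ss fin_mono_diff[OF \<alpha>] fin_mono_le[OF \<alpha>])
  also have "\<dots> = (\<Sum>\<gamma>\<in>{\<gamma>. \<gamma> \<le> \<alpha> \<and> deg \<gamma> = k}. int (kost \<mu> (\<alpha> - \<gamma>)))"
    using finite_mono_le[OF \<alpha>] by (simp add: sum.If_cases Int_def)
  also have "\<dots> = cf (\<Sum>\<xi>\<in>hsu \<mu> k. ss \<xi>) \<alpha>"
    using pieri_kost[OF \<mu> N, of k] by (simp add: cf_ss[OF \<alpha>] flip: of_nat_sum)
  finally show "cf (hh k * ss \<mu>) \<alpha> = cf (\<Sum>\<xi>\<in>hsu \<mu> k. ss \<xi>) \<alpha>" .
qed

definition pfs :: "nat \<Rightarrow> mono set" where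
  "pfs n = {p. is_pf p \<and> deg p = n}"

lemma pf_antimono: "is_pf p \<Longrightarrow> i \<le> j \<Longrightarrow> p j \<le> p i"
  using lift_Suc_antimono_le[of p i j] by (auto simp: is_pf_def)

lemma pf_zero_ge_deg: "is_pf p \<Longrightarrow> deg p \<le> i \<Longrightarrow> p i = 0"
proof (rule ccontr)
  assume p: "is_pf p" "deg p \<le> i" "p i \<noteq> 0"
  have f: "fin_mono p" using p by (simp add: is_pf_def)
  have nz: "p j \<ge> 1" if "j \<le> i" for j using pf_antimono[OF p(1) that] p(3) by simp
  have "Suc i = (\<Sum>j\<le>i. 1)" by simp
  also have "\<dots> \<le> (\<Sum>j\<le>i. p j)" by (rule sum_mono) (use nz in auto)
  also have "\<dots> \<le> (\<Sum>j\<in>{j. p j \<noteq> 0}. p j)"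
    by (rule sum_mono2) (use f nz in \<open>auto simp: fin_mono_def Suc_le_eq\<close>)
  also have "\<dots> = deg p" by (simp add: deg_def)
  finally show False using p by simp
qed

lemma finite_pfs: "finite (pfs n)"
proof -
  have f: "fin_mono (\<lambda>i. if i < n then n else 0)"
    unfolding fin_mono_def by (rule finite_subset[of _ "{..<n}"]) auto
  have "pfs n \<subseteq> {b. b \<le> (\<lambda>i. if i < n then n else 0)}"
    using pf_zero_ge_deg le_deg by (auto simp: pfs_def le_fun_def is_pf_def not_less)
  then show ?thesis using finite_mono_le[OF f] finite_subset by blast
qed

text \<open>Each factor h_k adds a horizontal strip, so the product counts chains of strips.
  Regrouping the last strip by its outer instead of its inner shape turns the sum into the recursion
  \<open>kost_rec\<close> for the letter \<open>length bs\<close>.\<close>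

lemma hl_kost: "hl bs = (\<Sum>\<xi>\<in>pfs (sum_list bs). of_nat (kost \<xi> (pf bs)) * ss \<xi>)"
proof (induction bs rule: rev_induct)
  case Nil
  have e: "pf [] = 0" by (simp add: pf_def fun_eq_iff)
  have i: "is_pf 0" by (simp add: is_pf_def)
  have "pfs 0 = {0}" using i deg_eq_0_iff by (auto simp: pfs_def is_pf_def)
  moreover have "ss 0 = 1"
  proof (rule mps_eqI)
    fix \<alpha> assume \<alpha>: "fin_mono \<alpha>"
    show "cf (ss 0) \<alpha> = cf 1 \<alpha>"
      using kost_deg[OF _ \<alpha>, of 0] kost_zero[OF i] deg_eq_0_iff[OF \<alpha>] by (auto simp: cf_ss[OF \<alpha>] cf_1)
  qed
  moreover have "kost 0 0 = 1" by (rule kost_self[OF i])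
  ultimately have "(\<Sum>\<xi>\<in>pfs 0. of_nat (kost \<xi> 0) * ss \<xi>) = 1" by (metis (no_types, lifting) finite.emptyI insert_absorb insert_not_empty mult_1 of_nat_1 sum.empty sum.insert add.right_neutral)
  then show ?case unfolding e hl_def list.map prod_list.Nil sum_list.Nil by (rule sym)
next
  case (snoc k bs)
  let ?n = "sum_list bs" and ?\<alpha> = "pf bs" and ?\<beta> = "pf (bs @ [k])"
  have b: "?\<beta> (length bs) = k" "?\<beta>(length bs := 0) = ?\<alpha>" "\<forall>i>length bs. ?\<beta> i = 0"
    by (auto simp: pf_def fun_eq_iff nth_append)
  have f: "fin_mono \<xi>" if "\<xi> \<in> pfs n" for \<xi> n using that by (simp add: pfs_def is_pf_def)
  have "hl (bs @ [k]) = hl bs * hh k" by (simp add: hl_def)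
  also have "\<dots> = (\<Sum>\<mu>\<in>pfs ?n. of_nat (kost \<mu> ?\<alpha>) * (hh k * ss \<mu>))"
    unfolding snoc.IH by (simp add: sum_distrib_right sum_distrib_left mult_ac)
  also have "\<dots> = (\<Sum>\<mu>\<in>pfs ?n. \<Sum>\<xi>\<in>hsu \<mu> k. of_nat (kost \<mu> ?\<alpha>) * ss \<xi>)"
    by (rule sum.cong[OF refl]) (simp add: pfs_def pieri sum_distrib_left)
  also have "\<dots> = (\<Sum>(\<mu>,\<xi>)\<in>Sigma (pfs ?n) (\<lambda>\<mu>. hsu \<mu> k). of_nat (kost \<mu> ?\<alpha>) * ss \<xi>)"
    by (rule sum.Sigma) (use finite_pfs finite_hsu f in auto)
  also have "\<dots> = (\<Sum>(\<xi>,\<mu>)\<in>Sigma (pfs (?n + k)) (\<lambda>\<xi>. hsd \<xi> k). of_nat (kost \<mu> ?\<alpha>) * ss \<xi>)"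
    by (rule sum.reindex_bij_witness[where i="\<lambda>(a,b). (b,a)" and j="\<lambda>(a,b). (b,a)"])
      (auto simp: pfs_def hsd_def hsu_def is_pf_def dest: hs_pf1 hs_pf2 intro: hs_pf1[unfolded is_pf_def, THEN conjunct1, rule_format] hs_pf2[unfolded is_pf_def, THEN conjunct1, rule_format] hs_fin[THEN iffD1] hs_fin[THEN iffD2])
  also have "\<dots> = (\<Sum>\<xi>\<in>pfs (?n + k). \<Sum>\<mu>\<in>hsd \<xi> k. of_nat (kost \<mu> ?\<alpha>) * ss \<xi>)"
    by (rule sum.Sigma[symmetric]) (use finite_pfs finite_hsd f in auto)
  also have "\<dots> = (\<Sum>\<xi>\<in>pfs (?n + k). of_nat (kost \<xi> ?\<beta>) * ss \<xi>)"
  proof (rule sum.cong[OF refl])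
    fix \<xi> assume "\<xi> \<in> pfs (?n + k)"
    then have "is_pf \<xi>" by (simp add: pfs_def)
    from kost_rec[OF this b(3)] show "(\<Sum>\<mu>\<in>hsd \<xi> k. of_nat (kost \<mu> ?\<alpha>) * ss \<xi>) = of_nat (kost \<xi> ?\<beta>) * ss \<xi>"
      by (simp add: b sum_distrib_right)
  qed
  finally show ?case by simp
qed

section \<open>The ring of symmetric functions and its Schur basis\<close>

lemma fin_mono_comp: "bij \<sigma> \<Longrightarrow> fin_mono (\<alpha> \<circ> \<sigma>) \<longleftrightarrow> fin_mono \<alpha>"
proof -
  assume \<sigma>: "bij \<sigma>"
  have e: "{i. (\<alpha> \<circ> \<sigma>) i \<noteq> 0} = \<sigma> -` {i. \<alpha> i \<noteq> 0}" by auto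
  show ?thesis unfolding fin_mono_def e by (rule finite_vimage_iff[OF \<sigma>])
qed

lemma deg_comp: "bij \<sigma> \<Longrightarrow> deg (\<alpha> \<circ> \<sigma>) = deg \<alpha>"
proof -
  assume \<sigma>: "bij \<sigma>"
  have e: "{i. (\<alpha> \<circ> \<sigma>) i \<noteq> 0} = \<sigma> -` {i. \<alpha> i \<noteq> 0}" by auto
  have "bij_betw \<sigma> (\<sigma> -` {i. \<alpha> i \<noteq> 0}) {i. \<alpha> i \<noteq> 0}"
    using \<sigma> by (auto simp: bij_betw_def bij_def inj_on_def image_vimage_eq)
  from sum.reindex_bij_betw[OF this, of \<alpha>] show ?thesis unfolding deg_def e by simp
qed

section \<open>Symmetric series and series of bounded degree\<close>

definition symm :: "int mps \<Rightarrow> bool" where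
  "symm f \<longleftrightarrow> (\<forall>\<alpha> \<sigma>. bij \<sigma> \<longrightarrow> cf f (\<alpha> \<circ> \<sigma>) = cf f \<alpha>)"

definition bdd :: "nat \<Rightarrow> int mps \<Rightarrow> bool" where
  "bdd d f \<longleftrightarrow> (\<forall>\<alpha>. cf f \<alpha> \<noteq> 0 \<longrightarrow> deg \<alpha> \<le> d)"

definition Lam :: "int mps set" where
  "Lam = {f. symm f \<and> (\<exists>d. bdd d f)}"

lemma cf_Lambda: "cf g \<in> Lambda \<longleftrightarrow> g \<in> Lam"
  by (auto simp: Lambda_def Lam_def is_symmetric_def symm_def bdd_def cf_nonfin)

lemma Lambda_cf_mk: "f \<in> Lambda \<Longrightarrow> cf (mk f) = f"
  by (auto simp: Lambda_def is_symmetric_def fun_eq_iff)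

lemma symm_0 [simp]: "symm 0" and symm_add: "symm f \<Longrightarrow> symm g \<Longrightarrow> symm (f + g)"
  and symm_diff: "symm f \<Longrightarrow> symm g \<Longrightarrow> symm (f - g)"
  and symm_uminus: "symm f \<Longrightarrow> symm (- f)"
  by (simp_all add: symm_def)

lemma comp_eq_0_iff: "bij \<sigma> \<Longrightarrow> (\<alpha>::mono) \<circ> \<sigma> = 0 \<longleftrightarrow> \<alpha> = 0"
  by (auto simp: fun_eq_iff bij_def surj_def) metis

lemma symm_1 [simp]: "symm 1"
  unfolding symm_def cf_1 by (intro allI impI) (simp only: comp_eq_0_iff)

lemma symm_mult:
  assumes "symm f" "symm g"
  shows "symm (f * g)"
  unfolding symm_def
proof (intro allI impI)
  fix \<alpha> :: mono and \<sigma> :: "nat \<Rightarrow> nat" assume \<sigma>: "bij \<sigma>"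
  show "cf (f * g) (\<alpha> \<circ> \<sigma>) = cf (f * g) \<alpha>"
  proof (cases "fin_mono \<alpha>")
    case True
    then have T: "fin_mono (\<alpha> \<circ> \<sigma>)" using fin_mono_comp[OF \<sigma>] by simp
    have inv: "\<sigma> (inv \<sigma> x) = x" "inv \<sigma> (\<sigma> x) = x" for x
      using \<sigma> by (simp_all add: bij_is_surj surj_f_inv_f bij_is_inj)
    have c: "cf f (\<beta> \<circ> \<sigma>) = cf f \<beta>" "cf g (\<beta> \<circ> \<sigma>) = cf g \<beta>" for \<beta>
      using assms \<sigma> by (auto simp: symm_def)
    have d: "(\<alpha> \<circ> \<sigma>) - (\<beta> \<circ> \<sigma>) = (\<alpha> - \<beta>) \<circ> \<sigma>" for \<beta> by (simp add: fun_eq_iff)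
    have "(\<Sum>\<beta>\<in>{\<beta>. \<beta> \<le> \<alpha>}. cf f \<beta> * cf g (\<alpha> - \<beta>))
        = (\<Sum>\<beta>\<in>{\<beta>. \<beta> \<le> \<alpha> \<circ> \<sigma>}. cf f \<beta> * cf g ((\<alpha> \<circ> \<sigma>) - \<beta>))"
    proof (rule sum.reindex_bij_witness[where i="\<lambda>\<beta>. \<beta> \<circ> inv \<sigma>" and j="\<lambda>\<beta>. \<beta> \<circ> \<sigma>"])
      fix \<beta> assume "\<beta> \<in> {\<beta>. \<beta> \<le> \<alpha> \<circ> \<sigma>}"
      then have "\<beta> (inv \<sigma> x) \<le> \<alpha> (\<sigma> (inv \<sigma> x))" for x by (simp add: le_fun_def)
      then show "\<beta> \<circ> inv \<sigma> \<in> {\<beta>. \<beta> \<le> \<alpha>}" by (simp add: inv le_fun_def)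
    qed (auto simp: le_fun_def fun_eq_iff inv d c)
    then show ?thesis by (simp add: cf_mult True T)
  next
    case False
    then show ?thesis using fin_mono_comp[OF \<sigma>, of \<alpha>] by (simp add: cf_nonfin)
  qed
qed

lemma symm_sum: "(\<And>x. x \<in> S \<Longrightarrow> symm (F x)) \<Longrightarrow> symm (sum F S)"
  by (induction S rule: infinite_finite_induct) (auto intro: symm_add)

lemma symm_hh: "symm (hh n)"
  by (simp add: symm_def cf_hh fin_mono_comp deg_comp)

lemma bdd_0 [simp]: "bdd d 0" and bdd_1 [simp]: "bdd d 1"
  by (simp_all add: bdd_def cf_1)

lemma bdd_mono: "bdd d f \<Longrightarrow> d \<le> e \<Longrightarrow> bdd e f"
  unfolding bdd_def using order_trans by blast

lemma bdd_add: "bdd d f \<Longrightarrow> bdd d g \<Longrightarrow> bdd d (f + g)"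
  unfolding bdd_def cf_add by (metis add.right_neutral)

lemma bdd_uminus: "bdd d f \<Longrightarrow> bdd d (- f)"
  by (simp add: bdd_def)

lemma bdd_diff: "bdd d f \<Longrightarrow> bdd d g \<Longrightarrow> bdd d (f - g)"
  using bdd_add[of d f "- g"] bdd_uminus[of d g] by simp

lemma bdd_sum: "(\<And>x. x \<in> S \<Longrightarrow> bdd d (F x)) \<Longrightarrow> bdd d (sum F S)"
  by (induction S rule: infinite_finite_induct) (auto intro: bdd_add)

lemma bdd_mult:
  assumes "bdd d f" "bdd e g"
  shows "bdd (d + e) (f * g)"
  unfolding bdd_def
proof (intro allI impI)
  fix \<alpha> assume nz: "cf (f * g) \<alpha> \<noteq> 0"
  then have \<alpha>: "fin_mono \<alpha>" using cf_nonfin by blast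
  obtain \<beta> where \<beta>: "\<beta> \<le> \<alpha>" "cf f \<beta> * cf g (\<alpha> - \<beta>) \<noteq> 0"
    using nz unfolding cf_mult[OF \<alpha>] by (metis (no_types, lifting) mem_Collect_eq sum.neutral)
  then have "deg \<beta> \<le> d" "deg (\<alpha> - \<beta>) \<le> e" using assms by (auto simp: bdd_def)
  then show "deg \<alpha> \<le> d + e" using deg_diff[OF \<alpha> \<beta>(1)] by linarith
qed

lemma bdd_hh: "bdd n (hh n)"
  by (simp add: bdd_def cf_hh)

lemma Lam_0: "0 \<in> Lam" and Lam_1: "1 \<in> Lam"
  by (auto simp: Lam_def)

lemma Lam_hh: "hh n \<in> Lam"
  using symm_hh bdd_hh by (auto simp: Lam_def)

lemma Lam_add: "f \<in> Lam \<Longrightarrow> g \<in> Lam \<Longrightarrow> f + g \<in> Lam"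
proof -
  assume "f \<in> Lam" "g \<in> Lam"
  then obtain d e where *: "symm f" "symm g" "bdd d f" "bdd e g" by (auto simp: Lam_def)
  then have "bdd (max d e) (f + g)" by (intro bdd_add) (auto elim: bdd_mono)
  then show ?thesis using * symm_add by (auto simp: Lam_def)
qed

lemma Lam_uminus: "f \<in> Lam \<Longrightarrow> - f \<in> Lam"
  using symm_uminus bdd_uminus by (auto simp: Lam_def)

lemma Lam_diff: "f \<in> Lam \<Longrightarrow> g \<in> Lam \<Longrightarrow> f - g \<in> Lam"
  using Lam_add[of f "- g"] Lam_uminus[of g] by simp

lemma Lam_mult: "f \<in> Lam \<Longrightarrow> g \<in> Lam \<Longrightarrow> f * g \<in> Lam"
  using symm_mult bdd_mult unfolding Lam_def by blast

lemma Lam_sum: "(\<And>x. x \<in> S \<Longrightarrow> F x \<in> Lam) \<Longrightarrow> sum F S \<in> Lam"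
  by (induction S rule: infinite_finite_induct) (auto intro: Lam_add Lam_0)

lemma Lam_hl: "hl bs \<in> Lam"
  by (induction bs) (auto simp: hl_def Lam_1 intro: Lam_mult Lam_hh)

text \<open>F is prescribed as an additive map, so integral combinations of generators are taken as
  an inductive set: identities between additive maps are proved by induction on it.\<close>

inductive_set addspan :: "'a::ab_group_add set \<Rightarrow> 'a set" for B where
  zero: "0 \<in> addspan B"
| plus: "x \<in> addspan B \<Longrightarrow> b \<in> B \<Longrightarrow> x + b \<in> addspan B"
| minus: "x \<in> addspan B \<Longrightarrow> b \<in> B \<Longrightarrow> x - b \<in> addspan B"

lemma addspan_base: "b \<in> B \<Longrightarrow> b \<in> addspan B"
  using addspan.plus[OF addspan.zero, of b B] by simp

lemma addspan_add: "y \<in> addspan B \<Longrightarrow> x \<in> addspan B \<Longrightarrow> x + y \<in> addspan B"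
proof (induction y rule: addspan.induct)
  case (plus y b)
  then show ?case using addspan.plus[of "x + y" B b] by (simp add: add.assoc)
next
  case (minus y b)
  then show ?case using addspan.minus[of "x + y" B b] by (simp add: algebra_simps)
qed simp

lemma addspan_uminus: "y \<in> addspan B \<Longrightarrow> - y \<in> addspan B"
proof (induction y rule: addspan.induct)
  case (plus y b)
  then show ?case using addspan.minus[of "- y" B b] by (simp only: minus_add_distrib diff_conv_add_uminus)
next
  case (minus y b)
  have "- (y - b) = - y + b" by simp
  then show ?case using addspan.plus[OF minus.IH minus.hyps(2)] by (simp only:)
qed (simp add: addspan.zero)

lemma addspan_diff: "x \<in> addspan B \<Longrightarrow> y \<in> addspan B \<Longrightarrow> x - y \<in> addspan B"
  using addspan_add[of "- y" B x] addspan_uminus[of y B] by simp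

lemma addspan_sum: "(\<And>x. x \<in> S \<Longrightarrow> F x \<in> addspan B) \<Longrightarrow> sum F S \<in> addspan B"
  by (induction S rule: infinite_finite_induct) (auto intro: addspan_add addspan.zero)

lemma addspan_of_int: "x \<in> addspan B \<Longrightarrow> of_int a * (x::'a::comm_ring_1) \<in> addspan B"
proof (induction a rule: int_induct[where k=0])
  case (step1 i)
  then show ?case using addspan_add[of x B "of_int i * x"] by (simp add: algebra_simps)
next
  case (step2 i)
  then show ?case using addspan_diff[of "of_int i * x" B x] by (simp add: algebra_simps)
qed (simp add: addspan.zero)

lemma addspan_subset: "B \<subseteq> addspan C \<Longrightarrow> addspan B \<subseteq> addspan C"
proof
  fix x assume "B \<subseteq> addspan C" "x \<in> addspan B"
  show "x \<in> addspan C"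
    using \<open>x \<in> addspan B\<close>
    by (induction rule: addspan.induct)
      (use \<open>B \<subseteq> addspan C\<close> in \<open>auto intro: addspan.zero addspan_add addspan_diff\<close>)
qed

lemma cf_of_int_mult: "cf (of_int a * g) \<alpha> = of_int a * cf g \<alpha>"
  by (induction a rule: int_induct[where k=0]) (auto simp: algebra_simps)

lemma cf_of_nat_mult: "cf (of_nat a * g) \<alpha> = of_nat a * cf g \<alpha>"
  by (induction a) (auto simp: algebra_simps)

lemma pf_list: "is_pf p \<Longrightarrow> deg p \<le> n \<Longrightarrow> pf (map p [0..<n]) = p"
  using pf_zero_ge_deg[of p] by (auto simp: pf_def fun_eq_iff not_less)

text \<open>Dominance is only a partial order; the sum of all partial sums is a number that strictly
  increases along it and serves as induction measure for the triangularity arguments.\<close>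

definition msr :: "mono \<Rightarrow> nat" where
  "msr p = (\<Sum>j\<le>deg p. \<Sum>i<j. p i)"

lemma msr_less_dominance:
  assumes p: "is_pf p" and q: "is_pf q" and d: "deg q = deg p"
    and le: "\<And>j. (\<Sum>i<j. q i) \<le> (\<Sum>i<j. p i)" and ne: "p \<noteq> q"
  shows "msr q < msr p"
proof -
  \<comment> \<open>Entries at or beyond the degree vanish, so partitions with equal partial sums up
    to the degree coincide.\<close>
  have "\<exists>j\<le>deg p. (\<Sum>i<j. q i) \<noteq> (\<Sum>i<j. p i)"
  proof (rule ccontr)
    assume "\<not> ?thesis"
    then have eq: "(\<Sum>i<j. q i) = (\<Sum>i<j. p i)" if "j \<le> deg p" for j using that by blast
    have "p i = q i" for i
    proof (cases "i < deg p")
      case True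
      then show ?thesis using eq[of i] eq[of "Suc i"] by simp
    next
      case False
      then show ?thesis using pf_zero_ge_deg[OF p, of i] pf_zero_ge_deg[OF q, of i] d by simp
    qed
    then show False using ne by auto
  qed
  then obtain j where "j \<le> deg p" "(\<Sum>i<j. q i) < (\<Sum>i<j. p i)" using le nat_less_le by blast
  then show ?thesis unfolding msr_def d
    by (intro sum_strict_mono_ex1) (use le in auto)
qed

lemma msr_less:
  assumes p: "is_pf p" and q: "is_pf q" and nz: "kost p q \<noteq> 0" and ne: "p \<noteq> q"
  shows "msr q < msr p"
  by (rule msr_less_dominance[OF p q]) (use kost_deg nz p q kost_dominance[OF p nz] ne in \<open>auto simp: is_pf_def\<close>)

text \<open>In the expansion of h_p the coefficient of s_p is 1 and every other shape that occurs
  has larger measure, so the Kostka matrix is inverted over the integers by induction downwards from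
  the maximal measure \<open>B\<close>.\<close>

lemma ss_in_addspan_hl:
  assumes "is_pf p"
  shows "ss p \<in> addspan (hl ` {bs. sum_list bs = deg p})"
proof -
  define n where "n = deg p"
  define B where "B = Max (msr ` pfs n)"
  have "ss p \<in> addspan (hl ` {bs. sum_list bs = n})" if "is_pf p" "deg p = n" for p
    using that
  proof (induction "B - msr p" arbitrary: p rule: less_induct)
    case less
    let ?bs = "map p [0..<n]"
    have pf: "pf ?bs = p" using pf_list[of p n] less.prems by simp
    have sl: "sum_list ?bs = n" using deg_pf[of ?bs] pf less.prems by simp
    have "hl ?bs = (\<Sum>\<xi>\<in>pfs n. of_nat (kost \<xi> p) * ss \<xi>)"
      using hl_kost[of ?bs] unfolding pf sl .
    also have "\<dots> = ss p + (\<Sum>\<xi>\<in>pfs n - {p}. of_nat (kost \<xi> p) * ss \<xi>)"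
      using less.prems kost_self[of p] by (subst sum.remove[of _ p]) (auto simp: finite_pfs, auto simp: pfs_def)
    finally have e: "ss p = hl ?bs - (\<Sum>\<xi>\<in>pfs n - {p}. of_int (int (kost \<xi> p)) * ss \<xi>)" by simp
    have "of_int (int (kost \<xi> p)) * ss \<xi> \<in> addspan (hl ` {bs. sum_list bs = n})" if \<xi>: "\<xi> \<in> pfs n - {p}" for \<xi>
    proof (cases "kost \<xi> p = 0")
      case False
      have "msr p < msr \<xi>" using msr_less[of \<xi> p] False \<xi> less.prems by (auto simp: pfs_def)
      moreover have "msr \<xi> \<le> B" unfolding B_def using \<xi> finite_pfs by (intro Max_ge) auto
      ultimately have "ss \<xi> \<in> addspan (hl ` {bs. sum_list bs = n})"
        using \<xi> by (intro less.hyps) (auto simp: pfs_def)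
      then show ?thesis by (rule addspan_of_int)
    qed (simp add: addspan.zero)
    moreover have "hl ?bs \<in> addspan (hl ` {bs. sum_list bs = n})" using sl by (intro addspan_base imageI) simp
    ultimately show ?case unfolding e by (intro addspan_diff addspan_sum)
  qed
  then show ?thesis using assms by (simp add: n_def)
qed

lemma Lam_addspan: "B \<subseteq> Lam \<Longrightarrow> addspan B \<subseteq> Lam"
proof
  fix x assume "B \<subseteq> Lam" "x \<in> addspan B"
  show "x \<in> Lam"
    using \<open>x \<in> addspan B\<close>
    by (induction rule: addspan.induct)
      (use \<open>B \<subseteq> Lam\<close> in \<open>auto intro: Lam_0 Lam_add Lam_diff\<close>)
qed

lemma Lam_ss: "is_pf p \<Longrightarrow> ss p \<in> Lam"
  using ss_in_addspan_hl Lam_addspan[of "hl ` {bs. sum_list bs = deg p}"] Lam_hl by blast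

lemma bdd_ss: "is_pf p \<Longrightarrow> bdd (deg p) (ss p)"
  unfolding bdd_def using kost_deg[of p] cf_nonfin[of _ "ss p"] cf_ss[of _ p] by (metis is_pf_def order_refl of_nat_0)

text \<open>Sorting the exponents is a permutation of the variables, so a symmetric series vanishes
  once its coefficients at partitions do.\<close>

lemma sort_mono:
  assumes "fin_mono \<alpha>"
  shows "\<exists>\<sigma>. bij \<sigma> \<and> is_pf (\<alpha> \<circ> \<sigma>)"
proof -
  obtain N where N: "\<forall>i\<ge>N. \<alpha> i = 0" using fin_mono_bound[OF assms] by blast
  define ys where "ys = map \<alpha> [0..<N]"
  have "mset (rev (sort ys)) = mset ys" by simp
  then obtain \<sigma> where \<sigma>: "\<sigma> permutes {..<length ys}" "permute_list \<sigma> ys = rev (sort ys)"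
    by (rule mset_eq_permutation)
  have l: "length ys = N" by (simp add: ys_def)
  have b: "bij \<sigma>" using \<sigma>(1) by (rule permutes_bij)
  have e: "\<alpha> (\<sigma> i) = rev (sort ys) ! i" if "i < N" for i
  proof -
    have "\<sigma> i < N" using permutes_in_image[OF \<sigma>(1), of i] that l by simp
    then have "\<alpha> (\<sigma> i) = ys ! \<sigma> i" by (simp add: ys_def)
    also have "\<dots> = permute_list \<sigma> ys ! i" using \<sigma>(1) that l by (simp add: permute_list_nth)
    finally show ?thesis using \<sigma>(2) by simp
  qed
  have z: "\<alpha> (\<sigma> i) = 0" if "i \<ge> N" for i
    using permutes_not_in[OF \<sigma>(1), of i] that l N by simp
  have "\<alpha> (\<sigma> (Suc i)) \<le> \<alpha> (\<sigma> i)" for i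
  proof (cases "Suc i < N")
    case True
    have "sorted (sort ys)" by simp
    then have "rev (sort ys) ! Suc i \<le> rev (sort ys) ! i"
      using True l by (simp add: rev_nth sorted_nth_mono)
    then show ?thesis using True e by simp
  qed (use z[of "Suc i"] in simp)
  then have "is_pf (\<alpha> \<circ> \<sigma>)" using assms fin_mono_comp[OF b] by (simp add: is_pf_def)
  then show ?thesis using b by blast
qed

definition pfsle :: "nat \<Rightarrow> mono set" where
  "pfsle d = {p. is_pf p \<and> deg p \<le> d}"

lemma finite_pfsle: "finite (pfsle d)"
proof -
  have "pfsle d = (\<Union>n\<le>d. pfs n)" by (auto simp: pfsle_def pfs_def)
  then show ?thesis using finite_pfs by simp
qed

text \<open>\<open>M\<close> strictly bounds the measures of the partitions with nonzero
  coefficient. Subtracting the Schur functions at the next level, with these coefficients, clears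
  that level and disturbs only lower ones.\<close>

lemma symm_bdd_addspan_ss:
  assumes "symm f" "bdd d f"
  shows "f \<in> addspan (ss ` pfsle d)"
proof -
  have step: "f \<in> addspan (ss ` pfsle d)"
    if "symm f" "bdd d f" "\<forall>p\<in>pfsle d. M \<le> msr p \<longrightarrow> cf f p = 0" for M f
    using that
  proof (induction M arbitrary: f)
    case 0
    have "f = 0"
    proof (rule mps_eqI)
      fix \<alpha> assume "fin_mono \<alpha>"
      then obtain \<sigma> where \<sigma>: "bij \<sigma>" "is_pf (\<alpha> \<circ> \<sigma>)" using sort_mono by blast
      have "cf f (\<alpha> \<circ> \<sigma>) = 0"
      proof (cases "deg (\<alpha> \<circ> \<sigma>) \<le> d")
        case True
        then show ?thesis using 0 \<sigma> by (simp add: pfsle_def)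
      qed (use 0 in \<open>auto simp: bdd_def\<close>)
      then show "cf f \<alpha> = cf 0 \<alpha>" using 0(1) \<sigma>(1) by (simp add: symm_def)
    qed
    then show ?case by (simp add: addspan.zero)
  next
    case (Suc M)
    define PM where "PM = {p \<in> pfsle d. msr p = M}"
    define g where "g = (\<Sum>p\<in>PM. of_int (cf f p) * ss p)"
    have fin: "finite PM" unfolding PM_def using finite_pfsle by simp
    have pf: "is_pf p" "deg p \<le> d" if "p \<in> PM" for p using that by (auto simp: PM_def pfsle_def)
    have g1: "g \<in> addspan (ss ` pfsle d)" unfolding g_def
      by (intro addspan_sum addspan_of_int addspan_base imageI) (auto simp: PM_def)
    have ss: "symm (of_int a * ss p)" "bdd d (of_int a * ss p)" if "p \<in> PM" for p a
      using Lam_ss[OF pf(1)[OF that]] bdd_mono[OF bdd_ss[OF pf(1)] pf(2), OF that that]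
      by (auto simp: Lam_def symm_def bdd_def cf_of_int_mult)
    have "\<forall>p\<in>pfsle d. M \<le> msr p \<longrightarrow> cf (f - g) p = 0"
    proof (intro ballI impI)
      fix q assume q: "q \<in> pfsle d" "M \<le> msr q"
      have qf: "is_pf q" "fin_mono q" using q by (auto simp: pfsle_def is_pf_def)
      \<comment> \<open>Off the diagonal a nonzero Kostka number needs msr q < msr p = M, which the
        choice of q excludes.\<close>
      have k: "kost p q = (if p = q then 1 else 0)" if "p \<in> PM" for p
        using msr_less[OF pf(1)[OF that] qf(1)] kost_self[OF qf(1)] q(2) that by (auto simp: PM_def)
      have "cf g q = (\<Sum>p\<in>PM. cf f p * int (kost p q))"
        by (simp add: g_def cf_of_int_mult cf_ss[OF qf(2)])
      also have "\<dots> = (\<Sum>p\<in>PM. if p = q then cf f q else 0)" by (rule sum.cong) (auto simp: k)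
      also have "\<dots> = (if q \<in> PM then cf f q else 0)" using fin by (simp add: sum.delta)
      also have "\<dots> = cf f q"
        using q Suc.prems(3) by (auto simp: PM_def)
      finally show "cf (f - g) q = 0" by simp
    qed
    moreover have "symm (f - g)" "bdd d (f - g)"
      unfolding g_def using ss Suc.prems by (auto intro!: symm_diff bdd_diff symm_sum bdd_sum)
    ultimately have "f - g \<in> addspan (ss ` pfsle d)" by (intro Suc.IH) auto
    from addspan_add[OF this g1] show ?case by simp
  qed
  have "msr p \<le> Max (insert 0 (msr ` pfsle d))" if "p \<in> pfsle d" for p
    by (rule Max_ge) (use that finite_pfsle[of d] in auto)
  then have "\<forall>p\<in>pfsle d. Suc (Max (insert 0 (msr ` pfsle d))) \<le> msr p \<longrightarrow> cf f p = 0"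
    by (meson not_less_eq_eq)
  from step[OF assms this] show ?thesis .
qed

text \<open>The passage from Schur functions to complete functions is homogeneous, so the degree
  bound survives. \<open>FS_top\<close> relies on having only products of total degree at most
  d.\<close>

lemma Lam_hl_addspan:
  assumes "symm f" "bdd d f"
  shows "f \<in> addspan (hl ` {bs. sum_list bs \<le> d})"
proof -
  have m: "addspan (hl ` {bs. sum_list bs = deg p}) \<subseteq> addspan (hl ` {bs. sum_list bs \<le> d})" if "p \<in> pfsle d" for p
    by (rule addspan_subset) (use that in \<open>auto simp: pfsle_def intro!: addspan_base\<close>)
  have "ss ` pfsle d \<subseteq> addspan (hl ` {bs. sum_list bs \<le> d})"
    using ss_in_addspan_hl m by (auto simp: pfsle_def)
  then show ?thesis using symm_bdd_addspan_ss[OF assms] addspan_subset by blast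
qed

section \<open>Uniqueness of Schur expansions and additive extension\<close>

definition is_rep :: "(mono \<Rightarrow> int) \<Rightarrow> int mps \<Rightarrow> bool" where
  "is_rep c f \<longleftrightarrow> (\<exists>P. finite P \<and> (\<forall>p\<in>P. is_pf p) \<and> (\<forall>p. p \<notin> P \<longrightarrow> c p = 0)
     \<and> f = (\<Sum>p\<in>P. of_int (c p) * ss p))"

lemma is_rep_sum:
  assumes "is_rep c f" "finite P" "\<forall>p. c p \<noteq> 0 \<longrightarrow> p \<in> P"
  shows "f = (\<Sum>p\<in>P. of_int (c p) * ss p)"
proof -
  obtain Q where Q: "finite Q" "\<forall>p. p \<notin> Q \<longrightarrow> c p = 0" "f = (\<Sum>p\<in>Q. of_int (c p) * ss p)"
    using assms(1) unfolding is_rep_def by auto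
  have c0: "c p = 0" if "p \<notin> P" for p using assms(3) that by blast
  have "f = (\<Sum>p\<in>P \<union> Q. of_int (c p) * ss p)"
    unfolding Q(3) by (rule sum.mono_neutral_left) (use assms(2) Q(1,2) in auto)
  also have "\<dots> = (\<Sum>p\<in>P. of_int (c p) * ss p)"
    by (rule sum.mono_neutral_right) (use assms(2) Q(1) c0 in auto)
  finally show ?thesis .
qed

lemma is_rep_add:
  assumes "is_rep c f" "is_rep c' f'"
  shows "is_rep (\<lambda>p. c p + c' p) (f + f')"
proof -
  obtain P where P: "finite P" "\<forall>p\<in>P. is_pf p" "\<forall>p. p \<notin> P \<longrightarrow> c p = 0"
    using assms(1) unfolding is_rep_def by auto
  obtain P' where P': "finite P'" "\<forall>p\<in>P'. is_pf p" "\<forall>p. p \<notin> P' \<longrightarrow> c' p = 0"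
    using assms(2) unfolding is_rep_def by auto
  have "f = (\<Sum>p\<in>P \<union> P'. of_int (c p) * ss p)"
    by (rule is_rep_sum[OF assms(1)]) (use P P' in auto)
  moreover have "f' = (\<Sum>p\<in>P \<union> P'. of_int (c' p) * ss p)"
    by (rule is_rep_sum[OF assms(2)]) (use P P' in auto)
  ultimately show ?thesis unfolding is_rep_def using P P'
    by (intro exI[of _ "P \<union> P'"]) (auto simp: distrib_right sum.distrib)
qed

lemma is_rep_single: "is_pf q \<Longrightarrow> is_rep (\<lambda>p. if p = q then a else 0) (of_int a * ss q)"
  unfolding is_rep_def by (intro exI[of _ "{q}"]) auto

lemma is_rep_exists: "f \<in> addspan (ss ` {p. is_pf p}) \<Longrightarrow> \<exists>c. is_rep c f"
proof (induction f rule: addspan.induct)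
  case zero
  show ?case unfolding is_rep_def by (intro exI[of _ "\<lambda>_. 0"] exI[of _ "{}"]) auto
next
  case (plus x b)
  then show ?case using is_rep_add is_rep_single[of _ 1] by fastforce
next
  case (minus x b)
  then obtain q c where q: "is_pf q" "b = ss q" "is_rep c x" by blast
  from is_rep_add[OF q(3) is_rep_single[OF q(1), of "-1"]] show ?case using q(2) by auto
qed

text \<open>Linear independence: for q of greatest measure in the support, the coefficient at x^q
  sees s_q alone, because any other shape with a nonzero Kostka number at q would have larger
  measure.\<close>

lemma is_rep_zero:
  assumes "is_rep c 0"
  shows "c p = 0"
proof (rule ccontr)
  assume nz: "c p \<noteq> 0"
  obtain P where P: "finite P" "\<forall>p\<in>P. is_pf p" "\<forall>p. p \<notin> P \<longrightarrow> c p = 0"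
    using assms(1) unfolding is_rep_def by auto
  define S where "S = {p. c p \<noteq> 0}"
  have S: "finite S" "S \<noteq> {}" using P nz by (auto simp: S_def intro: finite_subset[of _ P])
  have "Max (msr ` S) \<in> msr ` S" using S by (intro Max_in) auto
  then obtain q where q': "q \<in> S" "Max (msr ` S) = msr q" by blast
  have "msr p \<le> msr q" if "p \<in> S" for p
    unfolding q'(2)[symmetric] by (rule Max_ge) (use S that in auto)
  then have q: "q \<in> S" "\<forall>p\<in>S. msr p \<le> msr q" using q'(1) by auto
  have pf: "is_pf p" if "p \<in> S" for p using that P by (auto simp: S_def)
  have fq: "fin_mono q" using pf[OF q(1)] by (simp add: is_pf_def)
  have "0 = (\<Sum>p\<in>S. of_int (c p) * ss p)"
    by (rule is_rep_sum[OF assms]) (use S in \<open>auto simp: S_def\<close>)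
  then have "cf 0 q = cf (\<Sum>p\<in>S. of_int (c p) * ss p) q" by (rule arg_cong)
  then have "0 = (\<Sum>p\<in>S. c p * int (kost p q))"
    by (simp add: cf_of_int_mult cf_ss[OF fq])
  also have "\<dots> = (\<Sum>p\<in>S. if p = q then c q else 0)"
  proof (rule sum.cong[OF refl])
    fix p assume p: "p \<in> S"
    show "c p * int (kost p q) = (if p = q then c q else 0)"
    proof (cases "p = q")
      case False
      have "msr p \<le> msr q" using q(2) p by blast
      then have "kost p q = 0" using msr_less[OF pf[OF p] pf[OF q(1)]] False by linarith
      then show ?thesis using False by simp
    qed (simp add: kost_self[OF pf[OF q(1)]])
  qed
  also have "\<dots> = c q" using S q by (simp add: sum.delta)
  finally show False using q(1) by (simp add: S_def)
qed

lemma is_rep_unique: "is_rep c f \<Longrightarrow> is_rep c' f \<Longrightarrow> c = c'"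
proof
  fix p assume 1: "is_rep c f" and "is_rep c' f"
  then obtain P where "finite P" "\<forall>p\<in>P. is_pf p" "\<forall>p. p \<notin> P \<longrightarrow> c' p = 0"
    "f = (\<Sum>p\<in>P. of_int (c' p) * ss p)" unfolding is_rep_def by blast
  then have 2: "is_rep (\<lambda>p. - c' p) (- f)"
    unfolding is_rep_def by (intro exI[of _ P]) (auto simp: sum_negf)
  show "c p = c' p" using is_rep_zero[of "\<lambda>p. c p + - c' p" p] is_rep_add[OF 1 2] by simp
qed

lemma Lam_addspan_ss: "Lam \<subseteq> addspan (ss ` {p. is_pf p})"
proof
  fix f assume "f \<in> Lam"
  then obtain d where "symm f" "bdd d f" by (auto simp: Lam_def)
  then have "f \<in> addspan (ss ` pfsle d)" by (rule symm_bdd_addspan_ss)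
  moreover have "ss ` pfsle d \<subseteq> addspan (ss ` {p. is_pf p})"
    by (auto simp: pfsle_def intro: addspan_base)
  ultimately show "f \<in> addspan (ss ` {p. is_pf p})" using addspan_subset by blast
qed

text \<open>The Schur functions are a basis over the integers, so an additive map may be prescribed
  on them. The target is an arbitrary ring since both the real evaluations and F itself are obtained
  this way.\<close>

lemma additive_extension:
  fixes v :: "mono \<Rightarrow> 'v::comm_ring_1"
  shows "\<exists>L. (\<forall>f\<in>Lam. \<forall>g\<in>Lam. L (f + g) = L f + L g) \<and> (\<forall>p. is_pf p \<longrightarrow> L (ss p) = v p)"
proof -
  define c where "c f = (THE c. is_rep c f)" for f
  have c: "c f = d" if "is_rep d f" for f d
    unfolding c_def by (rule the_equality, rule that, rule is_rep_unique[OF _ that])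
  have r: "is_rep (c f) f" if "f \<in> Lam" for f
    using is_rep_exists[of f] c Lam_addspan_ss that by fastforce
  have fin: "finite {p. c f p \<noteq> 0}" if f: "f \<in> Lam" for f
  proof -
    obtain P where "finite P" "\<forall>p. p \<notin> P \<longrightarrow> c f p = 0" using r[OF f] unfolding is_rep_def by blast
    then show ?thesis by (auto intro: finite_subset[of _ P])
  qed
  define L where "L f = (\<Sum>p\<in>{p. c f p \<noteq> 0}. of_int (c f p) * v p)" for f
  have L: "L f = (\<Sum>p\<in>P. of_int (c f p) * v p)" if "finite P" "{p. c f p \<noteq> 0} \<subseteq> P" for f P
    unfolding L_def by (rule sum.mono_neutral_left) (use that in auto)
  have "L (f + g) = L f + L g" if "f \<in> Lam" "g \<in> Lam" for f g
  proof -
    have e: "c (f + g) = (\<lambda>p. c f p + c g p)" by (rule c, rule is_rep_add) (use r that in auto)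
    let ?P = "{p. c f p \<noteq> 0} \<union> {p. c g p \<noteq> 0}"
    have "L f = (\<Sum>p\<in>?P. of_int (c f p) * v p)" "L g = (\<Sum>p\<in>?P. of_int (c g p) * v p)"
      "L (f + g) = (\<Sum>p\<in>?P. of_int (c (f + g) p) * v p)"
      by (rule L; use fin that in \<open>auto simp: e\<close>)+
    then show ?thesis by (simp add: e distrib_right sum.distrib)
  qed
  moreover have "L (ss p) = v p" if "is_pf p" for p
  proof -
    have e: "c (ss p) = (\<lambda>q. if q = p then 1 else 0)" using c[OF is_rep_single[OF that, of 1]] by simp
    show ?thesis by (subst L[of "{p}"]) (auto simp: e)
  qed
  ultimately show ?thesis by blast
qed

section \<open>Young subgroups and orbit counting\<close>

text \<open>A Young subgroup is encoded by a labelling whose fibres are its blocks. Row groups,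
  column groups and, with a constant label, the whole symmetric group are instances, so one set of
  group lemmas serves all of them.\<close>

definition Yg :: "'x set \<Rightarrow> ('x \<Rightarrow> 'b) \<Rightarrow> ('x \<Rightarrow> 'x) set" where
  "Yg X f = {\<sigma>. \<sigma> permutes X \<and> (\<forall>x\<in>X. f (\<sigma> x) = f x)}"

lemma Yg_id [simp]: "id \<in> Yg X f"
  by (simp add: Yg_def permutes_id)

lemma Yg_permutes: "\<sigma> \<in> Yg X f \<Longrightarrow> \<sigma> permutes X"
  by (simp add: Yg_def)

lemma Yg_comp: "\<sigma> \<in> Yg X f \<Longrightarrow> \<tau> \<in> Yg X f \<Longrightarrow> \<sigma> \<circ> \<tau> \<in> Yg X f"
  by (auto simp: Yg_def permutes_compose permutes_in_image)

lemma Yg_inv: "\<sigma> \<in> Yg X f \<Longrightarrow> inv \<sigma> \<in> Yg X f"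
proof -
  assume s: "\<sigma> \<in> Yg X f"
  then have p: "\<sigma> permutes X" by (rule Yg_permutes)
  have "f (inv \<sigma> x) = f x" if "x \<in> X" for x
  proof -
    have "inv \<sigma> x \<in> X" using permutes_in_image[OF permutes_inv[OF p]] that by simp
    then have "f (\<sigma> (inv \<sigma> x)) = f (inv \<sigma> x)" using s by (simp add: Yg_def)
    then show ?thesis by (simp add: permutes_inverses(1)[OF p])
  qed
  then show ?thesis using p by (simp add: Yg_def permutes_inv)
qed

lemma Yg_comp_inv [simp]:
  assumes "\<sigma> \<in> Yg X f"
  shows "inv \<sigma> \<circ> \<sigma> = id" "\<sigma> \<circ> inv \<sigma> = id" "inv (inv \<sigma>) = \<sigma>"
    "inv \<sigma> \<circ> (\<sigma> \<circ> h) = h" "\<sigma> \<circ> (inv \<sigma> \<circ> k) = k"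
proof -
  note p = Yg_permutes[OF assms]
  show "inv \<sigma> \<circ> \<sigma> = id" "\<sigma> \<circ> inv \<sigma> = id" "inv (inv \<sigma>) = \<sigma>"
    using permutes_inv_o[OF p] permutes_inv_inv[OF p] by auto
  then show "inv \<sigma> \<circ> (\<sigma> \<circ> h) = h" "\<sigma> \<circ> (inv \<sigma> \<circ> k) = k" by (simp_all add: comp_assoc[symmetric])
qed

lemma Yg_inv_comp: "\<sigma> \<in> Yg X f \<Longrightarrow> \<tau> \<in> Yg X f \<Longrightarrow> inv (\<sigma> \<circ> \<tau>) = inv \<tau> \<circ> inv \<sigma>"
  using o_inv_distrib permutes_bij Yg_permutes by metis

lemma finite_Yg [simp]: "finite X \<Longrightarrow> finite (Yg X f)"
  by (rule finite_subset[OF _ finite_permutations[of X]]) (auto simp: Yg_def)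

lemma card_Yg_pos: "finite X \<Longrightarrow> 0 < card (Yg X f)"
  using Yg_id[of X f] finite_Yg[of X f] by (metis card_gt_0_iff empty_iff)

lemma sum_Yg_left:
  assumes "\<rho> \<in> Yg X f"
  shows "(\<Sum>\<sigma>\<in>Yg X f. F (\<rho> \<circ> \<sigma>)) = (\<Sum>\<sigma>\<in>Yg X f. F \<sigma>)"
  by (rule sum.reindex_bij_witness[where i="\<lambda>\<sigma>. inv \<rho> \<circ> \<sigma>" and j="\<lambda>\<sigma>. \<rho> \<circ> \<sigma>"])
    (use assms in \<open>auto intro: Yg_comp Yg_inv\<close>)

lemma sum_Yg_right:
  assumes "\<rho> \<in> Yg X f"
  shows "(\<Sum>\<sigma>\<in>Yg X f. F (\<sigma> \<circ> \<rho>)) = (\<Sum>\<sigma>\<in>Yg X f. F \<sigma>)"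
  by (rule sum.reindex_bij_witness[where i="\<lambda>\<sigma>. \<sigma> \<circ> inv \<rho>" and j="\<lambda>\<sigma>. \<sigma> \<circ> \<rho>"])
    (use assms in \<open>auto intro: Yg_comp Yg_inv simp: comp_assoc\<close>)

lemma sum_Yg_inv: "(\<Sum>\<sigma>\<in>Yg X f. F (inv \<sigma>)) = (\<Sum>\<sigma>\<in>Yg X f. F \<sigma>)"
  by (rule sum.reindex_bij_witness[where i=inv and j=inv]) (auto intro: Yg_inv)

section \<open>Contingency tables and orbit counting\<close>

definition content :: "'x set \<Rightarrow> ('x \<Rightarrow> 'b) \<Rightarrow> 'b \<Rightarrow> nat" where
  "content X f = (\<lambda>j. card {x \<in> X. f x = j})"

text \<open>The contingency table of two labellings. On functions extensional over a finite X it is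
  a complete invariant of the orbit of \<open>g\<close> under precomposition with the Young subgroup
  of \<open>f\<close>.\<close>

definition ty :: "'x set \<Rightarrow> ('x \<Rightarrow> 'b) \<Rightarrow> ('x \<Rightarrow> 'y) \<Rightarrow> 'b \<times> 'y \<Rightarrow> nat" where
  "ty X f g = content X (\<lambda>x. (f x, g x))"

lemma content_permutes: "\<sigma> permutes X \<Longrightarrow> content X (f \<circ> \<sigma>) = content X f"
proof
  fix j assume s: "\<sigma> permutes X"
  have "bij_betw \<sigma> {x \<in> X. (f \<circ> \<sigma>) x = j} {x \<in> X. f x = j}"
    unfolding bij_betw_def
  proof
    show "inj_on \<sigma> {x \<in> X. (f \<circ> \<sigma>) x = j}" using s by (meson inj_on_subset permutes_inj subset_UNIV)
    show "\<sigma> ` {x \<in> X. (f \<circ> \<sigma>) x = j} = {x \<in> X. f x = j}"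
    proof (intro equalityI subsetI)
      fix x assume x: "x \<in> {x \<in> X. f x = j}"
      then have "inv \<sigma> x \<in> {x \<in> X. (f \<circ> \<sigma>) x = j}"
        using permutes_in_image[OF permutes_inv[OF s]] by (simp add: permutes_inverses(1)[OF s])
      then show "x \<in> \<sigma> ` {x \<in> X. (f \<circ> \<sigma>) x = j}" using permutes_inverses(1)[OF s] by (metis imageI)
    qed (use permutes_in_image[OF s] in auto)
  qed
  then show "content X (f \<circ> \<sigma>) j = content X f j" unfolding content_def by (rule bij_betw_same_card)
qed

lemma ty_Yg: "\<sigma> \<in> Yg X f \<Longrightarrow> ty X f (g \<circ> \<sigma>) = ty X f g"
proof -
  assume s: "\<sigma> \<in> Yg X f"
  have "ty X f (g \<circ> \<sigma>) = content X ((\<lambda>x. (f x, g x)) \<circ> \<sigma>)"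
    unfolding ty_def content_def using s by (auto simp: Yg_def intro!: ext arg_cong[where f=card])
  also have "\<dots> = ty X f g" using content_permutes[OF Yg_permutes[OF s]] by (simp add: ty_def)
  finally show ?thesis .
qed

lemma content_eq_imp_permutes:
  assumes "finite X" "content X F = content X F'"
  obtains \<sigma> where "\<sigma> permutes X" "\<forall>x\<in>X. F x = F' (\<sigma> x)"
proof -
  have c: "count (image_mset F (mset_set X)) j = content X F j" for F :: "'a \<Rightarrow> 'b" and j
    using assms(1) by (simp add: count_image_mset_eq_card_vimage content_def vimage_def Int_def conj_commute)
  have "image_mset F (mset_set X) = image_mset F' (mset_set X)"
    by (rule multiset_eqI) (simp add: c assms(2))
  then show ?thesis using image_mset_eq_implies_permutes[OF assms(1)] that by metis
qed

lemma ty_eq_imp_Yg: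
  assumes "finite X" "ty X f g = ty X f h" "g \<in> extensional X" "h \<in> extensional X"
  shows "\<exists>\<sigma>\<in>Yg X f. h = g \<circ> \<sigma>"
proof -
  obtain \<sigma> where s: "\<sigma> permutes X" "\<forall>x\<in>X. (f x, h x) = (f (\<sigma> x), g (\<sigma> x))"
    using content_eq_imp_permutes[OF assms(1), of "\<lambda>x. (f x, h x)" "\<lambda>x. (f x, g x)"] assms(2)
    unfolding ty_def by metis
  have "h = g \<circ> \<sigma>"
  proof
    fix x
    show "h x = (g \<circ> \<sigma>) x"
    proof (cases "x \<in> X")
      case False
      then show ?thesis using assms(3,4) permutes_not_in[OF s(1)] by (simp add: extensional_def)
    qed (use s in auto)
  qed
  then show ?thesis using s by (auto simp: Yg_def)
qed

text \<open>The permutations that carry g to g \<circ> \<rho> form a right coset of the stabiliser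
  of g and a left coset of the stabiliser of g \<circ> \<rho>.\<close>

lemma card_Yg_transporter:
  assumes "\<rho> \<in> Yg X f"
  shows "card {\<sigma> \<in> Yg X f. g \<circ> \<sigma> = g \<circ> \<rho>} = card {\<sigma> \<in> Yg X f. g \<circ> \<sigma> = g}"
    and "card {\<sigma> \<in> Yg X f. g \<circ> \<sigma> = g \<circ> \<rho>} = card {\<sigma> \<in> Yg X f. g \<circ> \<rho> \<circ> \<sigma> = g \<circ> \<rho>}"
proof -
  let ?Y = "Yg X f"
  note [simp] = Yg_comp_inv(1,2,3)[OF assms]
  have "bij_betw (\<lambda>\<sigma>. \<sigma> \<circ> \<rho>) {\<sigma> \<in> ?Y. g \<circ> \<sigma> = g} {\<sigma> \<in> ?Y. g \<circ> \<sigma> = g \<circ> \<rho>}"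
  proof (rule bij_betw_byWitness[where f'="\<lambda>\<sigma>. \<sigma> \<circ> inv \<rho>"]; (intro ballI image_subsetI)?)
    fix \<sigma> assume "\<sigma> \<in> {\<sigma> \<in> ?Y. g \<circ> \<sigma> = g \<circ> \<rho>}"
    then have s: "\<sigma> \<in> ?Y" "g \<circ> \<sigma> = g \<circ> \<rho>" by auto
    have "g \<circ> (\<sigma> \<circ> inv \<rho>) = g" unfolding comp_assoc[symmetric] s(2) unfolding comp_assoc by simp
    then show "\<sigma> \<circ> inv \<rho> \<in> {\<sigma> \<in> ?Y. g \<circ> \<sigma> = g}" using Yg_comp[OF s(1) Yg_inv[OF assms]] by simp
  next
    fix \<sigma> assume "\<sigma> \<in> {\<sigma> \<in> ?Y. g \<circ> \<sigma> = g}"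
    then have s: "\<sigma> \<in> ?Y" "g \<circ> \<sigma> = g" by auto
    have "g \<circ> (\<sigma> \<circ> \<rho>) = g \<circ> \<rho>" unfolding comp_assoc[symmetric] s(2) ..
    then show "\<sigma> \<circ> \<rho> \<in> {\<sigma> \<in> ?Y. g \<circ> \<sigma> = g \<circ> \<rho>}" using Yg_comp[OF s(1) assms] by simp
  qed (simp_all add: comp_assoc)
  then show "card {\<sigma> \<in> ?Y. g \<circ> \<sigma> = g \<circ> \<rho>} = card {\<sigma> \<in> ?Y. g \<circ> \<sigma> = g}"
    by (rule bij_betw_same_card[symmetric])
  have "bij_betw (\<lambda>\<sigma>. \<rho> \<circ> \<sigma>) {\<sigma> \<in> ?Y. g \<circ> \<rho> \<circ> \<sigma> = g \<circ> \<rho>} {\<sigma> \<in> ?Y. g \<circ> \<sigma> = g \<circ> \<rho>}"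
  proof (rule bij_betw_byWitness[where f'="\<lambda>\<sigma>. inv \<rho> \<circ> \<sigma>"]; (intro ballI image_subsetI)?)
    fix \<sigma> assume "\<sigma> \<in> {\<sigma> \<in> ?Y. g \<circ> \<sigma> = g \<circ> \<rho>}"
    then have s: "\<sigma> \<in> ?Y" "g \<circ> \<sigma> = g \<circ> \<rho>" by auto
    have "g \<circ> \<rho> \<circ> (inv \<rho> \<circ> \<sigma>) = g \<circ> (\<rho> \<circ> inv \<rho>) \<circ> \<sigma>" by (simp only: comp_assoc)
    then have "g \<circ> \<rho> \<circ> (inv \<rho> \<circ> \<sigma>) = g \<circ> \<rho>" using s(2) by simp
    then show "inv \<rho> \<circ> \<sigma> \<in> {\<sigma> \<in> ?Y. g \<circ> \<rho> \<circ> \<sigma> = g \<circ> \<rho>}" using Yg_comp[OF Yg_inv[OF assms] s(1)] by simp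
  next
    fix \<sigma> assume "\<sigma> \<in> {\<sigma> \<in> ?Y. g \<circ> \<rho> \<circ> \<sigma> = g \<circ> \<rho>}"
    then show "\<rho> \<circ> \<sigma> \<in> {\<sigma> \<in> ?Y. g \<circ> \<sigma> = g \<circ> \<rho>}" using Yg_comp[OF assms] by (simp add: comp_assoc)
  qed (simp_all add: comp_assoc[symmetric])
  then show "card {\<sigma> \<in> ?Y. g \<circ> \<sigma> = g \<circ> \<rho>} = card {\<sigma> \<in> ?Y. g \<circ> \<rho> \<circ> \<sigma> = g \<circ> \<rho>}"
    by (rule bij_betw_same_card[symmetric])
qed

text \<open>Orbit counting, twisted by a map \<open>tw\<close>: for \<open>tw = id\<close> this is Burnside's lemma for the
  action of a Young subgroup on functions, in which the orbits are the fibres of \<open>ty X f\<close>.\<close>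

lemma twisted_orbit_count:
  assumes X: "finite X" and W: "finite W" "W \<subseteq> extensional X"
    and cl: "\<And>g \<sigma>. g \<in> W \<Longrightarrow> \<sigma> \<in> Yg X f \<Longrightarrow> g \<circ> \<sigma> \<in> W"
    and tw: "\<And>g. g \<in> W \<Longrightarrow> tw g \<in> extensional X"
    and tw_ty: "\<And>g h. g \<in> W \<Longrightarrow> h \<in> W \<Longrightarrow> ty X f g = ty X f h \<Longrightarrow> ty X f (tw g) = ty X f (tw h)"
  shows "(\<Sum>g\<in>W. card {\<sigma> \<in> Yg X f. g \<circ> \<sigma> = tw g})
    = card (Yg X f) * card (ty X f ` {g \<in> W. ty X f (tw g) = ty X f g})"
proof -
  let ?Y = "Yg X f" and ?W' = "{g \<in> W. ty X f (tw g) = ty X f g}"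
  have fY: "finite ?Y" using X by simp
  \<comment> \<open>Precomposition with the Young subgroup preserves tables, so nothing carries g to
    a function with another table.\<close>
  have 0: "card {\<sigma> \<in> ?Y. g \<circ> \<sigma> = tw g} = 0" if "g \<in> W - ?W'" for g
  proof -
    have "{\<sigma> \<in> ?Y. g \<circ> \<sigma> = tw g} = {}" using ty_Yg[of _ X f g] that by (auto, metis)
    then show ?thesis by (simp only: card.empty)
  qed
  \<comment> \<open>For equal tables the solutions form a coset of the stabiliser of g.\<close>
  have 1: "card {\<sigma> \<in> ?Y. g \<circ> \<sigma> = tw g} = card {\<sigma> \<in> ?Y. g \<circ> \<sigma> = g}" if g: "g \<in> ?W'" for g
  proof -
    obtain \<rho> where r: "\<rho> \<in> ?Y" "tw g = g \<circ> \<rho>"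
      using ty_eq_imp_Yg[OF X, of f g "tw g"] g W(2) tw[of g] by auto
    show ?thesis using card_Yg_transporter(1)[OF r(1), of g] unfolding r(2) .
  qed
  \<comment> \<open>The solutions of g0 \<circ> \<sigma> = g, for g in the orbit of g0, partition
    the group, so each orbit contributes the full group order.\<close>
  have 2: "(\<Sum>g\<in>{g \<in> ?W'. ty X f g = Z}. card {\<sigma> \<in> ?Y. g \<circ> \<sigma> = g}) = card ?Y" if Z: "Z \<in> ty X f ` ?W'" for Z
  proof -
    obtain g0 where g0: "g0 \<in> ?W'" "Z = ty X f g0" using Z by auto
    let ?C = "{g \<in> ?W'. ty X f g = Z}"
    have C: "?C = (\<lambda>\<sigma>. g0 \<circ> \<sigma>) ` ?Y"
    proof (intro equalityI subsetI)
      fix g assume g: "g \<in> ?C"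
      then have "ty X f g0 = ty X f g" "g0 \<in> extensional X" "g \<in> extensional X" using g0 W(2) by auto
      then show "g \<in> (\<lambda>\<sigma>. g0 \<circ> \<sigma>) ` ?Y" using ty_eq_imp_Yg[OF X] by blast
    next
      fix g assume "g \<in> (\<lambda>\<sigma>. g0 \<circ> \<sigma>) ` ?Y"
      then obtain \<sigma> where s: "\<sigma> \<in> ?Y" "g = g0 \<circ> \<sigma>" by auto
      have W0: "g \<in> W" "g0 \<in> W" using cl g0 s by auto
      have t: "ty X f g = ty X f g0" using ty_Yg s by metis
      have "ty X f (tw g) = ty X f (tw g0)" using tw_ty[OF W0 t] .
      then show "g \<in> ?C" using W0 t g0 by simp
    qed
    have "(\<Sum>g\<in>?C. card {\<sigma> \<in> ?Y. g \<circ> \<sigma> = g}) = (\<Sum>g\<in>?C. card {\<sigma> \<in> ?Y. g0 \<circ> \<sigma> = g})"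
    proof (rule sum.cong[OF refl])
      fix g assume "g \<in> ?C"
      then obtain \<rho> where r: "\<rho> \<in> ?Y" "g = g0 \<circ> \<rho>" unfolding C by auto
      show "card {\<sigma> \<in> ?Y. g \<circ> \<sigma> = g} = card {\<sigma> \<in> ?Y. g0 \<circ> \<sigma> = g}"
        using card_Yg_transporter(2)[OF r(1), of g0] unfolding r(2) by simp
    qed
    also have "\<dots> = card (\<Union>g\<in>?C. {\<sigma> \<in> ?Y. g0 \<circ> \<sigma> = g})"
      by (rule card_UN_disjoint[symmetric]) (use W(1) fY in auto)
    also have "(\<Union>g\<in>?C. {\<sigma> \<in> ?Y. g0 \<circ> \<sigma> = g}) = ?Y" unfolding C by auto
    finally show ?thesis .
  qed
  have fW': "finite ?W'" using W(1) by simp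
  have "(\<Sum>g\<in>W. card {\<sigma> \<in> ?Y. g \<circ> \<sigma> = tw g}) = (\<Sum>g\<in>?W'. card {\<sigma> \<in> ?Y. g \<circ> \<sigma> = tw g})"
    by (rule sum.mono_neutral_right) (use W(1) 0 in auto)
  also have "\<dots> = (\<Sum>g\<in>?W'. card {\<sigma> \<in> ?Y. g \<circ> \<sigma> = g})"
    by (rule sum.cong[OF refl]) (rule 1)
  also have "\<dots> = (\<Sum>Z\<in>ty X f ` ?W'. \<Sum>g\<in>{g \<in> ?W'. ty X f g = Z}. card {\<sigma> \<in> ?Y. g \<circ> \<sigma> = g})"
    by (rule sum.group[symmetric]) (use fW' in auto)
  also have "\<dots> = (\<Sum>Z\<in>ty X f ` ?W'. card ?Y)" by (rule sum.cong[OF refl]) (rule 2)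
  finally show ?thesis by simp
qed

text \<open>Orbit-stabiliser theorem with the orbit replaced by its invariant, the contingency
  table.\<close>

lemma orbit_class_count:
  assumes X: "finite X" and g0: "g0 \<in> extensional X"
  shows "card {g \<in> extensional X. ty X f g = ty X f g0} * card {\<sigma> \<in> Yg X f. g0 \<circ> \<sigma> = g0} = card (Yg X f)"
proof -
  let ?Y = "Yg X f"
  have fY: "finite ?Y" using X by simp
  have C: "{g \<in> extensional X. ty X f g = ty X f g0} = (\<lambda>\<sigma>. g0 \<circ> \<sigma>) ` ?Y"
  proof (intro equalityI subsetI)
    fix g assume "g \<in> {g \<in> extensional X. ty X f g = ty X f g0}"
    then show "g \<in> (\<lambda>\<sigma>. g0 \<circ> \<sigma>) ` ?Y" using ty_eq_imp_Yg[OF X, of f g0 g] g0 by auto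
  next
    fix g assume "g \<in> (\<lambda>\<sigma>. g0 \<circ> \<sigma>) ` ?Y"
    then obtain \<sigma> where s: "\<sigma> \<in> ?Y" "g = g0 \<circ> \<sigma>" by auto
    have "g \<in> extensional X" using g0 permutes_not_in[OF Yg_permutes[OF s(1)]]
      by (auto simp: s(2) extensional_def)
    then show "g \<in> {g \<in> extensional X. ty X f g = ty X f g0}" using ty_Yg[OF s(1)] s(2) by simp
  qed
  have "card ?Y = card (\<Union>g\<in>(\<lambda>\<sigma>. g0 \<circ> \<sigma>) ` ?Y. {\<sigma> \<in> ?Y. g0 \<circ> \<sigma> = g})"
    by (rule arg_cong[where f=card]) auto
  also have "\<dots> = (\<Sum>g\<in>(\<lambda>\<sigma>. g0 \<circ> \<sigma>) ` ?Y. card {\<sigma> \<in> ?Y. g0 \<circ> \<sigma> = g})"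
    by (rule card_UN_disjoint) (use fY in auto)
  also have "\<dots> = (\<Sum>g\<in>(\<lambda>\<sigma>. g0 \<circ> \<sigma>) ` ?Y. card {\<sigma> \<in> ?Y. g0 \<circ> \<sigma> = g0})"
    by (rule sum.cong[OF refl]) (use card_Yg_transporter(1)[of _ X f g0] in auto)
  finally show ?thesis unfolding C by simp
qed

lemma fin_mono_content: "finite X \<Longrightarrow> fin_mono (content X f)"
proof -
  assume X: "finite X"
  have "{i. content X f i \<noteq> 0} \<subseteq> f ` X" using X by (auto simp: content_def)
  then show ?thesis unfolding fin_mono_def using X finite_surj by blast
qed

lemma deg_content: "finite X \<Longrightarrow> deg (content X f) = card X"
proof -
  assume X: "finite X"
  have "{i. content X f i \<noteq> 0} \<subseteq> f ` X" using X by (auto simp: content_def)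
  then have "deg (content X f) = (\<Sum>i\<in>f ` X. card {x \<in> X. f x = i})"
    using X by (subst deg_eq_sum[of "f ` X"]) (auto simp: content_def)
  also have "\<dots> = card (\<Union>i\<in>f ` X. {x \<in> X. f x = i})"
    by (rule card_UN_disjoint[symmetric]) (use X in auto)
  also have "(\<Union>i\<in>f ` X. {x \<in> X. f x = i}) = X" by auto
  finally show ?thesis .
qed

text \<open>In each label class j the points are matched with a disjoint union of blocks of sizes Z
  (j, y), possible because the row sums are the class sizes; the block index is the second
  label.\<close>

lemma ty_realize:
  fixes Z :: "'b \<times> 'y \<Rightarrow> nat"
  assumes X: "finite X" and A: "finite A" and Z0: "\<And>j y. y \<notin> A \<Longrightarrow> Z (j, y) = 0"
    and Zs: "\<And>j. (\<Sum>y\<in>A. Z (j, y)) = content X f j"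
  obtains g where "g \<in> X \<rightarrow>\<^sub>E A" "ty X f g = Z"
proof -
  have "\<exists>\<phi>. bij_betw \<phi> {x \<in> X. f x = j} (Sigma A (\<lambda>y. {..<Z (j, y)}))" for j
    by (rule finite_same_card_bij) (use X A Zs in \<open>auto simp: content_def\<close>)
  then obtain \<phi> where \<phi>: "\<And>j. bij_betw (\<phi> j) {x \<in> X. f x = j} (Sigma A (\<lambda>y. {..<Z (j, y)}))"
    by metis
  define g where "g = restrict (\<lambda>x. fst (\<phi> (f x) x)) X"
  have m: "\<phi> (f x) x \<in> Sigma A (\<lambda>y. {..<Z (f x, y)})" if "x \<in> X" for x
    using \<phi>[of "f x"] that by (auto simp: bij_betw_def)
  have "g \<in> X \<rightarrow>\<^sub>E A" using m by (auto simp: g_def PiE_def extensional_def restrict_def) force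
  moreover have "ty X f g (j, y) = Z (j, y)" for j y
  proof -
    have "bij_betw (\<phi> j) {x \<in> X. f x = j \<and> g x = y} {c \<in> Sigma A (\<lambda>y. {..<Z (j, y)}). fst c = y}"
      unfolding bij_betw_def
    proof
      show "inj_on (\<phi> j) {x \<in> X. f x = j \<and> g x = y}"
        using \<phi>[of j] unfolding bij_betw_def by (rule conjunct1[THEN inj_on_subset]) auto
      show "\<phi> j ` {x \<in> X. f x = j \<and> g x = y} = {c \<in> Sigma A (\<lambda>y. {..<Z (j, y)}). fst c = y}"
      proof (intro equalityI subsetI)
        fix c assume c: "c \<in> {c \<in> Sigma A (\<lambda>y. {..<Z (j, y)}). fst c = y}"
        then have "c \<in> \<phi> j ` {x \<in> X. f x = j}" using \<phi>[of j] by (simp add: bij_betw_def)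
        then show "c \<in> \<phi> j ` {x \<in> X. f x = j \<and> g x = y}" using c by (auto simp: g_def)
      next
        fix c assume "c \<in> \<phi> j ` {x \<in> X. f x = j \<and> g x = y}"
        then obtain x where x: "x \<in> X" "f x = j" "g x = y" "c = \<phi> j x" by blast
        have "g x = fst (\<phi> (f x) x)" using x(1) by (simp add: g_def)
        then show "c \<in> {c \<in> Sigma A (\<lambda>y. {..<Z (j, y)}). fst c = y}"
          using m[OF x(1)] x by simp
      qed
    qed
    then have "card {x \<in> X. f x = j \<and> g x = y} = card {c \<in> Sigma A (\<lambda>y. {..<Z (j, y)}). fst c = y}"
      by (rule bij_betw_same_card)
    also have "{c \<in> Sigma A (\<lambda>y. {..<Z (j, y)}). fst c = y} = (if y \<in> A then {y} \<times> {..<Z (j, y)} else {})"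
      by auto
    also have "card \<dots> = Z (j, y)" using Z0 by auto
    finally show ?thesis by (simp add: ty_def content_def)
  qed
  ultimately show ?thesis by (intro that) (auto simp: fun_eq_iff)
qed

lemma ty_row_sum:
  assumes "finite X" "finite A" "\<And>x. x \<in> X \<Longrightarrow> g x \<in> A"
  shows "(\<Sum>y\<in>A. ty X f g (j, y)) = content X f j"
proof -
  have "(\<Sum>y\<in>A. card {x \<in> X. (f x, g x) = (j, y)}) = card (\<Union>y\<in>A. {x \<in> X. (f x, g x) = (j, y)})"
    by (rule card_UN_disjoint[symmetric]) (use assms in auto)
  also have "(\<Union>y\<in>A. {x \<in> X. (f x, g x) = (j, y)}) = {x \<in> X. f x = j}" using assms by auto
  finally show ?thesis by (simp add: ty_def content_def)
qed

lemma ty_col_sum: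
  assumes "finite X" "finite B" "\<And>x. x \<in> X \<Longrightarrow> f x \<in> B"
  shows "(\<Sum>j\<in>B. ty X f g (j, y)) = content X g y"
proof -
  have "(\<Sum>j\<in>B. card {x \<in> X. (f x, g x) = (j, y)}) = card (\<Union>j\<in>B. {x \<in> X. (f x, g x) = (j, y)})"
    by (rule card_UN_disjoint[symmetric]) (use assms in auto)
  also have "(\<Union>j\<in>B. {x \<in> X. (f x, g x) = (j, y)}) = {x \<in> X. g x = y}" using assms by auto
  finally show ?thesis by (simp add: ty_def content_def)
qed

section \<open>Young symmetrizers\<close>

definition Sn :: "nat \<Rightarrow> (nat \<Rightarrow> nat) set" where
  "Sn n = {\<sigma>. \<sigma> permutes {0..<n}}"

lemma Sn_Yg: "Sn n = Yg {0..<n} (\<lambda>_. ())"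
  by (simp add: Sn_def Yg_def)

lemma Yg_Sn: "\<sigma> \<in> Yg {0..<n} f \<Longrightarrow> \<sigma> \<in> Sn n"
  by (simp add: Sn_def Yg_def)

lemma Sn_id [simp]: "id \<in> Sn n" and Sn_comp: "\<sigma> \<in> Sn n \<Longrightarrow> \<tau> \<in> Sn n \<Longrightarrow> \<sigma> \<circ> \<tau> \<in> Sn n"
  and Sn_inv: "\<sigma> \<in> Sn n \<Longrightarrow> inv \<sigma> \<in> Sn n" and finite_Sn [simp]: "finite (Sn n)"
  and Sn_inv_comp: "\<sigma> \<in> Sn n \<Longrightarrow> \<tau> \<in> Sn n \<Longrightarrow> inv (\<sigma> \<circ> \<tau>) = inv \<tau> \<circ> inv \<sigma>"
  and sum_Sn_left: "\<rho> \<in> Sn n \<Longrightarrow> (\<Sum>\<sigma>\<in>Sn n. F (\<rho> \<circ> \<sigma>)) = (\<Sum>\<sigma>\<in>Sn n. F \<sigma>)"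
  and sum_Sn_right: "\<rho> \<in> Sn n \<Longrightarrow> (\<Sum>\<sigma>\<in>Sn n. F (\<sigma> \<circ> \<rho>)) = (\<Sum>\<sigma>\<in>Sn n. F \<sigma>)"
  and sum_Sn_inv: "(\<Sum>\<sigma>\<in>Sn n. F (inv \<sigma>)) = (\<Sum>\<sigma>\<in>Sn n. F \<sigma>)"
  unfolding Sn_Yg
  by (auto intro: Yg_comp Yg_inv Yg_inv_comp sum_Yg_left sum_Yg_right sum_Yg_inv)

lemma Sn_simps:
  assumes "\<sigma> \<in> Sn n"
  shows "inv \<sigma> \<circ> \<sigma> = id" "\<sigma> \<circ> inv \<sigma> = id" "inv (inv \<sigma>) = \<sigma>"
    "inv \<sigma> \<circ> (\<sigma> \<circ> h) = h" "\<sigma> \<circ> (inv \<sigma> \<circ> k) = k"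
  using Yg_comp_inv[OF assms[unfolded Sn_Yg]] by auto

lemma Sn_apply: "\<sigma> \<in> Sn n \<Longrightarrow> \<sigma> x < n \<longleftrightarrow> x < n"
  using permutes_in_image[of \<sigma> "{0..<n}" x] by (simp add: Sn_def)

lemma Sn_inv_apply: "\<sigma> \<in> Sn n \<Longrightarrow> \<sigma> (inv \<sigma> x) = x" "\<sigma> \<in> Sn n \<Longrightarrow> inv \<sigma> (\<sigma> x) = x"
  using permutes_inverses by (auto simp: Sn_def)

lemma Sn_permutation: "\<sigma> \<in> Sn n \<Longrightarrow> permutation \<sigma>"
  unfolding Sn_def permutation_permutes by (auto intro: exI[of _ "{0..<n}"])

section \<open>The integral group ring of the symmetric group\<close>

definition gm :: "nat \<Rightarrow> ((nat \<Rightarrow> nat) \<Rightarrow> int) \<Rightarrow> ((nat \<Rightarrow> nat) \<Rightarrow> int) \<Rightarrow> (nat \<Rightarrow> nat) \<Rightarrow> int" where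
  "gm n x y = (\<lambda>\<rho>. if \<rho> \<in> Sn n then \<Sum>\<sigma>\<in>Sn n. x \<sigma> * y (inv \<sigma> \<circ> \<rho>) else 0)"

lemma gm_assoc: "gm n (gm n x y) z = gm n x (gm n y z)"
proof
  fix \<rho>
  show "gm n (gm n x y) z \<rho> = gm n x (gm n y z) \<rho>"
  proof (cases "\<rho> \<in> Sn n")
    case True
    have "gm n (gm n x y) z \<rho> = (\<Sum>\<sigma>\<in>Sn n. \<Sum>\<pi>\<in>Sn n. x \<pi> * y (inv \<pi> \<circ> \<sigma>) * z (inv \<sigma> \<circ> \<rho>))"
      using True by (simp add: gm_def sum_distrib_right)
    also have "\<dots> = (\<Sum>\<pi>\<in>Sn n. \<Sum>\<sigma>\<in>Sn n. x \<pi> * y (inv \<pi> \<circ> \<sigma>) * z (inv \<sigma> \<circ> \<rho>))"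
      by (rule sum.swap)
    also have "\<dots> = (\<Sum>\<pi>\<in>Sn n. \<Sum>\<sigma>\<in>Sn n. x \<pi> * (y \<sigma> * z (inv \<sigma> \<circ> (inv \<pi> \<circ> \<rho>))))"
    proof (rule sum.cong[OF refl])
      fix \<pi> assume p: "\<pi> \<in> Sn n"
      have "(\<Sum>\<sigma>\<in>Sn n. x \<pi> * y (inv \<pi> \<circ> \<sigma>) * z (inv \<sigma> \<circ> \<rho>))
        = (\<Sum>\<sigma>\<in>Sn n. x \<pi> * y (inv \<pi> \<circ> (\<pi> \<circ> \<sigma>)) * z (inv (\<pi> \<circ> \<sigma>) \<circ> \<rho>))"
        by (rule sum_Sn_left[OF p, symmetric])
      also have "\<dots> = (\<Sum>\<sigma>\<in>Sn n. x \<pi> * (y \<sigma> * z (inv \<sigma> \<circ> (inv \<pi> \<circ> \<rho>))))"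
        by (rule sum.cong[OF refl]) (simp add: Sn_simps(4)[OF p] Sn_inv_comp[OF p] comp_assoc mult.assoc)
      finally show "(\<Sum>\<sigma>\<in>Sn n. x \<pi> * y (inv \<pi> \<circ> \<sigma>) * z (inv \<sigma> \<circ> \<rho>))
        = (\<Sum>\<sigma>\<in>Sn n. x \<pi> * (y \<sigma> * z (inv \<sigma> \<circ> (inv \<pi> \<circ> \<rho>))))" .
    qed
    also have "\<dots> = gm n x (gm n y z) \<rho>"
      using True by (simp add: gm_def sum_distrib_left Sn_comp Sn_inv)
    finally show ?thesis .
  qed (simp add: gm_def)
qed

lemma gm_id: "gm n x y id = (\<Sum>\<sigma>\<in>Sn n. x \<sigma> * y (inv \<sigma>))"
  by (simp add: gm_def)

lemma gm_id_commute: "gm n x y id = gm n y x id"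
proof -
  have "(\<Sum>\<sigma>\<in>Sn n. x \<sigma> * y (inv \<sigma>)) = (\<Sum>\<sigma>\<in>Sn n. x (inv \<sigma>) * y (inv (inv \<sigma>)))"
    by (rule sum_Sn_inv[symmetric])
  also have "\<dots> = (\<Sum>\<sigma>\<in>Sn n. y \<sigma> * x (inv \<sigma>))"
    by (rule sum.cong) (auto simp: Sn_simps(3) mult.commute)
  finally show ?thesis by (simp add: gm_id)
qed

lemma gm_scale_left: "gm n (\<lambda>\<sigma>. k * x \<sigma>) y = (\<lambda>\<sigma>. k * gm n x y \<sigma>)"
  by (auto simp: gm_def sum_distrib_left mult.assoc)

lemma gm_scale_right: "gm n x (\<lambda>\<sigma>. k * y \<sigma>) = (\<lambda>\<sigma>. k * gm n x y \<sigma>)"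
  by (auto simp: gm_def sum_distrib_left mult.left_commute)

text \<open>Inverting group elements reverses products; this is the source of the symmetry of
  \<open>aba\<close> and of the relation between \<open>dsym\<close> and
  \<open>ysym\<close>.\<close>

lemma gm_star: "\<rho> \<in> Sn n \<Longrightarrow> gm n x y (inv \<rho>) = gm n (\<lambda>\<sigma>. y (inv \<sigma>)) (\<lambda>\<sigma>. x (inv \<sigma>)) \<rho>"
proof -
  assume r: "\<rho> \<in> Sn n"
  have "gm n x y (inv \<rho>) = (\<Sum>\<sigma>\<in>Sn n. x \<sigma> * y (inv \<sigma> \<circ> inv \<rho>))" using r by (simp add: gm_def Sn_inv)
  also have "\<dots> = (\<Sum>\<sigma>\<in>Sn n. x (inv \<rho> \<circ> \<sigma>) * y (inv (inv \<rho> \<circ> \<sigma>) \<circ> inv \<rho>))"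
    by (rule sum_Sn_left[OF Sn_inv[OF r], symmetric])
  also have "\<dots> = (\<Sum>\<sigma>\<in>Sn n. y (inv \<sigma>) * x (inv (inv \<sigma> \<circ> \<rho>)))"
  proof (rule sum.cong[OF refl])
    fix \<sigma> assume s: "\<sigma> \<in> Sn n"
    have "inv (inv \<rho> \<circ> \<sigma>) \<circ> inv \<rho> = inv \<sigma>"
      using Sn_inv_comp[OF Sn_inv[OF r] s] Sn_simps[OF r] by (simp add: comp_assoc)
    moreover have "inv (inv \<sigma> \<circ> \<rho>) = inv \<rho> \<circ> \<sigma>"
      using Sn_inv_comp[OF Sn_inv[OF s] r] Sn_simps[OF s] by simp
    ultimately show "x (inv \<rho> \<circ> \<sigma>) * y (inv (inv \<rho> \<circ> \<sigma>) \<circ> inv \<rho>) = y (inv \<sigma>) * x (inv (inv \<sigma> \<circ> \<rho>))"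
      by simp
  qed
  also have "\<dots> = gm n (\<lambda>\<sigma>. y (inv \<sigma>)) (\<lambda>\<sigma>. x (inv \<sigma>)) \<rho>" using r by (simp add: gm_def)
  finally show ?thesis .
qed

lemma sum_Sn_Yg: "(\<Sum>\<sigma>\<in>Sn n. (if \<sigma> \<in> Yg {0..<n} f then F \<sigma> else (0::'c::comm_monoid_add))) = (\<Sum>\<sigma>\<in>Yg {0..<n} f. F \<sigma>)"
  by (rule sum.mono_neutral_cong_right) (auto intro: Yg_Sn)

definition yind :: "nat \<Rightarrow> (nat \<Rightarrow> nat) \<Rightarrow> (nat \<Rightarrow> nat) \<Rightarrow> int" where
  "yind n f = (\<lambda>\<sigma>. if \<sigma> \<in> Yg {0..<n} f then 1 else 0)"

definition ysgn :: "nat \<Rightarrow> (nat \<Rightarrow> nat) \<Rightarrow> (nat \<Rightarrow> nat) \<Rightarrow> int" where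
  "ysgn n f = (\<lambda>\<sigma>. if \<sigma> \<in> Yg {0..<n} f then sign \<sigma> else 0)"

lemma Yg_inv_iff: "\<sigma> \<in> Sn n \<Longrightarrow> inv \<sigma> \<in> Yg {0..<n} f \<longleftrightarrow> \<sigma> \<in> Yg {0..<n} f"
  using Yg_inv[of \<sigma>] Yg_inv[of "inv \<sigma>"] by (auto simp: Sn_simps)

lemma Yg_comp_left_iff: "\<rho> \<in> Yg {0..<n} f \<Longrightarrow> \<rho> \<circ> \<sigma> \<in> Yg {0..<n} f \<longleftrightarrow> \<sigma> \<in> Yg {0..<n} f"
  using Yg_comp[of \<rho> _ f \<sigma>] Yg_comp[OF Yg_inv[of \<rho>], of _ f "\<rho> \<circ> \<sigma>"] by auto

lemma yind_inv: "\<sigma> \<in> Sn n \<Longrightarrow> yind n f (inv \<sigma>) = yind n f \<sigma>"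
  by (simp add: yind_def Yg_inv_iff)

lemma ysgn_inv: "\<sigma> \<in> Sn n \<Longrightarrow> ysgn n f (inv \<sigma>) = ysgn n f \<sigma>"
  by (simp add: ysgn_def Yg_inv_iff sign_inverse Sn_permutation)

lemma yind_left: "\<rho> \<in> Yg {0..<n} f \<Longrightarrow> yind n f (\<rho> \<circ> \<sigma>) = yind n f \<sigma>"
  by (simp add: yind_def Yg_comp_left_iff)

lemma ysgn_left: "\<rho> \<in> Yg {0..<n} f \<Longrightarrow> \<sigma> \<in> Sn n \<Longrightarrow> ysgn n f (\<rho> \<circ> \<sigma>) = sign \<rho> * ysgn n f \<sigma>"
  by (auto simp: ysgn_def Yg_comp_left_iff intro!: sign_compose Sn_permutation Yg_Sn)

text \<open>If two points share both their \<open>f\<close>-label and (after \<open>g\<close>) their column, then a function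
  invariant under \<open>f\<close> on the left and alternating under columns on the right vanishes at \<open>g\<close>.\<close>

lemma alternating_vanish:
  fixes h :: "(nat \<Rightarrow> nat) \<Rightarrow> int"
  assumes l: "\<And>\<pi> g. \<pi> \<in> Yg {0..<n} f \<Longrightarrow> g \<in> Sn n \<Longrightarrow> h (\<pi> \<circ> g) = h g"
    and r: "\<And>g q. g \<in> Sn n \<Longrightarrow> q \<in> Yg {0..<n} cl \<Longrightarrow> h (g \<circ> q) = sign q * h g"
    and g: "g \<in> Sn n" and xy: "x < n" "y < n" "x \<noteq> y" "f (g x) = f (g y)" "cl x = cl y"
  shows "h g = 0"
proof -
  let ?t = "Transposition.transpose (g x) (g y)" and ?t' = "Transposition.transpose x y"
  have gi: "g x \<noteq> g y" using xy(3) Sn_inv_apply(2)[OF g] by metis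
  have gX: "g x < n" "g y < n" using xy g Sn_apply by auto
  have t: "?t \<in> Yg {0..<n} f" using gX xy(4) by (auto simp: Yg_def permutes_swap_id transpose_def)
  have t': "?t' \<in> Yg {0..<n} cl" using xy by (auto simp: Yg_def permutes_swap_id transpose_def)
  have inj: "g a = g b \<longleftrightarrow> a = b" for a b using Sn_inv_apply(2)[OF g] by metis
  \<comment> \<open>One transposition seen from both sides of g: on the left it leaves the value of
    h unchanged, on the right it changes the sign.\<close>
  have "?t \<circ> g = g \<circ> ?t'" by (auto simp: fun_eq_iff transpose_def inj)
  then have "h g = h (g \<circ> ?t')" using l[OF t g] by simp
  also have "\<dots> = - h g" using r[OF g t'] xy(3) by (simp add: sign_swap_id)
  finally show ?thesis by simp
qed

text \<open>Only the row and the column of each number enter, as two labellings that jointly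
  parametrise the diagram; row and column groups are then the Young subgroups of \<open>rw\<close>
  and \<open>cl\<close>.\<close>

locale tableau =
  fixes n :: nat and p :: mono and rw cl :: "nat \<Rightarrow> nat"
  assumes pf: "is_pf p" and bij: "bij_betw (\<lambda>x. (rw x, cl x)) {0..<n} (dg p)"
begin

lemma rc_inj: "x < n \<Longrightarrow> y < n \<Longrightarrow> rw x = rw y \<Longrightarrow> cl x = cl y \<Longrightarrow> x = y"
  using bij by (auto simp: bij_betw_def inj_on_def)

lemma rc_dg: "x < n \<Longrightarrow> cl x < p (rw x)"
  using bij by (auto simp: bij_betw_def dg_def)

lemma rc_surj: "j < p i \<Longrightarrow> \<exists>x<n. rw x = i \<and> cl x = j"
proof -
  assume "j < p i"
  then have "(i, j) \<in> (\<lambda>x. (rw x, cl x)) ` {0..<n}" using bij by (auto simp: bij_betw_def dg_def)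
  then show ?thesis by auto
qed

lemma deg_p: "deg p = n"
  using bij_betw_same_card[OF bij] card_dg pf by (simp add: is_pf_def)

lemma content_rw: "content {0..<n} rw = p"
proof
  fix i
  have "bij_betw cl {x \<in> {0..<n}. rw x = i} {..<p i}"
    unfolding bij_betw_def
  proof
    show "inj_on cl {x \<in> {0..<n}. rw x = i}" using rc_inj by (auto simp: inj_on_def)
    show "cl ` {x \<in> {0..<n}. rw x = i} = {..<p i}"
    proof (intro equalityI subsetI)
      fix j assume "j \<in> {..<p i}"
      then obtain x where "x < n" "rw x = i" "cl x = j" using rc_surj by auto
      then show "j \<in> cl ` {x \<in> {0..<n}. rw x = i}" by auto
    qed (use rc_dg in auto)
  qed
  then show "content {0..<n} rw i = p i" unfolding content_def by (simp add: bij_betw_same_card)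
qed

lemma column_height: "\<exists>m. {i. j < p i} = {..<m} \<and> card {x \<in> {0..<n}. cl x = j} = m"
proof -
  obtain N where N: "\<forall>i\<ge>N. p i = 0" using fin_mono_bound[of p] pf unfolding is_pf_def by blast
  define m where "m = (LEAST i. \<not> j < p i)"
  have "\<not> j < p N" using N by simp
  then have m: "\<not> j < p m" unfolding m_def by (rule LeastI)
  have "j < p i \<longleftrightarrow> i < m" for i
  proof
    assume "j < p i"
    then show "i < m" using m pf_antimono[OF pf, of m i] by (metis le_trans not_le)
  next
    assume "i < m" then show "j < p i" unfolding m_def using not_less_Least by blast
  qed
  then have e: "{i. j < p i} = {..<m}" by auto
  have "bij_betw rw {x \<in> {0..<n}. cl x = j} {i. j < p i}"
    unfolding bij_betw_def
  proof
    show "inj_on rw {x \<in> {0..<n}. cl x = j}" using rc_inj by (auto simp: inj_on_def)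
    show "rw ` {x \<in> {0..<n}. cl x = j} = {i. j < p i}"
    proof (intro equalityI subsetI)
      fix i assume "i \<in> {i. j < p i}"
      then obtain x where "x < n" "rw x = i" "cl x = j" using rc_surj by auto
      then show "i \<in> rw ` {x \<in> {0..<n}. cl x = j}" by auto
    qed (use rc_dg in auto)
  qed
  then have "card {x \<in> {0..<n}. cl x = j} = m" unfolding e by (simp add: bij_betw_same_card)
  then show ?thesis using e by blast
qed

text \<open>A column of height m holds the row numbers 0, ..., m - 1, so a labelling injective on it
  has at most min m N values below N, and the row labelling attains this bound.\<close>

lemma column_card_le:
  assumes F: "\<And>x y. x < n \<Longrightarrow> y < n \<Longrightarrow> F x = F y \<Longrightarrow> cl x = cl y \<Longrightarrow> x = y"
  shows "card {x \<in> {0..<n}. cl x = j \<and> F x < N} \<le> card {x \<in> {0..<n}. cl x = j \<and> rw x < N}"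
proof -
  obtain m where m: "{i. j < p i} = {..<m}" "card {x \<in> {0..<n}. cl x = j} = m"
    using column_height by blast
  have "rw ` {x \<in> {0..<n}. cl x = j \<and> rw x < N} = {..<min m N}"
  proof (intro equalityI subsetI)
    fix i assume "i \<in> {..<min m N}"
    then have "i \<in> {i. j < p i}" "i < N" unfolding m(1) by auto
    then obtain x where "x < n" "rw x = i" "cl x = j" using rc_surj by auto
    then show "i \<in> rw ` {x \<in> {0..<n}. cl x = j \<and> rw x < N}" using \<open>i < N\<close> by auto
  next
    fix i assume "i \<in> rw ` {x \<in> {0..<n}. cl x = j \<and> rw x < N}"
    then have "j < p i" "i < N" using rc_dg by auto
    then show "i \<in> {..<min m N}" using m(1) by auto
  qed
  moreover have "inj_on rw {x \<in> {0..<n}. cl x = j \<and> rw x < N}" using rc_inj by (auto simp: inj_on_def)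
  ultimately have "card {x \<in> {0..<n}. cl x = j \<and> rw x < N} = min m N"
    using card_image by fastforce
  moreover have "card {x \<in> {0..<n}. cl x = j \<and> F x < N} \<le> m"
    unfolding m(2)[symmetric] by (rule card_mono) auto
  moreover have "card {x \<in> {0..<n}. cl x = j \<and> F x < N} \<le> card {..<N}"
    by (rule card_inj_on_le[of F]) (use F in \<open>auto simp: inj_on_def\<close>)
  ultimately show ?thesis by simp
qed

lemma card_by_columns:
  "card {x \<in> {0..<n}. P x} = (\<Sum>j\<in>cl ` {0..<n}. card {x \<in> {0..<n}. cl x = j \<and> P x})"
proof -
  have "{x \<in> {0..<n}. P x} = (\<Union>j\<in>cl ` {0..<n}. {x \<in> {0..<n}. cl x = j \<and> P x})" (is "?A = ?B") by auto
  then have "card ?A = card ?B" by (rule arg_cong)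
  also have "card ?B = (\<Sum>j\<in>cl ` {0..<n}. card {x \<in> {0..<n}. cl x = j \<and> P x})"
    by (rule card_UN_disjoint) auto
  finally show ?thesis .
qed

lemma sum_content_lt:
  fixes F :: "nat \<Rightarrow> nat"
  shows "(\<Sum>i<N. content {0..<n} F i) = card {x \<in> {0..<n}. F x < N}"
proof -
  have "{x \<in> {0..<n}. F x < N} = (\<Union>i<N. {x \<in> {0..<n}. F x = i})" (is "?A = ?B") by auto
  then have "card ?A = card ?B" by (rule arg_cong)
  also have "card ?B = (\<Sum>i<N. card {x \<in> {0..<n}. F x = i})"
    by (rule card_UN_disjoint) auto
  finally show ?thesis by (simp only: content_def)
qed

text \<open>Column by column the row labelling has the most values below N; adding the columns gives
  dominance.\<close>

lemma transversal_dominance: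
  assumes F: "\<And>x y. x < n \<Longrightarrow> y < n \<Longrightarrow> F x = F y \<Longrightarrow> cl x = cl y \<Longrightarrow> x = y"
  shows "(\<Sum>i<N. content {0..<n} F i) \<le> (\<Sum>i<N. p i)"
proof -
  have "card {x \<in> {0..<n}. F x < N} \<le> card {x \<in> {0..<n}. rw x < N}"
    unfolding card_by_columns[of "\<lambda>x. _ x < _"] by (rule sum_mono) (rule column_card_le[OF F])
  then show ?thesis unfolding sum_content_lt[symmetric] content_rw .
qed

text \<open>Equality case: if the totals agree, the bound is attained in every column, so each
  column carries the labels 0, ..., m - 1 once each and is put in row order by a permutation inside
  the column.\<close>

lemma transversal_column_perm:
  assumes F: "\<And>x y. x < n \<Longrightarrow> y < n \<Longrightarrow> F x = F y \<Longrightarrow> cl x = cl y \<Longrightarrow> x = y"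
    and c: "content {0..<n} F = p"
  shows "\<exists>q\<in>Yg {0..<n} cl. \<forall>x<n. F x = rw (q x)"
proof -
  have le: "card {x \<in> {0..<n}. cl x = j \<and> F x < N} \<le> card {x \<in> {0..<n}. cl x = j \<and> rw x < N}" for j N
    by (rule column_card_le) (rule F)
  \<comment> \<open>A strict inequality in a single column would make the total smaller, but both
    totals are partial sums of \<open>p\<close>.\<close>
  have eq: "card {x \<in> {0..<n}. cl x = j \<and> F x < N} = card {x \<in> {0..<n}. cl x = j \<and> rw x < N}"
    if "j \<in> cl ` {0..<n}" for j N
  proof (rule ccontr)
    assume ne: "\<not> ?thesis"
    have "(\<Sum>j\<in>cl ` {0..<n}. card {x \<in> {0..<n}. cl x = j \<and> F x < N})
      < (\<Sum>j\<in>cl ` {0..<n}. card {x \<in> {0..<n}. cl x = j \<and> rw x < N})"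
    proof (rule sum_strict_mono_ex1)
      show "\<forall>j\<in>cl ` {0..<n}. card {x \<in> {0..<n}. cl x = j \<and> F x < N} \<le> card {x \<in> {0..<n}. cl x = j \<and> rw x < N}"
        using le by (intro ballI)
      have "card {x \<in> {0..<n}. cl x = j \<and> F x < N} < card {x \<in> {0..<n}. cl x = j \<and> rw x < N}"
        using le[of j N] ne by linarith
      then show "\<exists>j\<in>cl ` {0..<n}. card {x \<in> {0..<n}. cl x = j \<and> F x < N} < card {x \<in> {0..<n}. cl x = j \<and> rw x < N}"
        using that by (intro bexI)
    qed simp
    then have "card {x \<in> {0..<n}. F x < N} < card {x \<in> {0..<n}. rw x < N}"
      unfolding card_by_columns[of "\<lambda>x. _ x < _"] .
    then show False unfolding sum_content_lt[symmetric] c content_rw by simp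
  qed
  have dg: "cl x < p (F x)" if x: "x < n" for x
  proof -
    obtain m where m: "{i. cl x < p i} = {..<m}" "card {y \<in> {0..<n}. cl y = cl x} = m"
      using column_height by blast
    have "{y \<in> {0..<n}. cl y = cl x \<and> rw y < m} = {y \<in> {0..<n}. cl y = cl x}"
      using rc_dg m(1) by fastforce
    then have "card {y \<in> {0..<n}. cl y = cl x \<and> F y < m} = card {y \<in> {0..<n}. cl y = cl x}"
      using eq[of "cl x" m] x by simp
    then have "{y \<in> {0..<n}. cl y = cl x \<and> F y < m} = {y \<in> {0..<n}. cl y = cl x}"
      by (intro card_subset_eq) auto
    then have "F x < m" using x by auto
    then show ?thesis using m(1) by auto
  qed
  define q where "q x = (if x < n then SOME y. y < n \<and> rw y = F x \<and> cl y = cl x else x)" for x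
  have q: "q x < n \<and> rw (q x) = F x \<and> cl (q x) = cl x" if "x < n" for x
  proof -
    have "\<exists>y. y < n \<and> rw y = F x \<and> cl y = cl x" using rc_surj[OF dg[OF that]] by blast
    then have "(SOME y. y < n \<and> rw y = F x \<and> cl y = cl x) < n \<and> rw (SOME y. y < n \<and> rw y = F x \<and> cl y = cl x) = F x
      \<and> cl (SOME y. y < n \<and> rw y = F x \<and> cl y = cl x) = cl x" by (rule someI_ex)
    then show ?thesis using that by (simp add: q_def)
  qed
  have "inj_on q {0..<n}" using q F by (auto simp: inj_on_def) metis
  moreover have "q ` {0..<n} \<subseteq> {0..<n}" using q by auto
  ultimately have "bij_betw q {0..<n} {0..<n}"
    by (simp add: bij_betw_def endo_inj_surj)
  then have "q permutes {0..<n}" by (rule bij_imp_permutes) (simp add: q_def)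
  then have "q \<in> Yg {0..<n} cl" using q by (simp add: Yg_def)
  moreover have "\<forall>x<n. F x = rw (q x)" using q by simp
  ultimately show ?thesis by blast
qed

abbreviation "R \<equiv> Yg {0..<n} rw"
abbreviation "C \<equiv> Yg {0..<n} cl"
abbreviation "aR \<equiv> yind n rw"
abbreviation "bC \<equiv> ysgn n cl"

definition csym :: "(nat \<Rightarrow> nat) \<Rightarrow> int" where
  "csym = gm n aR bC"

lemma csym_sum: "\<rho> \<in> Sn n \<Longrightarrow> csym \<rho> = (\<Sum>\<pi>\<in>R. bC (inv \<pi> \<circ> \<rho>))"
proof -
  assume r: "\<rho> \<in> Sn n"
  have "csym \<rho> = (\<Sum>\<sigma>\<in>Sn n. if \<sigma> \<in> R then bC (inv \<sigma> \<circ> \<rho>) else 0)"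
    using r by (auto simp: csym_def gm_def yind_def intro!: sum.cong)
  then show ?thesis by (simp add: sum_Sn_Yg)
qed

lemma RC_trivial: "\<sigma> \<in> R \<Longrightarrow> \<sigma> \<in> C \<Longrightarrow> \<sigma> = id"
proof
  fix x assume "\<sigma> \<in> R" "\<sigma> \<in> C"
  then show "\<sigma> x = id x" using rc_inj[of "\<sigma> x" x] permutes_in_image[of \<sigma> "{0..<n}" x] permutes_not_in[of \<sigma> "{0..<n}" x]
    by (cases "x < n") (auto simp: Yg_def)
qed

lemma csym_id: "csym id = 1"
proof -
  have "csym id = (\<Sum>\<pi>\<in>R. if \<pi> = id then 1 else 0)"
    unfolding csym_sum[OF Sn_id]
  proof (rule sum.cong[OF refl])
    fix \<pi> assume p: "\<pi> \<in> R"
    show "bC (inv \<pi> \<circ> id) = (if \<pi> = id then 1 else 0)"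
    proof (cases "\<pi> = id")
      case False
      then have "\<pi> \<notin> C" using RC_trivial p by blast
      then have "inv \<pi> \<notin> C" using Yg_inv_iff[OF Yg_Sn[OF p], of cl] by blast
      then show ?thesis using False by (simp add: ysgn_def)
    qed (simp add: ysgn_def)
  qed
  then show ?thesis by (simp add: sum.delta)
qed

lemma csym_left: "\<pi> \<in> R \<Longrightarrow> g \<in> Sn n \<Longrightarrow> csym (\<pi> \<circ> g) = csym g"
proof -
  assume p: "\<pi> \<in> R" and g: "g \<in> Sn n"
  have pS: "\<pi> \<in> Sn n" using Yg_Sn[OF p] .
  have "csym (\<pi> \<circ> g) = (\<Sum>\<sigma>\<in>R. bC (inv \<sigma> \<circ> (\<pi> \<circ> g)))" using csym_sum Sn_comp[OF pS g] by simp
  also have "\<dots> = (\<Sum>\<sigma>\<in>R. bC (inv (\<pi> \<circ> \<sigma>) \<circ> (\<pi> \<circ> g)))"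
    by (rule sum_Yg_left[OF p, symmetric])
  also have "\<dots> = (\<Sum>\<sigma>\<in>R. bC (inv \<sigma> \<circ> g))"
    by (intro sum.cong refl) (simp add: Sn_inv_comp[OF pS] Yg_Sn comp_assoc Sn_simps(4)[OF pS])
  finally show ?thesis using csym_sum[OF g] by simp
qed

lemma bC_right: "q \<in> C \<Longrightarrow> g \<in> Sn n \<Longrightarrow> bC (g \<circ> q) = sign q * bC g"
proof -
  assume q: "q \<in> C" and g: "g \<in> Sn n"
  have qS: "q \<in> Sn n" using Yg_Sn[OF q] .
  have "bC (g \<circ> q) = bC (inv (g \<circ> q))" using ysgn_inv Sn_comp g qS by metis
  also have "\<dots> = bC (inv q \<circ> inv g)" using Sn_inv_comp g qS by simp
  also have "\<dots> = sign (inv q) * bC (inv g)" by (rule ysgn_left) (use Yg_inv[OF q] Sn_inv[OF g] in auto)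
  also have "\<dots> = sign q * bC g" using ysgn_inv[OF g] sign_inverse[OF Sn_permutation[OF qS]] by simp
  finally show ?thesis .
qed

lemma csym_right: "g \<in> Sn n \<Longrightarrow> q \<in> C \<Longrightarrow> csym (g \<circ> q) = sign q * csym g"
proof -
  assume g: "g \<in> Sn n" and q: "q \<in> C"
  have "csym (g \<circ> q) = (\<Sum>\<sigma>\<in>R. bC ((inv \<sigma> \<circ> g) \<circ> q))"
    using csym_sum[OF Sn_comp[OF g Yg_Sn[OF q]]] by (simp add: comp_assoc)
  also have "\<dots> = (\<Sum>\<sigma>\<in>R. sign q * bC (inv \<sigma> \<circ> g))"
    by (intro sum.cong refl bC_right q Sn_comp Sn_inv g Yg_Sn)
  finally show ?thesis using csym_sum[OF g] by (simp add: sum_distrib_left)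
qed

lemma csym_notin: "\<rho> \<notin> Sn n \<Longrightarrow> csym \<rho> = 0"
  by (simp add: csym_def gm_def)

text \<open>Von Neumann's lemma. If g sends two points of one column into one row, both sides
  vanish; otherwise g factors as a row permutation after a column permutation, and h g is a sign
  times h id.\<close>

lemma csym_characterization:
  fixes h :: "(nat \<Rightarrow> nat) \<Rightarrow> int"
  assumes l: "\<And>\<pi> g. \<pi> \<in> R \<Longrightarrow> g \<in> Sn n \<Longrightarrow> h (\<pi> \<circ> g) = h g"
    and r: "\<And>g q. g \<in> Sn n \<Longrightarrow> q \<in> C \<Longrightarrow> h (g \<circ> q) = sign q * h g"
    and g: "g \<in> Sn n"
  shows "h g = h id * csym g"
proof (cases "\<exists>x<n. \<exists>y<n. x \<noteq> y \<and> rw (g x) = rw (g y) \<and> cl x = cl y")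
  case True
  then obtain x y where xy: "x < n" "y < n" "x \<noteq> y" "rw (g x) = rw (g y)" "cl x = cl y" by blast
  have "h g = 0" by (rule alternating_vanish[of n rw h cl g x y]) (use l r g xy in auto)
  moreover have "csym g = 0" by (rule alternating_vanish[of n rw csym cl g x y]) (use csym_left csym_right g xy in auto)
  ultimately show ?thesis by simp
next
  case False
  have "content {0..<n} (rw \<circ> g) = p" using content_permutes[of g "{0..<n}" rw] g content_rw by (simp add: Sn_def)
  then obtain q where q: "q \<in> C" "\<forall>x<n. rw (g x) = rw (q x)"
    using transversal_column_perm[of "rw \<circ> g"] False by auto
  have qS: "q \<in> Sn n" using Yg_Sn[OF q(1)] .
  have "g \<circ> inv q \<in> R"
  proof -
    have "rw (g (inv q x)) = rw x" if "x < n" for x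
      using q(2) Sn_apply[OF Sn_inv[OF qS], of x] Sn_inv_apply(1)[OF qS, of x] that by auto
    then show ?thesis using Sn_comp[OF g Sn_inv[OF qS]] by (simp add: Yg_def Sn_def)
  qed
  moreover have "g = (g \<circ> inv q) \<circ> (id \<circ> q)" using Sn_simps(1)[OF qS] by (simp add: comp_assoc)
  ultimately have "k g = k (id \<circ> q)" if "\<And>\<pi> g. \<pi> \<in> R \<Longrightarrow> g \<in> Sn n \<Longrightarrow> k (\<pi> \<circ> g) = k g" for k :: "(nat \<Rightarrow> nat) \<Rightarrow> int"
    using that[of "g \<circ> inv q" "id \<circ> q"] qS by simp
  then have "h g = sign q * h id" "csym g = sign q * csym id"
    using l csym_left r[OF Sn_id q(1)] csym_right[OF Sn_id q(1)] by metis+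
  then show ?thesis using csym_id by simp
qed

text \<open>The product of the hook lengths.\<close>

definition hk :: int where
  "hk = gm n csym csym id"

lemma gm_left_inv:
  assumes "\<And>\<pi> g. \<pi> \<in> Yg {0..<n} f \<Longrightarrow> g \<in> Sn n \<Longrightarrow> x (\<pi> \<circ> g) = x g"
    "\<pi> \<in> Yg {0..<n} f" "g \<in> Sn n"
  shows "gm n x y (\<pi> \<circ> g) = gm n x y g"
proof -
  have pS: "\<pi> \<in> Sn n" using Yg_Sn[OF assms(2)] .
  have "gm n x y (\<pi> \<circ> g) = (\<Sum>\<sigma>\<in>Sn n. x \<sigma> * y (inv \<sigma> \<circ> (\<pi> \<circ> g)))"
    using Sn_comp[OF pS assms(3)] by (simp add: gm_def)
  also have "\<dots> = (\<Sum>\<sigma>\<in>Sn n. x (\<pi> \<circ> \<sigma>) * y (inv (\<pi> \<circ> \<sigma>) \<circ> (\<pi> \<circ> g)))"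
    by (rule sum_Sn_left[OF pS, symmetric])
  also have "\<dots> = (\<Sum>\<sigma>\<in>Sn n. x \<sigma> * y (inv \<sigma> \<circ> g))"
    by (intro sum.cong refl) (simp add: Sn_inv_comp[OF pS] comp_assoc Sn_simps(4)[OF pS] assms(1)[OF assms(2)])
  finally show ?thesis using assms(3) by (simp add: gm_def)
qed

lemma gm_right_alt:
  assumes "\<And>g q. g \<in> Sn n \<Longrightarrow> q \<in> C \<Longrightarrow> y (g \<circ> q) = sign q * y g" "g \<in> Sn n" "q \<in> C"
  shows "gm n x y (g \<circ> q) = sign q * gm n x y g"
proof -
  have "gm n x y (g \<circ> q) = (\<Sum>\<sigma>\<in>Sn n. x \<sigma> * y ((inv \<sigma> \<circ> g) \<circ> q))"
    using Sn_comp[OF assms(2) Yg_Sn[OF assms(3)]] by (simp add: gm_def comp_assoc)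
  also have "\<dots> = (\<Sum>\<sigma>\<in>Sn n. x \<sigma> * (sign q * y (inv \<sigma> \<circ> g)))"
    by (intro sum.cong refl arg_cong2[where f="(*)"] assms Sn_comp Sn_inv)
  finally show ?thesis using assms(2) by (simp add: gm_def sum_distrib_left mult.left_commute)
qed

text \<open>A product keeps the row invariance of its left factor and the column alternation of its
  right factor, so \<open>csym_characterization\<close> applies; the scalar is the value at the
  identity.\<close>

lemma csym_quasi_idem: "gm n csym csym = (\<lambda>\<sigma>. hk * csym \<sigma>)"
proof
  fix \<sigma>
  show "gm n csym csym \<sigma> = hk * csym \<sigma>"
  proof (cases "\<sigma> \<in> Sn n")
    case True
    show ?thesis unfolding hk_def
    proof (rule csym_characterization[OF _ _ True])
      fix \<pi> g assume "\<pi> \<in> R" "g \<in> Sn n"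
      then show "gm n csym csym (\<pi> \<circ> g) = gm n csym csym g" by (intro gm_left_inv[where x=csym and f=rw] csym_left)
    next
      fix g q assume "g \<in> Sn n" "q \<in> C"
      then show "gm n csym csym (g \<circ> q) = sign q * gm n csym csym g" by (intro gm_right_alt[where y=csym] csym_right)
    qed
  qed (simp add: gm_def csym_notin)
qed

text \<open>The element a b a, from the row sum a and the signed column sum b: it is fixed by
  inversion of group elements, which makes positivity arguments possible.\<close>

definition aba :: "(nat \<Rightarrow> nat) \<Rightarrow> int" where
  "aba = gm n csym aR"

lemma aba_alt: "aba = gm n aR (gm n bC aR)"
  by (simp add: aba_def csym_def gm_assoc)

lemma gm_cong: "(\<And>\<sigma>. \<sigma> \<in> Sn n \<Longrightarrow> x \<sigma> = x' \<sigma>) \<Longrightarrow> (\<And>\<sigma>. \<sigma> \<in> Sn n \<Longrightarrow> y \<sigma> = y' \<sigma>) \<Longrightarrow> gm n x y = gm n x' y'"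
  unfolding gm_def by (intro ext if_cong refl sum.cong arg_cong2[where f="(*)"]) (auto intro: Sn_comp Sn_inv)

lemma aba_inv: "\<rho> \<in> Sn n \<Longrightarrow> aba (inv \<rho>) = aba \<rho>"
proof -
  assume r: "\<rho> \<in> Sn n"
  have 1: "gm n (\<lambda>\<sigma>. aR (inv \<sigma>)) (\<lambda>\<sigma>. csym (inv \<sigma>)) = gm n aR (gm n bC aR)"
  proof (rule gm_cong)
    fix \<sigma> assume s: "\<sigma> \<in> Sn n"
    show "aR (inv \<sigma>) = aR \<sigma>" by (rule yind_inv[OF s])
    have "csym (inv \<sigma>) = gm n (\<lambda>\<sigma>. bC (inv \<sigma>)) (\<lambda>\<sigma>. aR (inv \<sigma>)) \<sigma>"
      unfolding csym_def by (rule gm_star[OF s])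
    also have "gm n (\<lambda>\<sigma>. bC (inv \<sigma>)) (\<lambda>\<sigma>. aR (inv \<sigma>)) = gm n bC aR"
      by (rule gm_cong) (auto simp: yind_inv ysgn_inv)
    finally show "csym (inv \<sigma>) = gm n bC aR \<sigma>" .
  qed
  have "aba (inv \<rho>) = gm n (\<lambda>\<sigma>. aR (inv \<sigma>)) (\<lambda>\<sigma>. csym (inv \<sigma>)) \<rho>"
    unfolding aba_def by (rule gm_star[OF r])
  then show ?thesis unfolding 1 aba_alt .
qed

lemma gm_aR_left: "(\<And>\<pi> g. \<pi> \<in> R \<Longrightarrow> g \<in> Sn n \<Longrightarrow> x (\<pi> \<circ> g) = x g) \<Longrightarrow> \<rho> \<in> Sn n \<Longrightarrow> gm n aR x \<rho> = int (card R) * x \<rho>"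
proof -
  assume x: "\<And>\<pi> g. \<pi> \<in> R \<Longrightarrow> g \<in> Sn n \<Longrightarrow> x (\<pi> \<circ> g) = x g" and r: "\<rho> \<in> Sn n"
  have "gm n aR x \<rho> = (\<Sum>\<sigma>\<in>Sn n. if \<sigma> \<in> R then x (inv \<sigma> \<circ> \<rho>) else 0)"
    using r by (auto simp: gm_def yind_def intro!: sum.cong)
  also have "\<dots> = (\<Sum>\<sigma>\<in>R. x (inv \<sigma> \<circ> \<rho>))" by (rule sum_Sn_Yg)
  also have "\<dots> = (\<Sum>\<sigma>\<in>R. x \<rho>)" by (intro sum.cong refl x Yg_inv r)
  finally show ?thesis by simp
qed

text \<open>As \<open>aba\<close> is fixed by inversion, the identity coefficient of its square is a
  sum of squares, and it is not zero since \<open>aba id\<close> is the order of R.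
  Quasi-idempotence evaluates the same coefficient as \<open>hk\<close> times the square of that
  order.\<close>

lemma hk_pos: "hk > 0"
proof -
  let ?r = "int (card R)"
  have r: "?r > 0" using card_Yg_pos[of "{0..<n}" rw] by simp
  have lc: "aba (\<pi> \<circ> g) = aba g" if "\<pi> \<in> R" "g \<in> Sn n" for \<pi> g
    unfolding aba_def by (rule gm_left_inv[of rw]) (use csym_left that in auto)
  have aa: "gm n aR aba = (\<lambda>\<rho>. ?r * aba \<rho>)"
  proof
    fix \<rho> show "gm n aR aba \<rho> = ?r * aba \<rho>"
      using gm_aR_left[OF lc] by (cases "\<rho> \<in> Sn n") (auto simp: gm_def aba_def)
  qed
  have aid: "aba id = ?r"
  proof -
    have "aba id = gm n aR csym id" unfolding aba_def by (rule gm_id_commute)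
    also have "\<dots> = ?r * csym id" by (rule gm_aR_left) (use csym_left in auto)
    finally show ?thesis using csym_id by simp
  qed
  have "gm n aba aba = gm n csym (gm n aR aba)" by (simp add: aba_def gm_assoc)
  also have "\<dots> = (\<lambda>\<rho>. ?r * gm n (gm n csym csym) aR \<rho>)"
    by (simp add: aa gm_scale_right gm_assoc) (simp add: aba_def)
  also have "\<dots> = (\<lambda>\<rho>. ?r * (hk * aba \<rho>))"
    by (simp add: csym_quasi_idem gm_scale_left aba_def)
  finally have "gm n aba aba id = ?r * (hk * ?r)" by (simp add: aid)
  moreover have "gm n aba aba id = (\<Sum>\<sigma>\<in>Sn n. (aba \<sigma>)\<^sup>2)"
    unfolding gm_id by (intro sum.cong refl) (simp add: aba_inv power2_eq_square)
  moreover have "(\<Sum>\<sigma>\<in>Sn n. (aba \<sigma>)\<^sup>2) > 0"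
    by (rule sum_pos2[of _ id]) (use aid r in auto)
  ultimately show ?thesis using r by (simp add: zero_less_mult_iff)
qed

lemma gm_csym_id:
  assumes "\<And>\<pi> g. \<pi> \<in> R \<Longrightarrow> g \<in> Sn n \<Longrightarrow> x (\<pi> \<circ> g) = x g"
  shows "gm n x (gm n aba bC) id = hk * gm n x csym id"
proof -
  have "gm n aba bC = gm n csym csym" by (simp add: aba_def gm_assoc) (simp add: csym_def)
  then show ?thesis by (simp add: csym_quasi_idem gm_scale_right)
qed

end

section \<open>The cocenter form\<close>

text \<open>\<open>BF n x y\<close> is the trace of \<open>z \<mapsto> x z y\<^sup>*\<close> on the group algebra; it only depends on the
  classes of \<open>x\<close> and \<open>y\<close> modulo commutators, and on those it is positive definite.\<close>

definition BF :: "nat \<Rightarrow> ((nat \<Rightarrow> nat) \<Rightarrow> 'c::comm_ring_1) \<Rightarrow> ((nat \<Rightarrow> nat) \<Rightarrow> 'c) \<Rightarrow> 'c" where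
  "BF n x y = (\<Sum>z\<in>Sn n. \<Sum>g\<in>Sn n. x g * y (inv z \<circ> g \<circ> z))"

text \<open>Up to the factor n!, the projection of y to class functions. By \<open>BF_bar\<close>
  and symmetry the form sees its arguments only through it.\<close>

definition bar :: "nat \<Rightarrow> ((nat \<Rightarrow> nat) \<Rightarrow> 'c::comm_ring_1) \<Rightarrow> (nat \<Rightarrow> nat) \<Rightarrow> 'c" where
  "bar n y g = (\<Sum>z\<in>Sn n. y (inv z \<circ> g \<circ> z))"

lemma BF_bar: "BF n x y = (\<Sum>g\<in>Sn n. x g * bar n y g)"
  unfolding BF_def bar_def sum_distrib_left by (rule sum.swap)

lemma sum_conj:
  assumes "z \<in> Sn n"
  shows "(\<Sum>g\<in>Sn n. F g (inv z \<circ> g \<circ> z)) = (\<Sum>g\<in>Sn n. F (z \<circ> g \<circ> inv z) g)"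
  by (rule sum.reindex_bij_witness[where i="\<lambda>g. z \<circ> g \<circ> inv z" and j="\<lambda>g. inv z \<circ> g \<circ> z"])
    (use assms in \<open>auto simp: Sn_simps comp_assoc intro!: Sn_comp Sn_inv\<close>)

lemma BF_commute: "BF n x y = BF n y x"
proof -
  have "BF n x y = (\<Sum>z\<in>Sn n. \<Sum>g\<in>Sn n. x (z \<circ> g \<circ> inv z) * y g)"
    unfolding BF_def by (intro sum.cong refl sum_conj[of _ n "\<lambda>a b. x a * y b"])
  also have "\<dots> = (\<Sum>z\<in>Sn n. \<Sum>g\<in>Sn n. x (inv z \<circ> g \<circ> inv (inv z)) * y g)"
    by (rule sum_Sn_inv[symmetric])
  also have "\<dots> = BF n y x" unfolding BF_def
    by (intro sum.cong refl) (simp add: Sn_simps mult.commute)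
  finally show ?thesis .
qed

lemma bar_class:
  assumes "g \<in> Sn n" "w \<in> Sn n"
  shows "bar n y (w \<circ> g \<circ> inv w) = bar n y g"
proof -
  have "bar n y (w \<circ> g \<circ> inv w) = (\<Sum>z\<in>Sn n. y (inv (w \<circ> z) \<circ> (w \<circ> g \<circ> inv w) \<circ> (w \<circ> z)))"
    unfolding bar_def by (rule sum_Sn_left[OF assms(2), symmetric])
  also have "\<dots> = bar n y g" unfolding bar_def
    by (intro sum.cong refl) (simp add: Sn_inv_comp[OF assms(2)] comp_assoc Sn_simps[OF assms(2)])
  finally show ?thesis .
qed

lemma sum_bar_class:
  assumes "\<And>g w. g \<in> Sn n \<Longrightarrow> w \<in> Sn n \<Longrightarrow> \<chi> (w \<circ> g \<circ> inv w) = \<chi> g"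
  shows "(\<Sum>g\<in>Sn n. bar n y g * \<chi> g) = of_nat (card (Sn n)) * (\<Sum>g\<in>Sn n. y g * \<chi> g)"
proof -
  have "(\<Sum>g\<in>Sn n. bar n y g * \<chi> g) = (\<Sum>z\<in>Sn n. \<Sum>g\<in>Sn n. \<chi> g * y (inv z \<circ> g \<circ> z))"
    unfolding bar_def sum_distrib_right by (subst sum.swap) (simp add: mult.commute)
  also have "\<dots> = (\<Sum>z\<in>Sn n. \<Sum>g\<in>Sn n. \<chi> (z \<circ> g \<circ> inv z) * y g)"
    by (intro sum.cong refl sum_conj[of _ n "\<lambda>a b. \<chi> a * y b"])
  also have "\<dots> = (\<Sum>z\<in>Sn n. \<Sum>g\<in>Sn n. y g * \<chi> g)"
    by (intro sum.cong refl) (simp add: assms mult.commute)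
  finally show ?thesis by simp
qed

text \<open>n! times \<open>BF n y y\<close> is the sum of the squares of the values of
  \<open>bar n y\<close>, and over the reals such a sum vanishes only termwise.\<close>

lemma BF_self_zero_imp_bar:
  fixes y :: "(nat \<Rightarrow> nat) \<Rightarrow> real"
  assumes "BF n y y = 0" "g \<in> Sn n"
  shows "bar n y g = 0"
proof -
  have "(\<Sum>g\<in>Sn n. bar n y g * bar n y g) = of_nat (card (Sn n)) * (\<Sum>g\<in>Sn n. y g * bar n y g)"
    by (rule sum_bar_class) (rule bar_class)
  also have "\<dots> = 0" using assms(1) unfolding BF_bar by simp
  finally have "\<forall>g\<in>Sn n. bar n y g * bar n y g = 0"
    by (subst (asm) sum_nonneg_eq_0_iff) auto
  then show ?thesis using assms(2) by auto
qed

lemma BF_diff_left: "BF n (\<lambda>\<sigma>. x \<sigma> - x' \<sigma>) y = BF n x y - BF n x' y"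
  by (simp add: BF_bar left_diff_distrib sum_subtractf)

lemma BF_scale_left: "BF n (\<lambda>\<sigma>. k * x \<sigma>) y = k * BF n x y"
  by (simp add: BF_bar sum_distrib_left mult.assoc)

lemma BF_sum_left: "BF n (\<lambda>\<sigma>. \<Sum>i\<in>I. x i \<sigma>) y = (\<Sum>i\<in>I. BF n (x i) y)"
  unfolding BF_bar sum_distrib_right by (rule sum.swap)

lemma BF_diff_right: "BF n y (\<lambda>\<sigma>. x \<sigma> - x' \<sigma>) = BF n y x - BF n y x'"
  using BF_diff_left[of n x x' y] by (simp add: BF_commute)

lemma BF_scale_right: "BF n y (\<lambda>\<sigma>. k * x \<sigma>) = k * BF n y x"
  using BF_scale_left[of n k x y] by (simp add: BF_commute)

lemma BF_sum_right: "BF n y (\<lambda>\<sigma>. \<Sum>i\<in>I. x i \<sigma>) = (\<Sum>i\<in>I. BF n y (x i))"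
  unfolding BF_commute[of n y] by (rule BF_sum_left)

lemma BF_of_int: "BF n (\<lambda>\<sigma>. of_int (x \<sigma>)) (\<lambda>\<sigma>. of_int (y \<sigma>)) = of_int (BF n x y)"
  by (simp add: BF_def)

section \<open>Pairing with a Young symmetrizer\<close>

context tableau
begin

text \<open>What remains of the pairing with \<open>csym\<close> once its row sum is opened and z is
  fixed. As a function of u it inherits left invariance from x and alternates on the right under
  columns, so the vanishing lemma and the characterisation of \<open>csym\<close> apply to
  it.\<close>

definition hz :: "((nat \<Rightarrow> nat) \<Rightarrow> int) \<Rightarrow> (nat \<Rightarrow> nat) \<Rightarrow> (nat \<Rightarrow> nat) \<Rightarrow> int" where
  "hz x z u = (\<Sum>g\<in>Sn n. x g * bC (inv u \<circ> g \<circ> z))"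

lemma BF_csym_hz: "BF n x csym = (\<Sum>z\<in>Sn n. \<Sum>\<pi>\<in>R. hz x z (z \<circ> \<pi>))"
  unfolding BF_def
proof (rule sum.cong[OF refl])
  fix z assume z: "z \<in> Sn n"
  have "(\<Sum>g\<in>Sn n. x g * csym (inv z \<circ> g \<circ> z)) = (\<Sum>g\<in>Sn n. \<Sum>\<pi>\<in>R. x g * bC (inv (z \<circ> \<pi>) \<circ> g \<circ> z))"
  proof (rule sum.cong[OF refl])
    fix g assume g: "g \<in> Sn n"
    have "csym (inv z \<circ> g \<circ> z) = (\<Sum>\<pi>\<in>R. bC (inv \<pi> \<circ> (inv z \<circ> g \<circ> z)))"
      by (intro csym_sum Sn_comp Sn_inv g z)
    also have "\<dots> = (\<Sum>\<pi>\<in>R. bC (inv (z \<circ> \<pi>) \<circ> g \<circ> z))"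
      by (intro sum.cong refl) (simp add: Sn_inv_comp[OF z] Yg_Sn comp_assoc)
    finally show "x g * csym (inv z \<circ> g \<circ> z) = (\<Sum>\<pi>\<in>R. x g * bC (inv (z \<circ> \<pi>) \<circ> g \<circ> z))"
      by (simp add: sum_distrib_left)
  qed
  also have "\<dots> = (\<Sum>\<pi>\<in>R. hz x z (z \<circ> \<pi>))" unfolding hz_def by (rule sum.swap)
  finally show "(\<Sum>g\<in>Sn n. x g * csym (inv z \<circ> g \<circ> z)) = (\<Sum>\<pi>\<in>R. hz x z (z \<circ> \<pi>))" .
qed

lemma hz_left:
  assumes x: "\<And>\<pi> g. \<pi> \<in> Yg {0..<n} f \<Longrightarrow> g \<in> Sn n \<Longrightarrow> x (\<pi> \<circ> g) = x g"
    and \<pi>: "\<pi> \<in> Yg {0..<n} f" and u: "u \<in> Sn n"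
  shows "hz x z (\<pi> \<circ> u) = hz x z u"
proof -
  have pS: "\<pi> \<in> Sn n" using Yg_Sn[OF \<pi>] .
  have "hz x z (\<pi> \<circ> u) = (\<Sum>g\<in>Sn n. x (\<pi> \<circ> g) * bC (inv (\<pi> \<circ> u) \<circ> (\<pi> \<circ> g) \<circ> z))"
    unfolding hz_def by (rule sum_Sn_left[OF pS, symmetric])
  also have "\<dots> = hz x z u" unfolding hz_def
    by (intro sum.cong refl) (simp add: x[OF \<pi>] Sn_inv_comp[OF pS u] comp_assoc Sn_simps(4)[OF pS])
  finally show ?thesis .
qed

lemma hz_right:
  assumes z: "z \<in> Sn n" and u: "u \<in> Sn n" and q: "q \<in> C"
  shows "hz x z (u \<circ> q) = sign q * hz x z u"
proof -
  have qS: "q \<in> Sn n" using Yg_Sn[OF q] .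
  have "bC (inv (u \<circ> q) \<circ> g \<circ> z) = sign q * bC (inv u \<circ> g \<circ> z)" if g: "g \<in> Sn n" for g
  proof -
    have "bC (inv (u \<circ> q) \<circ> g \<circ> z) = bC (inv q \<circ> (inv u \<circ> g \<circ> z))"
      using Sn_inv_comp[OF u qS] by (simp add: comp_assoc)
    also have "\<dots> = sign (inv q) * bC (inv u \<circ> g \<circ> z)"
      by (intro ysgn_left Yg_inv q Sn_comp Sn_inv u g z)
    finally show ?thesis using sign_inverse[OF Sn_permutation[OF qS]] by simp
  qed
  then show ?thesis unfolding hz_def sum_distrib_left
    by (intro sum.cong refl) (simp add: mult.left_commute)
qed

text \<open>By \<open>csym_characterization\<close> each \<open>hz x z\<close> is a multiple of
  \<open>csym\<close> on the coset z R. Summing \<open>csym\<close> over that coset produces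
  \<open>aba z\<close>, and a b a b = csym csym brings in the factor \<open>hk\<close>.\<close>

lemma BF_csym_eq:
  assumes x: "\<And>\<pi> g. \<pi> \<in> R \<Longrightarrow> g \<in> Sn n \<Longrightarrow> x (\<pi> \<circ> g) = x g"
  shows "BF n x csym = hk * gm n x csym id"
proof -
  have h: "hz x z (z \<circ> \<pi>) = hz x z id * csym (z \<circ> \<pi>)" if "z \<in> Sn n" "\<pi> \<in> R" for z \<pi>
    by (rule csym_characterization) (intro hz_left[where f=rw] hz_right x that Sn_comp Yg_Sn[OF that(2)]; assumption)+
  have ab: "(\<Sum>\<pi>\<in>R. csym (z \<circ> \<pi>)) = aba z" if z: "z \<in> Sn n" for z
  proof -
    have "aba z = (\<Sum>\<sigma>\<in>Sn n. csym (z \<circ> \<sigma>) * aR (inv (z \<circ> \<sigma>) \<circ> z))"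
      using z unfolding aba_def gm_def by (simp add: sum_Sn_left[OF z, of "\<lambda>\<sigma>. csym \<sigma> * aR (inv \<sigma> \<circ> z)"])
    also have "\<dots> = (\<Sum>\<sigma>\<in>Sn n. if \<sigma> \<in> R then csym (z \<circ> \<sigma>) else 0)"
      by (intro sum.cong refl) (simp add: Sn_inv_comp[OF z] comp_assoc Sn_simps[OF z] yind_inv, simp add: yind_def)
    finally show ?thesis by (simp add: sum_Sn_Yg)
  qed
  have "BF n x csym = (\<Sum>z\<in>Sn n. hz x z id * aba z)"
    unfolding BF_csym_hz by (intro sum.cong refl) (simp add: h ab flip: sum_distrib_left)
  also have "\<dots> = (\<Sum>z\<in>Sn n. \<Sum>g\<in>Sn n. x g * (aba z * bC (inv z \<circ> inv g)))"
  proof (rule sum.cong[OF refl])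
    fix z assume z: "z \<in> Sn n"
    have "bC (inv id \<circ> g \<circ> z) = bC (inv z \<circ> inv g)" if g: "g \<in> Sn n" for g
      using ysgn_inv[OF Sn_comp[OF g z]] Sn_inv_comp[OF g z] by simp
    then show "hz x z id * aba z = (\<Sum>g\<in>Sn n. x g * (aba z * bC (inv z \<circ> inv g)))"
      unfolding hz_def sum_distrib_right by (intro sum.cong refl) (simp add: mult_ac)
  qed
  also have "\<dots> = (\<Sum>g\<in>Sn n. \<Sum>z\<in>Sn n. x g * (aba z * bC (inv z \<circ> inv g)))" by (rule sum.swap)
  also have "\<dots> = gm n x (gm n aba bC) id"
    unfolding gm_id by (intro sum.cong refl) (simp add: gm_def Sn_inv sum_distrib_left)
  finally show ?thesis using gm_csym_id[OF x] by simp
qed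

text \<open>If some partial sum of the content of f exceeds that of p, then by
  \<open>transversal_dominance\<close> no f \<circ> u is injective on every column, and every
  \<open>hz x z u\<close> vanishes by \<open>alternating_vanish\<close>.\<close>

lemma BF_csym_vanish:
  assumes x: "\<And>\<pi> g. \<pi> \<in> Yg {0..<n} f \<Longrightarrow> g \<in> Sn n \<Longrightarrow> x (\<pi> \<circ> g) = x g"
    and d: "(\<Sum>i<N. p i) < (\<Sum>i<N. content {0..<n} f i)"
  shows "BF n x csym = 0"
proof -
  have "hz x z u = 0" if z: "z \<in> Sn n" and u: "u \<in> Sn n" for z u
  proof (cases "\<exists>a<n. \<exists>b<n. a \<noteq> b \<and> f (u a) = f (u b) \<and> cl a = cl b")
    case True
    then obtain a b where ab: "a < n" "b < n" "a \<noteq> b" "f (u a) = f (u b)" "cl a = cl b" by blast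
    show ?thesis
    proof (rule alternating_vanish[of n f "hz x z" cl u a b])
      fix \<pi> g assume "\<pi> \<in> Yg {0..<n} f" "g \<in> Sn n"
      then show "hz x z (\<pi> \<circ> g) = hz x z g" by (intro hz_left x)
    next
      fix g q assume "g \<in> Sn n" "q \<in> C"
      then show "hz x z (g \<circ> q) = sign q * hz x z g" by (intro hz_right z)
    qed (use u ab in auto)
  next
    case False
    then have "(\<Sum>i<N. content {0..<n} (f \<circ> u) i) \<le> (\<Sum>i<N. p i)"
      by (intro transversal_dominance) auto
    then show ?thesis using d content_permutes[of u "{0..<n}" f] u by (simp add: Sn_def)
  qed
  then show ?thesis unfolding BF_csym_hz by (intro sum.neutral ballI) (auto intro!: Sn_comp dest: Yg_Sn)
qed

lemma BF_csym_csym: "BF n csym csym = hk * hk"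
  using BF_csym_eq[of csym] csym_left by (simp add: hk_def)

lemma BF_aR_csym: "BF n aR csym = hk * int (card R)"
proof -
  have "BF n aR csym = hk * gm n aR csym id" by (rule BF_csym_eq) (rule yind_left)
  also have "gm n aR csym id = int (card R)" using gm_aR_left[of csym id] csym_left csym_id by simp
  finally show ?thesis .
qed

end

subsection \<open>Double cosets of Young subgroups\<close>

text \<open>Nonnegative integer matrices with row sums \<open>bs\<close> and column sums \<alpha>,
  stored as lists of rows: expanding the product of the h_b picks one monomial, a row, from each
  factor.\<close>

definition rowfam :: "nat list \<Rightarrow> mono \<Rightarrow> mono list set" where
  "rowfam bs \<alpha> = {gs. list_all2 (\<lambda>b \<gamma>. fin_mono \<gamma> \<and> deg \<gamma> = b) bs gs \<and> sum_list gs = \<alpha>}"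

lemma rowfam_Cons:
  assumes "fin_mono \<alpha>"
  shows "rowfam (b # bs) \<alpha> = (\<Union>\<gamma>\<in>{\<gamma>. \<gamma> \<le> \<alpha> \<and> deg \<gamma> = b}. (#) \<gamma> ` rowfam bs (\<alpha> - \<gamma>))"
proof (intro equalityI subsetI)
  fix gs assume "gs \<in> rowfam (b # bs) \<alpha>"
  then obtain \<gamma> hs where g: "gs = \<gamma> # hs" "fin_mono \<gamma>" "deg \<gamma> = b"
    "list_all2 (\<lambda>b \<gamma>. fin_mono \<gamma> \<and> deg \<gamma> = b) bs hs" "\<gamma> + sum_list hs = \<alpha>"
    by (auto simp: rowfam_def list_all2_Cons1)
  have "\<gamma> \<le> \<alpha>" "\<alpha> - \<gamma> = sum_list hs" using g(5) by (auto simp: le_fun_def mono_sum_diff)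
  then show "gs \<in> (\<Union>\<gamma>\<in>{\<gamma>. \<gamma> \<le> \<alpha> \<and> deg \<gamma> = b}. (#) \<gamma> ` rowfam bs (\<alpha> - \<gamma>))"
    using g by (auto simp: rowfam_def)
next
  fix gs assume "gs \<in> (\<Union>\<gamma>\<in>{\<gamma>. \<gamma> \<le> \<alpha> \<and> deg \<gamma> = b}. (#) \<gamma> ` rowfam bs (\<alpha> - \<gamma>))"
  then obtain \<gamma> hs where g: "gs = \<gamma> # hs" "\<gamma> \<le> \<alpha>" "deg \<gamma> = b" "hs \<in> rowfam bs (\<alpha> - \<gamma>)" by auto
  have "\<gamma> + sum_list hs = \<alpha>" using g(2,4) mono_add_diff by (simp add: rowfam_def)
  then show "gs \<in> rowfam (b # bs) \<alpha>" using g fin_mono_le[OF assms g(2)] by (simp add: rowfam_def)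
qed

lemma cf_hl_rowfam: "fin_mono \<alpha> \<Longrightarrow> finite (rowfam bs \<alpha>) \<and> cf (hl bs) \<alpha> = int (card (rowfam bs \<alpha>))"
proof (induction bs arbitrary: \<alpha>)
  case Nil
  have "rowfam [] \<alpha> = (if \<alpha> = 0 then {[]} else {})" by (auto simp: rowfam_def)
  then show ?case by (simp add: hl_def cf_1)
next
  case (Cons b bs)
  note f = Cons.prems
  let ?S = "{\<gamma>. \<gamma> \<le> \<alpha> \<and> deg \<gamma> = b}"
  have S: "finite ?S" by (rule finite_subset[OF _ finite_mono_le[OF f]]) auto
  have IH: "finite (rowfam bs (\<alpha> - \<gamma>))" "cf (hl bs) (\<alpha> - \<gamma>) = int (card (rowfam bs (\<alpha> - \<gamma>)))" for \<gamma>
    using Cons.IH[OF fin_mono_diff[OF f, of \<gamma>]] by blast+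
  have "cf (hl (b # bs)) \<alpha> = (\<Sum>\<beta>\<in>{\<beta>. \<beta> \<le> \<alpha>}. if deg \<beta> = b then int (card (rowfam bs (\<alpha> - \<beta>))) else 0)"
    unfolding hl_def list.map prod_list.Cons cf_mult[OF f]
    by (rule sum.cong) (auto simp: cf_hh fin_mono_le[OF f] IH(2)[unfolded hl_def])
  also have "\<dots> = (\<Sum>\<beta>\<in>?S. int (card (rowfam bs (\<alpha> - \<beta>))))"
    using finite_mono_le[OF f] by (simp add: sum.If_cases Int_def)
  also have "\<dots> = int (\<Sum>\<beta>\<in>?S. card ((#) \<beta> ` rowfam bs (\<alpha> - \<beta>)))"
    by (simp add: card_image)
  also have "(\<Sum>\<beta>\<in>?S. card ((#) \<beta> ` rowfam bs (\<alpha> - \<beta>))) = card (rowfam (b # bs) \<alpha>)"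
    unfolding rowfam_Cons[OF f] by (rule card_UN_disjoint[symmetric]) (use S IH in auto)
  finally have "cf (hl (b # bs)) \<alpha> = int (card (rowfam (b # bs) \<alpha>))" .
  moreover have "finite (rowfam (b # bs) \<alpha>)" unfolding rowfam_Cons[OF f] using S IH by auto
  ultimately show ?case by simp
qed

lemma sum_list_fun_apply: "(sum_list gs :: mono) y = (\<Sum>j<length gs. (gs ! j) y)"
proof (induction gs)
  case (Cons g gs)
  then show ?case by (simp add: sum.lessThan_Suc_shift del: sum.lessThan_Suc)
qed simp

text \<open>The table of f and g is a nonnegative matrix whose row sums are the block sizes of f and
  whose column sums are the content of g. By \<open>ty_realize\<close> all such matrices occur, and
  they are what the coefficient of \<open>hl bs\<close> counts.\<close>

lemma card_ty_content:
  assumes X: "finite X" and f: "content X f = pf bs" and \<alpha>: "fin_mono \<alpha>"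
  shows "int (card (ty X f ` {g \<in> extensional X. content X g = \<alpha>})) = cf (hl bs) \<alpha>"
proof -
  let ?W = "{g \<in> extensional X. content X g = \<alpha>}" and ?n = "length bs"
  define \<Theta> where "\<Theta> Z = map (\<lambda>j y. Z (j, y)) [0..<?n]" for Z :: "nat \<times> nat \<Rightarrow> nat"
  have f_lt: "f x < ?n" if "x \<in> X" for x
  proof (rule ccontr)
    assume "\<not> f x < ?n"
    then have "card {x' \<in> X. f x' = f x} = 0" using f by (auto simp: content_def pf_def fun_eq_iff)
    then show False using X that by auto
  qed
  let ?A = "{y. \<alpha> y \<noteq> 0}"
  have A: "finite ?A" using \<alpha> by (simp add: fin_mono_def)
  have gA: "g x \<in> ?A" if "x \<in> X" "content X g = \<alpha>" for g x
  proof -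
    have "x \<in> {x' \<in> X. g x' = g x}" using that by simp
    then have "card {x' \<in> X. g x' = g x} > 0" unfolding card_gt_0_iff using X by auto
    then show ?thesis using that(2) by (auto simp: content_def)
  qed
  have "inj_on \<Theta> (ty X f ` ?W)"
  proof (rule inj_onI)
    fix Z Z' assume Z: "Z \<in> ty X f ` ?W" "Z' \<in> ty X f ` ?W" "\<Theta> Z = \<Theta> Z'"
    have z: "U (j, y) = 0" if "U \<in> ty X f ` ?W" "\<not> j < ?n" for U j y
    proof -
      from that(1) obtain g where g: "U = ty X f g" by blast
      have "{x \<in> X. (f x, g x) = (j, y)} = {}" using that(2) f_lt by auto
      then show ?thesis by (simp only: g ty_def content_def card.empty)
    qed
    have "Z (j, y) = Z' (j, y)" for j y
    proof (cases "j < ?n")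
      case True
      then have "(\<Theta> Z ! j) y = (\<Theta> Z' ! j) y" using Z(3) by simp
      then show ?thesis using True by (simp add: \<Theta>_def)
    qed (use z[OF Z(1)] z[OF Z(2)] in simp)
    then show "Z = Z'" by (auto simp: fun_eq_iff)
  qed
  moreover have "\<Theta> ` (ty X f ` ?W) = rowfam bs \<alpha>"
  proof (intro equalityI subsetI)
    fix gs assume "gs \<in> \<Theta> ` (ty X f ` ?W)"
    then obtain g where g: "g \<in> extensional X" "content X g = \<alpha>" "gs = \<Theta> (ty X f g)" by auto
    have row: "fin_mono (\<lambda>y. ty X f g (j, y)) \<and> deg (\<lambda>y. ty X f g (j, y)) = bs ! j" if j: "j < ?n" for j
    proof -
      have s: "{y. ty X f g (j, y) \<noteq> 0} \<subseteq> ?A"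
      proof
        fix y assume "y \<in> {y. ty X f g (j, y) \<noteq> 0}"
        then have "card {x \<in> X. (f x, g x) = (j, y)} \<noteq> 0" by (simp only: ty_def content_def mem_Collect_eq) simp
        then have "{x \<in> X. (f x, g x) = (j, y)} \<noteq> {}" by (intro notI) (simp only: card.empty)
        then obtain x where "x \<in> X" "g x = y" by blast
        then show "y \<in> ?A" using gA[OF _ g(2)] by blast
      qed
      have "deg (\<lambda>y. ty X f g (j, y)) = (\<Sum>y\<in>?A. ty X f g (j, y))" by (rule deg_eq_sum[OF A s])
      also have "\<dots> = content X f j" by (rule ty_row_sum[OF X A]) (rule gA[OF _ g(2)])
      finally show ?thesis using j f finite_subset[OF s A] by (simp add: pf_def fin_mono_def)
    qed
    have "sum_list gs y = \<alpha> y" for y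
    proof -
      have "sum_list gs y = (\<Sum>j<?n. ty X f g (j, y))"
        unfolding sum_list_fun_apply g(3) \<Theta>_def by simp
      also have "\<dots> = \<alpha> y" unfolding g(2)[symmetric] by (rule ty_col_sum[OF X]) (use f_lt in auto)
      finally show ?thesis .
    qed
    then have "sum_list gs = \<alpha>" by (rule ext)
    then show "gs \<in> rowfam bs \<alpha>" using row
      by (simp add: rowfam_def g(3) \<Theta>_def list_all2_conv_all_nth)
  next
    fix gs assume gs: "gs \<in> rowfam bs \<alpha>"
    then have l: "length gs = ?n" and r: "\<And>j. j < ?n \<Longrightarrow> fin_mono (gs ! j) \<and> deg (gs ! j) = bs ! j"
      and s: "sum_list gs = \<alpha>" by (auto simp: rowfam_def list_all2_conv_all_nth)
    define Z where "Z = (\<lambda>(j, y). if j < ?n then (gs ! j) y else 0)"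
    have col: "(\<Sum>j<?n. (gs ! j) y) = \<alpha> y" for y using sum_list_fun_apply[of gs y] l s by simp
    have Z0: "Z (j, y) = 0" if "y \<notin> ?A" for j y
    proof (cases "j < ?n")
      case True
      then have "(gs ! j) y \<le> (\<Sum>j<?n. (gs ! j) y)" by (intro member_le_sum) auto
      then show ?thesis using that col by (simp add: Z_def)
    qed (simp add: Z_def)
    have Zs: "(\<Sum>y\<in>?A. Z (j, y)) = content X f j" for j
    proof (cases "j < ?n")
      case True
      have "deg (gs ! j) = (\<Sum>y\<in>?A. (gs ! j) y)"
      proof (rule deg_eq_sum[OF A], rule subsetI)
        fix y assume "y \<in> {y. (gs ! j) y \<noteq> 0}"
        then have "Z (j, y) \<noteq> 0" using True by (simp add: Z_def)
        then show "y \<in> ?A" using Z0[where y=y and j=j] by auto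
      qed
      then show ?thesis using r True f by (simp add: Z_def pf_def)
    qed (simp add: Z_def f pf_def)
    obtain g where g: "g \<in> X \<rightarrow>\<^sub>E ?A" "ty X f g = Z" using ty_realize[OF X A Z0 Zs] by blast
    have "content X g y = \<alpha> y" for y
    proof -
      have "content X g y = (\<Sum>j<?n. ty X f g (j, y))" by (rule ty_col_sum[OF X, symmetric]) (use f_lt in auto)
      then show ?thesis using col by (simp add: g(2) Z_def)
    qed
    then have "g \<in> ?W" using g(1) by (auto simp: PiE_def)
    moreover have "\<Theta> Z = gs" using l by (intro nth_equalityI) (auto simp: \<Theta>_def Z_def)
    ultimately show "gs \<in> \<Theta> ` (ty X f ` ?W)" using g(2) by blast
  qed
  ultimately have "card (ty X f ` ?W) = card (rowfam bs \<alpha>)" using card_image by fastforce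
  then show ?thesis using cf_hl_rowfam[OF \<alpha>] by simp
qed

text \<open>Up to the orders of the two subgroups the pairing counts their double cosets: the sum
  over z runs through the labellings with the content of f', and Burnside's lemma counts their
  orbits under the Young subgroup of f.\<close>

lemma BF_yind_yind:
  fixes f f' :: "nat \<Rightarrow> nat"
  assumes f: "content {0..<n} f = pf bs"
  shows "BF n (yind n f) (yind n f') = int (card (Yg {0..<n} f)) * int (card (Yg {0..<n} f')) * cf (hl bs) (content {0..<n} f')"
proof -
  let ?X = "{0..<n}" and ?Y = "Yg {0..<n} f" and ?Y' = "Yg {0..<n} f'"
  let ?\<alpha> = "content ?X f'"
  let ?W = "{g \<in> extensional ?X. content ?X g = ?\<alpha>}"
  have X: "finite ?X" by simp
  have fa: "fin_mono ?\<alpha>" by (rule fin_mono_content) simp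
  define G where "G z = restrict (f' \<circ> inv z) ?X" for z
  have GW: "G z \<in> ?W" if "z \<in> Sn n" for z
  proof -
    have "content ?X (G z) = content ?X (f' \<circ> inv z)" by (auto simp: G_def content_def intro!: ext arg_cong[where f=card])
    also have "\<dots> = ?\<alpha>" by (rule content_permutes) (use Sn_inv[OF that] in \<open>simp add: Sn_def\<close>)
    finally show ?thesis by (simp add: G_def)
  qed
  have W: "finite ?W"
  proof (rule finite_subset)
    show "?W \<subseteq> ?X \<rightarrow>\<^sub>E {y. ?\<alpha> y \<noteq> 0}"
    proof
      fix g assume g: "g \<in> ?W"
      have "?\<alpha> (g x) \<noteq> 0" if "x \<in> ?X" for x
      proof -
        have "x \<in> {x' \<in> ?X. g x' = g x}" using that by simp
        then have "card {x' \<in> ?X. g x' = g x} > 0" unfolding card_gt_0_iff using X by auto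
        then have "content ?X g (g x) \<noteq> 0" by (simp only: content_def)
        then show ?thesis using g by simp
      qed
      then show "g \<in> ?X \<rightarrow>\<^sub>E {y. ?\<alpha> y \<noteq> 0}" using g by (auto simp: PiE_def)
    qed
    show "finite (?X \<rightarrow>\<^sub>E {y. ?\<alpha> y \<noteq> 0})" using fa by (intro finite_PiE) (auto simp: fin_mono_def)
  qed
  \<comment> \<open>If w carries f' to g, then G z = g means that w \<circ> z lies in Y', so the
    fibres of G are cosets of Y'.\<close>
  have fib: "card {z \<in> Sn n. G z = g} = card ?Y'" if g: "g \<in> ?W" for g
  proof -
    obtain w where w: "w permutes ?X" "\<forall>x\<in>?X. g x = f' (w x)"
      using content_eq_imp_permutes[OF X, of g f'] g by auto
    have wS: "w \<in> Sn n" using w by (simp add: Sn_def)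
    have eq: "G z = g \<longleftrightarrow> w \<circ> z \<in> ?Y'" if z: "z \<in> Sn n" for z
    proof
      assume G: "G z = g"
      have "f' (w (z x)) = f' x" if "x < n" for x
      proof -
        have zx: "z x < n" using that Sn_apply[OF z] by simp
        then have "f' (w (z x)) = G z (z x)" using w(2) G by auto
        then show ?thesis using zx Sn_inv_apply(2)[OF z] by (simp add: G_def)
      qed
      then show "w \<circ> z \<in> ?Y'" using Sn_comp[OF wS z] by (simp add: Yg_def Sn_def)
    next
      assume Y: "w \<circ> z \<in> ?Y'"
      show "G z = g"
      proof
        fix x show "G z x = g x"
        proof (cases "x < n")
          case True
          then have "inv z x < n" using Sn_apply[OF Sn_inv[OF z]] by simp
          then have "f' ((w \<circ> z) (inv z x)) = f' (inv z x)" using Y by (simp add: Yg_def)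
          then show ?thesis using True w(2) Sn_inv_apply(1)[OF z] by (simp add: G_def)
        qed (use g in \<open>simp add: G_def extensional_def\<close>)
      qed
    qed
    have "bij_betw (\<lambda>z. w \<circ> z) {z \<in> Sn n. G z = g} ?Y'"
    proof (rule bij_betw_byWitness[where f'="\<lambda>z. inv w \<circ> z"]; (intro ballI image_subsetI)?)
      fix y assume y: "y \<in> ?Y'"
      have s: "inv w \<circ> y \<in> Sn n" using Sn_comp[OF Sn_inv[OF wS] Yg_Sn[OF y]] .
      then show "inv w \<circ> y \<in> {z \<in> Sn n. G z = g}" using eq[OF s, unfolded Sn_simps(5)[OF wS]] y s by blast
    next
      fix z assume "z \<in> {z \<in> Sn n. G z = g}"
      then show "w \<circ> z \<in> ?Y'" using eq by auto
    qed (simp_all add: Sn_simps[OF wS])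
    then show ?thesis by (rule bij_betw_same_card)
  qed
  \<comment> \<open>Conjugating g by z moves it into Y' precisely when g fixes the labelling f'
    \<circ> z^-1, so the inner sum counts a stabiliser.\<close>
  have inn: "(\<Sum>g\<in>Sn n. yind n f g * yind n f' (inv z \<circ> g \<circ> z)) = int (card {\<sigma> \<in> ?Y. G z \<circ> \<sigma> = G z})" if z: "z \<in> Sn n" for z
  proof -
    have eq: "inv z \<circ> g \<circ> z \<in> ?Y' \<longleftrightarrow> G z \<circ> g = G z" if g: "g \<in> Sn n" for g
    proof
      assume Y: "inv z \<circ> g \<circ> z \<in> ?Y'"
      show "G z \<circ> g = G z"
      proof
        fix x show "(G z \<circ> g) x = G z x"
        proof (cases "x < n")
          case True
          then have "inv z x < n" using Sn_apply[OF Sn_inv[OF z]] by simp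
          then have "f' ((inv z \<circ> g \<circ> z) (inv z x)) = f' (inv z x)" using Y by (simp add: Yg_def)
          then show ?thesis using True Sn_apply[OF g] Sn_inv_apply(1)[OF z] by (simp add: G_def)
        next
          case False
          then show ?thesis using Sn_apply[OF g, of x] by (simp add: G_def)
        qed
      qed
    next
      assume G: "G z \<circ> g = G z"
      have "f' (inv z (g (z x))) = f' x" if "x < n" for x
      proof -
        have zx: "z x < n" "g (z x) < n" using that Sn_apply[OF z] Sn_apply[OF g] by auto
        have "G z (g (z x)) = G z (z x)" using G by (metis comp_apply)
        then show ?thesis using zx Sn_inv_apply(2)[OF z] by (simp add: G_def)
      qed
      then show "inv z \<circ> g \<circ> z \<in> ?Y'" using Sn_comp[OF Sn_comp[OF Sn_inv[OF z] g] z] by (simp add: Yg_def Sn_def)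
    qed
    have "(\<Sum>g\<in>Sn n. yind n f g * yind n f' (inv z \<circ> g \<circ> z)) = (\<Sum>g\<in>Sn n. if g \<in> ?Y then (if G z \<circ> g = G z then 1 else 0) else 0)"
      by (intro sum.cong refl) (simp add: yind_def eq)
    also have "\<dots> = (\<Sum>g\<in>?Y. if G z \<circ> g = G z then 1 else 0)" by (rule sum_Sn_Yg)
    also have "\<dots> = int (card {\<sigma> \<in> ?Y. G z \<circ> \<sigma> = G z})"
      by (simp add: sum.If_cases Int_def)
    finally show ?thesis .
  qed
  have "BF n (yind n f) (yind n f') = (\<Sum>z\<in>Sn n. int (card {\<sigma> \<in> ?Y. G z \<circ> \<sigma> = G z}))"
    unfolding BF_def by (intro sum.cong refl inn)
  also have "\<dots> = (\<Sum>g\<in>?W. \<Sum>z\<in>{z \<in> Sn n. G z = g}. int (card {\<sigma> \<in> ?Y. G z \<circ> \<sigma> = G z}))"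
    by (rule sum.group[symmetric]) (use W GW in auto)
  also have "\<dots> = (\<Sum>g\<in>?W. int (card ?Y') * int (card {\<sigma> \<in> ?Y. g \<circ> \<sigma> = g}))"
    by (rule sum.cong[OF refl]) (simp add: fib)
  also have "\<dots> = int (card ?Y') * int (\<Sum>g\<in>?W. card {\<sigma> \<in> ?Y. g \<circ> \<sigma> = id g})"
    by (simp add: sum_distrib_left)
  also have "(\<Sum>g\<in>?W. card {\<sigma> \<in> ?Y. g \<circ> \<sigma> = id g}) = card ?Y * card (ty ?X f ` {g \<in> ?W. ty ?X f (id g) = ty ?X f g})"
  proof (rule twisted_orbit_count[OF X W])
    fix g \<sigma> assume g: "g \<in> ?W" and s: "\<sigma> \<in> ?Y"
    have "g \<circ> \<sigma> \<in> extensional ?X" using g permutes_not_in[OF Yg_permutes[OF s]] by (simp add: extensional_def)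
    then show "g \<circ> \<sigma> \<in> ?W" using g content_permutes[OF Yg_permutes[OF s], of g] by simp
  qed auto
  also have "{g \<in> ?W. ty ?X f (id g) = ty ?X f g} = ?W" by simp
  finally show ?thesis using card_ty_content[OF X f fa] by (simp add: mult_ac)
qed

lemma Yg_nonempty: "Yg X f \<noteq> {}"
  using Yg_id by blast

subsection \<open>The row-by-row tableau of a partition\<close>

lemma pf_cells: "cells la = dg (pf la)"
  by (auto simp: cells_def dg_def pf_def split: if_splits)

lemma sum_list_take_Suc: "i < length la \<Longrightarrow> sum_list (take (Suc i) la) = sum_list (take i la) + la ! i"
  by (simp add: take_Suc_conv_app_nth)

lemma sum_list_take_mono: "i \<le> j \<Longrightarrow> sum_list (take i la) \<le> sum_list (take j (la::nat list))"
proof -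
  assume "i \<le> j"
  then have "take j la = take i la @ take (j - i) (drop i la)" by (metis le_add_diff_inverse take_add)
  then show ?thesis by simp
qed

lemma pos_bound:
  assumes "c \<in> cells la"
  shows "sum_list (take (fst c) la) \<le> pos la c" "pos la c < sum_list (take (Suc (fst c)) la)"
  using assms by (auto simp: pos_def cells_def sum_list_take_Suc)

lemma pos_bij: "bij_betw (pos la) (cells la) {0..<sum_list la}"
proof -
  have less: "pos la c < pos la d" if "c \<in> cells la" "d \<in> cells la" "fst c < fst d" for c d
    using pos_bound(2)[OF that(1)] pos_bound(1)[OF that(2)] sum_list_take_mono[of "Suc (fst c)" "fst d" la] that(3)
    by linarith
  have inj: "inj_on (pos la) (cells la)"
  proof (rule inj_onI)
    fix c d assume cd: "c \<in> cells la" "d \<in> cells la" "pos la c = pos la d"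
    then have "fst c = fst d" using less[of c d] less[of d c] by (metis less_irrefl linorder_neqE_nat)
    then show "c = d" using cd(3) by (simp add: pos_def prod_eq_iff)
  qed
  have "pos la ` cells la \<subseteq> {0..<sum_list la}"
  proof
    fix x assume "x \<in> pos la ` cells la"
    then obtain c where c: "c \<in> cells la" "x = pos la c" by auto
    have "sum_list (take (Suc (fst c)) la) \<le> sum_list (take (length la) la)"
      by (rule sum_list_take_mono) (use c(1) in \<open>auto simp: cells_def\<close>)
    then show "x \<in> {0..<sum_list la}" using pos_bound(2)[OF c(1)] c(2) by simp
  qed
  moreover have "card (pos la ` cells la) = card {0..<sum_list la}"
    using card_image[OF inj] card_dg[of "pf la"] by (simp add: pf_cells deg_pf)
  ultimately have "pos la ` cells la = {0..<sum_list la}" by (intro card_subset_eq) auto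
  then show ?thesis using inj by (simp add: bij_betw_def)
qed

definition rowof :: "nat list \<Rightarrow> nat \<Rightarrow> nat" where
  "rowof la x = fst (inv_into (cells la) (pos la) x)"

definition colof :: "nat list \<Rightarrow> nat \<Rightarrow> nat" where
  "colof la x = snd (inv_into (cells la) (pos la) x)"

lemma rowof_pos: "c \<in> cells la \<Longrightarrow> rowof la (pos la c) = fst c"
  and colof_pos: "c \<in> cells la \<Longrightarrow> colof la (pos la c) = snd c"
  using pos_bij[of la] by (auto simp: rowof_def colof_def bij_betw_def)

lemma pos_cases:
  assumes "x < sum_list la"
  obtains c where "c \<in> cells la" "x = pos la c"
proof -
  have "x \<in> pos la ` cells la" using pos_bij[of la] assms by (auto simp: bij_betw_def)
  then show ?thesis using that by blast
qed

lemma is_pf_pf: "is_partition la \<Longrightarrow> is_pf (pf la)"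
  unfolding is_partition_def is_pf_def
  by (intro conjI fin_mono_pf) (auto simp: pf_def sorted_wrt_iff_nth_less)

lemma tableau_partition: "is_partition la \<Longrightarrow> tableau (sum_list la) (pf la) (rowof la) (colof la)"
proof
  show "is_partition la \<Longrightarrow> is_pf (pf la)" by (rule is_pf_pf)
  have "bij_betw (inv_into (cells la) (pos la)) {0..<sum_list la} (cells la)"
    by (rule bij_betw_inv_into[OF pos_bij])
  then show "bij_betw (\<lambda>x. (rowof la x, colof la x)) {0..<sum_list la} (dg (pf la))"
    by (simp add: rowof_def colof_def pf_cells)
qed

lemma row_grp_Yg: "row_grp la = Yg {0..<sum_list la} (rowof la)"
proof (intro equalityI subsetI)
  fix \<sigma> assume s: "\<sigma> \<in> row_grp la"
  have "rowof la (\<sigma> x) = rowof la x" if "x < sum_list la" for x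
  proof -
    obtain c where c: "c \<in> cells la" "x = pos la c" using pos_cases \<open>x < sum_list la\<close> by blast
    then obtain j where j: "(fst c, j) \<in> cells la" "\<sigma> (pos la c) = pos la (fst c, j)"
      using s by (auto simp: row_grp_def)
    then show ?thesis using c rowof_pos by simp
  qed
  then show "\<sigma> \<in> Yg {0..<sum_list la} (rowof la)" using s by (simp add: row_grp_def Yg_def)
next
  fix \<sigma> assume s: "\<sigma> \<in> Yg {0..<sum_list la} (rowof la)"
  have "\<exists>j. (fst c, j) \<in> cells la \<and> \<sigma> (pos la c) = pos la (fst c, j)" if c: "c \<in> cells la" for c
  proof -
    have x: "pos la c < sum_list la" using pos_bij[of la] c by (auto simp: bij_betw_def)
    then have "\<sigma> (pos la c) < sum_list la" using s permutes_in_image[of \<sigma> "{0..<sum_list la}" "pos la c"] by (simp add: Yg_def)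
    then obtain d where d: "d \<in> cells la" "\<sigma> (pos la c) = pos la d" using pos_cases by blast
    have "rowof la (\<sigma> (pos la c)) = rowof la (pos la c)" using s x by (simp add: Yg_def)
    then have "fst d = fst c" using d c rowof_pos by simp
    then show ?thesis using d by (metis prod.collapse)
  qed
  then show "\<sigma> \<in> row_grp la" using s by (simp add: row_grp_def Yg_def)
qed

lemma col_grp_Yg: "col_grp la = Yg {0..<sum_list la} (colof la)"
proof (intro equalityI subsetI)
  fix \<sigma> assume s: "\<sigma> \<in> col_grp la"
  have "colof la (\<sigma> x) = colof la x" if "x < sum_list la" for x
  proof -
    obtain c where c: "c \<in> cells la" "x = pos la c" using pos_cases \<open>x < sum_list la\<close> by blast
    then obtain j where j: "(j, snd c) \<in> cells la" "\<sigma> (pos la c) = pos la (j, snd c)"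
      using s by (auto simp: col_grp_def)
    then show ?thesis using c colof_pos by simp
  qed
  then show "\<sigma> \<in> Yg {0..<sum_list la} (colof la)" using s by (simp add: col_grp_def Yg_def)
next
  fix \<sigma> assume s: "\<sigma> \<in> Yg {0..<sum_list la} (colof la)"
  have "\<exists>i. (i, snd c) \<in> cells la \<and> \<sigma> (pos la c) = pos la (i, snd c)" if c: "c \<in> cells la" for c
  proof -
    have x: "pos la c < sum_list la" using pos_bij[of la] c by (auto simp: bij_betw_def)
    then have "\<sigma> (pos la c) < sum_list la" using s permutes_in_image[of \<sigma> "{0..<sum_list la}" "pos la c"] by (simp add: Yg_def)
    then obtain d where d: "d \<in> cells la" "\<sigma> (pos la c) = pos la d" using pos_cases by blast
    have "colof la (\<sigma> (pos la c)) = colof la (pos la c)" using s x by (simp add: Yg_def)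
    then have "snd d = snd c" using d c colof_pos by simp
    then show ?thesis using d by (metis prod.collapse)
  qed
  then show "\<sigma> \<in> col_grp la" using s by (simp add: col_grp_def Yg_def)
qed

definition ysym :: "nat list \<Rightarrow> (nat \<Rightarrow> nat) \<Rightarrow> int" where
  "ysym la = tableau.csym (sum_list la) (rowof la) (colof la)"

definition hook :: "nat list \<Rightarrow> int" where
  "hook la = tableau.hk (sum_list la) (rowof la) (colof la)"

definition parts :: "nat \<Rightarrow> nat list set" where
  "parts n = {la. is_partition la \<and> sum_list la = n}"

lemma parts_tableau: "la \<in> parts n \<Longrightarrow> tableau n (pf la) (rowof la) (colof la)"
  using tableau_partition[of la] by (auto simp: parts_def)

lemma partition_list_exists: "is_pf p \<Longrightarrow> \<exists>la. is_partition la \<and> pf la = p"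
proof -
  assume p: "is_pf p"
  obtain N where N: "\<forall>i\<ge>N. p i = 0" using fin_mono_bound[of p] p unfolding is_pf_def by blast
  define m where "m = (LEAST i. p i = 0)"
  have pm: "p m = 0" unfolding m_def by (rule LeastI[of _ N]) (use N in simp)
  have nz: "p i \<noteq> 0" if "i < m" for i using not_less_Least[of i "\<lambda>i. p i = 0"] that by (simp add: m_def)
  have z: "p i = 0" if "\<not> i < m" for i using pf_antimono[OF p, of m i] pm that by simp
  let ?la = "map p [0..<m]"
  have "pf ?la = p" using z by (auto simp: pf_def fun_eq_iff)
  moreover have "is_partition ?la"
    unfolding is_partition_def
  proof
    show "sorted_wrt (\<ge>) ?la" unfolding sorted_wrt_iff_nth_less using pf_antimono[OF p] by auto
    show "0 \<notin> set ?la" using nz by fastforce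
  qed
  ultimately show ?thesis by blast
qed

lemma pf_inj_partition:
  assumes "is_partition la" "is_partition mu" "pf la = pf mu"
  shows "la = mu"
proof -
  have nz: "pf la i \<noteq> 0 \<longleftrightarrow> i < length la" if "is_partition la" for la i
  proof -
    have "la ! i \<noteq> 0" if "i < length la" using \<open>is_partition la\<close> that unfolding is_partition_def by (metis nth_mem)
    then show ?thesis by (auto simp: pf_def)
  qed
  have "i < length la \<longleftrightarrow> i < length mu" for i using nz assms by metis
  then have l: "length la = length mu" by (metis less_irrefl linorder_neqE_nat)
  show ?thesis
  proof (rule nth_equalityI[OF l])
    fix i assume i: "i < length la"
    have "pf la i = pf mu i" using assms(3) by simp
    then show "la ! i = mu ! i" using i l by (simp add: pf_def)
  qed
qed

lemma bij_pf_parts: "bij_betw pf (parts n) (pfs n)"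
  unfolding bij_betw_def
proof
  show "inj_on pf (parts n)" using pf_inj_partition by (auto simp: inj_on_def parts_def)
  show "pf ` parts n = pfs n"
  proof (intro equalityI subsetI)
    fix p assume "p \<in> pfs n"
    then have p: "is_pf p" "deg p = n" by (auto simp: pfs_def)
    obtain la where la: "is_partition la" "pf la = p" using partition_list_exists[OF p(1)] by blast
    then have "la \<in> parts n" using p(2) deg_pf[of la] by (simp add: parts_def)
    then show "p \<in> pf ` parts n" using la by blast
  qed (auto simp: parts_def pfs_def is_pf_pf deg_pf)
qed

lemma finite_parts: "finite (parts n)"
  using bij_betw_finite[OF bij_pf_parts] finite_pfs by blast

lemma cf_hl_parts:
  assumes "fin_mono \<alpha>" "sum_list bs = n"
  shows "cf (hl bs) \<alpha> = (\<Sum>la\<in>parts n. int (kost (pf la) (pf bs)) * int (kost (pf la) \<alpha>))"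
proof -
  have "cf (hl bs) \<alpha> = (\<Sum>p\<in>pfs n. int (kost p (pf bs)) * int (kost p \<alpha>))"
    by (simp add: hl_kost cf_of_nat_mult cf_ss[OF assms(1)] assms(2))
  also have "\<dots> = (\<Sum>la\<in>parts n. int (kost (pf la) (pf bs)) * int (kost (pf la) \<alpha>))"
    by (rule sum.reindex_bij_betw[OF bij_pf_parts, symmetric])
  finally show ?thesis .
qed

subsection \<open>Young's rule\<close>

text \<open>With the denominators chosen here the \<open>chat\<close> become orthonormal for
  \<open>BF\<close>, and the coordinates of \<open>eps\<close> along them turn out to be Kostka
  numbers. Real values are taken because definiteness of the form is used.\<close>

definition eps :: "nat \<Rightarrow> (nat \<Rightarrow> nat) \<Rightarrow> (nat \<Rightarrow> nat) \<Rightarrow> real" where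
  "eps n f = (\<lambda>\<sigma>. (1 / real (card (Yg {0..<n} f))) * of_int (yind n f \<sigma>))"

definition chat :: "nat list \<Rightarrow> (nat \<Rightarrow> nat) \<Rightarrow> real" where
  "chat la = (\<lambda>\<sigma>. (1 / of_int (hook la)) * of_int (ysym la \<sigma>))"

lemma hook_pos: "la \<in> parts n \<Longrightarrow> hook la > 0"
  using tableau.hk_pos[OF parts_tableau] by (auto simp: hook_def parts_def)

text \<open>Of two distinct partitions at least one is not dominated by the other;
  \<open>BF_csym_vanish\<close> applies in that direction, and symmetry of the form covers both
  cases.\<close>

lemma BF_chat_chat:
  assumes la: "la \<in> parts n" and mu: "mu \<in> parts n"
  shows "BF n (chat la) (chat mu) = (if la = mu then 1 else 0)"
proof -
  interpret L: tableau n "pf la" "rowof la" "colof la" using parts_tableau[OF la] .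
  interpret M: tableau n "pf mu" "rowof mu" "colof mu" using parts_tableau[OF mu] .
  have n: "sum_list la = n" "sum_list mu = n" using la mu by (auto simp: parts_def)
  have y: "ysym la = L.csym" "ysym mu = M.csym" "hook la = L.hk" "hook mu = M.hk"
    by (simp_all add: ysym_def hook_def n)
  have BFi: "BF n (chat la) (chat mu) = of_int (BF n L.csym M.csym) / (of_int L.hk * of_int M.hk)"
    unfolding chat_def BF_scale_left BF_scale_right BF_of_int y by simp
  show ?thesis
  proof (cases "la = mu")
    case True
    then show ?thesis using BFi L.BF_csym_csym L.hk_pos by (simp add: y[symmetric])
  next
    case False
    then have ne: "pf la \<noteq> pf mu" using pf_inj_partition la mu by (auto simp: parts_def)
    have "BF n L.csym M.csym = 0"
    proof (cases "\<exists>N. (\<Sum>i<N. pf mu i) < (\<Sum>i<N. pf la i)")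
      case True
      then obtain N where "(\<Sum>i<N. pf mu i) < (\<Sum>i<N. content {0..<n} (rowof la) i)"
        using L.content_rw by auto
      then show ?thesis by (intro M.BF_csym_vanish[where f="rowof la"] L.csym_left)
    next
      case F: False
      have "\<exists>N. (\<Sum>i<N. pf la i) < (\<Sum>i<N. pf mu i)"
      proof (rule ccontr)
        assume "\<not> ?thesis"
        then have eq: "(\<Sum>i<N. pf la i) = (\<Sum>i<N. pf mu i)" for N using F by (meson linorder_neqE_nat)
        have "pf la i = pf mu i" for i using eq[of i] eq[of "Suc i"] by simp
        then show False using ne by auto
      qed
      then obtain N where "(\<Sum>i<N. pf la i) < (\<Sum>i<N. content {0..<n} (rowof mu) i)"
        using M.content_rw by auto
      then have "BF n M.csym L.csym = 0" by (intro L.BF_csym_vanish[where f="rowof mu"] M.csym_left)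
      then show ?thesis by (simp add: BF_commute)
    qed
    then show ?thesis using BFi False by simp
  qed
qed

lemma BF_eps_chat_vanish:
  assumes la: "la \<in> parts n" and d: "(\<Sum>i<N. pf la i) < (\<Sum>i<N. content {0..<n} f i)"
  shows "BF n (eps n f) (chat la) = 0"
proof -
  interpret L: tableau n "pf la" "rowof la" "colof la" using parts_tableau[OF la] .
  have n: "sum_list la = n" using la by (auto simp: parts_def)
  have "BF n (yind n f) L.csym = 0" by (rule L.BF_csym_vanish[OF yind_left d])
  then show ?thesis unfolding eps_def chat_def BF_scale_left BF_scale_right BF_of_int
    by (simp add: ysym_def n)
qed

lemma BF_eps_chat_self:
  assumes la: "la \<in> parts n"
  shows "BF n (eps n (rowof la)) (chat la) = 1"
proof -
  interpret L: tableau n "pf la" "rowof la" "colof la" using parts_tableau[OF la] .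
  have n: "sum_list la = n" using la by (auto simp: parts_def)
  show ?thesis unfolding eps_def chat_def BF_scale_left BF_scale_right BF_of_int
    using L.BF_aR_csym L.hk_pos card_Yg_pos[of "{0..<n}" "rowof la"]
    by (simp add: ysym_def hook_def n Yg_nonempty)
qed

lemma content_list_exists: "\<exists>bs. content {0..<n} f = pf bs \<and> sum_list bs = n"
proof -
  have c: "fin_mono (content {0..<n} f)" "deg (content {0..<n} f) = n"
    using fin_mono_content[of "{0..<n}" f] deg_content[of "{0..<n}" f] by auto
  obtain N where N: "\<forall>i\<ge>N. content {0..<n} f i = 0" using fin_mono_bound[OF c(1)] by blast
  let ?bs = "map (content {0..<n} f) [0..<N]"
  have e: "pf ?bs = content {0..<n} f" using N by (auto simp: pf_def fun_eq_iff)
  then show ?thesis using c(2) deg_pf[of ?bs] by (intro exI[of _ ?bs]) simp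
qed

text \<open>Double coset numbers are coefficients of products of complete functions, which
  \<open>hl_kost\<close> expands: the Gram matrix of the \<open>eps\<close> is a product of the
  Kostka matrix with its transpose.\<close>

lemma BF_eps_eps:
  "BF n (eps n f) (eps n f') = (\<Sum>la\<in>parts n. real (kost (pf la) (content {0..<n} f)) * real (kost (pf la) (content {0..<n} f')))"
proof -
  obtain bs where bs: "content {0..<n} f = pf bs" "sum_list bs = n" using content_list_exists by blast
  have fa: "fin_mono (content {0..<n} f')" by (rule fin_mono_content) simp
  have "BF n (eps n f) (eps n f') = of_int (cf (hl bs) (content {0..<n} f'))"
    unfolding eps_def BF_scale_left BF_scale_right BF_of_int BF_yind_yind[OF bs(1)]
    by (simp add: Yg_nonempty)
  then show ?thesis unfolding cf_hl_parts[OF fa bs(2)] bs(1) by simp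
qed

text \<open>Pairing \<open>eps n f\<close> with \<open>eps n (rowof mu)\<close> in two ways gives a
  unitriangular system for the coordinates of \<open>eps n f\<close>, solved from the largest
  measure downwards. The upward closed set \<open>U\<close> restricts it to those mu whose own
  expansion is already known.\<close>

lemma kost_eq_BF:
  assumes U: "U \<subseteq> parts n" "\<And>mu la. mu \<in> U \<Longrightarrow> la \<in> parts n \<Longrightarrow> msr (pf mu) < msr (pf la) \<Longrightarrow> la \<in> U"
    and Z: "\<And>mu x. mu \<in> U \<Longrightarrow> BF n x (eps n (rowof mu)) = (\<Sum>la\<in>parts n. real (kost (pf la) (pf mu)) * BF n x (chat la))"
    and mu: "mu \<in> U"
  shows "BF n (eps n f) (chat mu) = real (kost (pf mu) (content {0..<n} f))"
proof -
  define B where "B = Max (msr ` pf ` parts n)"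
  have "mu \<in> U \<Longrightarrow> BF n (eps n f) (chat mu) = real (kost (pf mu) (content {0..<n} f))" for mu
  proof (induction "B - msr (pf mu)" arbitrary: mu rule: less_induct)
    case less
    have muP: "mu \<in> parts n" using less.prems U(1) by blast
    interpret M: tableau n "pf mu" "rowof mu" "colof mu" using parts_tableau[OF muP] .
    let ?K = "\<lambda>la. real (kost (pf la) (pf mu))" and ?k = "\<lambda>la. real (kost (pf la) (content {0..<n} f))"
    let ?b = "\<lambda>la. BF n (eps n f) (chat la)"
    have "(\<Sum>la\<in>parts n. ?K la * ?b la) = BF n (eps n f) (eps n (rowof mu))" using Z[OF less.prems] by simp
    also have "\<dots> = (\<Sum>la\<in>parts n. ?k la * ?K la)" unfolding BF_eps_eps M.content_rw ..
    finally have "(\<Sum>la\<in>parts n. ?K la * (?b la - ?k la)) = 0"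
      by (simp add: right_diff_distrib sum_subtractf mult.commute)
    moreover have z: "?K la * (?b la - ?k la) = 0" if la: "la \<in> parts n - {mu}" for la
    proof (cases "kost (pf la) (pf mu) = 0")
      case False
      have pne: "pf la \<noteq> pf mu" using pf_inj_partition la muP by (auto simp: parts_def)
      have m: "msr (pf mu) < msr (pf la)"
        using msr_less[OF _ _ False pne] la muP by (auto simp: parts_def is_pf_pf)
      have laU: "la \<in> U" using U(2)[OF less.prems _ m] la by blast
      have "msr (pf la) \<le> B" unfolding B_def using la finite_parts by (intro Max_ge) auto
      then have "?b la = ?k la" using m by (intro less.hyps laU) auto
      then show ?thesis by simp
    qed simp
    have "(\<Sum>la\<in>parts n. ?K la * (?b la - ?k la)) = ?K mu * (?b mu - ?k mu) + (\<Sum>la\<in>parts n - {mu}. ?K la * (?b la - ?k la))"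
      by (rule sum.remove[OF finite_parts muP])
    moreover have "(\<Sum>la\<in>parts n - {mu}. ?K la * (?b la - ?k la)) = 0"
      by (rule sum.neutral) (use z in blast)
    ultimately show ?case using kost_self[of "pf mu"] muP by (simp add: parts_def is_pf_pf)
  qed
  then show ?thesis using mu by blast
qed

text \<open>Equality in Bessel's inequality: the norm of \<open>eps n f\<close> equals the sum of
  the squares of its coordinates, so its difference from the projection has norm zero, and
  definiteness makes \<open>bar\<close> of it vanish.\<close>

lemma eps_decomposition:
  assumes "\<And>la. la \<in> parts n \<Longrightarrow> BF n (eps n f) (chat la) = real (kost (pf la) (content {0..<n} f))"
    and g: "g \<in> Sn n"
  shows "bar n (\<lambda>\<sigma>. eps n f \<sigma> - (\<Sum>la\<in>parts n. real (kost (pf la) (content {0..<n} f)) * chat la \<sigma>)) g = 0"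
proof (rule BF_self_zero_imp_bar[OF _ g])
  let ?k = "\<lambda>la. real (kost (pf la) (content {0..<n} f))"
  let ?S = "\<Sum>la\<in>parts n. ?k la * ?k la"
  have 1: "BF n (\<lambda>\<sigma>. \<Sum>la\<in>parts n. ?k la * chat la \<sigma>) (eps n f) = ?S"
    unfolding BF_sum_left BF_scale_left by (intro sum.cong refl) (simp add: BF_commute[of n _ "eps n f"] assms)
  have 2: "BF n (\<lambda>\<sigma>. \<Sum>la\<in>parts n. ?k la * chat la \<sigma>) (\<lambda>\<sigma>. \<Sum>la\<in>parts n. ?k la * chat la \<sigma>) = ?S"
  proof -
    have "BF n (chat la) (\<lambda>\<sigma>. \<Sum>mu\<in>parts n. ?k mu * chat mu \<sigma>) = ?k la" if la: "la \<in> parts n" for la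
    proof -
      have "BF n (chat la) (\<lambda>\<sigma>. \<Sum>mu\<in>parts n. ?k mu * chat mu \<sigma>) = (\<Sum>mu\<in>parts n. ?k mu * (if la = mu then 1 else 0))"
        unfolding BF_sum_right BF_scale_right by (intro sum.cong refl) (simp add: BF_chat_chat[OF la])
      also have "\<dots> = (\<Sum>mu\<in>parts n. if la = mu then ?k la else 0)" by (intro sum.cong) auto
      also have "\<dots> = ?k la" using la finite_parts by (simp add: sum.delta')
      finally show ?thesis .
    qed
    then show ?thesis unfolding BF_sum_left[of n "\<lambda>la \<sigma>. ?k la * chat la \<sigma>"] BF_scale_left by (intro sum.cong refl) simp
  qed
  have 3: "BF n (eps n f) (eps n f) = ?S" by (rule BF_eps_eps)
  show "BF n (\<lambda>\<sigma>. eps n f \<sigma> - (\<Sum>la\<in>parts n. ?k la * chat la \<sigma>)) (\<lambda>\<sigma>. eps n f \<sigma> - (\<Sum>la\<in>parts n. ?k la * chat la \<sigma>)) = 0"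
    unfolding BF_diff_left BF_diff_right 2 3 1 using 1 by (simp add: BF_commute[of n "eps n f"])
qed

lemma bar_zero_BF:
  assumes "\<And>g. g \<in> Sn n \<Longrightarrow> bar n (\<lambda>\<sigma>. eps n f \<sigma> - (\<Sum>la\<in>parts n. k la * chat la \<sigma>)) g = 0"
  shows "BF n x (eps n f) = (\<Sum>la\<in>parts n. k la * BF n x (chat la))"
proof -
  have "BF n x (\<lambda>\<sigma>. eps n f \<sigma> - (\<Sum>la\<in>parts n. k la * chat la \<sigma>)) = 0"
    unfolding BF_bar by (rule sum.neutral) (use assms in simp)
  then show ?thesis unfolding BF_diff_right BF_sum_right BF_scale_right by simp
qed

text \<open>Induction downwards on the measure of mu. The partitions of larger measure form the set
  \<open>U\<close> to which \<open>kost_eq_BF\<close> applies; at mu itself the coordinate is 1, and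
  at all others both the pairing and the Kostka number vanish.\<close>

lemma BF_eps_rowof:
  assumes "mu \<in> parts n"
  shows "BF n x (eps n (rowof mu)) = (\<Sum>la\<in>parts n. real (kost (pf la) (pf mu)) * BF n x (chat la))"
proof -
  define B where "B = Max (msr ` pf ` parts n)"
  have "mu \<in> parts n \<Longrightarrow> BF n x (eps n (rowof mu)) = (\<Sum>la\<in>parts n. real (kost (pf la) (pf mu)) * BF n x (chat la))" for mu x
  proof (induction "B - msr (pf mu)" arbitrary: mu x rule: less_induct)
    case less
    interpret M: tableau n "pf mu" "rowof mu" "colof mu" using parts_tableau[OF less.prems] .
    define U where "U = {la \<in> parts n. msr (pf mu) < msr (pf la)}"
    have ZU: "BF n x (eps n (rowof nu)) = (\<Sum>la\<in>parts n. real (kost (pf la) (pf nu)) * BF n x (chat la))" if "nu \<in> U" for nu x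
    proof (rule less.hyps)
      have "msr (pf nu) \<le> B" unfolding B_def using that finite_parts by (intro Max_ge) (auto simp: U_def)
      then show "B - msr (pf nu) < B - msr (pf mu)" "nu \<in> parts n" using that by (auto simp: U_def)
    qed
    have "BF n (eps n (rowof mu)) (chat la) = real (kost (pf la) (content {0..<n} (rowof mu)))" if la: "la \<in> parts n" for la
    proof (cases "la \<in> U")
      case True
      show ?thesis by (rule kost_eq_BF[OF _ _ ZU True]) (auto simp: U_def)
    next
      case False
      show ?thesis
      proof (cases "la = mu")
        case True
        then show ?thesis using BF_eps_chat_self[OF la] kost_self[OF M.pf] by (simp add: M.content_rw)
      next
        case ne: False
        then have pne: "pf la \<noteq> pf mu" using pf_inj_partition la less.prems by (auto simp: parts_def)
        have pl: "is_pf (pf la)" "deg (pf la) = n" using la by (auto simp: parts_def is_pf_pf deg_pf)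
        have nm: "\<not> msr (pf mu) < msr (pf la)" using False la by (simp add: U_def)
        have "\<not> (\<forall>N. (\<Sum>i<N. pf mu i) \<le> (\<Sum>i<N. pf la i))"
          using msr_less_dominance[OF pl(1) M.pf _ _ pne] nm pl(2) M.deg_p by auto
        then obtain N where "(\<Sum>i<N. pf la i) < (\<Sum>i<N. content {0..<n} (rowof mu) i)"
          using M.content_rw by (auto simp: not_le)
        then have "BF n (eps n (rowof mu)) (chat la) = 0" by (rule BF_eps_chat_vanish[OF la])
        moreover have "kost (pf la) (pf mu) = 0" using msr_less[OF pl(1) M.pf _ pne] nm by blast
        ultimately show ?thesis by (simp add: M.content_rw)
      qed
    qed
    from eps_decomposition[OF this] show ?case
      by (intro bar_zero_BF) (simp add: M.content_rw)
  qed
  then show ?thesis using assms by blast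
qed

text \<open>A class function sees only \<open>bar\<close>, so it may be paired with the expansion of
  \<open>eps\<close> in the \<open>chat\<close>. For the character of a representation the last
  factor is the trace of an idempotent, that is, the multiplicity of the Specht module.\<close>

theorem young_rule:
  fixes \<chi> :: "(nat \<Rightarrow> nat) \<Rightarrow> real"
  assumes \<chi>: "\<And>g w. g \<in> Sn n \<Longrightarrow> w \<in> Sn n \<Longrightarrow> \<chi> (w \<circ> g \<circ> inv w) = \<chi> g"
  shows "(\<Sum>\<sigma>\<in>Yg {0..<n} f. \<chi> \<sigma>) / real (card (Yg {0..<n} f))
    = (\<Sum>la\<in>parts n. real (kost (pf la) (content {0..<n} f)) * ((\<Sum>\<sigma>\<in>Sn n. of_int (ysym la \<sigma>) * \<chi> \<sigma>) / of_int (hook la)))"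
proof -
  let ?k = "\<lambda>la. real (kost (pf la) (content {0..<n} f))"
  let ?y = "\<lambda>\<sigma>. eps n f \<sigma> - (\<Sum>la\<in>parts n. ?k la * chat la \<sigma>)"
  have K: "BF n (eps n f) (chat la) = ?k la" if "la \<in> parts n" for la
    by (rule kost_eq_BF[OF _ _ BF_eps_rowof that]) auto
  have "(\<Sum>g\<in>Sn n. bar n ?y g * \<chi> g) = 0"
    by (rule sum.neutral) (use eps_decomposition[OF K] in simp)
  then have "(\<Sum>g\<in>Sn n. ?y g * \<chi> g) = 0"
    using sum_bar_class[of n \<chi> ?y, OF \<chi>] Yg_nonempty[of "{0..<n}" "\<lambda>_. ()"] by (simp add: Sn_Yg)
  then have "(\<Sum>g\<in>Sn n. eps n f g * \<chi> g) = (\<Sum>g\<in>Sn n. \<Sum>la\<in>parts n. ?k la * chat la g * \<chi> g)"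
    by (simp add: left_diff_distrib sum_subtractf sum_distrib_right)
  also have "\<dots> = (\<Sum>la\<in>parts n. \<Sum>g\<in>Sn n. ?k la * chat la g * \<chi> g)" by (rule sum.swap)
  also have "\<dots> = (\<Sum>la\<in>parts n. ?k la * ((\<Sum>\<sigma>\<in>Sn n. of_int (ysym la \<sigma>) * \<chi> \<sigma>) / of_int (hook la)))"
    by (intro sum.cong refl) (simp add: chat_def sum_distrib_left sum_divide_distrib mult.assoc)
  also have "(\<Sum>g\<in>Sn n. eps n f g * \<chi> g) = (\<Sum>g\<in>Sn n. if g \<in> Yg {0..<n} f then \<chi> g / real (card (Yg {0..<n} f)) else 0)"
    by (intro sum.cong refl) (simp add: eps_def yind_def)
  also have "\<dots> = (\<Sum>\<sigma>\<in>Yg {0..<n} f. \<chi> \<sigma>) / real (card (Yg {0..<n} f))"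
    by (simp add: sum_Sn_Yg sum_divide_distrib)
  finally show ?thesis .
qed

section \<open>Multiplicities as traces\<close>

lemma vector_space_fun: "vector_space (\<lambda>(c::complex) v (i::'x). c * v i)"
  by unfold_locales (simp_all add: fun_eq_iff distrib_left distrib_right mult.assoc)

lemma vector_space_fun2: "vector_space (\<lambda>(c::complex) f (x::'x) (y::'y). c * f x y)"
  by unfold_locales (simp_all add: fun_eq_iff distrib_left distrib_right mult.assoc)

lemma dim_linear_inj_image:
  assumes lf: "Vector_Spaces.linear s1 s2 f" and fi: "inj_on f S" and S: "module.subspace s1 S"
  shows "vector_space.dim s2 (f ` S) = vector_space.dim s1 S"
proof -
  interpret lf: Vector_Spaces.linear s1 s2 f by fact
  have sp: "lf.vs1.span S = S" using S by (simp add: lf.vs1.span_eq_iff)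
  obtain B where B: "B \<subseteq> S" "lf.vs1.independent B" "S \<subseteq> lf.vs1.span B" "card B = lf.vs1.dim S"
    using lf.vs1.basis_exists by blast
  have spB: "lf.vs1.span B = S"
    using B(3) lf.vs1.span_mono[OF B(1)] sp by auto
  have "lf.vs2.independent (f ` B)" using lf.dependent_inj_imageD[of B] B(2) fi spB by auto
  moreover have "lf.vs2.span (f ` B) = f ` S" using lf.span_image[of B] spB by simp
  ultimately have "lf.vs2.dim (f ` S) = card (f ` B)" by (metis lf.vs2.dim_span_eq_card_independent)
  also have "\<dots> = card B" by (rule card_image) (use fi B(1) in \<open>rule inj_on_subset\<close>)
  finally show ?thesis using B(4) by simp
qed

text \<open>Factor E through a basis B of its range, as synthesis after coordinate functionals
  \<open>r\<close>. Idempotence says that the functionals are dual to B, and the trace of a product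
  may be computed in either order.\<close>

lemma dim_range_idempotent:
  fixes E :: "('x \<Rightarrow> complex) \<Rightarrow> 'x \<Rightarrow> complex"
  assumes X: "finite X"
    and E: "\<And>v w. E v w = (if w \<in> X then \<Sum>w'\<in>X. M w w' * v w' else 0)"
    and idem: "\<And>v. E (E v) = E v"
  shows "of_nat (vector_space.dim (\<lambda>(c::complex) v (i::'x). c * v i) (range E)) = (\<Sum>w\<in>X. M w w)"
proof -
  interpret fv: vector_space "\<lambda>(c::complex) v (i::'x). c * v i" by (rule vector_space_fun)
  define \<delta> where "\<delta> x = (\<lambda>i. if i = x then 1 else (0::complex))" for x :: 'x
  have supp: "v \<in> fv.span (\<delta> ` X)" if "\<And>w. w \<notin> X \<Longrightarrow> v w = 0" for v
  proof -
    have "v = (\<Sum>x\<in>X. (\<lambda>i. v x * \<delta> x i))"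
    proof
      fix i
      have "(\<Sum>x\<in>X. (\<lambda>i. v x * \<delta> x i)) i = (\<Sum>x\<in>X. if i = x then v x else 0)"
        unfolding sum_fun_apply by (intro sum.cong refl) (simp add: \<delta>_def)
      also have "\<dots> = v i" using X that by (simp add: sum.delta)
      finally show "v i = (\<Sum>x\<in>X. (\<lambda>i. v x * \<delta> x i)) i" by simp
    qed
    also have "\<dots> \<in> fv.span (\<delta> ` X)"
      by (intro fv.span_sum fv.span_scale fv.span_base imageI)
    finally show ?thesis .
  qed
  obtain B where B: "B \<subseteq> range E" "fv.independent B" "range E \<subseteq> fv.span B" "card B = fv.dim (range E)"
    using fv.basis_exists by blast
  have "B \<subseteq> fv.span (\<delta> ` X)"
  proof
    fix b assume "b \<in> B"
    then obtain v where "b = E v" using B(1) by blast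
    then show "b \<in> fv.span (\<delta> ` X)" by (intro supp) (simp add: E)
  qed
  then have fB: "finite B" using fv.independent_span_bound[of "\<delta> ` X" B] X B(2) by blast
  have "\<exists>u. E (\<delta> x) = (\<Sum>b\<in>B. (\<lambda>i. u b * b i))" for x
  proof -
    have "E (\<delta> x) \<in> fv.span B" using B(3) by blast
    then show ?thesis unfolding fv.span_finite[OF fB] by blast
  qed
  then obtain r where r: "\<And>x. E (\<delta> x) = (\<Sum>b\<in>B. (\<lambda>i. r x b * b i))" by metis
  have Ed: "E (\<delta> x) w = (if w \<in> X then M w x else 0)" if "x \<in> X" for x w
  proof -
    have "(\<Sum>w'\<in>X. M w w' * \<delta> x w') = (\<Sum>w'\<in>X. if w' = x then M w x else 0)"
      by (intro sum.cong) (auto simp: \<delta>_def)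
    then show ?thesis using X that by (simp add: E sum.delta)
  qed
  have Ev: "E v = (\<Sum>b\<in>B. (\<lambda>i. (\<Sum>x\<in>X. v x * r x b) * b i))" for v
  proof
    fix w
    have "E v w = (\<Sum>x\<in>X. v x * E (\<delta> x) w)"
      by (simp add: Ed) (simp add: E mult.commute)
    also have "\<dots> = (\<Sum>x\<in>X. \<Sum>b\<in>B. v x * r x b * b w)"
      by (simp add: r sum_fun_apply sum_distrib_left mult.assoc)
    also have "\<dots> = (\<Sum>b\<in>B. \<Sum>x\<in>X. v x * r x b * b w)" by (rule sum.swap)
    finally show "E v w = (\<Sum>b\<in>B. (\<lambda>i. (\<Sum>x\<in>X. v x * r x b) * b i)) w"
      by (simp add: sum_fun_apply sum_distrib_right)
  qed
  \<comment> \<open>E b = b together with independence of B: the b-coordinate of b is 1.\<close>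
  have one: "(\<Sum>x\<in>X. b x * r x b) = 1" if b: "b \<in> B" for b
  proof -
    let ?u = "\<lambda>c. (\<Sum>x\<in>X. b x * r x c) - (if c = b then 1 else 0)"
    obtain v where "b = E v" using b B(1) by blast
    then have "E b = b" using idem by simp
    have "(\<Sum>c\<in>B. (\<lambda>i. ?u c * c i)) = 0"
    proof
      fix i
      have "(\<Sum>c\<in>B. (\<lambda>i. ?u c * c i)) i = (\<Sum>c\<in>B. (\<Sum>x\<in>X. b x * r x c) * c i - (if c = b then b i else 0))"
        unfolding sum_fun_apply by (intro sum.cong refl) (simp add: left_diff_distrib)
      also have "\<dots> = E b i - b i" unfolding Ev[of b] sum_fun_apply sum_subtractf
        using fB b by (simp add: sum.delta)
      finally show "(\<Sum>c\<in>B. (\<lambda>i. ?u c * c i)) i = 0 i" using \<open>E b = b\<close> by simp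
    qed
    then have "?u b = 0" by (rule fv.independentD[OF B(2) fB subset_refl]) (rule b)
    then show ?thesis by simp
  qed
  have "(\<Sum>x\<in>X. M x x) = (\<Sum>x\<in>X. E (\<delta> x) x)" by (intro sum.cong refl) (simp add: Ed)
  also have "\<dots> = (\<Sum>x\<in>X. \<Sum>b\<in>B. r x b * b x)" by (simp add: r sum_fun_apply)
  also have "\<dots> = (\<Sum>b\<in>B. \<Sum>x\<in>X. b x * r x b)" by (subst sum.swap) (simp add: mult.commute)
  also have "\<dots> = of_nat (card B)" by (simp add: one)
  finally show ?thesis using B(4) by simp
qed

lemma conv_sum:
  fixes F :: "(nat \<Rightarrow> nat) \<Rightarrow> 'c::comm_ring_1"
  shows "(\<Sum>\<sigma>\<in>Sn n. \<Sum>\<tau>\<in>Sn n. of_int (x \<sigma>) * (of_int (y \<tau>) * F (\<sigma> \<circ> \<tau>))) = (\<Sum>\<rho>\<in>Sn n. of_int (gm n x y \<rho>) * F \<rho>)"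
proof -
  have "(\<Sum>\<rho>\<in>Sn n. of_int (gm n x y \<rho>) * F \<rho>) = (\<Sum>\<rho>\<in>Sn n. \<Sum>\<sigma>\<in>Sn n. of_int (x \<sigma>) * (of_int (y (inv \<sigma> \<circ> \<rho>)) * F \<rho>))"
    by (intro sum.cong refl) (simp add: gm_def sum_distrib_right mult.assoc)
  also have "\<dots> = (\<Sum>\<sigma>\<in>Sn n. \<Sum>\<rho>\<in>Sn n. of_int (x \<sigma>) * (of_int (y (inv \<sigma> \<circ> \<rho>)) * F \<rho>))" by (rule sum.swap)
  also have "\<dots> = (\<Sum>\<sigma>\<in>Sn n. \<Sum>\<tau>\<in>Sn n. of_int (x \<sigma>) * (of_int (y \<tau>) * F (\<sigma> \<circ> \<tau>)))"
  proof (rule sum.cong[OF refl])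
    fix \<sigma> assume s: "\<sigma> \<in> Sn n"
    have "(\<Sum>\<rho>\<in>Sn n. of_int (x \<sigma>) * (of_int (y (inv \<sigma> \<circ> \<rho>)) * F \<rho>))
      = (\<Sum>\<tau>\<in>Sn n. of_int (x \<sigma>) * (of_int (y (inv \<sigma> \<circ> (\<sigma> \<circ> \<tau>))) * F (\<sigma> \<circ> \<tau>)))"
      by (rule sum_Sn_left[OF s, symmetric])
    then show "(\<Sum>\<rho>\<in>Sn n. of_int (x \<sigma>) * (of_int (y (inv \<sigma> \<circ> \<rho>)) * F \<rho>))
      = (\<Sum>\<tau>\<in>Sn n. of_int (x \<sigma>) * (of_int (y \<tau>) * F (\<sigma> \<circ> \<tau>)))"
      by (simp only: Sn_simps(4)[OF s])
  qed
  finally show ?thesis by simp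
qed

lemma sum_yind: "(\<Sum>\<sigma>\<in>Sn n. of_int (yind n f \<sigma>) * F \<sigma>) = (\<Sum>\<sigma>\<in>Yg {0..<n} f. (F \<sigma> :: 'c::comm_ring_1))"
  by (subst sum_Sn_Yg[symmetric]) (auto simp: yind_def intro!: sum.cong)

lemma sum_ysgn: "(\<Sum>\<sigma>\<in>Sn n. of_int (ysgn n f \<sigma>) * F \<sigma>) = (\<Sum>\<sigma>\<in>Yg {0..<n} f. of_int (sign \<sigma>) * (F \<sigma> :: 'c::comm_ring_1))"
  by (subst sum_Sn_Yg[symmetric]) (auto simp: ysgn_def intro!: sum.cong)

section \<open>Words, place permutations and fixed points\<close>

definition words :: "nat \<Rightarrow> nat \<Rightarrow> nat list set" where
  "words k n = {w. length w = k \<and> set w \<subseteq> {0..<n}}"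

lemma finite_words [simp]: "finite (words k n)"
  using finite_lists_length_eq[of "{0..<n}" k] by (simp add: words_def conj_commute)

definition wact :: "(nat \<Rightarrow> nat) \<Rightarrow> (nat \<Rightarrow> nat) \<Rightarrow> nat list \<Rightarrow> nat list" where
  "wact \<sigma> g w = permute_list \<sigma> (map (inv g) w)"

lemma Sn_permutes_lt: "\<sigma> \<in> Sn k \<Longrightarrow> \<sigma> permutes {..<k}"
  by (simp add: Sn_def atLeast0LessThan)

lemma wact_words:
  assumes "\<sigma> \<in> Sn k" "g \<in> Sn n" "w \<in> words k n"
  shows "wact \<sigma> g w \<in> words k n"
proof -
  have l: "length w = k" using assms(3) by (simp add: words_def)
  have "set (wact \<sigma> g w) = inv g ` set w"
    unfolding wact_def using set_permute_list[of \<sigma> "map (inv g) w"] Sn_permutes_lt[OF assms(1)] l by simp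
  also have "\<dots> \<subseteq> {0..<n}" using assms(3) Sn_apply[OF Sn_inv[OF assms(2)]] by (auto simp: words_def)
  finally show ?thesis using l by (simp add: words_def wact_def)
qed

lemma wact_wact:
  assumes "\<sigma> \<in> Sn k" "g \<in> Sn n" "\<tau> \<in> Sn k" "h \<in> Sn n" "w \<in> words k n"
  shows "wact \<tau> h (wact \<sigma> g w) = wact (\<sigma> \<circ> \<tau>) (g \<circ> h) w"
proof -
  have l: "length w = k" using assms(5) by (simp add: words_def)
  have "map (inv h) (permute_list \<sigma> (map (inv g) w)) = permute_list \<sigma> (map (inv h) (map (inv g) w))"
    using permute_list_map[of \<sigma> "map (inv g) w" "inv h"] Sn_permutes_lt[OF assms(1)] l by simp
  then have "wact \<tau> h (wact \<sigma> g w) = permute_list \<tau> (permute_list \<sigma> (map (inv h \<circ> inv g) w))"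
    by (simp add: wact_def)
  also have "\<dots> = permute_list (\<sigma> \<circ> \<tau>) (map (inv h \<circ> inv g) w)"
    by (rule permute_list_compose[symmetric]) (use Sn_permutes_lt[OF assms(3)] l in simp)
  finally show ?thesis using Sn_inv_comp[OF assms(2,4)] by (simp add: wact_def)
qed

text \<open>The pair (\<sigma>, g) permutes the words, a basis of the tensor power, so the number of
  fixed words is its trace there.\<close>

definition Fix :: "nat \<Rightarrow> nat \<Rightarrow> (nat \<Rightarrow> nat) \<Rightarrow> (nat \<Rightarrow> nat) \<Rightarrow> nat" where
  "Fix k n \<sigma> g = card {w \<in> words k n. wact \<sigma> g w = w}"

lemma Fix_conj:
  assumes "\<sigma> \<in> Sn k" "g \<in> Sn n" "z \<in> Sn k" "y \<in> Sn n"
  shows "Fix k n (z \<circ> \<sigma> \<circ> inv z) (y \<circ> g \<circ> inv y) = Fix k n \<sigma> g"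
proof -
  note S = Sn_inv[OF assms(3)] Sn_inv[OF assms(4)]
  have "bij_betw (wact z y) {w \<in> words k n. wact (z \<circ> \<sigma> \<circ> inv z) (y \<circ> g \<circ> inv y) w = w} {w \<in> words k n. wact \<sigma> g w = w}"
  proof (rule bij_betw_byWitness[where f'="wact (inv z) (inv y)"]; (intro ballI image_subsetI)?)
    fix w assume "w \<in> {w \<in> words k n. wact (z \<circ> \<sigma> \<circ> inv z) (y \<circ> g \<circ> inv y) w = w}"
    then have w: "w \<in> words k n" "wact (z \<circ> \<sigma> \<circ> inv z) (y \<circ> g \<circ> inv y) w = w" by auto
    have "w = wact id id w" by (simp add: wact_def)
    then show "wact (inv z) (inv y) (wact z y w) = w"
      using wact_wact[OF assms(3,4) S w(1)] Sn_simps(2) assms by simp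
    have "wact \<sigma> g (wact z y w) = wact (z \<circ> \<sigma>) (y \<circ> g) w" by (rule wact_wact[OF assms(3,4,1,2) w(1)])
    also have "\<dots> = wact (z \<circ> \<sigma> \<circ> inv z \<circ> z) (y \<circ> g \<circ> inv y \<circ> y) w"
      by (simp add: comp_assoc Sn_simps(1)[OF assms(3)] Sn_simps(1)[OF assms(4)])
    also have "\<dots> = wact z y (wact (z \<circ> \<sigma> \<circ> inv z) (y \<circ> g \<circ> inv y) w)"
      by (rule wact_wact[where k=k and n=n, symmetric]) (intro Sn_comp S assms w(1))+
    finally show "wact z y w \<in> {w \<in> words k n. wact \<sigma> g w = w}"
      using w wact_words[OF assms(3,4) w(1)] by simp
  next
    fix w assume "w \<in> {w \<in> words k n. wact \<sigma> g w = w}"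
    then have w: "w \<in> words k n" "wact \<sigma> g w = w" by auto
    have "w = wact id id w" by (simp add: wact_def)
    then show "wact z y (wact (inv z) (inv y) w) = w"
      using wact_wact[OF S assms(3,4) w(1)] Sn_simps(1)[OF assms(3)] Sn_simps(1)[OF assms(4)] by simp
    have "wact (z \<circ> \<sigma> \<circ> inv z) (y \<circ> g \<circ> inv y) (wact (inv z) (inv y) w) = wact (inv z \<circ> (z \<circ> \<sigma> \<circ> inv z)) (inv y \<circ> (y \<circ> g \<circ> inv y)) w"
      by (rule wact_wact[where k=k and n=n]) (intro Sn_comp S assms w(1))+
    also have "\<dots> = wact (\<sigma> \<circ> inv z) (g \<circ> inv y) w"
      by (simp add: comp_assoc Sn_simps(4)[OF assms(3)] Sn_simps(4)[OF assms(4)])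
    also have "\<dots> = wact (inv z) (inv y) (wact \<sigma> g w)"
      by (rule wact_wact[where k=k and n=n, symmetric]) (intro S assms w(1))+
    finally show "wact (inv z) (inv y) w \<in> {w \<in> words k n. wact (z \<circ> \<sigma> \<circ> inv z) (y \<circ> g \<circ> inv y) w = w}"
      using w wact_words[OF S w(1)] by simp
  qed
  then show ?thesis unfolding Fix_def by (rule bij_betw_same_card)
qed

text \<open>The Schur module of the statement composes q \<circ> p with the column permutation
  outside, so its symmetrizer is b a, whereas \<open>ysym\<close> is a b; inversion of group
  elements exchanges the two.\<close>

definition dsym :: "nat list \<Rightarrow> (nat \<Rightarrow> nat) \<Rightarrow> int" where
  "dsym la = gm (sum_list la) (ysgn (sum_list la) (colof la)) (yind (sum_list la) (rowof la))"

lemma ysym_gm: "ysym la = gm (sum_list la) (yind (sum_list la) (rowof la)) (ysgn (sum_list la) (colof la))"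
  if "is_partition la"
proof -
  interpret tableau "sum_list la" "pf la" "rowof la" "colof la" using tableau_partition[OF that] .
  show ?thesis unfolding ysym_def csym_def ..
qed

lemma dsym_inv: "is_partition la \<Longrightarrow> \<rho> \<in> Sn (sum_list la) \<Longrightarrow> dsym la \<rho> = ysym la (inv \<rho>)"
proof -
  assume la: "is_partition la" and r: "\<rho> \<in> Sn (sum_list la)"
  interpret tableau "sum_list la" "pf la" "rowof la" "colof la" using tableau_partition[OF la] .
  have "ysym la (inv \<rho>) = gm (sum_list la) (\<lambda>\<sigma>. bC (inv \<sigma>)) (\<lambda>\<sigma>. aR (inv \<sigma>)) \<rho>"
    unfolding ysym_gm[OF la] by (rule gm_star[OF r])
  also have "gm (sum_list la) (\<lambda>\<sigma>. bC (inv \<sigma>)) (\<lambda>\<sigma>. aR (inv \<sigma>)) = dsym la"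
    unfolding dsym_def by (rule gm_cong) (auto simp: yind_inv ysgn_inv)
  finally show ?thesis by simp
qed

lemma ysym_quasi: "is_partition la \<Longrightarrow> gm (sum_list la) (ysym la) (ysym la) = (\<lambda>\<sigma>. hook la * ysym la \<sigma>)"
  using tableau.csym_quasi_idem[OF tableau_partition] by (simp add: ysym_def hook_def)

lemma dsym_quasi:
  assumes la: "is_partition la"
  shows "gm (sum_list la) (dsym la) (dsym la) = (\<lambda>\<sigma>. hook la * dsym la \<sigma>)"
proof
  fix \<sigma>
  interpret tableau "sum_list la" "pf la" "rowof la" "colof la" using tableau_partition[OF la] .
  show "gm (sum_list la) (dsym la) (dsym la) \<sigma> = hook la * dsym la \<sigma>"
  proof (cases "\<sigma> \<in> Sn (sum_list la)")
    case True
    have "gm (sum_list la) (dsym la) (dsym la) = gm (sum_list la) (\<lambda>\<sigma>. ysym la (inv \<sigma>)) (\<lambda>\<sigma>. ysym la (inv \<sigma>))"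
      by (rule gm_cong) (auto simp: dsym_inv[OF la])
    then have "gm (sum_list la) (dsym la) (dsym la) \<sigma> = gm (sum_list la) (ysym la) (ysym la) (inv \<sigma>)"
      by (simp add: gm_star[OF True])
    then show ?thesis by (simp add: ysym_quasi[OF la] dsym_inv[OF la True])
  qed (simp add: gm_def dsym_def)
qed

text \<open>\<chi> (\<sigma> \<circ> \<tau>) = \<chi> (\<tau> \<circ> \<sigma>) for a class
  function, so it cannot tell a b from b a.\<close>

lemma sum_dsym_class:
  fixes \<chi> :: "(nat \<Rightarrow> nat) \<Rightarrow> 'c::comm_ring_1"
  assumes la: "is_partition la" and k: "k = sum_list la"
    and \<chi>: "\<And>g w. g \<in> Sn k \<Longrightarrow> w \<in> Sn k \<Longrightarrow> \<chi> (w \<circ> g \<circ> inv w) = \<chi> g"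
  shows "(\<Sum>\<sigma>\<in>Sn k. of_int (dsym la \<sigma>) * \<chi> \<sigma>) = (\<Sum>\<sigma>\<in>Sn k. of_int (ysym la \<sigma>) * \<chi> \<sigma>)"
proof -
  let ?a = "yind k (rowof la)" and ?b = "ysgn k (colof la)"
  have "(\<Sum>\<sigma>\<in>Sn k. of_int (dsym la \<sigma>) * \<chi> \<sigma>) = (\<Sum>\<sigma>\<in>Sn k. \<Sum>\<tau>\<in>Sn k. of_int (?b \<sigma>) * (of_int (?a \<tau>) * \<chi> (\<sigma> \<circ> \<tau>)))"
    unfolding dsym_def k by (rule conv_sum[symmetric])
  also have "\<dots> = (\<Sum>\<tau>\<in>Sn k. \<Sum>\<sigma>\<in>Sn k. of_int (?b \<sigma>) * (of_int (?a \<tau>) * \<chi> (\<sigma> \<circ> \<tau>)))" by (rule sum.swap)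
  also have "\<dots> = (\<Sum>\<tau>\<in>Sn k. \<Sum>\<sigma>\<in>Sn k. of_int (?a \<tau>) * (of_int (?b \<sigma>) * \<chi> (\<tau> \<circ> \<sigma>)))"
  proof (intro sum.cong refl)
    fix \<tau> \<sigma> assume s: "\<tau> \<in> Sn k" "\<sigma> \<in> Sn k"
    have "\<chi> (\<tau> \<circ> \<sigma>) = \<chi> (\<sigma> \<circ> (\<tau> \<circ> \<sigma>) \<circ> inv \<sigma>)" by (rule \<chi>[symmetric]) (intro Sn_comp s)+
    also have "\<sigma> \<circ> (\<tau> \<circ> \<sigma>) \<circ> inv \<sigma> = \<sigma> \<circ> \<tau>" by (simp add: comp_assoc Sn_simps(2)[OF s(2)])
    finally have e: "\<chi> (\<tau> \<circ> \<sigma>) = \<chi> (\<sigma> \<circ> \<tau>)" .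
    show "of_int (?b \<sigma>) * (of_int (?a \<tau>) * \<chi> (\<sigma> \<circ> \<tau>)) = of_int (?a \<tau>) * (of_int (?b \<sigma>) * \<chi> (\<tau> \<circ> \<sigma>))"
      unfolding e by (rule mult.left_commute)
  qed
  also have "\<dots> = (\<Sum>\<sigma>\<in>Sn k. of_int (ysym la \<sigma>) * \<chi> \<sigma>)"
    unfolding ysym_gm[OF la] k by (rule conv_sum)
  finally show ?thesis .
qed

definition tact :: "nat \<Rightarrow> nat list \<Rightarrow> (nat list \<Rightarrow> complex) \<Rightarrow> nat list \<Rightarrow> complex" where
  "tact n mu v = (\<lambda>w. \<Sum>g\<in>Sn n. of_int (ysym mu g) * v (map (inv g) w))"

definition pact :: "nat \<Rightarrow> nat list \<Rightarrow> (nat list \<Rightarrow> complex) \<Rightarrow> nat list \<Rightarrow> complex" where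
  "pact k la v = (\<lambda>w. \<Sum>\<sigma>\<in>Sn k. of_int (dsym la \<sigma>) * v (permute_list \<sigma> w))"

lemma tensors_iff: "v \<in> tensors k n \<longleftrightarrow> (\<forall>w. w \<notin> words k n \<longrightarrow> v w = 0)"
  by (auto simp: tensors_def words_def)

lemma map_words: "g \<in> Sn n \<Longrightarrow> map g w \<in> words k n \<longleftrightarrow> w \<in> words k n"
  using Sn_apply[of g n] by (auto simp: words_def)

lemma permute_list_words: "\<sigma> \<in> Sn k \<Longrightarrow> permute_list \<sigma> w \<in> words k n \<longleftrightarrow> w \<in> words k n"
  using set_permute_list[of \<sigma> w] Sn_permutes_lt[of \<sigma> k] by (auto simp: words_def)

lemma tact_tensors: "v \<in> tensors k n \<Longrightarrow> tact n mu v \<in> tensors k n"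
  by (auto simp: tensors_iff tact_def map_words Sn_inv intro!: sum.neutral)

lemma pact_tensors: "v \<in> tensors k n \<Longrightarrow> pact k la v \<in> tensors k n"
  by (auto simp: tensors_iff pact_def permute_list_words intro!: sum.neutral)

lemma tact_tact:
  assumes mu: "is_partition mu" and n: "n = sum_list mu"
  shows "tact n mu (tact n mu v) = (\<lambda>w. of_int (hook mu) * tact n mu v w)"
proof
  fix w
  have "tact n mu (tact n mu v) w = (\<Sum>g\<in>Sn n. \<Sum>h\<in>Sn n. of_int (ysym mu g) * (of_int (ysym mu h) * v (map (inv (g \<circ> h)) w)))"
    by (auto simp: tact_def sum_distrib_left Sn_inv_comp intro!: sum.cong)
  also have "\<dots> = (\<Sum>g\<in>Sn n. of_int (gm n (ysym mu) (ysym mu) g) * v (map (inv g) w))"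
    by (rule conv_sum)
  finally show "tact n mu (tact n mu v) w = of_int (hook mu) * tact n mu v w"
    using ysym_quasi[OF mu] by (simp add: n tact_def sum_distrib_left mult.assoc)
qed

lemma pact_pact:
  assumes la: "is_partition la" and k: "k = sum_list la" and v: "v \<in> tensors k n"
  shows "pact k la (pact k la v) = (\<lambda>w. of_int (hook la) * pact k la v w)"
proof
  fix w
  show "pact k la (pact k la v) w = of_int (hook la) * pact k la v w"
  proof (cases "w \<in> words k n")
    case True
    then have l: "length w = k" by (simp add: words_def)
    have "pact k la (pact k la v) w = (\<Sum>\<sigma>\<in>Sn k. \<Sum>\<tau>\<in>Sn k. of_int (dsym la \<sigma>) * (of_int (dsym la \<tau>) * v (permute_list (\<sigma> \<circ> \<tau>) w)))"
      using Sn_permutes_lt l by (auto simp: pact_def sum_distrib_left permute_list_compose intro!: sum.cong)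
    also have "\<dots> = (\<Sum>\<sigma>\<in>Sn k. of_int (gm k (dsym la) (dsym la) \<sigma>) * v (permute_list \<sigma> w))"
      by (rule conv_sum)
    finally show ?thesis
      using dsym_quasi[OF la] by (simp add: k pact_def sum_distrib_left mult.assoc)
  next
    case False
    then show ?thesis using pact_tensors[OF v] pact_tensors[OF pact_tensors[OF v]] by (simp add: tensors_iff)
  qed
qed

lemma tact_pact:
  assumes v: "v \<in> tensors k n"
  shows "tact n mu (pact k la v) = pact k la (tact n mu v)"
proof
  fix w
  show "tact n mu (pact k la v) w = pact k la (tact n mu v) w"
  proof (cases "w \<in> words k n")
    case True
    then have l: "length w = k" by (simp add: words_def)
    have "tact n mu (pact k la v) w = (\<Sum>g\<in>Sn n. \<Sum>\<sigma>\<in>Sn k. of_int (ysym mu g) * (of_int (dsym la \<sigma>) * v (permute_list \<sigma> (map (inv g) w))))"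
      by (simp add: tact_def pact_def sum_distrib_left)
    also have "\<dots> = (\<Sum>\<sigma>\<in>Sn k. \<Sum>g\<in>Sn n. of_int (ysym mu g) * (of_int (dsym la \<sigma>) * v (permute_list \<sigma> (map (inv g) w))))"
      by (rule sum.swap)
    also have "\<dots> = (\<Sum>\<sigma>\<in>Sn k. \<Sum>g\<in>Sn n. of_int (dsym la \<sigma>) * (of_int (ysym mu g) * v (map (inv g) (permute_list \<sigma> w))))"
    proof (intro sum.cong refl)
      fix \<sigma> g :: "nat \<Rightarrow> nat" assume "\<sigma> \<in> Sn k"
      then have "permute_list \<sigma> (map (inv g) w) = map (inv g) (permute_list \<sigma> w)"
        using permute_list_map[of \<sigma> w "inv g"] Sn_permutes_lt l by simp
      then show "of_int (ysym mu g) * (of_int (dsym la \<sigma>) * v (permute_list \<sigma> (map (inv g) w)))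
        = of_int (dsym la \<sigma>) * (of_int (ysym mu g) * v (map (inv g) (permute_list \<sigma> w)))"
        by (simp add: mult.left_commute)
    qed
    also have "\<dots> = pact k la (tact n mu v) w" by (simp add: tact_def pact_def sum_distrib_left)
    finally show ?thesis .
  next
    case False
    then show ?thesis using tact_tensors[OF pact_tensors[OF v]] pact_tensors[OF tact_tensors[OF v]] by (simp add: tensors_iff)
  qed
qed

lemma schur_module_pact:
  assumes k: "k = sum_list la"
  shows "schur_module la n = pact k la ` tensors k n"
proof -
  have "(\<lambda>w. \<Sum>q\<in>col_grp la. \<Sum>p\<in>row_grp la. of_int (sign q) * v (permute_list (q \<circ> p) w)) = pact k la v" for v
  proof
    fix w
    let ?a = "yind k (rowof la)" and ?b = "ysgn k (colof la)"
    have "pact k la v w = (\<Sum>q\<in>Sn k. \<Sum>p\<in>Sn k. of_int (?b q) * (of_int (?a p) * v (permute_list (q \<circ> p) w)))"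
      unfolding pact_def dsym_def k by (rule conv_sum[symmetric])
    also have "\<dots> = (\<Sum>q\<in>Sn k. of_int (?b q) * (\<Sum>p\<in>Sn k. of_int (?a p) * v (permute_list (q \<circ> p) w)))"
      by (simp add: sum_distrib_left)
    also have "\<dots> = (\<Sum>q\<in>col_grp la. of_int (sign q) * (\<Sum>p\<in>row_grp la. v (permute_list (q \<circ> p) w)))"
      unfolding sum_ysgn sum_yind col_grp_Yg row_grp_Yg k ..
    finally show "(\<Sum>q\<in>col_grp la. \<Sum>p\<in>row_grp la. of_int (sign q) * v (permute_list (q \<circ> p) w)) = pact k la v w"
      by (simp add: sum_distrib_left)
  qed
  then show ?thesis unfolding schur_module_def k by (auto simp: image_def)
qed

lemma conj_cong_right: "(Q \<Longrightarrow> P = P') \<Longrightarrow> (P \<and> Q) = (P' \<and> Q)"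
  by blast

text \<open>Opening the symmetrizer and substituting g = \<rho> q^-1 p^-1 rewrites the defining sum
  as right multiplication by \<open>ysym mu\<close>, the form in which quasi-idempotence can be
  applied.\<close>

lemma specht_eq:
  assumes mu: "is_partition mu" and n: "n = sum_list mu"
  shows "specht mu = {(\<lambda>\<rho>. \<Sum>g\<in>Sn n. x g * of_int (ysym mu (inv g \<circ> \<rho>))) | x. \<forall>\<tau>. \<tau> \<notin> Sn n \<longrightarrow> x \<tau> = 0}"
proof -
  interpret tableau n "pf mu" "rowof mu" "colof mu" using tableau_partition[OF mu] n by simp
  have y: "ysym mu = csym" by (simp add: ysym_def n)
  have e: "(\<lambda>\<rho>. \<Sum>p\<in>row_grp mu. \<Sum>q\<in>col_grp mu. of_int (sign q) * x (\<rho> \<circ> inv q \<circ> inv p))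
    = (\<lambda>\<rho>. \<Sum>g\<in>Sn n. x g * of_int (ysym mu (inv g \<circ> \<rho>)))" if x: "\<forall>\<tau>. \<tau> \<notin> Sn n \<longrightarrow> x \<tau> = (0::complex)" for x
  proof
    fix \<rho>
    show "(\<Sum>p\<in>row_grp mu. \<Sum>q\<in>col_grp mu. of_int (sign q) * x (\<rho> \<circ> inv q \<circ> inv p)) = (\<Sum>g\<in>Sn n. x g * of_int (ysym mu (inv g \<circ> \<rho>)))"
    proof (cases "\<rho> \<in> Sn n")
      case True
      have "(\<Sum>g\<in>Sn n. x g * of_int (csym (inv g \<circ> \<rho>))) = (\<Sum>g\<in>Sn n. \<Sum>p\<in>R. x g * of_int (bC (inv p \<circ> (inv g \<circ> \<rho>))))"
        by (intro sum.cong refl) (simp add: csym_sum Sn_comp Sn_inv True sum_distrib_left)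
      also have "\<dots> = (\<Sum>p\<in>R. \<Sum>g\<in>Sn n. x g * of_int (bC (inv p \<circ> (inv g \<circ> \<rho>))))" by (rule sum.swap)
      also have "\<dots> = (\<Sum>p\<in>R. \<Sum>q\<in>C. of_int (sign q) * x (\<rho> \<circ> inv q \<circ> inv p))"
      proof (rule sum.cong[OF refl])
        fix p assume "p \<in> R"
        then have p: "p \<in> Sn n" by (rule Yg_Sn)
        have "(\<Sum>g\<in>Sn n. x g * of_int (bC (inv p \<circ> (inv g \<circ> \<rho>)))) = (\<Sum>q\<in>Sn n. of_int (bC q) * x (\<rho> \<circ> inv q \<circ> inv p))"
        proof (rule sum.reindex_bij_witness[where i="\<lambda>q. \<rho> \<circ> inv q \<circ> inv p" and j="\<lambda>g. inv p \<circ> (inv g \<circ> \<rho>)"])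
          fix g assume g: "g \<in> Sn n"
          have i: "inv (inv p \<circ> (inv g \<circ> \<rho>)) = (inv \<rho> \<circ> g) \<circ> p"
            using Sn_inv_comp[OF Sn_inv[OF p] Sn_comp[OF Sn_inv[OF g] True]] Sn_inv_comp[OF Sn_inv[OF g] True]
            by (simp add: Sn_simps(3)[OF p] Sn_simps(3)[OF g])
          show r: "\<rho> \<circ> inv (inv p \<circ> (inv g \<circ> \<rho>)) \<circ> inv p = g"
            unfolding i by (simp add: comp_assoc Sn_simps(5)[OF True] Sn_simps(2)[OF p])
          show "inv p \<circ> (inv g \<circ> \<rho>) \<in> Sn n" by (intro Sn_comp Sn_inv p g True)
          show "of_int (bC (inv p \<circ> (inv g \<circ> \<rho>))) * x (\<rho> \<circ> inv (inv p \<circ> (inv g \<circ> \<rho>)) \<circ> inv p) = x g * of_int (bC (inv p \<circ> (inv g \<circ> \<rho>)))"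
            unfolding r by simp
        next
          fix q assume q: "q \<in> Sn n"
          have i: "inv (\<rho> \<circ> inv q \<circ> inv p) = p \<circ> (q \<circ> inv \<rho>)"
            using Sn_inv_comp[OF Sn_comp[OF True Sn_inv[OF q]] Sn_inv[OF p]] Sn_inv_comp[OF True Sn_inv[OF q]]
            by (simp add: Sn_simps(3)[OF p] Sn_simps(3)[OF q])
          show "inv p \<circ> (inv (\<rho> \<circ> inv q \<circ> inv p) \<circ> \<rho>) = q"
            unfolding i by (simp add: comp_assoc Sn_simps(4)[OF p] Sn_simps(1)[OF True])
          show "\<rho> \<circ> inv q \<circ> inv p \<in> Sn n" by (intro Sn_comp Sn_inv p q True)
        qed
        then show "(\<Sum>g\<in>Sn n. x g * of_int (bC (inv p \<circ> (inv g \<circ> \<rho>)))) = (\<Sum>q\<in>C. of_int (sign q) * x (\<rho> \<circ> inv q \<circ> inv p))"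
          by (simp only: sum_ysgn)
      qed
      finally show ?thesis by (simp only: y row_grp_Yg col_grp_Yg n)
    next
      case False
      have "\<rho> \<circ> inv q \<circ> inv p \<notin> Sn n" if "p \<in> Sn n" "q \<in> Sn n" for p q
      proof
        assume "\<rho> \<circ> inv q \<circ> inv p \<in> Sn n"
        then have "(\<rho> \<circ> inv q \<circ> inv p) \<circ> (p \<circ> q) \<in> Sn n" by (rule Sn_comp) (rule Sn_comp[OF that])
        moreover have "(\<rho> \<circ> inv q \<circ> inv p) \<circ> (p \<circ> q) = \<rho>"
          by (simp add: comp_assoc Sn_simps(4)[OF that(1)] Sn_simps(1)[OF that(2)])
        ultimately show False using False by simp
      qed
      then have 1: "(\<Sum>p\<in>row_grp mu. \<Sum>q\<in>col_grp mu. of_int (sign q) * x (\<rho> \<circ> inv q \<circ> inv p)) = 0"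
        using x unfolding row_grp_Yg col_grp_Yg n[symmetric] by (intro sum.neutral ballI) (simp add: Yg_Sn)
      have "inv g \<circ> \<rho> \<notin> Sn n" if "g \<in> Sn n" for g
      proof
        assume "inv g \<circ> \<rho> \<in> Sn n"
        then have "g \<circ> (inv g \<circ> \<rho>) \<in> Sn n" by (rule Sn_comp[OF that])
        then show False using False by (simp add: Sn_simps(5)[OF that])
      qed
      then have "(\<Sum>g\<in>Sn n. x g * of_int (ysym mu (inv g \<circ> \<rho>))) = 0"
        unfolding y by (intro sum.neutral ballI) (simp add: csym_notin)
      then show ?thesis using 1 by simp
    qed
  qed
  have S: "Sym_grp n = Sn n" by (simp add: Sym_grp_def Sn_def)
  show ?thesis unfolding specht_def n[symmetric] S
    by (intro Collect_cong ex_cong1 conj_cong_right) (simp only: e)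
qed

definition regd :: "nat \<Rightarrow> nat list \<Rightarrow> ((nat \<Rightarrow> nat) \<Rightarrow> complex) \<Rightarrow> (nat \<Rightarrow> nat) \<Rightarrow> complex" where
  "regd n mu x = (\<lambda>\<rho>. \<Sum>g\<in>Sn n. x g * of_int (ysym mu (inv g \<circ> \<rho>)))"

section \<open>Homomorphisms from a Specht module to a Schur module\<close>

context
  fixes la mu :: "nat list" and k n :: nat
  assumes la: "is_partition la" and mu: "is_partition mu" and k: "k = sum_list la" and n: "n = sum_list mu"
begin

text \<open>The product of two commuting idempotents on the tensor power, one acting on letters and
  one on places; its image is a model of the Hom space. Cutting off outside the words of length k
  over n letters makes it a finite matrix.\<close>

definition Emap :: "(nat list \<Rightarrow> complex) \<Rightarrow> nat list \<Rightarrow> complex" where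
  "Emap v = (\<lambda>w. (1 / (of_int (hook la) * of_int (hook mu))) *
     pact k la (tact n mu (\<lambda>w. if w \<in> words k n then v w else 0)) w)"

lemma hl0: "(of_int (hook la) :: complex) \<noteq> 0" "(of_int (hook mu) :: complex) \<noteq> 0"
  using hook_pos[of la k] hook_pos[of mu n] la mu k n by (auto simp: parts_def)

lemma cut_tensors: "(\<lambda>w. if w \<in> words k n then v w else 0) \<in> tensors k n"
  by (simp add: tensors_iff)

lemma cut_id: "v \<in> tensors k n \<Longrightarrow> (\<lambda>w. if w \<in> words k n then v w else 0) = v"
  by (auto simp: tensors_iff)

lemma tensors_scale: "v \<in> tensors k n \<Longrightarrow> (\<lambda>w. c * v w) \<in> tensors k n"
  by (simp add: tensors_iff)

lemma pact_scale: "pact k la (\<lambda>w. c * v w) = (\<lambda>w. c * pact k la v w)"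
  by (simp add: pact_def sum_distrib_left mult.left_commute)

lemma tact_scale: "tact n mu (\<lambda>w. c * v w) = (\<lambda>w. c * tact n mu v w)"
  by (simp add: tact_def sum_distrib_left mult.left_commute)

lemma Emap_tensors: "Emap v \<in> tensors k n"
  unfolding Emap_def by (intro tensors_scale pact_tensors tact_tensors cut_tensors)

text \<open>The normalised symmetrizers are commuting idempotents, so the image of their product is
  the intersection of their fixed spaces.\<close>

lemma range_Emap: "w0 \<in> range Emap \<longleftrightarrow> w0 \<in> tensors k n \<and> pact k la w0 = (\<lambda>w. of_int (hook la) * w0 w)
    \<and> tact n mu w0 = (\<lambda>w. of_int (hook mu) * w0 w)"
proof
  assume "w0 \<in> range Emap"
  then obtain v where v: "w0 = Emap v" by blast
  let ?u = "\<lambda>w. if w \<in> words k n then v w else 0" and ?c = "1 / (of_int (hook la) * of_int (hook mu)) :: complex"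
  have w0: "w0 = (\<lambda>w. ?c * pact k la (tact n mu ?u) w)" unfolding v Emap_def ..
  have "pact k la w0 = (\<lambda>w. of_int (hook la) * w0 w)"
    unfolding w0 pact_scale pact_pact[OF la k tact_tensors[OF cut_tensors]] by (simp add: mult.left_commute)
  moreover have "tact n mu w0 = (\<lambda>w. of_int (hook mu) * w0 w)"
    unfolding w0 tact_scale tact_pact[OF tact_tensors[OF cut_tensors]] tact_tact[OF mu n] pact_scale by (simp add: mult.left_commute)
  ultimately show "w0 \<in> tensors k n \<and> pact k la w0 = (\<lambda>w. of_int (hook la) * w0 w)
    \<and> tact n mu w0 = (\<lambda>w. of_int (hook mu) * w0 w)" using Emap_tensors v by blast
next
  assume w: "w0 \<in> tensors k n \<and> pact k la w0 = (\<lambda>w. of_int (hook la) * w0 w)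
    \<and> tact n mu w0 = (\<lambda>w. of_int (hook mu) * w0 w)"
  have "Emap w0 = w0"
    unfolding Emap_def using w hl0 by (simp add: cut_id pact_scale)
  then show "w0 \<in> range Emap" by (metis rangeI)
qed

lemma Emap_idem: "Emap (Emap v) = Emap v"
proof -
  have "Emap v \<in> range Emap" by blast
  then have w: "Emap v \<in> tensors k n" "pact k la (Emap v) = (\<lambda>w. of_int (hook la) * Emap v w)"
    "tact n mu (Emap v) = (\<lambda>w. of_int (hook mu) * Emap v w)" unfolding range_Emap by auto
  show ?thesis unfolding Emap_def[of "Emap v"] using w hl0 by (simp add: cut_id pact_scale)
qed

definition Mmat :: "nat list \<Rightarrow> nat list \<Rightarrow> complex" where
  "Mmat w w' = (1 / (of_int (hook la) * of_int (hook mu))) *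
     (\<Sum>\<sigma>\<in>Sn k. \<Sum>g\<in>Sn n. of_int (dsym la \<sigma>) * of_int (ysym mu g) * (if wact \<sigma> g w = w' then 1 else 0))"

lemma Emap_matrix: "Emap v w = (if w \<in> words k n then \<Sum>w'\<in>words k n. Mmat w w' * v w' else 0)"
proof (cases "w \<in> words k n")
  case True
  let ?c = "1 / (of_int (hook la) * of_int (hook mu)) :: complex"
  have l: "length w = k" using True by (simp add: words_def)
  have wa: "map (inv g) (permute_list \<sigma> w) = wact \<sigma> g w" if "\<sigma> \<in> Sn k" for \<sigma> g
    unfolding wact_def using permute_list_map[of \<sigma> w "inv g"] Sn_permutes_lt[OF that] l by simp
  have "Emap v w = ?c * (\<Sum>\<sigma>\<in>Sn k. \<Sum>g\<in>Sn n. of_int (dsym la \<sigma>) * of_int (ysym mu g) * v (wact \<sigma> g w))"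
    unfolding Emap_def pact_def tact_def
    by (intro arg_cong2[where f="(*)"] refl sum.cong) (simp add: sum_distrib_left wa wact_words[OF _ _ True] mult.assoc)
  also have "\<dots> = ?c * (\<Sum>\<sigma>\<in>Sn k. \<Sum>g\<in>Sn n. \<Sum>w'\<in>words k n. of_int (dsym la \<sigma>) * of_int (ysym mu g) * (if wact \<sigma> g w = w' then 1 else 0) * v w')"
  proof (intro arg_cong2[where f="(*)"] refl sum.cong)
    fix \<sigma> g assume s: "\<sigma> \<in> Sn k" "g \<in> Sn n"
    have "(\<Sum>w'\<in>words k n. of_int (dsym la \<sigma>) * of_int (ysym mu g) * (if wact \<sigma> g w = w' then 1 else 0) * v w')
      = (\<Sum>w'\<in>words k n. if wact \<sigma> g w = w' then of_int (dsym la \<sigma>) * of_int (ysym mu g) * v w' else 0)"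
      by (intro sum.cong) auto
    also have "\<dots> = of_int (dsym la \<sigma>) * of_int (ysym mu g) * v (wact \<sigma> g w)"
      using wact_words[OF s True] by (simp add: sum.delta')
    finally show "of_int (dsym la \<sigma>) * of_int (ysym mu g) * v (wact \<sigma> g w)
      = (\<Sum>w'\<in>words k n. of_int (dsym la \<sigma>) * of_int (ysym mu g) * (if wact \<sigma> g w = w' then 1 else 0) * v w')" by simp
  qed
  also have "\<dots> = ?c * (\<Sum>w'\<in>words k n. \<Sum>\<sigma>\<in>Sn k. \<Sum>g\<in>Sn n. of_int (dsym la \<sigma>) * of_int (ysym mu g) * (if wact \<sigma> g w = w' then 1 else 0) * v w')"
    by (subst (2) sum.swap, subst sum.swap) (rule refl)
  also have "\<dots> = (\<Sum>w'\<in>words k n. Mmat w w' * v w')"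
    by (simp only: Mmat_def sum_distrib_right sum_distrib_left mult.assoc)
  finally show ?thesis using True by simp
qed (use Emap_tensors in \<open>simp add: tensors_iff\<close>)

lemma trace_Mmat:
  "of_int (hook la) * of_int (hook mu) * (\<Sum>w\<in>words k n. Mmat w w)
    = (\<Sum>\<sigma>\<in>Sn k. \<Sum>g\<in>Sn n. of_int (dsym la \<sigma>) * of_int (ysym mu g) * of_nat (Fix k n \<sigma> g))"
proof -
  have "of_int (hook la) * of_int (hook mu) * (\<Sum>w\<in>words k n. Mmat w w)
    = (\<Sum>w\<in>words k n. \<Sum>\<sigma>\<in>Sn k. \<Sum>g\<in>Sn n. of_int (dsym la \<sigma>) * of_int (ysym mu g) * (if wact \<sigma> g w = w then 1 else 0))"
    unfolding sum_distrib_left Mmat_def using hl0 by (simp add: field_simps)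
  also have "\<dots> = (\<Sum>\<sigma>\<in>Sn k. \<Sum>g\<in>Sn n. \<Sum>w\<in>words k n. of_int (dsym la \<sigma>) * of_int (ysym mu g) * (if wact \<sigma> g w = w then 1 else 0))"
    by (subst sum.swap, subst (2) sum.swap) (rule refl)
  also have "\<dots> = (\<Sum>\<sigma>\<in>Sn k. \<Sum>g\<in>Sn n. of_int (dsym la \<sigma>) * of_int (ysym mu g) * of_nat (Fix k n \<sigma> g))"
    by (simp add: Fix_def sum.If_cases Int_def flip: sum_distrib_left)
  finally show ?thesis .
qed

abbreviation "V \<equiv> specht mu"
abbreviation "W \<equiv> schur_module la n"

lemma V_iff: "v \<in> V \<longleftrightarrow> (\<exists>x. (\<forall>\<tau>. \<tau> \<notin> Sn n \<longrightarrow> x \<tau> = 0) \<and> v = regd n mu x)"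
  unfolding specht_eq[OF mu n] regd_def by auto

lemma V_add: "u \<in> V \<Longrightarrow> v \<in> V \<Longrightarrow> u + v \<in> V"
proof -
  assume "u \<in> V" "v \<in> V"
  then obtain x y where x: "\<forall>\<tau>. \<tau> \<notin> Sn n \<longrightarrow> x \<tau> = 0" "u = regd n mu x" and y: "\<forall>\<tau>. \<tau> \<notin> Sn n \<longrightarrow> y \<tau> = 0" "v = regd n mu y"
    unfolding V_iff by blast
  have "u + v = regd n mu (\<lambda>\<tau>. x \<tau> + y \<tau>)"
    unfolding x(2) y(2) by (simp add: regd_def fun_eq_iff distrib_right sum.distrib)
  then show ?thesis unfolding V_iff using x(1) y(1) by (intro exI[of _ "\<lambda>\<tau>. x \<tau> + y \<tau>"]) simp
qed

lemma V_scale: "v \<in> V \<Longrightarrow> (\<lambda>i. c * v i) \<in> V"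
proof -
  assume "v \<in> V"
  then obtain x where x: "\<forall>\<tau>. \<tau> \<notin> Sn n \<longrightarrow> x \<tau> = 0" "v = regd n mu x" unfolding V_iff by blast
  have "(\<lambda>i. c * v i) = regd n mu (\<lambda>\<tau>. c * x \<tau>)"
    unfolding x(2) by (simp add: regd_def fun_eq_iff sum_distrib_left mult.assoc)
  then show ?thesis unfolding V_iff using x(1) by (intro exI[of _ "\<lambda>\<tau>. c * x \<tau>"]) simp
qed

lemma V_regact: "v \<in> V \<Longrightarrow> h \<in> Sn n \<Longrightarrow> regact h v \<in> V"
proof -
  assume "v \<in> V" and h: "h \<in> Sn n"
  then obtain x where x: "\<forall>\<tau>. \<tau> \<notin> Sn n \<longrightarrow> x \<tau> = 0" "v = regd n mu x" unfolding V_iff by blast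
  have "regact h v = regd n mu (\<lambda>g. x (inv h \<circ> g))"
  proof
    fix \<rho>
    have "regd n mu (\<lambda>g. x (inv h \<circ> g)) \<rho> = (\<Sum>g\<in>Sn n. x (inv h \<circ> (h \<circ> g)) * of_int (ysym mu (inv (h \<circ> g) \<circ> \<rho>)))"
      unfolding regd_def by (rule sum_Sn_left[OF h, symmetric])
    also have "\<dots> = regact h v \<rho>" unfolding x(2) regact_def regd_def
      by (intro sum.cong refl) (simp add: Sn_simps(4)[OF h] Sn_inv_comp[OF h] comp_assoc)
    finally show "regact h v \<rho> = regd n mu (\<lambda>g. x (inv h \<circ> g)) \<rho>" by simp
  qed
  moreover have "x (inv h \<circ> g) = 0" if "g \<notin> Sn n" for g
  proof -
    have "inv h \<circ> g \<notin> Sn n"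
    proof
      assume "inv h \<circ> g \<in> Sn n"
      then have "h \<circ> (inv h \<circ> g) \<in> Sn n" by (rule Sn_comp[OF h])
      then show False using \<open>g \<notin> Sn n\<close> by (simp add: Sn_simps(5)[OF h])
    qed
    then show ?thesis using x(1) by blast
  qed
  ultimately show ?thesis unfolding V_iff
    by (intro exI[of _ "\<lambda>g. x (inv h \<circ> g)"] conjI allI impI)
qed

text \<open>The Young symmetrizer itself, which generates the Specht module: an equivariant map is
  determined by its value here.\<close>

definition c0 :: "(nat \<Rightarrow> nat) \<Rightarrow> complex" where
  "c0 = (\<lambda>\<rho>. of_int (ysym mu \<rho>))"

lemma c0_V: "c0 \<in> V"
proof -
  have "regd n mu (\<lambda>\<tau>. if \<tau> = id then 1 else 0) = c0"
  proof
    fix \<rho>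
    have "regd n mu (\<lambda>\<tau>. if \<tau> = id then 1 else 0) \<rho> = (\<Sum>g\<in>Sn n. if g = id then of_int (ysym mu \<rho>) else 0)"
      unfolding regd_def by (intro sum.cong) auto
    then show "regd n mu (\<lambda>\<tau>. if \<tau> = id then 1 else 0) \<rho> = c0 \<rho>" by (simp add: sum.delta c0_def)
  qed
  then show ?thesis unfolding V_iff by (intro exI[of _ "\<lambda>\<tau>. if \<tau> = id then 1 else 0"]) auto
qed

lemma regd_regact: "regd n mu x = (\<lambda>i. \<Sum>g\<in>Sn n. x g * regact g c0 i)"
  by (simp add: regd_def regact_def c0_def)

lemma regd_c0: "regd n mu c0 = (\<lambda>i. of_int (hook mu) * c0 i)"
proof
  fix \<rho>
  have "regd n mu c0 \<rho> = of_int (gm n (ysym mu) (ysym mu) \<rho>)"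
  proof (cases "\<rho> \<in> Sn n")
    case False
    have "ysym mu (inv g \<circ> \<rho>) = 0" if "g \<in> Sn n" for g
    proof -
      have "inv g \<circ> \<rho> \<notin> Sn n"
      proof
        assume "inv g \<circ> \<rho> \<in> Sn n"
        then have "g \<circ> (inv g \<circ> \<rho>) \<in> Sn n" by (rule Sn_comp[OF that])
        then show False using False by (simp add: Sn_simps(5)[OF that])
      qed
      then show ?thesis by (simp add: ysym_gm[OF mu] gm_def n)
    qed
    then show ?thesis using False by (simp add: regd_def gm_def)
  qed (simp add: regd_def c0_def gm_def)
  then show "regd n mu c0 \<rho> = of_int (hook mu) * c0 \<rho>" using ysym_quasi[OF mu] by (simp add: n c0_def)
qed

lemma tensact_tensact: "h \<in> Sn n \<Longrightarrow> g \<in> Sn n \<Longrightarrow> tensact h (tensact g w) = tensact (h \<circ> g) w"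
  by (simp add: tensact_def Sn_inv_comp)

lemma tact_tensact: "tact n mu w = (\<lambda>j. \<Sum>g\<in>Sn n. c0 g * tensact g w j)"
  by (simp add: tact_def c0_def tensact_def)

text \<open>The homomorphism that sends the generator \<open>c0\<close> to w, for w in the image of
  \<open>Emap\<close>: a vector of V acts as an element of the group algebra, and division by
  \<open>hook mu\<close> undoes c0 c0 = hook c0. The value 0 outside V matches the normalisation in
  \<open>hom_space\<close>.\<close>

definition Psi :: "(nat list \<Rightarrow> complex) \<Rightarrow> ((nat \<Rightarrow> nat) \<Rightarrow> complex) \<Rightarrow> nat list \<Rightarrow> complex" where
  "Psi w = (\<lambda>v. if v \<in> V then (\<lambda>j. \<Sum>g\<in>Sn n. (v g / of_int (hook mu)) * tensact g w j) else 0)"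

lemma Psi_linear: "Vector_Spaces.linear (\<lambda>(c::complex) v i. c * v i) (\<lambda>c f x y. c * f x y) Psi"
  unfolding Vector_Spaces.linear_iff
proof (intro conjI allI vector_space_fun vector_space_fun2)
  fix u w :: "nat list \<Rightarrow> complex" and c :: complex
  show "Psi (u + w) = Psi u + Psi w"
    by (simp add: Psi_def fun_eq_iff tensact_def distrib_left sum.distrib)
  show "Psi (\<lambda>i. c * w i) = (\<lambda>x y. c * Psi w x y)"
    by (simp add: Psi_def fun_eq_iff tensact_def sum_distrib_left mult.left_commute)
qed

lemma Psi_c0: "tact n mu w = (\<lambda>j. of_int (hook mu) * w j) \<Longrightarrow> Psi w c0 = w"
  using hl0(2) by (simp add: Psi_def c0_V tact_tensact fun_eq_iff sum_divide_distrib[symmetric])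

lemma schur_module_sum:
  assumes "finite A" "\<And>g. g \<in> A \<Longrightarrow> u g \<in> W"
  shows "(\<lambda>j. \<Sum>g\<in>A. a g * u g j) \<in> W"
proof -
  have "\<exists>x. \<forall>g\<in>A. x g \<in> tensors k n \<and> u g = pact k la (x g)"
    by (rule bchoice) (use assms(2) schur_module_pact[OF k, of n] in auto)
  then obtain x where x: "\<And>g. g \<in> A \<Longrightarrow> x g \<in> tensors k n" "\<And>g. g \<in> A \<Longrightarrow> u g = pact k la (x g)" by blast
  have "(\<lambda>j. \<Sum>g\<in>A. a g * u g j) = (\<lambda>j. \<Sum>g\<in>A. a g * pact k la (x g) j)"
    by (rule ext) (auto intro!: sum.cong simp: x(2))
  also have "\<dots> = pact k la (\<lambda>j. \<Sum>g\<in>A. a g * x g j)"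
    by (rule ext) (simp add: pact_def sum_distrib_left, subst sum.swap, simp add: mult.left_commute)
  finally have "(\<lambda>j. \<Sum>g\<in>A. a g * u g j) = pact k la (\<lambda>j. \<Sum>g\<in>A. a g * x g j)" .
  moreover have "(\<lambda>j. \<Sum>g\<in>A. a g * x g j) \<in> tensors k n" using x(1) by (auto simp: tensors_iff intro!: sum.neutral)
  ultimately show ?thesis unfolding schur_module_pact[OF k] by blast
qed

lemma tensact_W: "u \<in> W \<Longrightarrow> g \<in> Sn n \<Longrightarrow> tensact g u \<in> W"
proof -
  assume "u \<in> W" and g: "g \<in> Sn n"
  then obtain x where x: "x \<in> tensors k n" "u = pact k la x" unfolding schur_module_pact[OF k] by blast
  have t: "tensact g x \<in> tensors k n" using x(1) by (simp add: tensors_iff tensact_def map_words Sn_inv[OF g])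
  have "tensact g u j = pact k la (tensact g x) j" for j
  proof (cases "j \<in> words k n")
    case True
    then have l: "length j = k" by (simp add: words_def)
    show ?thesis unfolding x(2) tensact_def pact_def
      by (intro sum.cong refl) (use permute_list_map[of _ j "inv g"] Sn_permutes_lt l in auto)
  next
    case False
    then show ?thesis using pact_tensors[OF t, of la] pact_tensors[OF x(1), of la]
      by (simp add: tensors_iff x(2) tensact_def map_words Sn_inv[OF g])
  qed
  then have "tensact g u = pact k la (tensact g x)" by (rule ext)
  then show ?thesis using t unfolding schur_module_pact[OF k] by blast
qed

lemma hom_space_sum:
  assumes f: "f \<in> hom_space (Sym_grp n) regact V tensact W" and A: "finite A" "\<And>g. g \<in> A \<Longrightarrow> v g \<in> V"
  shows "(\<lambda>i. \<Sum>g\<in>A. a g * v g i) \<in> V \<and> f (\<lambda>i. \<Sum>g\<in>A. a g * v g i) = (\<lambda>j. \<Sum>g\<in>A. a g * f (v g) j)"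
  using A
proof (induction A)
  case empty
  have "(\<lambda>i. 0 * c0 i) \<in> V" by (rule V_scale[OF c0_V])
  moreover have "f (\<lambda>i. 0 * c0 i) = (\<lambda>j. 0 * f c0 j)" using f c0_V unfolding hom_space_def by blast
  ultimately show ?case by simp
next
  case (insert g A)
  have 1: "(\<lambda>i. a g * v g i) \<in> V" "f (\<lambda>i. a g * v g i) = (\<lambda>j. a g * f (v g) j)"
    using f insert.prems V_scale unfolding hom_space_def by blast+
  have 2: "(\<lambda>i. \<Sum>g\<in>A. a g * v g i) \<in> V" "f (\<lambda>i. \<Sum>g\<in>A. a g * v g i) = (\<lambda>j. \<Sum>g\<in>A. a g * f (v g) j)"
    using insert by auto
  have e: "(\<lambda>i. \<Sum>g\<in>insert g A. a g * v g i) = (\<lambda>i. a g * v g i) + (\<lambda>i. \<Sum>g\<in>A. a g * v g i)"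
    using insert.hyps by (simp add: fun_eq_iff)
  have "f ((\<lambda>i. a g * v g i) + (\<lambda>i. \<Sum>g\<in>A. a g * v g i)) = f (\<lambda>i. a g * v g i) + f (\<lambda>i. \<Sum>g\<in>A. a g * v g i)"
    using f 1(1) 2(1) unfolding hom_space_def by blast
  then show ?case unfolding e using V_add[OF 1(1) 2(1)] insert.hyps by (simp add: 1(2) 2(2) fun_eq_iff)
qed

text \<open>An equivariant f is determined by w = f c0. Applying f to c0 c0 = hook c0 shows that w
  is an eigenvector of \<open>tact\<close>, and lying in the Schur module makes it an eigenvector of
  \<open>pact\<close>. Conversely \<open>Psi\<close> turns each such w into a homomorphism.\<close>

lemma hom_space_Psi: "hom_space (Sym_grp n) regact V tensact W = Psi ` range Emap"
proof (intro equalityI subsetI)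
  fix f assume f: "f \<in> hom_space (Sym_grp n) regact V tensact W"
  have eqv: "f (regact g c0) = tensact g (f c0)" "regact g c0 \<in> V" if "g \<in> Sn n" for g
    using f c0_V V_regact[OF c0_V that] that unfolding hom_space_def by (auto simp: Sym_grp_def Sn_def)
  define w0 where "w0 = f c0"
  have w0W: "w0 \<in> W" using f c0_V unfolding hom_space_def w0_def by blast
  have fr: "f (regd n mu x) = (\<lambda>j. \<Sum>g\<in>Sn n. x g * tensact g w0 j)" for x
    unfolding regd_regact using hom_space_sum[OF f finite_Sn[of n], where v="\<lambda>g. regact g c0" and a=x] eqv by (simp add: w0_def)
  obtain u where u: "u \<in> tensors k n" "w0 = pact k la u" using w0W unfolding schur_module_pact[OF k] by blast
  have p: "pact k la w0 = (\<lambda>w. of_int (hook la) * w0 w)" unfolding u(2) by (rule pact_pact[OF la k u(1)])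
  have "tact n mu w0 = f (\<lambda>i. of_int (hook mu) * c0 i)"
    unfolding tact_tensact regd_c0[symmetric] fr ..
  also have "\<dots> = (\<lambda>w. of_int (hook mu) * w0 w)" using f c0_V unfolding hom_space_def w0_def by blast
  finally have t: "tact n mu w0 = (\<lambda>w. of_int (hook mu) * w0 w)" .
  have wE: "w0 \<in> range Emap" unfolding range_Emap using p t pact_tensors[OF u(1)] u(2) by blast
  have "f v = Psi w0 v" for v
  proof (cases "v \<in> V")
    case True
    then obtain x where x: "v = regd n mu x" unfolding V_iff by blast
    show ?thesis
    proof
      fix j
      let ?h = "of_int (hook mu) :: complex"
      have "Psi w0 v j = (\<Sum>g\<in>Sn n. (\<Sum>h\<in>Sn n. x h * of_int (ysym mu (inv h \<circ> g))) / ?h * tensact g w0 j)"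
        using True by (simp add: Psi_def x regd_def)
      also have "\<dots> = (\<Sum>g\<in>Sn n. \<Sum>h\<in>Sn n. x h / ?h * (of_int (ysym mu (inv h \<circ> g)) * tensact g w0 j))"
        by (simp add: sum_divide_distrib sum_distrib_right mult.assoc)
      also have "\<dots> = (\<Sum>h\<in>Sn n. \<Sum>g\<in>Sn n. x h / ?h * (of_int (ysym mu (inv h \<circ> g)) * tensact g w0 j))"
        by (rule sum.swap)
      also have "\<dots> = (\<Sum>h\<in>Sn n. x h / ?h * (?h * tensact h w0 j))"
      proof (rule sum.cong[OF refl])
        fix h assume h: "h \<in> Sn n"
        have "(\<Sum>g\<in>Sn n. of_int (ysym mu (inv h \<circ> g)) * tensact g w0 j)
          = (\<Sum>g\<in>Sn n. of_int (ysym mu (inv h \<circ> (h \<circ> g))) * tensact (h \<circ> g) w0 j)"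
          by (rule sum_Sn_left[OF h, symmetric])
        also have "\<dots> = (\<Sum>g\<in>Sn n. c0 g * tensact g w0 (map (inv h) j))"
          by (intro sum.cong refl) (simp add: Sn_simps(4)[OF h] tensact_tensact[OF h, symmetric] c0_def, simp add: tensact_def)
        also have "\<dots> = ?h * tensact h w0 j"
          using fun_cong[OF t, of "map (inv h) j"] by (simp add: tact_tensact) (simp add: tensact_def)
        finally show "(\<Sum>g\<in>Sn n. x h / ?h * (of_int (ysym mu (inv h \<circ> g)) * tensact g w0 j)) = x h / ?h * (?h * tensact h w0 j)"
          by (simp only: sum_distrib_left[symmetric])
      qed
      also have "\<dots> = f v j" unfolding x fr using hl0(2) by simp
      finally show "f v j = Psi w0 v j" by simp
    qed
  next
    case False
    then show ?thesis using f unfolding hom_space_def Psi_def by auto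
  qed
  then have "f = Psi w0" by (rule ext)
  then show "f \<in> Psi ` range Emap" using wE by blast
next
  fix f assume "f \<in> Psi ` range Emap"
  then obtain w where f: "f = Psi w" and w: "w \<in> range Emap" by blast
  have wt: "w \<in> tensors k n" "pact k la w = (\<lambda>j. of_int (hook la) * w j)" using w unfolding range_Emap by auto
  have "w = pact k la (\<lambda>j. (1 / of_int (hook la)) * w j)"
    unfolding pact_scale wt(2) using hl0(1) by simp
  then have wW: "w \<in> W" unfolding schur_module_pact[OF k] using tensors_scale[OF wt(1)] by blast
  show "f \<in> hom_space (Sym_grp n) regact V tensact W"
    unfolding hom_space_def f
  proof (intro CollectI conjI ballI allI impI)
    fix x assume x: "x \<in> V"
    have "(\<lambda>j. \<Sum>g\<in>Sn n. (x g / of_int (hook mu)) * tensact g w j) \<in> W"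
      by (rule schur_module_sum) (use tensact_W[OF wW] in auto)
    then show "Psi w x \<in> W" unfolding Psi_def using x by (simp only: if_True)
  next
    fix x y assume x: "x \<in> V" "y \<in> V"
    then show "Psi w (x + y) = Psi w x + Psi w y"
      using V_add by (simp add: Psi_def fun_eq_iff add_divide_distrib distrib_right sum.distrib)
  next
    fix c x assume x: "x \<in> V"
    then show "Psi w (\<lambda>i. c * x i) = (\<lambda>j. c * Psi w x j)"
      using V_scale by (simp add: Psi_def fun_eq_iff sum_distrib_left mult.assoc)
  next
    fix x assume "x \<notin> V" then show "Psi w x = 0" by (simp add: Psi_def)
  next
    fix h x assume "h \<in> Sym_grp n" and x: "x \<in> V"
    then have h: "h \<in> Sn n" by (simp add: Sym_grp_def Sn_def)
    show "Psi w (regact h x) = tensact h (Psi w x)"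
    proof
      fix j
      have "Psi w (regact h x) j = (\<Sum>g\<in>Sn n. (x (inv h \<circ> g) / of_int (hook mu)) * tensact g w j)"
        using V_regact[OF x h] by (simp add: Psi_def) (simp add: regact_def)
      also have "\<dots> = (\<Sum>g\<in>Sn n. (x (inv h \<circ> (h \<circ> g)) / of_int (hook mu)) * tensact (h \<circ> g) w j)"
        by (rule sum_Sn_left[OF h, symmetric])
      also have "\<dots> = tensact h (Psi w x) j"
        using x by (simp add: Sn_simps(4)[OF h] tensact_tensact[OF h, symmetric]) (simp add: tensact_def Psi_def)
      finally show "Psi w (regact h x) j = tensact h (Psi w x) j" .
    qed
  qed
qed

text \<open>The dimension is the rank of the idempotent \<open>Emap\<close>, hence its trace, and
  the trace expands into fixed-point counts.\<close>

lemma rcoef_trace: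
  "int (rcoef la mu) * hook la * hook mu
    = (\<Sum>\<sigma>\<in>Sn k. \<Sum>g\<in>Sn n. ysym la \<sigma> * ysym mu g * int (Fix k n \<sigma> g))"
proof -
  interpret fv: vector_space "\<lambda>(c::complex) v (i::nat list). c * v i" by (rule vector_space_fun)
  have sub: "fv.subspace (range Emap)"
  proof (rule fv.subspaceI)
    have z: "0 \<in> tensors k n" by (simp add: tensors_iff)
    show "0 \<in> range Emap" unfolding range_Emap using z by (simp add: pact_def tact_def fun_eq_iff)
    fix x y assume "x \<in> range Emap" "y \<in> range Emap"
    then show "x + y \<in> range Emap" unfolding range_Emap
      by (simp add: tensors_iff pact_def tact_def fun_eq_iff distrib_left sum.distrib)
  next
    fix c x assume "x \<in> range Emap"
    then show "(\<lambda>i. c * x i) \<in> range Emap" unfolding range_Emap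
      by (simp add: tensors_scale pact_scale tact_scale mult.left_commute)
  qed
  have inj: "inj_on Psi (range Emap)"
  proof (rule inj_onI)
    fix x y assume xy: "x \<in> range Emap" "y \<in> range Emap" "Psi x = Psi y"
    have "Psi x c0 = x" "Psi y c0 = y" using xy(1,2) Psi_c0 unfolding range_Emap by auto
    then show "x = y" using xy(3) by metis
  qed
  have "rcoef la mu = vector_space.dim (\<lambda>c f x y. c * f x y) (Psi ` range Emap)"
    unfolding rcoef_def hom_dim_def n[symmetric] hom_space_Psi ..
  also have "\<dots> = fv.dim (range Emap)"
    by (rule dim_linear_inj_image[OF Psi_linear inj sub])
  finally have "of_nat (rcoef la mu) = (\<Sum>w\<in>words k n. Mmat w w)"
    using dim_range_idempotent[of "words k n" Emap Mmat] Emap_matrix Emap_idem by simp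
  then have "of_int (hook la) * of_int (hook mu) * of_nat (rcoef la mu)
    = (\<Sum>\<sigma>\<in>Sn k. \<Sum>g\<in>Sn n. of_int (dsym la \<sigma>) * of_int (ysym mu g) * of_nat (Fix k n \<sigma> g) :: complex)"
    using trace_Mmat by simp
  then have "(of_int (hook la * hook mu * int (rcoef la mu)) :: complex)
    = of_int (\<Sum>\<sigma>\<in>Sn k. \<Sum>g\<in>Sn n. dsym la \<sigma> * ysym mu g * int (Fix k n \<sigma> g))" by simp
  then have "hook la * hook mu * int (rcoef la mu) = (\<Sum>\<sigma>\<in>Sn k. \<Sum>g\<in>Sn n. dsym la \<sigma> * ysym mu g * int (Fix k n \<sigma> g))"
    by (simp only: of_int_eq_iff)
  also have "\<dots> = (\<Sum>\<sigma>\<in>Sn k. of_int (dsym la \<sigma>) * (\<Sum>g\<in>Sn n. ysym mu g * int (Fix k n \<sigma> g)))"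
    by (simp add: sum_distrib_left mult.assoc)
  \<comment> \<open>Fixed-point counts are class functions of the place permutation, and these do
    not distinguish b a from a b.\<close>
  also have "\<dots> = (\<Sum>\<sigma>\<in>Sn k. of_int (ysym la \<sigma>) * (\<Sum>g\<in>Sn n. ysym mu g * int (Fix k n \<sigma> g)))"
  proof (rule sum_dsym_class[OF la k])
    fix s z assume s: "s \<in> Sn k" "z \<in> Sn k"
    have "Fix k n (z \<circ> s \<circ> inv z) g = Fix k n s g" if "g \<in> Sn n" for g
      using Fix_conj[OF s(1) that s(2) Sn_id] by simp
    then show "(\<Sum>g\<in>Sn n. ysym mu g * int (Fix k n (z \<circ> s \<circ> inv z) g)) = (\<Sum>g\<in>Sn n. ysym mu g * int (Fix k n s g))"
      by simp
  qed
  also have "\<dots> = (\<Sum>\<sigma>\<in>Sn k. \<Sum>g\<in>Sn n. ysym la \<sigma> * ysym mu g * int (Fix k n \<sigma> g))"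
    by (simp add: sum_distrib_left mult.assoc)
  finally show ?thesis by (simp add: mult_ac)
qed

end

section \<open>Evaluation at a permutation\<close>

text \<open>\<open>chi n \<tau> la\<close> is the character of the Schur functor of \<open>la\<close> on \<open>C^n\<close> at \<open>\<tau>\<close>.\<close>

definition chi :: "nat \<Rightarrow> (nat \<Rightarrow> nat) \<Rightarrow> nat list \<Rightarrow> real" where
  "chi n \<tau> la = (\<Sum>\<sigma>\<in>Sn (sum_list la). of_int (ysym la \<sigma>) * real (Fix (sum_list la) n \<sigma> \<tau>)) / of_int (hook la)"

lemma chi_class:
  assumes "\<tau> \<in> Sn n" "w \<in> Sn n"
  shows "chi n (w \<circ> \<tau> \<circ> inv w) la = chi n \<tau> la"
proof -
  have "Fix (sum_list la) n \<sigma> (w \<circ> \<tau> \<circ> inv w) = Fix (sum_list la) n \<sigma> \<tau>" if "\<sigma> \<in> Sn (sum_list la)" for \<sigma>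
    using Fix_conj[OF that assms(1) Sn_id assms(2)] by simp
  then show ?thesis by (simp add: chi_def)
qed

text \<open>\<open>rcoef_trace\<close> identifies \<open>rcoef la mu\<close> with the sum of
  \<open>ysym mu\<close> against the class function \<open>chi\<close>, divided by the hook, and the
  coefficient of s_mu at x^\<alpha> is a Kostka number; Young's rule adds these products up to an
  average.\<close>

lemma Fs_avg:
  assumes la: "is_partition la" and \<alpha>: "fin_mono \<alpha>" and bl: "content {0..<n} bl = \<alpha>"
  shows "of_int (Fs la \<alpha>) = (\<Sum>\<tau>\<in>Yg {0..<n} bl. chi n \<tau> la) / real (card (Yg {0..<n} bl))"
proof -
  have n: "deg \<alpha> = n" using deg_content[of "{0..<n}" bl] bl by simp
  have P: "{mu. is_partition mu \<and> sum_list mu = deg \<alpha>} = parts n" by (simp add: parts_def n)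
  have "real_of_int (Fs la \<alpha>) = (\<Sum>mu\<in>parts n. real (rcoef la mu) * real (kost (pf mu) \<alpha>))"
    unfolding Fs_def P by (simp add: schur_kost[OF \<alpha>])
  also have "\<dots> = (\<Sum>mu\<in>parts n. real (kost (pf mu) (content {0..<n} bl)) * ((\<Sum>\<tau>\<in>Sn n. of_int (ysym mu \<tau>) * chi n \<tau> la) / of_int (hook mu)))"
  proof (rule sum.cong[OF refl])
    fix mu assume mu: "mu \<in> parts n"
    let ?k = "sum_list la"
    have hl: "real_of_int (hook la) \<noteq> 0" "real_of_int (hook mu) \<noteq> 0"
      using hook_pos[of la ?k] hook_pos[OF mu] la by (auto simp: parts_def)
    have "(\<Sum>\<tau>\<in>Sn n. of_int (ysym mu \<tau>) * chi n \<tau> la)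
      = (\<Sum>\<tau>\<in>Sn n. \<Sum>\<sigma>\<in>Sn ?k. of_int (ysym mu \<tau>) * (of_int (ysym la \<sigma>) * real (Fix ?k n \<sigma> \<tau>))) / of_int (hook la)"
      by (simp add: chi_def sum_divide_distrib sum_distrib_left)
    also have "(\<Sum>\<tau>\<in>Sn n. \<Sum>\<sigma>\<in>Sn ?k. of_int (ysym mu \<tau>) * (of_int (ysym la \<sigma>) * real (Fix ?k n \<sigma> \<tau>)))
      = (\<Sum>\<sigma>\<in>Sn ?k. \<Sum>\<tau>\<in>Sn n. of_int (ysym la \<sigma>) * of_int (ysym mu \<tau>) * real (Fix ?k n \<sigma> \<tau>))"
      by (subst sum.swap) (simp add: mult_ac)
    also have "\<dots> = real_of_int (\<Sum>\<sigma>\<in>Sn ?k. \<Sum>\<tau>\<in>Sn n. ysym la \<sigma> * ysym mu \<tau> * int (Fix ?k n \<sigma> \<tau>))" by simp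
    also have "\<dots> = of_int (int (rcoef la mu) * hook la * hook mu)"
      using rcoef_trace[OF la _ refl, of mu n] mu by (simp add: parts_def)
    finally show "real (rcoef la mu) * real (kost (pf mu) \<alpha>)
      = real (kost (pf mu) (content {0..<n} bl)) * ((\<Sum>\<tau>\<in>Sn n. of_int (ysym mu \<tau>) * chi n \<tau> la) / of_int (hook mu))"
      using hl bl by simp
  qed
  also have "\<dots> = (\<Sum>\<tau>\<in>Yg {0..<n} bl. chi n \<tau> la) / real (card (Yg {0..<n} bl))"
    by (rule young_rule[symmetric]) (rule chi_class)
  finally show ?thesis .
qed

text \<open>Values are prescribed on Schur functions because F is given there; multiplicativity
  becomes visible only on the products \<open>hl\<close>.\<close>

definition psi :: "nat \<Rightarrow> (nat \<Rightarrow> nat) \<Rightarrow> int mps \<Rightarrow> real" where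
  "psi n \<tau> = (SOME L. (\<forall>f\<in>Lam. \<forall>g\<in>Lam. L (f + g) = L f + L g) \<and> (\<forall>la. is_partition la \<longrightarrow> L (ss (pf la)) = chi n \<tau> la))"

lemma additive_extension_parts:
  fixes v :: "nat list \<Rightarrow> 'v::comm_ring_1"
  shows "\<exists>L. (\<forall>f\<in>Lam. \<forall>g\<in>Lam. L (f + g) = L f + L g) \<and> (\<forall>la. is_partition la \<longrightarrow> L (ss (pf la)) = v la)"
proof -
  define v' where "v' p = v (THE la. is_partition la \<and> pf la = p)" for p
  have "(THE mu. is_partition mu \<and> pf mu = pf la) = la" if "is_partition la" for la
    by (rule the_equality) (use that pf_inj_partition in auto)
  then have "v' (pf la) = v la" if "is_partition la" for la using that by (simp add: v'_def)
  then show ?thesis using additive_extension[of v'] is_pf_pf by metis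
qed

lemma psi_add: "f \<in> Lam \<Longrightarrow> g \<in> Lam \<Longrightarrow> psi n \<tau> (f + g) = psi n \<tau> f + psi n \<tau> g"
  and psi_ss: "is_partition la \<Longrightarrow> psi n \<tau> (ss (pf la)) = chi n \<tau> la"
  using someI_ex[OF additive_extension_parts[of "chi n \<tau>"]] unfolding psi_def[symmetric] by blast+

lemma psi_0 [simp]: "psi n \<tau> 0 = 0"
  using psi_add[OF Lam_0 Lam_0, of n \<tau>] by simp

lemma psi_uminus: "f \<in> Lam \<Longrightarrow> psi n \<tau> (- f) = - psi n \<tau> f"
  using psi_add[of f "- f" n \<tau>] Lam_uminus[of f] by simp

lemma psi_diff: "f \<in> Lam \<Longrightarrow> g \<in> Lam \<Longrightarrow> psi n \<tau> (f - g) = psi n \<tau> f - psi n \<tau> g"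
  using psi_add[of f "- g" n \<tau>] psi_uminus[of g n \<tau>] Lam_uminus[of g] by simp

lemma psi_sum: "(\<And>x. x \<in> S \<Longrightarrow> F x \<in> Lam) \<Longrightarrow> psi n \<tau> (sum F S) = (\<Sum>x\<in>S. psi n \<tau> (F x))"
  by (induction S rule: infinite_finite_induct) (auto simp: psi_add Lam_sum)

lemma Lam_of_nat_mult: "f \<in> Lam \<Longrightarrow> of_nat m * f \<in> Lam"
  by (induction m) (auto simp: distrib_right intro: Lam_0 Lam_add)

lemma psi_of_nat_mult: "f \<in> Lam \<Longrightarrow> psi n \<tau> (of_nat m * f) = real m * psi n \<tau> f"
  by (induction m) (auto simp: distrib_right psi_add Lam_of_nat_mult)

subsection \<open>Invariant multisets\<close>

text \<open>Multisets of m letters fixed by \<tau>. They index the fixed monomials, so their number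
  is the trace of \<tau> on the m-th symmetric power of C^n.\<close>

definition Qset :: "nat \<Rightarrow> (nat \<Rightarrow> nat) \<Rightarrow> nat \<Rightarrow> mono set" where
  "Qset n \<tau> m = {\<gamma>. (\<forall>y\<ge>n. \<gamma> y = 0) \<and> (\<forall>y<n. \<gamma> (\<tau> y) = \<gamma> y) \<and> (\<Sum>y<n. \<gamma> y) = m}"

lemma content_exists:
  assumes "fin_mono \<alpha>"
  shows "\<exists>f. content {0..<deg \<alpha>} f = \<alpha>"
proof -
  let ?X = "{0..<deg \<alpha>}" and ?A = "{i. \<alpha> i \<noteq> 0}"
  have A: "finite ?A" using assms by (simp add: fin_mono_def)
  define Z where "Z = (\<lambda>(j::nat, y). if j = 0 then \<alpha> y else 0)"
  have Z0: "y \<notin> ?A \<Longrightarrow> Z (j, y) = 0" for j y by (simp add: Z_def)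
  have Zs: "(\<Sum>y\<in>?A. Z (j, y)) = content ?X (\<lambda>_. 0) j" for j
    by (cases "j = 0") (auto simp: Z_def content_def deg_def)
  obtain g where g: "ty ?X (\<lambda>_. 0) g = Z" using ty_realize[OF _ A Z0 Zs] by auto
  have "content ?X g y = \<alpha> y" for y
    using ty_col_sum[of ?X "{0}" "\<lambda>_. 0::nat" g y] g by (simp add: Z_def)
  then show ?thesis by blast
qed

lemma card_list_all2: "card {gs. list_all2 (\<lambda>b \<gamma>. \<gamma> \<in> S b) bs gs} = prod_list (map (\<lambda>b. card (S b)) bs)"
proof (induction bs)
  case (Cons b bs)
  have "{gs. list_all2 (\<lambda>b \<gamma>. \<gamma> \<in> S b) (b # bs) gs} = (\<lambda>(g, gs). g # gs) ` (S b \<times> {gs. list_all2 (\<lambda>b \<gamma>. \<gamma> \<in> S b) bs gs})"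
    by (auto simp: list_all2_Cons1)
  moreover have "inj_on (\<lambda>(g, gs). g # gs) (S b \<times> {gs. list_all2 (\<lambda>b \<gamma>. \<gamma> \<in> S b) bs gs})"
    by (auto simp: inj_on_def)
  ultimately show ?case using Cons by (simp add: card_image card_cartesian_product)
qed simp

lemma Fix_funcset:
  assumes "\<sigma> \<in> Sn k" "\<tau> \<in> Sn n"
  shows "Fix k n \<sigma> \<tau> = card {g \<in> {0..<k} \<rightarrow>\<^sub>E {0..<n}. g \<circ> \<sigma> = restrict (\<tau> \<circ> g) {0..<k}}"
proof -
  have eq: "wact \<sigma> \<tau> w = w \<longleftrightarrow> restrict (nth w) {0..<k} \<circ> \<sigma> = restrict (\<tau> \<circ> restrict (nth w) {0..<k}) {0..<k}"
    if w: "w \<in> words k n" for w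
  proof -
    have l: "length w = k" using w by (simp add: words_def)
    have n1: "wact \<sigma> \<tau> w ! i = inv \<tau> (w ! \<sigma> i)" if "i < k" for i
      using permute_list_nth[of \<sigma> "map (inv \<tau>) w" i] Sn_permutes_lt[OF assms(1)] l that Sn_apply[OF assms(1), of i]
      by (simp add: wact_def)
    have i: "inv \<tau> a = b \<longleftrightarrow> a = \<tau> b" for a b using Sn_inv_apply[OF assms(2)] by metis
    have "wact \<sigma> \<tau> w = w \<longleftrightarrow> (\<forall>i<k. wact \<sigma> \<tau> w ! i = w ! i)"
      using l by (auto simp: list_eq_iff_nth_eq wact_def)
    also have "\<dots> \<longleftrightarrow> (\<forall>i<k. w ! \<sigma> i = \<tau> (w ! i))" using n1 i by simp
    also have "\<dots> \<longleftrightarrow> restrict (nth w) {0..<k} \<circ> \<sigma> = restrict (\<tau> \<circ> restrict (nth w) {0..<k}) {0..<k}"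
      using Sn_apply[OF assms(1)] by (auto simp: fun_eq_iff restrict_def)
    finally show ?thesis .
  qed
  have "bij_betw (\<lambda>w. restrict (nth w) {0..<k}) {w \<in> words k n. wact \<sigma> \<tau> w = w}
    {g \<in> {0..<k} \<rightarrow>\<^sub>E {0..<n}. g \<circ> \<sigma> = restrict (\<tau> \<circ> g) {0..<k}}"
  proof (rule bij_betw_byWitness[where f'="\<lambda>g. map g [0..<k]"]; (intro ballI image_subsetI)?)
    fix w assume w: "w \<in> {w \<in> words k n. wact \<sigma> \<tau> w = w}"
    then have l: "length w = k" "set w \<subseteq> {0..<n}" by (auto simp: words_def)
    show "map (restrict (nth w) {0..<k}) [0..<k] = w" using l by (auto intro: nth_equalityI)
    have "restrict (nth w) {0..<k} \<in> {0..<k} \<rightarrow>\<^sub>E {0..<n}" using l nth_mem by fastforce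
    then show "restrict (nth w) {0..<k} \<in> {g \<in> {0..<k} \<rightarrow>\<^sub>E {0..<n}. g \<circ> \<sigma> = restrict (\<tau> \<circ> g) {0..<k}}"
      using eq w by auto
  next
    fix g assume g: "g \<in> {g \<in> {0..<k} \<rightarrow>\<^sub>E {0..<n}. g \<circ> \<sigma> = restrict (\<tau> \<circ> g) {0..<k}}"
    show r: "restrict (nth (map g [0..<k])) {0..<k} = g"
      using g by (auto simp: fun_eq_iff restrict_def PiE_def extensional_def)
    have w: "map g [0..<k] \<in> words k n" using g by (auto simp: words_def)
    show "map g [0..<k] \<in> {w \<in> words k n. wact \<sigma> \<tau> w = w}"
      using w eq[OF w] g unfolding r by simp
  qed
  then show ?thesis unfolding Fix_def by (rule bij_betw_same_card)
qed

text \<open>Orbit counting twisted by \<tau>: modulo place permutations inside the blocks a word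
  becomes a tuple of multisets of letters, one for each block, and the orbits preserved by \<tau>
  are the tuples of multisets fixed by \<tau>.\<close>

lemma sum_Fix_Yg:
  assumes \<tau>: "\<tau> \<in> Sn n" and f: "content {0..<k} f = pf bs" and k: "k = sum_list bs"
  shows "(\<Sum>\<sigma>\<in>Yg {0..<k} f. Fix k n \<sigma> \<tau>) = card (Yg {0..<k} f) * prod_list (map (\<lambda>b. card (Qset n \<tau> b)) bs)"
proof -
  let ?X = "{0..<k}" and ?A = "{0..<n}" and ?m = "length bs"
  let ?Y = "Yg ?X f" and ?W = "?X \<rightarrow>\<^sub>E ?A"
  define tw where "tw g = restrict (\<tau> \<circ> g) ?X" for g :: "nat \<Rightarrow> nat"
  have fY: "finite ?Y" and fW: "finite ?W" by (auto intro: finite_PiE)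
  have inv: "\<tau> a = b \<longleftrightarrow> a = inv \<tau> b" for a b using Sn_inv_apply[OF \<tau>] by metis
  have ty_tw: "ty ?X f (tw g) (j, y) = ty ?X f g (j, inv \<tau> y)" for g :: "nat \<Rightarrow> nat" and j y
  proof -
    have "{x \<in> ?X. (f x, tw g x) = (j, y)} = {x \<in> ?X. (f x, g x) = (j, inv \<tau> y)}"
      by (auto simp: tw_def inv)
    then show ?thesis by (simp only: ty_def content_def)
  qed
  have "(\<Sum>\<sigma>\<in>?Y. Fix k n \<sigma> \<tau>) = (\<Sum>\<sigma>\<in>?Y. \<Sum>g\<in>?W. if g \<circ> \<sigma> = tw g then 1 else 0)"
    using Fix_funcset[OF Yg_Sn \<tau>] fW by (intro sum.cong refl) (simp add: tw_def sum.If_cases Int_def)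
  also have "\<dots> = (\<Sum>g\<in>?W. \<Sum>\<sigma>\<in>?Y. if g \<circ> \<sigma> = tw g then 1 else 0)" by (rule sum.swap)
  also have "\<dots> = (\<Sum>g\<in>?W. card {\<sigma> \<in> ?Y. g \<circ> \<sigma> = tw g})"
    using fY by (simp add: sum.If_cases Int_def)
  also have "\<dots> = card ?Y * card (ty ?X f ` {g \<in> ?W. ty ?X f (tw g) = ty ?X f g})"
  proof (rule twisted_orbit_count)
    fix g :: "nat \<Rightarrow> nat" and \<sigma> assume g: "g \<in> ?W" and s: "\<sigma> \<in> ?Y"
    have p: "\<sigma> permutes ?X" using s by (rule Yg_permutes)
    show "g \<circ> \<sigma> \<in> ?W" using g permutes_in_image[OF p] permutes_not_in[OF p]
      by (auto simp: PiE_def extensional_def Pi_def)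
  next
    fix g h :: "nat \<Rightarrow> nat" assume "ty ?X f g = ty ?X f h"
    then show "ty ?X f (tw g) = ty ?X f (tw h)" by (auto simp: fun_eq_iff ty_tw)
  qed (use fW in \<open>auto simp: PiE_def tw_def\<close>)
  also have "card (ty ?X f ` {g \<in> ?W. ty ?X f (tw g) = ty ?X f g}) = card {gs. list_all2 (\<lambda>b \<gamma>. \<gamma> \<in> Qset n \<tau> b) bs gs}"
  proof -
    let ?W' = "{g \<in> ?W. ty ?X f (tw g) = ty ?X f g}"
    define \<Theta> where "\<Theta> Z = map (\<lambda>j y. Z (j, y)) [0..<?m]" for Z :: "nat \<times> nat \<Rightarrow> nat"
    have f_lt: "f x < ?m" if "x \<in> ?X" for x
    proof (rule ccontr)
      assume "\<not> f x < ?m"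
      then have "card {x' \<in> ?X. f x' = f x} = 0" using f by (auto simp: content_def pf_def fun_eq_iff)
      then show False using that by auto
    qed
    have "inj_on \<Theta> (ty ?X f ` ?W')"
    proof (rule inj_onI)
      fix Z Z' assume Z: "Z \<in> ty ?X f ` ?W'" "Z' \<in> ty ?X f ` ?W'" "\<Theta> Z = \<Theta> Z'"
      have z: "U (j, y) = 0" if "U \<in> ty ?X f ` ?W'" "\<not> j < ?m" for U j y
      proof -
        from that(1) obtain g where g: "U = ty ?X f g" by blast
        have "{x \<in> ?X. (f x, g x) = (j, y)} = {}" using that(2) f_lt by auto
        then show ?thesis by (simp only: g ty_def content_def card.empty)
      qed
      have "Z (j, y) = Z' (j, y)" for j y
      proof (cases "j < ?m")
        case True
        then have "(\<Theta> Z ! j) y = (\<Theta> Z' ! j) y" using Z(3) by simp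
        then show ?thesis using True by (simp add: \<Theta>_def)
      qed (use z[OF Z(1)] z[OF Z(2)] in simp)
      then show "Z = Z'" by (auto simp: fun_eq_iff)
    qed
    moreover have "\<Theta> ` (ty ?X f ` ?W') = {gs. list_all2 (\<lambda>b \<gamma>. \<gamma> \<in> Qset n \<tau> b) bs gs}"
    proof (intro equalityI subsetI)
      fix gs assume "gs \<in> \<Theta> ` (ty ?X f ` ?W')"
      then obtain g where g: "g \<in> ?W" "ty ?X f (tw g) = ty ?X f g" "gs = \<Theta> (ty ?X f g)" by auto
      have "(\<lambda>y. ty ?X f g (j, y)) \<in> Qset n \<tau> (bs ! j)" if j: "j < ?m" for j
      proof -
        have "ty ?X f g (j, y) = 0" if "y \<ge> n" for y
        proof -
          have "{x \<in> ?X. (f x, g x) = (j, y)} = {}"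
          proof (rule equals0I)
            fix x assume "x \<in> {x \<in> ?X. (f x, g x) = (j, y)}"
            then have x: "x \<in> ?X" "g x = y" by auto
            then have "g x \<in> ?A" using g(1) by blast
            then show False using x(2) \<open>y \<ge> n\<close> by simp
          qed
          then show ?thesis by (simp only: ty_def content_def card.empty)
        qed
        moreover have "ty ?X f g (j, \<tau> y) = ty ?X f g (j, y)" for y
          using ty_tw[of g j "\<tau> y"] g(2) Sn_inv_apply(2)[OF \<tau>] by simp
        moreover have "(\<Sum>y\<in>?A. ty ?X f g (j, y)) = content ?X f j"
          by (rule ty_row_sum) (use g(1) in auto)
        ultimately show ?thesis using f j by (simp add: Qset_def pf_def atLeast0LessThan)
      qed
      then show "gs \<in> {gs. list_all2 (\<lambda>b \<gamma>. \<gamma> \<in> Qset n \<tau> b) bs gs}"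
        by (simp add: g(3) \<Theta>_def list_all2_conv_all_nth)
    next
      fix gs assume gs: "gs \<in> {gs. list_all2 (\<lambda>b \<gamma>. \<gamma> \<in> Qset n \<tau> b) bs gs}"
      then have l: "length gs = ?m" and r: "\<And>j. j < ?m \<Longrightarrow> gs ! j \<in> Qset n \<tau> (bs ! j)"
        by (auto simp: list_all2_conv_all_nth)
      define Z where "Z = (\<lambda>(j, y). if j < ?m then (gs ! j) y else 0)"
      have Z0: "Z (j, y) = 0" if "y \<notin> ?A" for j y
        using r[of j] that by (auto simp: Z_def Qset_def)
      have Zs: "(\<Sum>y\<in>?A. Z (j, y)) = content ?X f j" for j
        using r[of j] f by (auto simp: Z_def Qset_def pf_def atLeast0LessThan)
      obtain g where g: "g \<in> ?W" "ty ?X f g = Z" using ty_realize[OF _ _ Z0 Zs] by auto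
      have "Z (j, inv \<tau> y) = Z (j, y)" for j y
      proof (cases "j < ?m")
        case True
        have q: "\<forall>y\<ge>n. (gs ! j) y = 0" "\<forall>y<n. (gs ! j) (\<tau> y) = (gs ! j) y" using r[OF True] by (auto simp: Qset_def)
        show ?thesis
        proof (cases "y < n")
          case T: True
          then have "inv \<tau> y < n" using Sn_apply[OF Sn_inv[OF \<tau>]] by simp
          then show ?thesis using q(2)[rule_format, of "inv \<tau> y"] Sn_inv_apply(1)[OF \<tau>, of y] True by (simp add: Z_def)
        next
          case False
          then have "\<not> inv \<tau> y < n" using Sn_apply[OF Sn_inv[OF \<tau>]] by simp
          then show ?thesis using q(1) False True by (simp add: Z_def)
        qed
      qed (simp add: Z_def)
      then have "ty ?X f (tw g) = ty ?X f g" by (auto simp: fun_eq_iff ty_tw g(2))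
      moreover have "\<Theta> Z = gs" using l by (intro nth_equalityI) (auto simp: \<Theta>_def Z_def)
      ultimately show "gs \<in> \<Theta> ` (ty ?X f ` ?W')" using g by blast
    qed
    ultimately show ?thesis using card_image by fastforce
  qed
  finally show ?thesis by (simp add: card_list_all2)
qed

text \<open>Young's rule for S_k permuting places, with fixed-point counts as class function: the
  Kostka expansion of \<open>hl bs\<close> matches its right-hand side, so the value is an average
  over a Young subgroup with block sizes \<open>bs\<close>.\<close>

lemma psi_hl:
  assumes \<tau>: "\<tau> \<in> Sn n"
  shows "psi n \<tau> (hl bs) = real (prod_list (map (\<lambda>b. card (Qset n \<tau> b)) bs))"
proof -
  define k where "k = sum_list bs"
  obtain f where f: "content {0..<k} f = pf bs" using content_exists[OF fin_mono_pf[of bs]] unfolding k_def deg_pf by blast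
  have "hl bs = (\<Sum>p\<in>pfs k. of_nat (kost p (pf bs)) * ss p)" unfolding k_def by (rule hl_kost)
  also have "\<dots> = (\<Sum>la\<in>parts k. of_nat (kost (pf la) (pf bs)) * ss (pf la))"
    by (rule sum.reindex_bij_betw[OF bij_pf_parts, symmetric])
  finally have "psi n \<tau> (hl bs) = (\<Sum>la\<in>parts k. psi n \<tau> (of_nat (kost (pf la) (pf bs)) * ss (pf la)))"
    by (simp, subst psi_sum) (auto simp: parts_def is_pf_pf intro!: Lam_of_nat_mult Lam_ss)
  also have "\<dots> = (\<Sum>la\<in>parts k. real (kost (pf la) (content {0..<k} f)) * ((\<Sum>\<sigma>\<in>Sn k. of_int (ysym la \<sigma>) * real (Fix k n \<sigma> \<tau>)) / of_int (hook la)))"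
    by (intro sum.cong refl) (auto simp: psi_of_nat_mult Lam_ss is_pf_pf psi_ss chi_def f parts_def)
  also have "\<dots> = (\<Sum>\<sigma>\<in>Yg {0..<k} f. real (Fix k n \<sigma> \<tau>)) / real (card (Yg {0..<k} f))"
  proof (rule young_rule[symmetric])
    fix g w assume "g \<in> Sn k" "w \<in> Sn k"
    then show "real (Fix k n (w \<circ> g \<circ> inv w) \<tau>) = real (Fix k n g \<tau>)"
      using Fix_conj[OF _ \<tau> _ Sn_id, of g k w] by simp
  qed
  also have "\<dots> = real (\<Sum>\<sigma>\<in>Yg {0..<k} f. Fix k n \<sigma> \<tau>) / real (card (Yg {0..<k} f))" by simp
  also have "\<dots> = real (prod_list (map (\<lambda>b. card (Qset n \<tau> b)) bs))"
    unfolding sum_Fix_Yg[OF \<tau> f k_def] by (simp add: Yg_nonempty)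
  finally show ?thesis .
qed

lemma Lam_eq_addspan_hl: "Lam \<subseteq> addspan (range hl)"
proof
  fix f assume "f \<in> Lam"
  then obtain d where "symm f" "bdd d f" by (auto simp: Lam_def)
  then have "f \<in> addspan (hl ` {bs. sum_list bs \<le> d})" by (rule Lam_hl_addspan)
  moreover have "hl ` {bs. sum_list bs \<le> d} \<subseteq> addspan (range hl)" by (auto intro: addspan_base)
  ultimately show "f \<in> addspan (range hl)" using addspan_subset by blast
qed

lemma addspan_hl_Lam: "f \<in> addspan (range hl) \<Longrightarrow> f \<in> Lam"
  using Lam_addspan[of "range hl"] Lam_hl by blast

lemma hl_append: "hl (bs @ cs) = hl bs * hl cs"
  by (simp add: hl_def)

text \<open>On products of complete functions the value is a product over the factors, and
  \<open>hl\<close> turns concatenation into multiplication; additivity in each argument carries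
  this to all of \<open>Lam\<close>.\<close>

lemma psi_mult:
  assumes \<tau>: "\<tau> \<in> Sn n" and f: "f \<in> Lam" and g: "g \<in> Lam"
  shows "psi n \<tau> (f * g) = psi n \<tau> f * psi n \<tau> g"
proof -
  have 1: "psi n \<tau> (f * hl cs) = psi n \<tau> f * psi n \<tau> (hl cs)" if "f \<in> addspan (range hl)" for f cs
    using that
  proof (induction f rule: addspan.induct)
    case (plus x b)
    then obtain bs where b: "b = hl bs" by blast
    show ?case using plus psi_hl[OF \<tau>] addspan_hl_Lam[OF plus.hyps(1)]
      by (simp add: b distrib_right psi_add Lam_mult Lam_hl hl_append[symmetric])
  next
    case (minus x b)
    then obtain bs where b: "b = hl bs" by blast
    show ?case using minus psi_hl[OF \<tau>] addspan_hl_Lam[OF minus.hyps(1)]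
      by (simp add: b left_diff_distrib psi_diff Lam_mult Lam_hl hl_append[symmetric])
  qed simp
  have "psi n \<tau> (f * g) = psi n \<tau> f * psi n \<tau> g" if "g \<in> addspan (range hl)" for g
    using that
  proof (induction g rule: addspan.induct)
    case (plus x b)
    then obtain bs where b: "b = hl bs" by blast
    show ?case using plus 1[of f bs] f Lam_eq_addspan_hl addspan_hl_Lam[OF plus.hyps(1)]
      by (auto simp: b distrib_left psi_add Lam_mult Lam_hl)
  next
    case (minus x b)
    then obtain bs where b: "b = hl bs" by blast
    show ?case using minus 1[of f bs] f Lam_eq_addspan_hl addspan_hl_Lam[OF minus.hyps(1)]
      by (auto simp: b right_diff_distrib psi_diff Lam_mult Lam_hl)
  qed simp
  then show ?thesis using g Lam_eq_addspan_hl by blast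
qed

lemma psi_hh: "\<tau> \<in> Sn n \<Longrightarrow> psi n \<tau> (hh m) = real (card (Qset n \<tau> m))"
  using psi_hl[of \<tau> n "[m]"] by (simp add: hl_def)

lemma psi_1: "\<tau> \<in> Sn n \<Longrightarrow> psi n \<tau> 1 = 1"
  using psi_hl[of \<tau> n "[]"] by (simp add: hl_def)

subsection \<open>The map F\<close>

definition FF :: "int mps \<Rightarrow> int mps" where
  "FF = (SOME L. (\<forall>f\<in>Lam. \<forall>g\<in>Lam. L (f + g) = L f + L g) \<and> (\<forall>la. is_partition la \<longrightarrow> L (ss (pf la)) = mk (Fs la)))"

lemma FF_add: "f \<in> Lam \<Longrightarrow> g \<in> Lam \<Longrightarrow> FF (f + g) = FF f + FF g"
  and FF_ss: "is_partition la \<Longrightarrow> FF (ss (pf la)) = mk (Fs la)"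
  using someI_ex[OF additive_extension_parts[of "\<lambda>la. mk (Fs la)"]] unfolding FF_def[symmetric] by blast+

lemma FF_0: "FF 0 = 0"
  using FF_add[OF Lam_0 Lam_0] by simp

lemma FF_diff: "f \<in> Lam \<Longrightarrow> g \<in> Lam \<Longrightarrow> FF (f - g) = FF f - FF g"
  using FF_add[of "f - g" g] Lam_diff[of f g] by (simp add: algebra_simps)

lemma Lam_addspan_parts: "Lam \<subseteq> addspan (ss ` pf ` {la. is_partition la})"
proof -
  have "{p. is_pf p} = pf ` {la. is_partition la}"
    using partition_list_exists is_pf_pf by fastforce
  then show ?thesis using Lam_addspan_ss by simp
qed

lemma addspan_parts_Lam: "f \<in> addspan (ss ` pf ` {la. is_partition la}) \<Longrightarrow> f \<in> Lam"
  using Lam_addspan[of "ss ` pf ` {la. is_partition la}"] Lam_ss is_pf_pf by blast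

lemma FF_avg:
  assumes f: "f \<in> Lam" and \<alpha>: "fin_mono \<alpha>" and bl: "content {0..<n} bl = \<alpha>"
  shows "of_int (cf (FF f) \<alpha>) = (\<Sum>\<tau>\<in>Yg {0..<n} bl. psi n \<tau> f) / real (card (Yg {0..<n} bl))"
proof -
  have "f \<in> addspan (ss ` pf ` {la. is_partition la})" using f Lam_addspan_parts by blast
  then show ?thesis
  proof (induction f rule: addspan.induct)
    case zero
    then show ?case by (simp add: FF_0)
  next
    case (plus x b)
    then obtain la where b: "b = ss (pf la)" "is_partition la" by blast
    then show ?case using plus.IH addspan_parts_Lam[OF plus.hyps(1)] Fs_avg[OF b(2) \<alpha> bl] \<alpha>
      by (simp add: FF_add psi_add Lam_ss is_pf_pf FF_ss psi_ss sum.distrib add_divide_distrib)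
  next
    case (minus x b)
    then obtain la where b: "b = ss (pf la)" "is_partition la" by blast
    then show ?case using minus.IH addspan_parts_Lam[OF minus.hyps(1)] Fs_avg[OF b(2) \<alpha> bl] \<alpha>
      by (simp add: FF_diff psi_diff Lam_ss is_pf_pf FF_ss psi_ss sum_subtractf diff_divide_distrib)
  qed
qed

lemma cf_plus: "cf (f + g) = cf f + cf g"
  by (rule ext) simp

lemma Fs_fin: "cf (mk (Fs la)) = Fs la"
proof
  fix \<alpha> show "cf (mk (Fs la)) \<alpha> = Fs la \<alpha>" by (auto simp: Fs_def schur_def)
qed

lemma schur_cf: "cf (ss (pf la)) = schur la"
  by (rule ext) (simp add: ss_schur schur_def)

text \<open>\<open>FF\<close> meets the definite description, and any other solution agrees with it
  by induction along the additive span of the Schur functions; the step for a difference is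
  recovered from additivity.\<close>

lemma Fmap_cf: "f \<in> Lam \<Longrightarrow> Fmap (cf f) = cf (FF f)"
proof -
  define \<Phi>0 where "\<Phi>0 f = (if f \<in> Lambda then cf (FF (mk f)) else 0)" for f
  have L: "f \<in> Lambda \<Longrightarrow> mk f \<in> Lam \<and> cf (mk f) = f" for f
    using Lambda_cf_mk cf_Lambda by metis
  have Ladd: "f + g \<in> Lambda \<and> mk (f + g) = mk f + mk g" if "f \<in> Lambda" "g \<in> Lambda" for f g
  proof -
    have "cf (mk f + mk g) = f + g" using L[OF that(1)] L[OF that(2)] by (simp add: cf_plus)
    moreover have "cf (mk f + mk g) \<in> Lambda" using cf_Lambda Lam_add L that by metis
    ultimately show ?thesis by (metis mk_cf)
  qed
  have ssL: "schur la \<in> Lambda \<and> mk (schur la) = ss (pf la)" if "is_partition la" for la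
    using cf_Lambda Lam_ss[OF is_pf_pf[OF that]] schur_cf ss_schur by metis
  let ?P = "\<lambda>\<Phi>. (\<forall>f\<in>Lambda. \<forall>g\<in>Lambda. \<Phi> (f + g) = \<Phi> f + \<Phi> g) \<and>
                  (\<forall>la. is_partition la \<longrightarrow> \<Phi> (schur la) = Fs la) \<and>
                  (\<forall>f. f \<notin> Lambda \<longrightarrow> \<Phi> f = 0)"
  have P0: "?P \<Phi>0"
    using L Ladd ssL by (auto simp: \<Phi>0_def FF_add cf_plus FF_ss Fs_fin simp del: cf_mk)
  have uniq: "\<Phi> = \<Phi>0" if P: "?P \<Phi>" for \<Phi>
  proof
    fix f
    have add: "\<Phi> (cf (x + y)) = \<Phi> (cf x) + \<Phi> (cf y)" if "x \<in> Lam" "y \<in> Lam" for x y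
      using P that cf_Lambda unfolding cf_plus by blast
    have eq: "\<Phi> (cf x) = cf (FF x)" if "x \<in> addspan (ss ` pf ` {la. is_partition la})" for x
      using that
    proof (induction x rule: addspan.induct)
      case zero
      have "\<Phi> (cf 0) = \<Phi> (cf 0) + \<Phi> (cf 0)" using add[OF Lam_0 Lam_0] by simp
      then have h: "\<Phi> (cf 0) = 0" by (metis add_cancel_left_left)
      have z: "cf 0 = (0::sym)" by (rule ext) simp
      show ?case unfolding FF_0 by (rule trans[OF h z[symmetric]])
    next
      case (plus x b)
      then obtain la where b: "b = ss (pf la)" "is_partition la" by blast
      have "\<Phi> (cf b) = cf (FF b)" using P b by (simp add: schur_cf FF_ss Fs_fin del: cf_mk)
      have L: "x \<in> Lam" "b \<in> Lam" using addspan_parts_Lam[OF plus.hyps(1)] b Lam_ss[OF is_pf_pf[OF b(2)]] by simp_all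
      have "\<Phi> (cf (x + b)) = cf (FF x) + cf (FF b)" unfolding add[OF L] plus.IH \<open>\<Phi> (cf b) = cf (FF b)\<close> ..
      also have "\<dots> = cf (FF (x + b))" unfolding FF_add[OF L] cf_plus ..
      finally show ?case .
    next
      case (minus x b)
      then obtain la where b: "b = ss (pf la)" "is_partition la" by blast
      have bL: "b \<in> Lam" using b Lam_ss is_pf_pf by simp
      have xL: "x \<in> Lam" by (rule addspan_parts_Lam[OF minus.hyps(1)])
      have 1: "\<Phi> (cf b) = cf (FF b)" using P b by (simp add: schur_cf FF_ss Fs_fin del: cf_mk)
      have "\<Phi> (cf x) = \<Phi> (cf (x - b)) + \<Phi> (cf b)" using add[OF Lam_diff[OF xL bL] bL] by simp
      then have "\<Phi> (cf (x - b)) = cf (FF x) - cf (FF b)" using minus.IH 1 by (simp add: algebra_simps)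
      also have "\<dots> = cf (FF (x - b))" by (rule ext) (simp add: FF_diff[OF xL bL])
      finally show ?case .
    qed
    show "\<Phi> f = \<Phi>0 f"
    proof (cases "f \<in> Lambda")
      case True
      then have "mk f \<in> Lam" "cf (mk f) = f" using L by auto
      then show ?thesis using eq[of "mk f"] Lam_addspan_parts True by (auto simp: \<Phi>0_def)
    qed (use P in \<open>simp add: \<Phi>0_def\<close>)
  qed
  have "Fmap = \<Phi>0" unfolding Fmap_def by (rule the_equality, rule P0, rule uniq)
  moreover assume "f \<in> Lam"
  then have "cf f \<in> Lambda" by (simp only: cf_Lambda)
  ultimately have "Fmap (cf f) = \<Phi>0 (cf f)" by (simp only:)
  also have "\<dots> = cf (FF (mk (cf f)))" unfolding \<Phi>0_def using \<open>cf f \<in> Lambda\<close> by (rule if_P)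
  finally show "Fmap (cf f) = cf (FF f)" unfolding mk_cf .
qed

subsection \<open>Orbits of a permutation\<close>

definition Orb :: "('x \<Rightarrow> 'x) \<Rightarrow> 'x set \<Rightarrow> 'x set set" where
  "Orb \<tau> X = orbit \<tau> ` X"

lemma finite_Orb [simp]: "finite X \<Longrightarrow> finite (Orb \<tau> X)"
  by (simp add: Orb_def)

lemma orbit_self: "finite X \<Longrightarrow> \<tau> permutes X \<Longrightarrow> x \<in> orbit \<tau> x"
  using permutation_self_in_orbit permutation_permutes by metis

lemma orbit_eq: "finite X \<Longrightarrow> \<tau> permutes X \<Longrightarrow> y \<in> orbit \<tau> x \<Longrightarrow> orbit \<tau> y = orbit \<tau> x"
  using orbit_swap[OF orbit_self] orbit_trans by (metis subsetI subset_antisym)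

lemma orbit_sub: "\<tau> permutes X \<Longrightarrow> x \<in> X \<Longrightarrow> orbit \<tau> x \<subseteq> X"
  by (rule permutes_orbit_subset)

lemma Orb_disjoint:
  assumes "finite X" "\<tau> permutes X" "c \<in> Orb \<tau> X" "d \<in> Orb \<tau> X" "c \<noteq> d"
  shows "c \<inter> d = {}"
proof (rule ccontr)
  assume "c \<inter> d \<noteq> {}"
  then obtain z where z: "z \<in> c" "z \<in> d" by blast
  obtain x y where "c = orbit \<tau> x" "d = orbit \<tau> y" using assms by (auto simp: Orb_def)
  then show False using orbit_eq[OF assms(1,2)] z assms(5) by metis
qed

lemma Orb_Union: "finite X \<Longrightarrow> \<tau> permutes X \<Longrightarrow> \<Union> (Orb \<tau> X) = X"
  using orbit_self[of X \<tau>] orbit_sub[of \<tau> X] by (auto simp: Orb_def)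

lemma Orb_sub: "\<tau> permutes X \<Longrightarrow> c \<in> Orb \<tau> X \<Longrightarrow> c \<subseteq> X"
  using orbit_sub[of \<tau> X] by (auto simp: Orb_def)

lemma Orb_eq_orbit: "finite X \<Longrightarrow> \<tau> permutes X \<Longrightarrow> c \<in> Orb \<tau> X \<Longrightarrow> x \<in> c \<Longrightarrow> c = orbit \<tau> x"
  using orbit_eq[of X \<tau>] by (auto simp: Orb_def)

lemma Orb_nonempty: "finite X \<Longrightarrow> \<tau> permutes X \<Longrightarrow> c \<in> Orb \<tau> X \<Longrightarrow> c \<noteq> {}"
  using orbit_nonempty by (fastforce simp: Orb_def)

lemma Orb_card_pos: "finite X \<Longrightarrow> \<tau> permutes X \<Longrightarrow> c \<in> Orb \<tau> X \<Longrightarrow> card c \<ge> 1"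
  using Orb_nonempty[of X \<tau> c] Orb_sub[of \<tau> X c] finite_subset[of c X]
  by (metis One_nat_def Suc_leI card_gt_0_iff)

lemma Orb_image: "\<tau> permutes X \<Longrightarrow> c \<in> Orb \<tau> X \<Longrightarrow> x \<in> c \<Longrightarrow> \<tau> x \<in> c"
  by (auto simp: Orb_def intro: orbit.step)

lemma sum_Orb:
  assumes "finite X" "\<tau> permutes X"
  shows "(\<Sum>x\<in>X. F x) = (\<Sum>c\<in>Orb \<tau> X. \<Sum>x\<in>c. F x)"
proof -
  have "(\<Sum>x\<in>\<Union> (Orb \<tau> X). F x) = (\<Sum>c\<in>Orb \<tau> X. \<Sum>x\<in>c. F x)"
  proof (rule sum.Union_disjoint[unfolded comp_def])
    show "\<forall>c\<in>Orb \<tau> X. finite c" using Orb_sub[OF assms(2)] finite_subset[OF _ assms(1)] by blast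
    show "\<forall>c\<in>Orb \<tau> X. \<forall>d\<in>Orb \<tau> X. c \<noteq> d \<longrightarrow> c \<inter> d = {}" using Orb_disjoint[OF assms] by blast
  qed
  then show ?thesis using Orb_Union[OF assms] by simp
qed

lemma orbit_constant:
  assumes "finite X" "\<tau> permutes X" "\<And>x. x \<in> X \<Longrightarrow> \<gamma> (\<tau> x) = \<gamma> x" "x \<in> X" "y \<in> orbit \<tau> x"
  shows "\<gamma> y = \<gamma> x"
  using assms(5)
proof (induction rule: orbit.induct)
  case base
  then show ?case using assms by simp
next
  case (step y)
  then have "y \<in> X" using orbit_sub[OF assms(2,4)] by blast
  then show ?case using step assms(3) by simp
qed

text \<open>A multiset fixed by \<tau> has constant multiplicity on each orbit. The bound D makes
  the multiplicities range over a finite product, the index set met when truncated geometric series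
  are multiplied out.\<close>

definition orbmul :: "nat \<Rightarrow> (nat \<Rightarrow> nat) \<Rightarrow> nat \<Rightarrow> nat \<Rightarrow> (nat set \<Rightarrow> nat) set" where
  "orbmul n \<tau> D m = {h \<in> Orb \<tau> {0..<n} \<rightarrow>\<^sub>E {..D}. (\<Sum>c\<in>Orb \<tau> {0..<n}. card c * h c) = m}"

lemma card_orbmul:
  assumes \<tau>: "\<tau> \<in> Sn n" and m: "m \<le> D"
  shows "card (orbmul n \<tau> D m) = card (Qset n \<tau> m)"
proof -
  let ?X = "{0..<n}" and ?O = "Orb \<tau> {0..<n}"
  have X: "finite ?X" and p: "\<tau> permutes ?X" using \<tau> by (auto simp: Sn_def)
  define up where "up h y = (if y < n then h (orbit \<tau> y) else 0)" for h :: "nat set \<Rightarrow> nat" and y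
  define dn where "dn \<gamma> = restrict (\<lambda>c. \<gamma> (SOME x. x \<in> c)) ?O" for \<gamma> :: mono
  have oc: "orbit \<tau> y = c" if "c \<in> ?O" "y \<in> c" for c y using Orb_eq_orbit[OF X p that] by simp
  have someO: "(SOME x. x \<in> c) \<in> c" if "c \<in> ?O" for c
    using Orb_nonempty[OF X p that] by (simp add: some_in_eq)
  have sum_up: "(\<Sum>y<n. up h y) = (\<Sum>c\<in>?O. card c * h c)" for h
  proof -
    have "(\<Sum>y<n. up h y) = (\<Sum>c\<in>?O. \<Sum>y\<in>c. up h y)"
      using sum_Orb[OF X p, of "up h"] by (simp add: atLeast0LessThan)
    also have "\<dots> = (\<Sum>c\<in>?O. \<Sum>y\<in>c. h c)"
    proof (intro sum.cong refl)
      fix c y assume c: "c \<in> ?O" "y \<in> c"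
      then have "y < n" using Orb_sub[OF p] by fastforce
      then show "up h y = h c" using oc[OF c] by (simp add: up_def)
    qed
    finally show ?thesis by simp
  qed
  have dn_c: "dn \<gamma> (orbit \<tau> y) = \<gamma> y" if "\<gamma> \<in> Qset n \<tau> m" "y < n" for \<gamma> y
  proof -
    have c: "orbit \<tau> y \<in> ?O" using that by (simp add: Orb_def)
    have "(SOME x. x \<in> orbit \<tau> y) \<in> orbit \<tau> y" by (rule someO[OF c])
    then have "\<gamma> (SOME x. x \<in> orbit \<tau> y) = \<gamma> y"
      by (rule orbit_constant[OF X p, rotated 2]) (use that in \<open>auto simp: Qset_def\<close>)
    then show ?thesis using c by (simp add: dn_def)
  qed
  have updn: "up (dn \<gamma>) = \<gamma>" if "\<gamma> \<in> Qset n \<tau> m" for \<gamma>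
    using dn_c[OF that] that by (auto simp: up_def Qset_def fun_eq_iff)
  have "bij_betw up (orbmul n \<tau> D m) (Qset n \<tau> m)"
  proof (rule bij_betw_byWitness[where f'=dn]; (intro ballI image_subsetI)?)
    fix h assume h: "h \<in> orbmul n \<tau> D m"
    show "dn (up h) = h"
    proof
      fix c show "dn (up h) c = h c"
      proof (cases "c \<in> ?O")
        case True
        have "(SOME x. x \<in> c) < n" using someO[OF True] Orb_sub[OF p True] by auto
        then show ?thesis using True oc[OF True someO[OF True]] by (simp add: dn_def up_def)
      next
        case False
        have "h \<in> extensional ?O" using h by (simp add: orbmul_def PiE_def)
        then show ?thesis using False by (simp add: dn_def extensional_def)
      qed
    qed
    have "up h (\<tau> y) = up h y" if "y < n" for y
    proof -
      have c: "orbit \<tau> y \<in> ?O" using that by (simp add: Orb_def)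
      have "\<tau> y \<in> orbit \<tau> y" by (rule orbit.base)
      then have "orbit \<tau> (\<tau> y) = orbit \<tau> y" by (rule oc[OF c])
      then show ?thesis using that Sn_apply[OF \<tau>] by (simp add: up_def)
    qed
    moreover have "(\<Sum>y<n. up h y) = m" unfolding sum_up using h by (simp add: orbmul_def)
    ultimately show "up h \<in> Qset n \<tau> m" by (simp add: Qset_def) (simp add: up_def)
  next
    fix \<gamma> assume g: "\<gamma> \<in> Qset n \<tau> m"
    show "up (dn \<gamma>) = \<gamma>" by (rule updn[OF g])
    have s: "(\<Sum>c\<in>?O. card c * dn \<gamma> c) = m"
      using sum_up[of "dn \<gamma>"] updn[OF g] g by (simp add: Qset_def)
    have "dn \<gamma> c \<le> D" if c: "c \<in> ?O" for c
    proof -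
      have "dn \<gamma> c \<le> card c * dn \<gamma> c" using Orb_card_pos[OF X p c] by simp
      also have "\<dots> \<le> (\<Sum>c\<in>?O. card c * dn \<gamma> c)" by (rule member_le_sum) (use c X in auto)
      finally show ?thesis using s m by simp
    qed
    then show "dn \<gamma> \<in> orbmul n \<tau> D m" using s by (auto simp: orbmul_def dn_def)
  qed
  then show ?thesis by (rule bij_betw_same_card)
qed

subsection \<open>Coefficientwise evaluation\<close>

definition LamT :: "int mps mps set" where
  "LamT = {Z. \<forall>\<beta>. cf Z \<beta> \<in> Lam}"

definition PsiT :: "nat \<Rightarrow> (nat \<Rightarrow> nat) \<Rightarrow> int mps mps \<Rightarrow> real mps" where
  "PsiT n \<tau> Z = mk (\<lambda>\<beta>. psi n \<tau> (cf Z \<beta>))"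

lemma cf_PsiT: "cf (PsiT n \<tau> Z) \<beta> = psi n \<tau> (cf Z \<beta>)"
  by (simp add: PsiT_def cf_nonfin)

lemma LamT_add: "X \<in> LamT \<Longrightarrow> Y \<in> LamT \<Longrightarrow> X + Y \<in> LamT"
  and LamT_diff: "X \<in> LamT \<Longrightarrow> Y \<in> LamT \<Longrightarrow> X - Y \<in> LamT"
  and LamT_0: "0 \<in> LamT"
  by (simp_all add: LamT_def Lam_add Lam_diff Lam_0)

lemma LamT_1: "1 \<in> LamT"
  by (simp add: LamT_def cf_1 Lam_0 Lam_1)

lemma LamT_mult:
  assumes "X \<in> LamT" "Y \<in> LamT"
  shows "X * Y \<in> LamT"
  unfolding LamT_def
proof (intro CollectI allI)
  fix \<beta>
  show "cf (X * Y) \<beta> \<in> Lam"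
  proof (cases "fin_mono \<beta>")
    case True
    then show ?thesis unfolding cf_mult[OF True]
      by (intro Lam_sum Lam_mult) (use assms in \<open>auto simp: LamT_def\<close>)
  qed (simp add: cf_nonfin Lam_0)
qed

lemma LamT_power: "X \<in> LamT \<Longrightarrow> X ^ k \<in> LamT"
  by (induction k) (auto intro: LamT_1 LamT_mult)

lemma LamT_sum: "(\<And>x. x \<in> S \<Longrightarrow> F x \<in> LamT) \<Longrightarrow> sum F S \<in> LamT"
  by (induction S rule: infinite_finite_induct) (auto intro: LamT_0 LamT_add)

lemma LamT_prod: "(\<And>x. x \<in> S \<Longrightarrow> F x \<in> LamT) \<Longrightarrow> prod F S \<in> LamT"
  by (induction S rule: infinite_finite_induct) (auto intro: LamT_1 LamT_mult)

text \<open>Each coefficient of the inverse is a coefficient of a polynomial in X, by the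
  approximations recorded in \<open>mps_inverse_exists\<close>.\<close>

lemma LamT_inverse:
  assumes "X \<in> LamT" "X * Y = 1" "cf X 0 = 1"
  shows "Y \<in> LamT"
proof -
  obtain Y' where Y': "X * Y' = 1" "\<forall>n. eqv n Y' (\<Sum>k<n. (1 - X) ^ k)"
    using mps_inverse_exists[OF assms(3)] by blast
  have Y: "Y = Y'" using mps_inverse_unique assms(2) Y'(1) by blast
  have "cf Y \<beta> \<in> Lam" for \<beta>
  proof (cases "fin_mono \<beta>")
    case True
    have "cf Y \<beta> = cf (\<Sum>k<Suc (deg \<beta>). (1 - X) ^ k) \<beta>"
      using Y'(2)[rule_format, of "Suc (deg \<beta>)"] True unfolding Y eqv_cf by blast
    moreover have "(\<Sum>k<Suc (deg \<beta>). (1 - X) ^ k) \<in> LamT"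
      by (intro LamT_sum LamT_power LamT_diff LamT_1 assms)
    ultimately show ?thesis by (simp only: LamT_def) blast
  qed (simp add: cf_nonfin Lam_0)
  then show ?thesis by (simp add: LamT_def)
qed

lemma PsiT_mult:
  assumes "\<tau> \<in> Sn n" "X \<in> LamT" "Y \<in> LamT"
  shows "PsiT n \<tau> (X * Y) = PsiT n \<tau> X * PsiT n \<tau> Y"
proof (rule mps_eqI)
  fix \<beta> assume b: "fin_mono \<beta>"
  have L: "cf X \<gamma> \<in> Lam" "cf Y \<gamma> \<in> Lam" for \<gamma> using assms by (auto simp: LamT_def)
  show "cf (PsiT n \<tau> (X * Y)) \<beta> = cf (PsiT n \<tau> X * PsiT n \<tau> Y) \<beta>"
    unfolding cf_PsiT cf_mult[OF b]
    by (subst psi_sum) (auto intro: Lam_mult L simp: psi_mult[OF assms(1) L])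
qed

lemma PsiT_1: "\<tau> \<in> Sn n \<Longrightarrow> PsiT n \<tau> 1 = 1"
  by (rule mps_eqI) (simp add: cf_PsiT cf_1 psi_1)

lemma PsiT_prod:
  assumes "\<tau> \<in> Sn n" "\<And>x. x \<in> S \<Longrightarrow> F x \<in> LamT"
  shows "PsiT n \<tau> (prod F S) = (\<Prod>x\<in>S. PsiT n \<tau> (F x))"
  using assms(2)
  by (induction S rule: infinite_finite_induct) (simp_all add: PsiT_1[OF assms(1)] PsiT_mult[OF assms(1)] LamT_prod)

section \<open>The series H(t^c) and its evaluation\<close>

definition HT :: "mono \<Rightarrow> int mps mps" where
  "HT c = mkt (Ht c)"

lemma msc_inj: "c \<noteq> 0 \<Longrightarrow> msc m c = msc m' c \<Longrightarrow> m = m'"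
proof -
  assume c: "c \<noteq> 0" and e: "msc m c = msc m' c"
  then obtain i where "c i \<noteq> 0" by (metis ext zero_fun_apply)
  moreover have "m * c i = m' * c i" using fun_cong[OF e, of i] by (simp add: msc_def)
  ultimately show ?thesis by simp
qed

lemma cf_HT_msc: "fin_mono c \<Longrightarrow> c \<noteq> 0 \<Longrightarrow> cf (HT c) (msc m c) = hh m"
proof -
  assume c: "fin_mono c" "c \<noteq> 0"
  have "(SOME k. msc m c = (\<lambda>i. k * c i)) = m"
    by (rule some_equality) (use msc_inj[OF c(2)] in \<open>auto simp: msc_def\<close>)
  then have "Ht c (msc m c) = hfun m" by (auto simp: Ht_def msc_def)
  then show ?thesis using c by (simp add: HT_def mkt_def hh_def)
qed

lemma cf_HT_other: "(\<And>m. \<alpha> \<noteq> msc m c) \<Longrightarrow> cf (HT c) \<alpha> = 0"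
proof -
  assume "\<And>m. \<alpha> \<noteq> msc m c"
  then have "Ht c \<alpha> = 0" by (auto simp: Ht_def msc_def)
  moreover have "mk (0::sym) = 0" by (rule mps_eqI) simp
  ultimately show ?thesis by (simp add: HT_def mkt_def)
qed

lemma HT_LamT:
  assumes "fin_mono c" "c \<noteq> 0"
  shows "HT c \<in> LamT"
  unfolding LamT_def
proof (intro CollectI allI)
  fix \<beta> show "cf (HT c) \<beta> \<in> Lam"
  proof (cases "\<exists>m. \<beta> = msc m c")
    case True
    then show ?thesis using cf_HT_msc[OF assms] Lam_hh by auto
  next
    case False
    then have "cf (HT c) \<beta> = 0" by (intro cf_HT_other) blast
    then show ?thesis using Lam_0 by simp
  qed
qed

lemma msc_0: "msc 0 c = 0"
  by (simp add: msc_def fun_eq_iff)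

lemma cf_HT_0: "fin_mono c \<Longrightarrow> c \<noteq> 0 \<Longrightarrow> cf (HT c) 0 = 1"
proof -
  assume "fin_mono c" "c \<noteq> 0"
  then have "cf (HT c) (msc 0 c) = hh 0" by (rule cf_HT_msc)
  moreover have "hh 0 = 1" by (rule mps_eqI) (auto simp: cf_hh cf_1 deg_eq_0_iff)
  ultimately show ?thesis by (simp only: msc_0)
qed

lemma HT_truncate:
  assumes c: "fin_mono c" "c \<noteq> 0"
  shows "eqv (Suc D) (HT c) (\<Sum>m\<le>D. mon (msc m c) (hh m))"
  unfolding eqv_cf
proof (intro allI impI)
  fix \<alpha> assume a: "fin_mono \<alpha>" "deg \<alpha> < Suc D"
  have S: "cf (\<Sum>m\<le>D. mon (msc m c) (hh m)) \<alpha> = (\<Sum>m\<le>D. if \<alpha> = msc m c then hh m else 0)"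
    using c by (simp add: cf_mon)
  show "cf (HT c) \<alpha> = cf (\<Sum>m\<le>D. mon (msc m c) (hh m)) \<alpha>"
  proof (cases "\<exists>m. \<alpha> = msc m c")
    case True
    then obtain m where m: "\<alpha> = msc m c" by blast
    have "deg c \<ge> 1" using deg_eq_0_iff[OF c(1)] c(2) by simp
    then have "m \<le> D" using a(2) deg_msc[OF c(1), of m] unfolding m by (metis less_Suc_eq_le le_trans mult.right_neutral mult_le_mono2)
    have "(\<Sum>m'\<le>D. if \<alpha> = msc m' c then hh m' else 0) = (\<Sum>m'\<le>D. if m' = m then hh m else 0)"
      unfolding m using msc_inj[OF c(2)] by (intro sum.cong) auto
    also have "\<dots> = hh m" using \<open>m \<le> D\<close> by (simp add: sum.delta)
    finally show ?thesis unfolding S using cf_HT_msc[OF c, of m] m by simp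
  next
    case False
    then show ?thesis unfolding S using cf_HT_other[of \<alpha> c] by (auto intro!: sum.neutral[symmetric])
  qed
qed

lemma PsiT_eqv: "eqv n X Y \<Longrightarrow> eqv n (PsiT k \<tau> X) (PsiT k \<tau> Y)"
  by (simp add: eqv_cf cf_PsiT)

lemma one_minus_geometric:
  assumes c: "fin_mono c" "c \<noteq> 0" and j: "j \<ge> 1"
  shows "eqv (Suc D) ((1 - mon (msc j c) 1) * (\<Sum>i\<le>D. mon (msc j c) 1 ^ i)) (1 :: real mps)"
proof -
  have "deg c \<ge> 1" using deg_eq_0_iff[OF c(1)] c(2) by simp
  then have "deg (msc j c) \<ge> 1" using deg_msc[OF c(1), of j] j by simp
  then have oo: "ord_ge 1 (mon (msc j c) (1::real))" by (intro ord_ge_mon) (use c in auto)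
  have "{..D} = {..<Suc D}" by auto
  then show ?thesis using geometric_eqv[OF oo, of "Suc D" "Suc D"] by (simp only: le_refl)
qed

text \<open>A multiset fixed by \<tau> chooses a multiplicity for every orbit and pays the orbit
  length each time, so the generating series of these multisets is a product of geometric series,
  one per orbit.\<close>

lemma PsiT_HT:
  assumes \<tau>: "\<tau> \<in> Sn n" and c: "fin_mono c" "c \<noteq> 0"
  shows "PsiT n \<tau> (HT c) * (\<Prod>q\<in>Orb \<tau> {0..<n}. 1 - mon (msc (card q) c) 1) = 1"
proof (rule eqv_all)
  fix D0 :: nat
  define D where "D = D0"
  let ?O = "Orb \<tau> {0..<n}" and ?y = "mon c 1 :: real mps"
  have X: "finite {0..<n}" and p: "\<tau> permutes {0..<n}" using \<tau> by (auto simp: Sn_def)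
  have dc: "deg c \<ge> 1" using deg_eq_0_iff[OF c(1)] c(2) by simp
  have yo: "ord_ge (Suc D) (?y ^ m)" if "m > D" for m
  proof -
    have "ord_ge (1 * m) (?y ^ m)" by (rule ord_ge_power) (use c dc in \<open>auto intro: ord_ge_mon\<close>)
    then show ?thesis by (rule ord_ge_mono) (use that in simp)
  qed
  have "eqv (Suc D) (PsiT n \<tau> (HT c)) (PsiT n \<tau> (\<Sum>m\<le>D. mon (msc m c) (hh m)))"
    by (rule PsiT_eqv[OF HT_truncate[OF c]])
  also have "PsiT n \<tau> (\<Sum>m\<le>D. mon (msc m c) (hh m)) = (\<Sum>m\<le>D. of_nat (card (Qset n \<tau> m)) * ?y ^ m)"
  proof (rule mps_eqI)
    fix \<alpha> assume "fin_mono \<alpha>"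
    have "cf (PsiT n \<tau> (\<Sum>m\<le>D. mon (msc m c) (hh m))) \<alpha> = psi n \<tau> (\<Sum>m\<le>D. if \<alpha> = msc m c then hh m else 0)"
      using c by (simp add: cf_PsiT cf_mon)
    also have "\<dots> = (\<Sum>m\<le>D. psi n \<tau> (if \<alpha> = msc m c then hh m else 0))"
      by (rule psi_sum) (simp add: Lam_hh Lam_0)
    also have "\<dots> = cf (\<Sum>m\<le>D. of_nat (card (Qset n \<tau> m)) * ?y ^ m) \<alpha>"
      using c by (auto simp: cf_of_nat_mult mon_power cf_mon psi_hh[OF \<tau>] intro!: sum.cong)
    finally show "cf (PsiT n \<tau> (\<Sum>m\<le>D. mon (msc m c) (hh m))) \<alpha> = cf (\<Sum>m\<le>D. of_nat (card (Qset n \<tau> m)) * ?y ^ m) \<alpha>" .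
  qed
  also have "eqv (Suc D) \<dots> (\<Prod>q\<in>?O. \<Sum>i\<le>D. mon (msc (card q) c) 1 ^ i)"
  proof -
    have e: "(\<Prod>q\<in>?O. \<Sum>i\<le>D. mon (msc (card q) c) 1 ^ i) = (\<Sum>h\<in>?O \<rightarrow>\<^sub>E {..D}. ?y ^ (\<Sum>q\<in>?O. card q * h q))"
    proof -
      have "(\<Prod>q\<in>?O. \<Sum>i\<le>D. mon (msc (card q) c) 1 ^ i) = (\<Prod>q\<in>?O. \<Sum>i\<le>D. ?y ^ (card q * i))"
        using c by (intro prod.cong sum.cong refl) (simp add: mon_power[symmetric] power_mult)
      also have "\<dots> = (\<Sum>h\<in>?O \<rightarrow>\<^sub>E {..D}. \<Prod>q\<in>?O. ?y ^ (card q * h q))"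
        by (rule prod_sum_PiE) auto
      finally show ?thesis by (simp add: power_sum)
    qed
    have fP: "finite (?O \<rightarrow>\<^sub>E {..D})" by (rule finite_PiE) auto
    let ?t = "\<lambda>h. \<Sum>q\<in>?O. card q * h q"
    \<comment> \<open>Terms of weighted degree above D are invisible modulo degree D + 1; the others
      are grouped by that degree into invariant multisets.\<close>
    have "eqv (Suc D) (\<Sum>h\<in>?O \<rightarrow>\<^sub>E {..D}. ?y ^ ?t h) (\<Sum>h\<in>{h \<in> ?O \<rightarrow>\<^sub>E {..D}. ?t h \<le> D}. ?y ^ ?t h)"
    proof -
      have "(\<Sum>h\<in>?O \<rightarrow>\<^sub>E {..D}. ?y ^ ?t h) - (\<Sum>h\<in>{h \<in> ?O \<rightarrow>\<^sub>E {..D}. ?t h \<le> D}. ?y ^ ?t h)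
        = (\<Sum>h\<in>(?O \<rightarrow>\<^sub>E {..D}) - {h \<in> ?O \<rightarrow>\<^sub>E {..D}. ?t h \<le> D}. ?y ^ ?t h)"
        by (rule sum_diff[symmetric]) (use fP in auto)
      then show ?thesis unfolding eqv_def by (simp only:) (rule ord_ge_sum, rule yo, auto)
    qed
    also have "(\<Sum>h\<in>{h \<in> ?O \<rightarrow>\<^sub>E {..D}. ?t h \<le> D}. ?y ^ ?t h)
      = (\<Sum>m\<le>D. \<Sum>h\<in>{h \<in> {h \<in> ?O \<rightarrow>\<^sub>E {..D}. ?t h \<le> D}. ?t h = m}. ?y ^ ?t h)"
      by (rule sum.group[symmetric]) (use fP in auto)
    also have "\<dots> = (\<Sum>m\<le>D. of_nat (card (Qset n \<tau> m)) * ?y ^ m)"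
    proof (rule sum.cong[OF refl])
      fix m assume "m \<in> {..D}"
      then have m: "m \<le> D" by simp
      have "{h \<in> {h \<in> ?O \<rightarrow>\<^sub>E {..D}. ?t h \<le> D}. ?t h = m} = orbmul n \<tau> D m"
        using m by (auto simp: orbmul_def)
      then have "(\<Sum>h\<in>{h \<in> {h \<in> ?O \<rightarrow>\<^sub>E {..D}. ?t h \<le> D}. ?t h = m}. ?y ^ ?t h) = (\<Sum>h\<in>orbmul n \<tau> D m. ?y ^ m)"
        by (auto simp: orbmul_def intro!: sum.cong)
      then show "(\<Sum>h\<in>{h \<in> {h \<in> ?O \<rightarrow>\<^sub>E {..D}. ?t h \<le> D}. ?t h = m}. ?y ^ ?t h) = of_nat (card (Qset n \<tau> m)) * ?y ^ m"
        by (simp add: card_orbmul[OF \<tau> m])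
    qed
    finally show ?thesis unfolding e by (rule eqv_sym)
  qed
  finally have "eqv (Suc D) (PsiT n \<tau> (HT c) * (\<Prod>q\<in>?O. 1 - mon (msc (card q) c) 1))
    ((\<Prod>q\<in>?O. \<Sum>i\<le>D. mon (msc (card q) c) 1 ^ i) * (\<Prod>q\<in>?O. 1 - mon (msc (card q) c) 1))"
    by (intro eqv_mult eqv_refl)
  also have "(\<Prod>q\<in>?O. \<Sum>i\<le>D. mon (msc (card q) c) 1 ^ i) * (\<Prod>q\<in>?O. 1 - mon (msc (card q) c) 1)
    = (\<Prod>q\<in>?O. (1 - mon (msc (card q) c) 1) * (\<Sum>i\<le>D. mon (msc (card q) c) (1::real) ^ i))"
    by (simp add: prod.distrib mult.commute)
  also have "eqv (Suc D) \<dots> (\<Prod>q\<in>?O. 1)"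
  proof (rule eqv_prod)
    fix q assume "q \<in> ?O"
    then show "eqv (Suc D) ((1 - mon (msc (card q) c) 1) * (\<Sum>i\<le>D. mon (msc (card q) c) 1 ^ i)) (1 :: real mps)"
      by (intro one_minus_geometric c Orb_card_pos[OF X p])
  qed
  finally show "eqv D0 (PsiT n \<tau> (HT c) * (\<Prod>q\<in>?O. 1 - mon (msc (card q) c) 1)) 1"
    by (simp add: D_def eqv_mono[of "Suc D0"])
qed

section \<open>An exponential formula for Young subgroups\<close>

text \<open>An unnormalised cycle index of a Young subgroup; \<open>Orb\<close> contains the fixed
  points as orbits of size 1, so the orbit sizes always add up to the cardinality of X.\<close>

definition cyc :: "nat set \<Rightarrow> (nat \<Rightarrow> nat) \<Rightarrow> (nat \<Rightarrow> 'a::comm_ring_1) \<Rightarrow> 'a" where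
  "cyc X bl u = (\<Sum>\<tau>\<in>Yg X bl. \<Prod>q\<in>Orb \<tau> X. u (card q))"

section \<open>Conjugation of permutations and of their orbits\<close>

lemma permutes_iff_bij: "p permutes S \<longleftrightarrow> bij p \<and> (\<forall>x. x \<notin> S \<longrightarrow> p x = x)"
  by (auto simp: permutes_def bij_iff)

lemma orbit_conj_sub:
  fixes \<pi> :: "'x \<Rightarrow> 'x"
  assumes "bij \<pi>" "y \<in> orbit \<tau> x"
  shows "\<pi> y \<in> orbit (\<pi> \<circ> \<tau> \<circ> inv \<pi>) (\<pi> x)"
  using assms(2)
proof induction
  case base
  have "(\<pi> \<circ> \<tau> \<circ> inv \<pi>) (\<pi> x) \<in> orbit (\<pi> \<circ> \<tau> \<circ> inv \<pi>) (\<pi> x)" by (rule orbit.base)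
  moreover have "(\<pi> \<circ> \<tau> \<circ> inv \<pi>) (\<pi> x) = \<pi> (\<tau> x)" using assms(1) by (simp add: bij_is_inj)
  ultimately show ?case by (simp only:)
next
  case (step y)
  then have "(\<pi> \<circ> \<tau> \<circ> inv \<pi>) (\<pi> y) \<in> orbit (\<pi> \<circ> \<tau> \<circ> inv \<pi>) (\<pi> x)" by (intro orbit.step)
  moreover have "(\<pi> \<circ> \<tau> \<circ> inv \<pi>) (\<pi> y) = \<pi> (\<tau> y)" using assms(1) by (simp add: bij_is_inj)
  ultimately show ?case by (simp only:)
qed

lemma conj_conj: "bij (\<pi> :: 'x \<Rightarrow> 'x) \<Longrightarrow> inv \<pi> \<circ> (\<pi> \<circ> \<tau> \<circ> inv \<pi>) \<circ> \<pi> = \<tau>"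
  by (auto simp: fun_eq_iff bij_is_inj)

lemma orbit_conj:
  fixes \<pi> :: "'x \<Rightarrow> 'x"
  assumes "bij \<pi>"
  shows "orbit (\<pi> \<circ> \<tau> \<circ> inv \<pi>) (\<pi> x) = \<pi> ` orbit \<tau> x"
proof
  show "\<pi> ` orbit \<tau> x \<subseteq> orbit (\<pi> \<circ> \<tau> \<circ> inv \<pi>) (\<pi> x)" using orbit_conj_sub[OF assms] by auto
  show "orbit (\<pi> \<circ> \<tau> \<circ> inv \<pi>) (\<pi> x) \<subseteq> \<pi> ` orbit \<tau> x"
  proof
    fix y assume "y \<in> orbit (\<pi> \<circ> \<tau> \<circ> inv \<pi>) (\<pi> x)"
    then have "inv \<pi> y \<in> orbit (inv \<pi> \<circ> (\<pi> \<circ> \<tau> \<circ> inv \<pi>) \<circ> inv (inv \<pi>)) (inv \<pi> (\<pi> x))"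
      by (rule orbit_conj_sub[OF bij_imp_bij_inv[OF assms]])
    then have "inv \<pi> y \<in> orbit \<tau> x"
      unfolding inv_inv_eq[OF assms] conj_conj[OF assms] inv_f_f[OF bij_is_inj[OF assms]] .
    then show "y \<in> \<pi> ` orbit \<tau> x" by (rule rev_image_eqI) (simp add: surj_f_inv_f[OF bij_is_surj[OF assms]])
  qed
qed

lemma Orb_conj: "bij (\<pi> :: 'x \<Rightarrow> 'x) \<Longrightarrow> Orb (\<pi> \<circ> \<tau> \<circ> inv \<pi>) (\<pi> ` S) = (`) \<pi> ` Orb \<tau> S"
  using orbit_conj[of \<pi> \<tau>] by (auto simp: Orb_def)

lemma Yg_conj:
  assumes "bij \<pi>" "\<And>x. x \<in> S \<Longrightarrow> bl' (\<pi> x) = bl x" "\<tau> \<in> Yg S bl"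
  shows "\<pi> \<circ> \<tau> \<circ> inv \<pi> \<in> Yg (\<pi> ` S) bl'"
proof -
  have t: "bij \<tau>" "\<And>x. x \<notin> S \<Longrightarrow> \<tau> x = x" "\<And>x. x \<in> S \<Longrightarrow> \<tau> x \<in> S" "\<And>x. x \<in> S \<Longrightarrow> bl (\<tau> x) = bl x"
    using assms(3) by (auto simp: Yg_def permutes_in_image permutes_bij permutes_not_in)
  have "bij (\<pi> \<circ> \<tau> \<circ> inv \<pi>)" using assms(1) t(1) by (intro bij_comp bij_imp_bij_inv)
  moreover have "(\<pi> \<circ> \<tau> \<circ> inv \<pi>) y = y" if "y \<notin> \<pi> ` S" for y
  proof -
    have y: "\<pi> (inv \<pi> y) = y" using assms(1) by (simp add: bij_is_surj surj_f_inv_f)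
    then have "inv \<pi> y \<notin> S" using that by (metis imageI)
    then show ?thesis using t(2) y by simp
  qed
  moreover have "bl' ((\<pi> \<circ> \<tau> \<circ> inv \<pi>) y) = bl' y" if "y \<in> \<pi> ` S" for y
    using that t assms(1,2) by (auto simp: bij_is_inj)
  ultimately show ?thesis by (simp add: Yg_def permutes_iff_bij)
qed

lemma cyc_conj:
  assumes b: "bij \<pi>" and c: "\<And>x. x \<in> S \<Longrightarrow> bl' (\<pi> x) = bl x"
  shows "cyc S bl u = cyc (\<pi> ` S) bl' u"
  unfolding cyc_def
proof (rule sum.reindex_bij_witness[where i="\<lambda>\<tau>. inv \<pi> \<circ> \<tau> \<circ> \<pi>" and j="\<lambda>\<tau>. \<pi> \<circ> \<tau> \<circ> inv \<pi>"])
  have b': "bij (inv \<pi>)" by (rule bij_imp_bij_inv[OF b])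
  have ii: "inv (inv \<pi>) = \<pi>" by (rule inv_inv_eq[OF b])
  fix \<tau> assume t: "\<tau> \<in> Yg S bl"
  show "inv \<pi> \<circ> (\<pi> \<circ> \<tau> \<circ> inv \<pi>) \<circ> \<pi> = \<tau>" by (rule conj_conj[OF b])
  show "\<pi> \<circ> \<tau> \<circ> inv \<pi> \<in> Yg (\<pi> ` S) bl'" by (rule Yg_conj[OF b c t])
  have "(\<Prod>q\<in>Orb (\<pi> \<circ> \<tau> \<circ> inv \<pi>) (\<pi> ` S). u (card q)) = (\<Prod>q\<in>Orb \<tau> S. u (card (\<pi> ` q)))"
    unfolding Orb_conj[OF b] by (subst prod.reindex) (use inj_image_eq_iff[OF bij_is_inj[OF b]] in \<open>simp_all add: inj_on_def\<close>)
  then show "(\<Prod>q\<in>Orb (\<pi> \<circ> \<tau> \<circ> inv \<pi>) (\<pi> ` S). u (card q)) = (\<Prod>q\<in>Orb \<tau> S. u (card q))"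
    using b by (simp add: card_image bij_is_inj inj_on_subset[OF bij_is_inj])
next
  have b': "bij (inv \<pi>)" by (rule bij_imp_bij_inv[OF b])
  have ii: "inv (inv \<pi>) = \<pi>" by (rule inv_inv_eq[OF b])
  fix \<tau> assume t: "\<tau> \<in> Yg (\<pi> ` S) bl'"
  show "\<pi> \<circ> (inv \<pi> \<circ> \<tau> \<circ> \<pi>) \<circ> inv \<pi> = \<tau>" using conj_conj[OF b', of \<tau>] by (simp only: ii)
  have "inv \<pi> \<circ> \<tau> \<circ> inv (inv \<pi>) \<in> Yg (inv \<pi> ` \<pi> ` S) bl"
    by (rule Yg_conj[OF b' _ t]) (use b c in \<open>auto simp: bij_is_inj\<close>)
  then show "inv \<pi> \<circ> \<tau> \<circ> \<pi> \<in> Yg S bl" using b by (simp add: ii image_image bij_is_inj)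
qed

text \<open>Conjugation carries one Young subgroup to another with the same block sizes and
  preserves cycle lengths. This is what makes the choice of a labelling in \<open>Gs\<close>
  immaterial.\<close>

lemma cyc_content:
  assumes S: "finite S" and T: "finite T" and e: "content S bl = content T bl'"
  shows "cyc S bl u = cyc T bl' u"
proof -
  let ?Z = "S \<union> T"
  \<comment> \<open>Labels are shifted by one so that 0 marks the points outside U; then a single
    permutation of S \<union> T transports S to T together with the labels.\<close>
  define F where "F U b x = (if x \<in> U then Suc (b x) else 0)" for U :: "nat set" and b :: "nat \<Rightarrow> nat" and x
  have k: "card S = card T" using deg_content[OF S, of bl] deg_content[OF T, of bl'] e by simp
  have h: "content ?Z (F U b) j = (case j of 0 \<Rightarrow> card ?Z - card U | Suc i \<Rightarrow> content U b i)"
    if "U \<subseteq> ?Z" for U b j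
  proof (cases j)
    case 0
    have "{x \<in> ?Z. F U b x = 0} = ?Z - U" by (auto simp: F_def)
    then show ?thesis using 0 that card_Diff_subset[OF finite_subset[OF that] that] S T by (simp add: content_def)
  next
    case (Suc i)
    have "{x \<in> ?Z. F U b x = Suc i} = {x \<in> U. b x = i}" using that by (auto simp: F_def)
    then show ?thesis using Suc by (simp add: content_def)
  qed
  have "content ?Z (F S bl) = content ?Z (F T bl')"
    by (rule ext) (simp add: h k e split: nat.split)
  then obtain \<pi> where p: "\<pi> permutes ?Z" "\<forall>x\<in>?Z. F S bl x = F T bl' (\<pi> x)"
    using content_eq_imp_permutes[of ?Z "F S bl" "F T bl'"] S T by blast
  have p1: "\<pi> x \<in> T \<and> bl' (\<pi> x) = bl x" if "x \<in> S" for x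
    using p(2)[rule_format, of x] that by (auto simp: F_def split: if_splits)
  have "\<pi> ` S = T"
    by (rule card_subset_eq[OF T]) (use p1 k p(1) in \<open>auto simp: card_image permutes_inj_on\<close>)
  moreover have "cyc S bl u = cyc (\<pi> ` S) bl' u"
    by (rule cyc_conj[OF permutes_bij[OF p(1)]]) (use p1 in auto)
  ultimately show ?thesis by simp
qed

subsection \<open>Splitting along invariant subsets\<close>

lemma Orb_Un: "Orb \<tau> (A \<union> B) = Orb \<tau> A \<union> Orb \<tau> B"
  by (auto simp: Orb_def)

lemma permutes_invariant_compl:
  assumes "finite S" "\<tau> permutes X" "\<tau> ` S \<subseteq> S"
  shows "\<tau> ` S = S" "x \<in> X - S \<Longrightarrow> \<tau> x \<in> X - S"
proof -
  show e: "\<tau> ` S = S"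
    by (rule card_subset_eq) (use assms in \<open>auto simp: card_image permutes_inj_on\<close>)
  show "\<tau> x \<in> X - S" if "x \<in> X - S"
  proof -
    have "\<tau> x \<notin> \<tau> ` S" using that permutes_inj[OF assms(2)] by (auto simp: inj_image_mem_iff)
    then show ?thesis unfolding e using that permutes_in_image[OF assms(2), of x] by simp
  qed
qed

lemma orbit_invariant: "\<tau> ` S \<subseteq> S \<Longrightarrow> x \<in> S \<Longrightarrow> y \<in> orbit \<tau> x \<Longrightarrow> y \<in> S"
proof -
  assume s: "\<tau> ` S \<subseteq> S" "x \<in> S" and y: "y \<in> orbit \<tau> x"
  from y show "y \<in> S" by induction (use s in auto)
qed

lemma Orb_disjoint_Diff:
  assumes "finite X" "\<tau> permutes X" "S \<subseteq> X" "\<tau> ` S \<subseteq> S"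
  shows "Orb \<tau> S \<inter> Orb \<tau> (X - S) = {}"
proof -
  have False if "x \<in> S" "y \<in> X - S" "orbit \<tau> x = orbit \<tau> y" for x y
    using that orbit_self[OF assms(1,2), of y] orbit_invariant[OF assms(4) that(1)] by auto
  then show ?thesis by (auto simp: Orb_def)
qed

text \<open>Expanding the product chooses a set of orbits for u and leaves the others to v; unions
  of orbits are precisely the invariant subsets.\<close>

lemma prod_Orb_add:
  fixes u v :: "nat \<Rightarrow> 'a::comm_ring_1"
  assumes X: "finite X" and p: "\<tau> permutes X"
  shows "(\<Prod>q\<in>Orb \<tau> X. u (card q) + v (card q)) = (\<Sum>S\<in>{S. S \<subseteq> X \<and> \<tau> ` S \<subseteq> S}.
    (\<Prod>q\<in>Orb \<tau> S. u (card q)) * (\<Prod>q\<in>Orb \<tau> (X - S). v (card q)))"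
proof -
  have inv: "\<Union> P \<subseteq> X" "\<tau> ` \<Union> P \<subseteq> \<Union> P" if P: "P \<subseteq> Orb \<tau> X" for P
    using P Orb_sub[OF p] Orb_image[OF p] by blast+
  have OU: "Orb \<tau> (\<Union> P) = P" if P: "P \<subseteq> Orb \<tau> X" for P
  proof
    show "Orb \<tau> (\<Union> P) \<subseteq> P"
    proof
      fix c assume "c \<in> Orb \<tau> (\<Union> P)"
      then obtain x d where x: "x \<in> d" "d \<in> P" "c = orbit \<tau> x" by (auto simp: Orb_def)
      then have "d = orbit \<tau> x" using P Orb_eq_orbit[OF X p] by blast
      then show "c \<in> P" using x by simp
    qed
    show "P \<subseteq> Orb \<tau> (\<Union> P)"
    proof
      fix c assume c: "c \<in> P"
      then obtain x where x: "x \<in> c" using P Orb_nonempty[OF X p] by blast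
      then have "c = orbit \<tau> x" using c P Orb_eq_orbit[OF X p] by blast
      then show "c \<in> Orb \<tau> (\<Union> P)" using x c by (auto simp: Orb_def)
    qed
  qed
  have UO: "\<Union> (Orb \<tau> S) = S" if S: "S \<subseteq> X" "\<tau> ` S \<subseteq> S" for S
    using orbit_invariant[OF S(2)] orbit_self[OF X p] by (auto simp: Orb_def)
  have D: "Orb \<tau> X - Orb \<tau> S = Orb \<tau> (X - S)" if S: "S \<subseteq> X" "\<tau> ` S \<subseteq> S" for S
  proof -
    have "Orb \<tau> X = Orb \<tau> S \<union> Orb \<tau> (X - S)" using S(1) by (simp add: Orb_Un[symmetric] Un_absorb1)
    then show ?thesis using Orb_disjoint_Diff[OF X p S] by blast
  qed
  have "(\<Prod>q\<in>Orb \<tau> X. u (card q) + v (card q))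
    = (\<Sum>P\<in>Pow (Orb \<tau> X). (\<Prod>q\<in>P. u (card q)) * (\<Prod>q\<in>Orb \<tau> X - P. v (card q)))"
    by (rule prod_add) (use X in simp)
  also have "\<dots> = (\<Sum>S\<in>{S. S \<subseteq> X \<and> \<tau> ` S \<subseteq> S}. (\<Prod>q\<in>Orb \<tau> S. u (card q)) * (\<Prod>q\<in>Orb \<tau> (X - S). v (card q)))"
  proof (rule sum.reindex_bij_witness[where i="Orb \<tau>" and j=Union])
    fix P assume "P \<in> Pow (Orb \<tau> X)"
    then have P: "P \<subseteq> Orb \<tau> X" by simp
    show "Orb \<tau> (\<Union> P) = P" by (rule OU[OF P])
    show "\<Union> P \<in> {S. S \<subseteq> X \<and> \<tau> ` S \<subseteq> S}" using inv[OF P] by blast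
    show "(\<Prod>q\<in>Orb \<tau> (\<Union> P). u (card q)) * (\<Prod>q\<in>Orb \<tau> (X - \<Union> P). v (card q))
      = (\<Prod>q\<in>P. u (card q)) * (\<Prod>q\<in>Orb \<tau> X - P. v (card q))"
      using D[OF inv[OF P]] OU[OF P] by simp
  next
    fix S assume "S \<in> {S. S \<subseteq> X \<and> \<tau> ` S \<subseteq> S}"
    then show "\<Union> (Orb \<tau> S) = S" "Orb \<tau> S \<in> Pow (Orb \<tau> X)" using UO by (auto simp: Orb_def)
  qed
  finally show ?thesis .
qed

lemma orbit_perm_restrict:
  assumes "\<tau> ` S \<subseteq> S" "x \<in> S" "\<And>y. y \<in> S \<Longrightarrow> \<rho> y = \<tau> y"
  shows "orbit \<rho> x = orbit \<tau> x"
  by (rule orbit_cong0[of x S]) (use assms in auto)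

text \<open>By finiteness a permutation preserving S also preserves its complement, and it is the
  product of its two restrictions.\<close>

lemma Yg_split:
  assumes X: "finite X" and S: "S \<subseteq> X"
  shows "bij_betw (\<lambda>(a, b). a \<circ> b) (Yg S bl \<times> Yg (X - S) bl) {\<tau> \<in> Yg X bl. \<tau> ` S \<subseteq> S}"
proof -
  have fS: "finite S" using X S finite_subset by blast
  have ab: "(a \<circ> b) x = (if x \<in> S then a x else b x)" if "a \<in> Yg S bl" "b \<in> Yg (X - S) bl" for a b x
  proof -
    have p: "a permutes S" "b permutes (X - S)" using that by (auto simp: Yg_def)
    have "b x \<notin> S" if "x \<notin> S"
      using that permutes_in_image[OF p(2), of x] permutes_not_in[OF p(2), of x] by (cases "x \<in> X") auto
    then show ?thesis using permutes_not_in[OF p(2), of x] permutes_not_in[OF p(1), of "b x"] by auto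
  qed
  show ?thesis
  proof (rule bij_betw_byWitness[where f'="\<lambda>\<tau>. (perm_restrict \<tau> S, perm_restrict \<tau> (X - S))"])
    show "\<forall>p\<in>Yg S bl \<times> Yg (X - S) bl. (perm_restrict ((\<lambda>(a, b). a \<circ> b) p) S, perm_restrict ((\<lambda>(a, b). a \<circ> b) p) (X - S)) = p"
    proof (clarsimp, intro conjI ext)
      fix a b x assume h: "a \<in> Yg S bl" "b \<in> Yg (X - S) bl"
      show "perm_restrict (a \<circ> b) S x = a x"
        using ab[OF h, of x] permutes_not_in[OF Yg_permutes[OF h(1)], of x] by (auto simp: perm_restrict_def)
      show "perm_restrict (a \<circ> b) (X - S) x = b x"
        using ab[OF h, of x] permutes_not_in[OF Yg_permutes[OF h(2)], of x] by (auto simp: perm_restrict_def)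
    qed
    have R: "perm_restrict \<tau> S \<in> Yg S bl \<and> perm_restrict \<tau> (X - S) \<in> Yg (X - S) bl"
      if "\<tau> \<in> {\<tau> \<in> Yg X bl. \<tau> ` S \<subseteq> S}" for \<tau>
    proof -
      have t: "\<tau> permutes X" "\<tau> ` S \<subseteq> S" "\<forall>x\<in>X. bl (\<tau> x) = bl x" using that by (auto simp: Yg_def)
      note c = permutes_invariant_compl[OF fS t(1,2)]
      have inj: "inj_on \<tau> Z" for Z using t(1) by (rule permutes_inj_on)
      have "perm_restrict \<tau> U permutes U" if "\<tau> ` U \<subseteq> U" "finite U" for U
      proof (rule bij_imp_permutes)
        have "\<tau> ` U = U" by (rule card_subset_eq) (use that inj[of U] in \<open>auto simp: card_image\<close>)
        then have "bij_betw \<tau> U U" using inj[of U] by (simp add: bij_betw_def)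
        then show "bij_betw (perm_restrict \<tau> U) U U" using bij_betw_cong[of U "perm_restrict \<tau> U" \<tau> U]
          by (simp add: perm_restrict_def)
      qed (simp add: perm_restrict_def)
      moreover have "\<tau> ` (X - S) \<subseteq> X - S" using c(2) by blast
      ultimately show ?thesis using t X fS S by (auto simp: Yg_def perm_restrict_def)
    qed
    show "(\<lambda>\<tau>. (perm_restrict \<tau> S, perm_restrict \<tau> (X - S))) ` {\<tau> \<in> Yg X bl. \<tau> ` S \<subseteq> S} \<subseteq> Yg S bl \<times> Yg (X - S) bl"
      using R by blast
    show "\<forall>\<tau>\<in>{\<tau> \<in> Yg X bl. \<tau> ` S \<subseteq> S}. (\<lambda>(a, b). a \<circ> b) (perm_restrict \<tau> S, perm_restrict \<tau> (X - S)) = \<tau>"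
    proof (intro ballI ext)
      fix \<tau> x assume h: "\<tau> \<in> {\<tau> \<in> Yg X bl. \<tau> ` S \<subseteq> S}"
      have "\<tau> permutes X" using h by (simp add: Yg_def)
      then show "(\<lambda>(a, b). a \<circ> b) (perm_restrict \<tau> S, perm_restrict \<tau> (X - S)) x = \<tau> x"
        using ab[of "perm_restrict \<tau> S" "perm_restrict \<tau> (X - S)" x] R[OF h] permutes_not_in[of \<tau> X x]
        by (auto simp: perm_restrict_def)
    qed
    show "(\<lambda>(a, b). a \<circ> b) ` (Yg S bl \<times> Yg (X - S) bl) \<subseteq> {\<tau> \<in> Yg X bl. \<tau> ` S \<subseteq> S}"
    proof clarsimp
      fix a b assume h: "a \<in> Yg S bl" "b \<in> Yg (X - S) bl"
      note pa = Yg_permutes[OF h(1)] and pb = Yg_permutes[OF h(2)]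
      have "a \<circ> b permutes X"
        using permutes_compose[OF permutes_subset[OF pb] permutes_subset[OF pa S]] by blast
      moreover have "bl ((a \<circ> b) x) = bl x" if "x \<in> X" for x
        unfolding ab[OF h] using that h by (auto simp: Yg_def)
      moreover have "(a \<circ> b) ` S \<subseteq> S" using ab[OF h] permutes_in_image[OF pa] by auto
      ultimately show "a \<circ> b \<in> Yg X bl \<and> (\<lambda>x. a (b x)) ` S \<subseteq> S" by (simp add: Yg_def comp_def)
    qed
  qed
qed

text \<open>Interchange the sum over permutations with the sum over their invariant subsets: for a
  fixed subset S the permutations preserving it are pairs by \<open>Yg_split\<close>.\<close>

lemma cyc_add:
  assumes X: "finite X"
  shows "cyc X bl (\<lambda>k. u k + v k) = (\<Sum>S\<in>Pow X. cyc S bl u * cyc (X - S) bl v)"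
proof -
  let ?g = "\<lambda>\<tau> S. (\<Prod>q\<in>Orb \<tau> S. u (card q)) * (\<Prod>q\<in>Orb \<tau> (X - S). v (card q))"
  have "cyc X bl (\<lambda>k. u k + v k) = (\<Sum>\<tau>\<in>Yg X bl. \<Sum>S\<in>{S \<in> Pow X. \<tau> ` S \<subseteq> S}. ?g \<tau> S)"
    unfolding cyc_def using prod_Orb_add[OF X] by (intro sum.cong refl) (auto simp: Yg_def)
  also have "\<dots> = (\<Sum>S\<in>Pow X. \<Sum>\<tau>\<in>{\<tau> \<in> Yg X bl. \<tau> ` S \<subseteq> S}. ?g \<tau> S)"
    by (rule sum.swap_restrict) (use X in auto)
  also have "\<dots> = (\<Sum>S\<in>Pow X. cyc S bl u * cyc (X - S) bl v)"
  proof (rule sum.cong[OF refl])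
    fix S assume "S \<in> Pow X"
    then have S: "S \<subseteq> X" by simp
    have "(\<Sum>\<tau>\<in>{\<tau> \<in> Yg X bl. \<tau> ` S \<subseteq> S}. ?g \<tau> S) = (\<Sum>(a, b)\<in>Yg S bl \<times> Yg (X - S) bl. ?g (a \<circ> b) S)"
      using sum.reindex_bij_betw[OF Yg_split[OF X S, of bl], of "\<lambda>\<tau>. ?g \<tau> S"] by (simp add: case_prod_unfold)
    also have "\<dots> = (\<Sum>(a, b)\<in>Yg S bl \<times> Yg (X - S) bl. (\<Prod>q\<in>Orb a S. u (card q)) * (\<Prod>q\<in>Orb b (X - S). v (card q)))"
    proof (rule sum.cong[OF refl], clarify)
      fix a b assume h: "a \<in> Yg S bl" "b \<in> Yg (X - S) bl"
      note pa = Yg_permutes[OF h(1)] and pb = Yg_permutes[OF h(2)]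
      have 1: "(a \<circ> b) y = a y" if "y \<in> S" for y using that permutes_not_in[OF pb] by simp
      have 2: "(a \<circ> b) y = b y" if "y \<in> X - S" for y
        using that permutes_in_image[OF pb, of y] permutes_not_in[OF pa, of "b y"] by simp
      have "Orb (a \<circ> b) S = Orb a S"
        unfolding Orb_def using orbit_perm_restrict[of a S _ "a \<circ> b"] 1 permutes_in_image[OF pa] by (intro image_cong refl) blast
      moreover have "Orb (a \<circ> b) (X - S) = Orb b (X - S)"
        unfolding Orb_def using orbit_perm_restrict[of b "X - S" _ "a \<circ> b"] 2 permutes_in_image[OF pb] by (intro image_cong refl) blast
      ultimately show "?g (a \<circ> b) S = (\<Prod>q\<in>Orb a S. u (card q)) * (\<Prod>q\<in>Orb b (X - S). v (card q))" by simp
    qed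
    also have "\<dots> = cyc S bl u * cyc (X - S) bl v"
      unfolding cyc_def by (simp add: sum_product sum.cartesian_product)
    finally show "(\<Sum>\<tau>\<in>{\<tau> \<in> Yg X bl. \<tau> ` S \<subseteq> S}. ?g \<tau> S) = cyc S bl u * cyc (X - S) bl v" .
  qed
  finally show ?thesis .
qed

lemma content_Diff:
  assumes "finite X" "S \<subseteq> X"
  shows "content (X - S) bl = content X bl - content S bl" "content S bl \<le> content X bl"
proof -
  have m: "{x \<in> S. bl x = j} \<subseteq> {x \<in> X. bl x = j}" for j using assms by blast
  have f: "finite {x \<in> X. bl x = j}" for j using assms by simp
  have "content S bl j \<le> content X bl j" for j unfolding content_def by (rule card_mono[OF f m])
  then show "content S bl \<le> content X bl" by (simp add: le_fun_def)
  have "{x \<in> X - S. bl x = j} = {x \<in> X. bl x = j} - {x \<in> S. bl x = j}" for j by blast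
  then have "content (X - S) bl j = content X bl j - content S bl j" for j
    unfolding content_def by (simp only: card_Diff_subset[OF finite_subset[OF m f] m])
  then show "content (X - S) bl = content X bl - content S bl" by (simp add: fun_eq_iff)
qed

lemma subset_of_content:
  assumes "finite X" "\<beta> \<le> content X bl"
  obtains S where "S \<subseteq> X" "content S bl = \<beta>"
proof -
  have "\<exists>T. T \<subseteq> {x \<in> X. bl x = j} \<and> card T = \<beta> j" for j
    using assms(2) obtain_subset_with_card_n[of "\<beta> j" "{x \<in> X. bl x = j}"]
    by (metis content_def le_fun_def)
  then obtain T where T: "\<And>j. T j \<subseteq> {x \<in> X. bl x = j} \<and> card (T j) = \<beta> j" by metis
  have "{x \<in> (\<Union>j. T j). bl x = j} = T j" for j using T by blast
  then have "content (\<Union>j. T j) bl = \<beta>" using T by (simp add: content_def)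
  moreover have "(\<Union>j. T j) \<subseteq> X" using T by blast
  ultimately show ?thesis using that by blast
qed

text \<open>Orbit-stabiliser for the indicator function of S0: its orbit consists of the subsets of
  the same content and its stabiliser is the split group. The count is a product of binomial
  coefficients.\<close>

lemma card_subsets_content:
  fixes X :: "nat set"
  assumes X: "finite X" and S0: "S0 \<subseteq> X"
  shows "card {S. S \<subseteq> X \<and> content S bl = content S0 bl} * (card (Yg S0 bl) * card (Yg (X - S0) bl)) = card (Yg X bl)"
proof -
  define ind where "ind S = restrict (\<lambda>x. x \<in> S) X" for S :: "nat set"
  have tyT: "ty X bl (ind S) (j, True) = content S bl j" "ty X bl (ind S) (j, False) = content (X - S) bl j"
    if "S \<subseteq> X" for S j
    using that by (auto simp: ty_def content_def ind_def intro!: arg_cong[where f=card])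
  have "bij_betw ind {S. S \<subseteq> X \<and> content S bl = content S0 bl} {g \<in> extensional X. ty X bl g = ty X bl (ind S0)}"
  proof (rule bij_betw_byWitness[where f'="\<lambda>g. {x \<in> X. g x}"])
    show "\<forall>S\<in>{S. S \<subseteq> X \<and> content S bl = content S0 bl}. {x \<in> X. ind S x} = S" by (auto simp: ind_def)
    have ig: "ind {x \<in> X. g x} = g" if "g \<in> extensional X" for g
      using that by (auto simp: ind_def fun_eq_iff extensional_def restrict_def)
    then show "\<forall>g\<in>{g \<in> extensional X. ty X bl g = ty X bl (ind S0)}. ind {x \<in> X. g x} = g" by auto
    show "ind ` {S. S \<subseteq> X \<and> content S bl = content S0 bl} \<subseteq> {g \<in> extensional X. ty X bl g = ty X bl (ind S0)}"
    proof clarify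
      fix S assume S: "S \<subseteq> X" "content S bl = content S0 bl"
      have "ty X bl (ind S) (j, b) = ty X bl (ind S0) (j, b)" for j b
        using S(2) by (cases b) (simp_all add: tyT(1)[OF S(1)] tyT(1)[OF S0] tyT(2)[OF S(1)] tyT(2)[OF S0] content_Diff(1)[OF X S(1)] content_Diff(1)[OF X S0])
      then show "ind S \<in> extensional X \<and> ty X bl (ind S) = ty X bl (ind S0)" by (auto simp: ind_def fun_eq_iff)
    qed
    show "(\<lambda>g. {x \<in> X. g x}) ` {g \<in> extensional X. ty X bl g = ty X bl (ind S0)} \<subseteq> {S. S \<subseteq> X \<and> content S bl = content S0 bl}"
    proof clarify
      fix g :: "nat \<Rightarrow> bool" assume g: "g \<in> extensional X" "ty X bl g = ty X bl (ind S0)"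
      have "content {x \<in> X. g x} bl j = content S0 bl j" for j
        using tyT(1)[of "{x \<in> X. g x}" j] tyT(1)[OF S0, of j] ig[OF g(1)] g(2) by simp
      then show "{x \<in> X. g x} \<subseteq> X \<and> content {x \<in> X. g x} bl = content S0 bl" by (auto simp: fun_eq_iff)
    qed
  qed
  then have 1: "card {S. S \<subseteq> X \<and> content S bl = content S0 bl} = card {g \<in> extensional X. ty X bl g = ty X bl (ind S0)}"
    by (rule bij_betw_same_card)
  have "{\<sigma> \<in> Yg X bl. ind S0 \<circ> \<sigma> = ind S0} = {\<tau> \<in> Yg X bl. \<tau> ` S0 \<subseteq> S0}"
  proof (intro Collect_cong conj_cong refl)
    fix \<tau> assume "\<tau> \<in> Yg X bl"
    then have p: "\<tau> permutes X" by (rule Yg_permutes)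
    show "(ind S0 \<circ> \<tau> = ind S0) = (\<tau> ` S0 \<subseteq> S0)"
    proof
      assume h: "ind S0 \<circ> \<tau> = ind S0"
      have "\<tau> x \<in> S0" if "x \<in> S0" for x
        using fun_cong[OF h, of x] that S0 permutes_in_image[OF p, of x] by (auto simp: ind_def)
      then show "\<tau> ` S0 \<subseteq> S0" by blast
    next
      assume h: "\<tau> ` S0 \<subseteq> S0"
      note c = permutes_invariant_compl(2)[OF finite_subset[OF S0 X] p h]
      have "ind S0 (\<tau> x) = ind S0 x" for x
        using h c[of x] permutes_in_image[OF p, of x] by (cases "x \<in> S0") (auto simp: ind_def restrict_def)
      then show "ind S0 \<circ> \<tau> = ind S0" by (simp add: fun_eq_iff)
    qed
  qed
  then have "card {\<sigma> \<in> Yg X bl. ind S0 \<circ> \<sigma> = ind S0} = card (Yg S0 bl \<times> Yg (X - S0) bl)"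
    using bij_betw_same_card[OF Yg_split[OF X S0, of bl]] by simp
  moreover have "ind S0 \<in> extensional X" by (simp add: ind_def)
  ultimately show ?thesis using orbit_class_count[OF X, of "ind S0" bl] 1 by (simp add: card_cartesian_product)
qed

subsection \<open>The generating series\<close>

text \<open>\<open>cf_Gs\<close> shows that the chosen labelling is immaterial. The group order is
  divided out as a constant series \<open>mon 0\<close>, because the values of U are themselves
  series in t.\<close>

definition Gs :: "(nat \<Rightarrow> real mps) \<Rightarrow> real mps mps" where
  "Gs U = mk (\<lambda>\<alpha>. let bl = SOME bl. content {0..<deg \<alpha>} bl = \<alpha> in
    mon 0 (1 / real (card (Yg {0..<deg \<alpha>} bl))) * cyc {0..<deg \<alpha>} bl U)"

lemma card_Yg_content:
  fixes X Y :: "nat set" and bl bl' :: "nat \<Rightarrow> nat"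
  assumes "finite X" "finite Y" "content X bl = content Y bl'"
  shows "card (Yg X bl) = card (Yg Y bl')"
  using cyc_content[OF assms, of "\<lambda>_. 1::int"] by (simp add: cyc_def)

lemma cf_Gs:
  assumes X: "finite X" and c: "content X bl = \<alpha>"
  shows "cf (Gs U) \<alpha> = mon 0 (1 / real (card (Yg X bl))) * cyc X bl U"
proof -
  have f: "fin_mono \<alpha>" using fin_mono_content[OF X, of bl] c by simp
  define bl' where "bl' = (SOME bl. content {0..<deg \<alpha>} bl = \<alpha>)"
  have "content {0..<deg \<alpha>} bl' = \<alpha>" unfolding bl'_def by (rule someI_ex[OF content_exists[OF f]])
  then have e: "content {0..<deg \<alpha>} bl' = content X bl" using c by simp
  show ?thesis
    using card_Yg_content[OF _ X e] cyc_content[OF _ X e, of U] f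
    unfolding Gs_def by (simp add: Let_def bl'_def[symmetric])
qed

lemma of_nat_mon: "of_nat k = mon 0 (of_nat k :: 'a::comm_ring_1)"
proof (rule mps_eqI)
  fix \<alpha>
  have "cf (of_nat k :: 'a mps) \<alpha> = cf (of_nat k * 1) \<alpha>" by simp
  also have "\<dots> = cf (mon 0 (of_nat k)) \<alpha>" unfolding cf_of_nat_mult by (simp add: cf_1 cf_mon)
  finally show "cf (of_nat k :: 'a mps) \<alpha> = cf (mon 0 (of_nat k)) \<alpha>" .
qed

text \<open>The number of subsets of content \<beta> is the quotient of the group order for \<alpha>
  by those for \<beta> and \<alpha> - \<beta>, so after normalisation the sum over subsets in
  \<open>cyc_add\<close> becomes a convolution over exponents, as for exponential generating
  functions.\<close>

lemma Gs_add: "Gs (\<lambda>k. U k + U2 k) = Gs U * Gs U2"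
proof (rule mps_eqI)
  fix \<alpha> :: mono assume f: "fin_mono \<alpha>"
  obtain bl where bl: "content {0..<deg \<alpha>} bl = \<alpha>" using content_exists[OF f] by blast
  define X where "X = {0..<deg \<alpha>}"
  have X: "finite X" and c: "content X bl = \<alpha>" using bl by (auto simp: X_def)
  let ?y = "\<lambda>S. real (card (Yg S bl))"
  have y0: "?y S \<noteq> 0" if "S \<subseteq> X" for S using card_Yg_pos[OF finite_subset[OF that X], of bl] by simp
  have "cf (Gs (\<lambda>k. U k + U2 k)) \<alpha> = mon 0 (1 / ?y X) * (\<Sum>S\<in>Pow X. cyc S bl U * cyc (X - S) bl U2)"
    unfolding cf_Gs[OF X c] cyc_add[OF X] ..
  also have "(\<Sum>S\<in>Pow X. cyc S bl U * cyc (X - S) bl U2)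
    = (\<Sum>\<beta>\<in>{\<beta>. \<beta> \<le> \<alpha>}. \<Sum>S\<in>{S \<in> Pow X. content S bl = \<beta>}. cyc S bl U * cyc (X - S) bl U2)"
    by (rule sum.group[symmetric]) (use X finite_mono_le[OF f] content_Diff(2)[OF X, of _ bl] c in auto)
  also have "mon 0 (1 / ?y X) * \<dots> = (\<Sum>\<beta>\<in>{\<beta>. \<beta> \<le> \<alpha>}. cf (Gs U) \<beta> * cf (Gs U2) (\<alpha> - \<beta>))"
  proof (subst sum_distrib_left, rule sum.cong[OF refl])
    fix \<beta> assume "\<beta> \<in> {\<beta>. \<beta> \<le> \<alpha>}"
    then obtain S0 where S0: "S0 \<subseteq> X" "content S0 bl = \<beta>" using subset_of_content[OF X, of \<beta> bl] c by blast
    have c1: "content (X - S0) bl = \<alpha> - \<beta>" using content_Diff(1)[OF X S0(1), of bl] c S0 by simp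
    have fS: "finite S0" "finite (X - S0)" using X S0 finite_subset by auto
    let ?N = "card {S. S \<subseteq> X \<and> content S bl = content S0 bl}"
    have N: "real ?N * (?y S0 * ?y (X - S0)) = ?y X"
      using arg_cong[OF card_subsets_content[OF X S0(1), of bl], of real] by (simp only: of_nat_mult)
    then have N': "1 / ?y X * real ?N = 1 / ?y S0 * (1 / ?y (X - S0))"
      using y0[of X] y0[OF S0(1)] y0[of "X - S0"] by (simp add: field_simps)
    have "(\<Sum>S\<in>{S \<in> Pow X. content S bl = \<beta>}. cyc S bl U * cyc (X - S) bl U2)
      = (\<Sum>S\<in>{S \<in> Pow X. content S bl = \<beta>}. cyc S0 bl U * cyc (X - S0) bl U2)"
    proof (rule sum.cong[OF refl])
      fix S assume "S \<in> {S \<in> Pow X. content S bl = \<beta>}"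
      then have S: "S \<subseteq> X" "content S bl = \<beta>" by auto
      have fS': "finite S" "finite (X - S)" using X S finite_subset by auto
      have "content (X - S) bl = content (X - S0) bl" using content_Diff(1)[OF X S(1), of bl] c1 S c by simp
      then show "cyc S bl U * cyc (X - S) bl U2 = cyc S0 bl U * cyc (X - S0) bl U2"
        using cyc_content[OF fS'(2) fS(2), of bl bl U2] cyc_content[OF fS'(1) fS(1), of bl bl U] S S0 by simp
    qed
    also have "\<dots> = mon 0 (real ?N) * (cyc S0 bl U * cyc (X - S0) bl U2)"
      using S0(2) by (simp add: of_nat_mon[symmetric] Pow_def)
    finally have "mon 0 (1 / ?y X) * (\<Sum>S\<in>{S \<in> Pow X. content S bl = \<beta>}. cyc S bl U * cyc (X - S) bl U2)
      = (mon 0 (1 / ?y X) * mon 0 (real ?N)) * (cyc S0 bl U * cyc (X - S0) bl U2)" by (simp only: mult.assoc)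
    also have "mon 0 (1 / ?y X) * mon 0 (real ?N) = mon 0 (1 / ?y S0) * mon 0 (1 / ?y (X - S0))"
      by (simp only: mon_mult_mon fin_mono_zero N')
    finally show "mon 0 (1 / ?y X) * (\<Sum>S\<in>{S \<in> Pow X. content S bl = \<beta>}. cyc S bl U * cyc (X - S) bl U2)
      = cf (Gs U) \<beta> * cf (Gs U2) (\<alpha> - \<beta>)"
      unfolding cf_Gs[OF fS(1) S0(2)] cf_Gs[OF fS(2) c1] by (simp only: mult_ac)
  qed
  also have "\<dots> = cf (Gs U * Gs U2) \<alpha>" by (rule cf_mult[OF f, symmetric])
  finally show "cf (Gs (\<lambda>k. U k + U2 k)) \<alpha> = cf (Gs U * Gs U2) \<alpha>" .
qed

text \<open>Every permutation contributes the same monomial, because its orbit lengths add up to deg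
  \<alpha>; the average is therefore that monomial.\<close>

lemma cf_Gs_mon:
  assumes c: "fin_mono c" and f: "fin_mono \<alpha>"
  shows "cf (Gs (\<lambda>k. mon (msc k c) 1)) \<alpha> = mon (msc (deg \<alpha>) c) 1"
proof -
  obtain bl where bl: "content {0..<deg \<alpha>} bl = \<alpha>" using content_exists[OF f] by blast
  define X where "X = {0..<deg \<alpha>}"
  have X: "finite X" and cX: "content X bl = \<alpha>" "card X = deg \<alpha>" using bl by (auto simp: X_def)
  have "(\<Prod>q\<in>Orb \<tau> X. mon (msc (card q) c) (1::real)) = mon (msc (deg \<alpha>) c) 1" if "\<tau> \<in> Yg X bl" for \<tau>
  proof -
    have "(\<Sum>q\<in>Orb \<tau> X. card q) = deg \<alpha>"
      using sum_Orb[OF X Yg_permutes[OF that], of "\<lambda>_. 1::nat"] cX by simp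
    then show ?thesis using c by (simp add: mon_power[symmetric] power_sum[symmetric])
  qed
  then have "cyc X bl (\<lambda>k. mon (msc k c) (1::real)) = of_nat (card (Yg X bl)) * mon (msc (deg \<alpha>) c) 1"
    by (simp add: cyc_def)
  then show ?thesis unfolding cf_Gs[OF X cX(1)] of_nat_mon
    using card_Yg_pos[OF X, of bl] by (simp add: mult.assoc[symmetric] mon_mult_mon) (simp add: mon_0_1)
qed

text \<open>The case c = 0 of \<open>cf_Gs_mon\<close>.\<close>

lemma Gs_1: "Gs (\<lambda>_. 1) = mk (\<lambda>_. 1)"
proof (rule mps_eqI)
  fix \<alpha> :: mono assume f: "fin_mono \<alpha>"
  have "(\<lambda>k. mon (msc k 0) 1) = (\<lambda>_. 1 :: real mps)" by (simp add: msc_def mon_0_1[symmetric] zero_fun_def)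
  then show "cf (Gs (\<lambda>_. 1)) \<alpha> = cf (mk (\<lambda>_. 1)) \<alpha>"
    using cf_Gs_mon[OF fin_mono_zero f] f by (simp add: msc_def mon_0_1[symmetric] zero_fun_def)
qed

text \<open>Additivity gives \<open>Gs\<close> of 1 times \<open>Gs\<close> of 0 equal to
  \<open>Gs\<close> of 1, and the latter is a unit.\<close>

lemma Gs_0: "Gs (\<lambda>_. 0) = 1"
proof -
  have "cf (Gs (\<lambda>_. 1)) 0 = 1" by (simp add: Gs_1)
  then obtain g where g: "Gs (\<lambda>_. 1) * g = 1" using mps_inverse_exists by blast
  have "Gs (\<lambda>_. 1) * Gs (\<lambda>_. 0) = Gs (\<lambda>_. 1)" using Gs_add[of "\<lambda>_. 1" "\<lambda>_. 0"] by simp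
  then have "g * (Gs (\<lambda>_. 1) * Gs (\<lambda>_. 0)) = g * Gs (\<lambda>_. 1)" by simp
  then show ?thesis using g by (simp add: mult.assoc[symmetric] mult.commute[of g])
qed

lemma Gs_sum: "finite I \<Longrightarrow> Gs (\<lambda>k. \<Sum>i\<in>I. U2 i k) = (\<Prod>i\<in>I. Gs (U2 i))"
  by (induction I rule: finite_induct) (simp_all add: Gs_0 Gs_add)

lemma Gs_comp:
  assumes "bij \<sigma>" "fin_mono \<alpha>"
  shows "cf (Gs U) (\<alpha> \<circ> \<sigma>) = cf (Gs U) \<alpha>"
proof -
  obtain bl where bl: "content {0..<deg \<alpha>} bl = \<alpha>" using content_exists[OF assms(2)] by blast
  let ?bl = "inv \<sigma> \<circ> bl"
  have e: "inv \<sigma> x = y \<longleftrightarrow> x = \<sigma> y" for x y using assms(1) by (metis bij_inv_eq_iff)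
  have "content {0..<deg \<alpha>} ?bl = \<alpha> \<circ> \<sigma>"
    using bl by (auto simp: content_def fun_eq_iff e)
  moreover have "Yg {0..<deg \<alpha>} ?bl = Yg {0..<deg \<alpha>} bl"
    using assms(1) by (auto simp: Yg_def e bij_is_surj surj_f_inv_f)
  ultimately show ?thesis
    using cf_Gs[of "{0..<deg \<alpha>}" ?bl "\<alpha> \<circ> \<sigma>" U] cf_Gs[of "{0..<deg \<alpha>}" bl \<alpha> U] bl by (simp add: cyc_def)
qed

text \<open>\<open>sw\<close> exchanges the variables: the outer monomials of its argument are in \<open>t\<close>, those of its value in \<open>x\<close>.\<close>

definition sw :: "int mps mps \<Rightarrow> real mps mps" where
  "sw Z = mk (\<lambda>\<alpha>. mk (\<lambda>\<beta>. of_int (cf (cf Z \<beta>) \<alpha>)))"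

lemma cf_cf_sw: "cf (cf (sw Z) \<alpha>) \<beta> = of_int (cf (cf Z \<beta>) \<alpha>)"
  by (simp add: sw_def cf_nonfin)

lemma sw_inject: "sw Y = sw Z \<Longrightarrow> Y = Z"
proof (intro mps_eqI)
  fix \<alpha> \<beta> assume "sw Y = sw Z"
  then have "cf (cf (sw Y) \<alpha>) \<beta> = cf (cf (sw Z) \<alpha>) \<beta>" by simp
  then show "cf (cf Y \<beta>) \<alpha> = cf (cf Z \<beta>) \<alpha>" by (simp add: cf_cf_sw)
qed

lemma sw_mult: "sw (Y * Z) = sw Y * sw Z"
proof (intro mps_eqI)
  fix \<alpha> \<beta> assume a: "fin_mono \<alpha>" and b: "fin_mono \<beta>"
  show "cf (cf (sw (Y * Z)) \<alpha>) \<beta> = cf (cf (sw Y * sw Z) \<alpha>) \<beta>"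
    unfolding cf_cf_sw cf_mult[OF a] cf_mult[OF b] cf_sum of_int_sum of_int_mult
    by (rule sum.swap)
qed

lemma sw_1: "sw 1 = 1"
  by (intro mps_eqI) (auto simp: cf_cf_sw cf_1)

lemma sw_prod: "sw (prod F S) = (\<Prod>x\<in>S. sw (F x))"
  by (induction S rule: infinite_finite_induct) (simp_all add: sw_1 sw_mult)

section \<open>F applied coefficientwise, as an average over Young subgroups\<close>

definition FT :: "int mps mps \<Rightarrow> int mps mps" where
  "FT Z = mk (\<lambda>\<beta>. FF (cf Z \<beta>))"

lemma cf_FT: "cf (FT Z) \<beta> = FF (cf Z \<beta>)"
  by (simp add: FT_def cf_nonfin FF_0)

text \<open>\<open>FF_avg\<close> expresses F by averages of \<open>psi\<close> over Young
  subgroups; when \<open>psi\<close> is a product over orbits these averages are the ones defining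
  \<open>Gs\<close>. This is the bridge from representations to series.\<close>

lemma sw_FT:
  assumes Z: "Z \<in> LamT" and U: "\<And>n \<tau>. \<tau> \<in> Sn n \<Longrightarrow> PsiT n \<tau> Z = (\<Prod>q\<in>Orb \<tau> {0..<n}. U (card q))"
  shows "sw (FT Z) = Gs U"
proof (intro mps_eqI)
  fix \<alpha> \<beta> :: mono assume a: "fin_mono \<alpha>" and b: "fin_mono \<beta>"
  obtain bl where bl: "content {0..<deg \<alpha>} bl = \<alpha>" using content_exists[OF a] by blast
  let ?X = "{0..<deg \<alpha>}"
  have "cf (cf (sw (FT Z)) \<alpha>) \<beta> = (\<Sum>\<tau>\<in>Yg ?X bl. psi (deg \<alpha>) \<tau> (cf Z \<beta>)) / real (card (Yg ?X bl))"
    unfolding cf_cf_sw cf_FT by (rule FF_avg[OF _ a bl]) (use Z in \<open>simp add: LamT_def\<close>)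
  also have "(\<Sum>\<tau>\<in>Yg ?X bl. psi (deg \<alpha>) \<tau> (cf Z \<beta>)) = cf (cyc ?X bl U) \<beta>"
    unfolding cyc_def cf_sum
  proof (rule sum.cong[OF refl])
    fix \<tau> assume "\<tau> \<in> Yg ?X bl"
    then have "\<tau> \<in> Sn (deg \<alpha>)" by (simp add: Yg_def Sn_def)
    then show "psi (deg \<alpha>) \<tau> (cf Z \<beta>) = cf (\<Prod>q\<in>Orb \<tau> ?X. U (card q)) \<beta>" by (simp add: U[symmetric] cf_PsiT)
  qed
  also have "cf (cyc ?X bl U) \<beta> / real (card (Yg ?X bl)) = cf (cf (Gs U) \<alpha>) \<beta>"
    unfolding cf_Gs[OF finite_atLeastLessThan bl] by (simp add: cf_mon_mult le_fun_def)
  finally show "cf (cf (sw (FT Z)) \<alpha>) \<beta> = cf (cf (Gs U) \<alpha>) \<beta>" .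
qed

definition Hx :: "int mps" where "Hx = mk Hsym"

lemma sw_Hx: "sw (mon 0 Hx) = Gs (\<lambda>_. 1)"
  by (intro mps_eqI) (auto simp: cf_cf_sw Gs_1 cf_mon cf_1 Hx_def Hsym_def hfun_def)

text \<open>At x^\<alpha> only h_m with m = deg \<alpha> has a coefficient, namely 1, so H(t^c)
  contributes the single monomial (t^c)^(deg \<alpha>), as in \<open>cf_Gs_mon\<close>.\<close>

lemma sw_HT:
  assumes c: "fin_mono c" "c \<noteq> 0"
  shows "sw (HT c) = Gs (\<lambda>k. mon (msc k c) 1)"
proof (intro mps_eqI)
  fix \<alpha> \<beta> assume a: "fin_mono \<alpha>" and b: "fin_mono \<beta>"
  show "cf (cf (sw (HT c)) \<alpha>) \<beta> = cf (cf (Gs (\<lambda>k. mon (msc k c) 1)) \<alpha>) \<beta>"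
  proof (cases "\<exists>m. \<beta> = msc m c")
    case True
    then obtain m where m: "\<beta> = msc m c" by blast
    show ?thesis unfolding cf_cf_sw cf_Gs_mon[OF c(1) a] m cf_HT_msc[OF c]
      using msc_inj[OF c(2), of m "deg \<alpha>"] c a by (auto simp: cf_mon cf_hh)
  next
    case False
    then show ?thesis unfolding cf_cf_sw cf_Gs_mon[OF c(1) a]
      using cf_HT_other[of \<beta> c] c by (auto simp: cf_mon)
  qed
qed

section \<open>The map to surjections\<close>

subsection \<open>Coefficients of products of complete series\<close>

lemma fin_mono_tvar [simp]: "fin_mono (tvar j)"
  by (simp add: fin_mono_def tvar_def)

lemma tvar_nonzero [simp]: "tvar j \<noteq> 0"
  by (auto simp: tvar_def fun_eq_iff)

lemma deg_tvar [simp]: "deg (tvar j) = 1"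
  by (subst deg_eq_sum[of "{j}"]) (auto simp: tvar_def)

lemma msc_tvar: "msc m (tvar l) = (\<lambda>j. if j = l then m else 0)"
  by (auto simp: msc_def tvar_def)

text \<open>For varying l its coefficients run through the products of complete functions, which
  span \<open>Lam\<close>, so properties of F on \<open>Lam\<close> are read off from this series.
  Variables are numbered from 0 to match positions in lists.\<close>

definition Ql :: "nat \<Rightarrow> int mps mps" where
  "Ql l = (\<Prod>j<l. HT (tvar j))"

lemma cf_Ql: "fin_mono \<beta> \<Longrightarrow> cf (Ql l) \<beta> = (if \<forall>j\<ge>l. \<beta> j = 0 then \<Prod>j<l. hh (\<beta> j) else 0)"
proof (induction l arbitrary: \<beta>)
  case 0
  then show ?case by (auto simp: Ql_def cf_1 fun_eq_iff)
next
  case (Suc l)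
  let ?c = "\<beta>(l := 0)"
  have H: "cf (HT (tvar l)) \<delta> = (if \<forall>j. j \<noteq> l \<longrightarrow> \<delta> j = 0 then hh (\<delta> l) else 0)" for \<delta>
  proof (cases "\<forall>j. j \<noteq> l \<longrightarrow> \<delta> j = 0")
    case True
    then have "\<delta> = msc (\<delta> l) (tvar l)" by (auto simp: msc_tvar)
    then show ?thesis using cf_HT_msc[of "tvar l" "\<delta> l"] True by simp
  next
    case False
    then have "cf (HT (tvar l)) \<delta> = 0" by (intro cf_HT_other) (auto simp: msc_tvar)
    then show ?thesis using False by (simp only: if_False)
  qed
  \<comment> \<open>Only one splitting of \<beta> contributes: \<open>Ql l\<close> takes no exponent
    at l, and the new factor takes nothing else.\<close>
  have c: "?c \<in> {\<gamma>. \<gamma> \<le> \<beta>}" by (simp add: le_fun_def)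
  have fin: "fin_mono \<gamma>" if "\<gamma> \<le> \<beta>" for \<gamma> using fin_mono_le[OF Suc.prems that] .
  have "cf (Ql (Suc l)) \<beta> = (\<Sum>\<gamma>\<in>{\<gamma>. \<gamma> \<le> \<beta>}. cf (Ql l) \<gamma> * cf (HT (tvar l)) (\<beta> - \<gamma>))"
    by (simp add: Ql_def cf_mult[OF Suc.prems])
  also have "\<dots> = (\<Sum>\<gamma>\<in>{?c}. cf (Ql l) \<gamma> * cf (HT (tvar l)) (\<beta> - \<gamma>))"
  proof (rule sum.mono_neutral_right[OF finite_mono_le[OF Suc.prems]])
    show "{?c} \<subseteq> {\<gamma>. \<gamma> \<le> \<beta>}" using c by simp
    show "\<forall>\<gamma>\<in>{\<gamma>. \<gamma> \<le> \<beta>} - {?c}. cf (Ql l) \<gamma> * cf (HT (tvar l)) (\<beta> - \<gamma>) = 0"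
    proof
      fix \<gamma> assume g: "\<gamma> \<in> {\<gamma>. \<gamma> \<le> \<beta>} - {?c}"
      then have le: "\<gamma> j \<le> \<beta> j" for j by (simp add: le_fun_def)
      have "\<gamma> \<noteq> ?c" using g by blast
      then obtain j where j: "\<gamma> j \<noteq> ?c j" by blast
      show "cf (Ql l) \<gamma> * cf (HT (tvar l)) (\<beta> - \<gamma>) = 0"
      proof (cases "j = l")
        case True
        then have "cf (Ql l) \<gamma> = 0" using Suc.IH[of \<gamma>] fin g j by auto
        then show ?thesis by simp
      next
        case False
        then have "(\<beta> - \<gamma>) j \<noteq> 0" using j le[of j] by simp
        then have "cf (HT (tvar l)) (\<beta> - \<gamma>) = 0" using H False by auto
        then show ?thesis by simp
      qed
    qed
  qed
  also have "\<dots> = cf (Ql l) ?c * hh (\<beta> l)" by (simp add: H)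
  also have "cf (Ql l) ?c = (if \<forall>j\<ge>l. ?c j = 0 then \<Prod>j<l. hh (?c j) else 0)"
    by (rule Suc.IH) (use fin c in blast)
  also have "(\<forall>j\<ge>l. ?c j = 0) \<longleftrightarrow> (\<forall>j\<ge>Suc l. \<beta> j = 0)" by (auto simp: Suc_le_eq)
  also have "(\<Prod>j<l. hh (?c j)) = (\<Prod>j<l. hh (\<beta> j))" by (rule prod.cong) auto
  finally have e: "cf (Ql (Suc l)) \<beta> = (if \<forall>j\<ge>Suc l. \<beta> j = 0 then \<Prod>j<l. hh (\<beta> j) else 0) * hh (\<beta> l)" .
  show ?case
  proof (cases "\<forall>j\<ge>Suc l. \<beta> j = 0")
    case True
    show ?thesis unfolding e if_P[OF True] prod.lessThan_Suc ..
  next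
    case False
    show ?thesis unfolding e if_not_P[OF False] by (rule mult_zero_left)
  qed
qed

lemma hl_coefficient: "cf (Ql (length bs)) (\<lambda>j. if j < length bs then bs ! j else 0) = hl bs"
proof -
  let ?b = "\<lambda>j. if j < length bs then bs ! j else 0"
  have "fin_mono ?b" unfolding fin_mono_def by (rule finite_subset[of _ "{..<length bs}"]) auto
  moreover have "(\<Prod>j<length bs. hh (?b j)) = hl bs"
    unfolding hl_def by (simp add: prod.list_conv_set_nth atLeast0LessThan)
  ultimately show ?thesis using cf_Ql[of ?b "length bs"] by simp
qed

lemma sw_Ql: "sw (Ql l) = Gs (\<lambda>k. \<Sum>j<l. mon (msc k (tvar j)) 1)"
  unfolding Ql_def sw_prod by (simp add: Gs_sum sw_HT)

lemma Ql_LamT: "Ql l \<in> LamT"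
  unfolding Ql_def by (intro LamT_prod HT_LamT) auto

subsection \<open>The reduced power series\<close>

definition gi :: "nat \<Rightarrow> nat \<Rightarrow> real mps" where
  "gi j k = (SOME g. (1 - mon (msc k (tvar j)) 1) * g = 1)"

lemma gi: "k \<ge> 1 \<Longrightarrow> (1 - mon (msc k (tvar j)) 1) * gi j k = 1"
proof -
  assume k: "k \<ge> 1"
  have "msc k (tvar j) \<noteq> 0" using k by (auto simp: msc_tvar fun_eq_iff)
  then have "cf (1 - mon (msc k (tvar j)) 1) 0 = (1::real)" by (auto simp: cf_mon cf_1)
  then have "\<exists>g. (1 - mon (msc k (tvar j)) (1::real)) * g = 1" using mps_inverse_exists by fast
  then show ?thesis unfolding gi_def by (rule someI_ex)
qed

text \<open>The summand 1 in each orbit factor of the evaluation accounts for H, since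
  \<open>Gs\<close> sends the constant 1 to H; what is left over belongs to F divided by H.\<close>

definition red :: "nat \<Rightarrow> nat \<Rightarrow> real mps" where
  "red l k = (\<Prod>j<l. gi j k) - 1"

lemma PsiT_Ql:
  assumes t: "\<tau> \<in> Sn n"
  shows "PsiT n \<tau> (Ql l) = (\<Prod>q\<in>Orb \<tau> {0..<n}. 1 + red l (card q))"
proof -
  have X: "finite {0..<n}" and p: "\<tau> permutes {0..<n}" using t by (auto simp: Sn_def)
  have "PsiT n \<tau> (HT (tvar j)) = (\<Prod>q\<in>Orb \<tau> {0..<n}. gi j (card q))" for j
  proof (rule mps_inverse_unique)
    show "(\<Prod>q\<in>Orb \<tau> {0..<n}. 1 - mon (msc (card q) (tvar j)) 1) * PsiT n \<tau> (HT (tvar j)) = 1"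
      using PsiT_HT[OF t fin_mono_tvar tvar_nonzero, of j] by (simp add: mult.commute)
    show "(\<Prod>q\<in>Orb \<tau> {0..<n}. 1 - mon (msc (card q) (tvar j)) 1) * (\<Prod>q\<in>Orb \<tau> {0..<n}. gi j (card q)) = 1"
      unfolding prod.distrib[symmetric] by (rule prod.neutral) (use gi Orb_card_pos[OF X p] in auto)
  qed
  then have "PsiT n \<tau> (Ql l) = (\<Prod>j<l. \<Prod>q\<in>Orb \<tau> {0..<n}. gi j (card q))"
    unfolding Ql_def by (subst PsiT_prod[OF t]) (auto intro: HT_LamT)
  also have "\<dots> = (\<Prod>q\<in>Orb \<tau> {0..<n}. \<Prod>j<l. gi j (card q))" by (rule prod.swap)
  finally show ?thesis by (simp add: red_def)
qed

lemma gi_eqv: "k \<ge> 1 \<Longrightarrow> eqv (Suc k) (gi j k) (1 + mon (msc k (tvar j)) 1)"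
proof -
  assume k: "k \<ge> 1"
  let ?x = "mon (msc k (tvar j)) (1::real)"
  have "gi j k - (1 + ?x) = gi j k - (1 + ?x) * ((1 - ?x) * gi j k)" by (simp add: gi[OF k])
  also have "\<dots> = (?x * ?x) * gi j k" by (simp add: algebra_simps)
  finally have e: "gi j k - (1 + ?x) = (?x * ?x) * gi j k" .
  have "ord_ge k ?x" by (rule ord_ge_mon) (simp_all add: deg_msc)
  then have "ord_ge (k + k) (?x * ?x)" by (intro ord_ge_mult)
  then have "ord_ge (Suc k) (?x * ?x)" by (rule ord_ge_mono) (use k in simp)
  then have "ord_ge (Suc k) ((?x * ?x) * gi j k)" by (rule ord_ge_mult_right)
  then show ?thesis by (simp only: eqv_def e)
qed

text \<open>The lowest-degree part of \<open>red l k\<close> is the power sum of degree k: products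
  of two of its terms have degree at least 2 k, which exceeds k.\<close>

lemma red_eqv:
  assumes k: "k \<ge> 1"
  shows "eqv (Suc k) (red l k) (\<Sum>j<l. mon (msc k (tvar j)) 1)"
proof -
  have "eqv (Suc k) (\<Prod>j<l. gi j k) (1 + (\<Sum>j<l. mon (msc k (tvar j)) 1))"
  proof (induction l)
    case (Suc l)
    let ?s = "\<Sum>j<l. mon (msc k (tvar j)) (1::real)" and ?x = "mon (msc k (tvar l)) (1::real)"
    have "eqv (Suc k) (\<Prod>j<Suc l. gi j k) ((1 + ?s) * (1 + ?x))"
      unfolding prod.lessThan_Suc by (intro eqv_mult Suc gi_eqv k)
    also have "eqv (Suc k) ((1 + ?s) * (1 + ?x)) (1 + (?s + ?x))"
    proof -
      have "ord_ge k ?s" "ord_ge k ?x" by (intro ord_ge_sum ord_ge_mon; simp add: deg_msc)+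
      then have "ord_ge (k + k) (?s * ?x)" by (rule ord_ge_mult)
      then have "ord_ge (Suc k) (?s * ?x)" by (rule ord_ge_mono) (use k in simp)
      moreover have "(1 + ?s) * (1 + ?x) - (1 + (?s + ?x)) = ?s * ?x" by (simp add: algebra_simps)
      ultimately show ?thesis by (simp only: eqv_def)
    qed
    finally show ?case by simp
  qed simp
  then show ?thesis by (simp add: eqv_def red_def algebra_simps)
qed

text \<open>In the lowest degree that a product can reach, each factor enters only through its own
  lowest part.\<close>

lemma prod_eqv_graded:
  assumes "\<And>x. x \<in> S \<Longrightarrow> ord_ge (d x) (G x)" "\<And>x. x \<in> S \<Longrightarrow> eqv (Suc (d x)) (F x) (G x)"
  shows "eqv (Suc (sum d S)) (prod F S) (prod G S)"
  using assms
proof (induction S rule: infinite_finite_induct)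
  case (insert x S)
  have F: "ord_ge (d y) (F y)" if "y \<in> insert x S" for y
  proof -
    have "ord_ge (d y) (F y - G y)" using insert.prems(2)[OF that] by (auto simp: eqv_def intro: ord_ge_mono)
    then show ?thesis using ord_ge_add[OF _ insert.prems(1)[OF that]] by fastforce
  qed
  have 1: "ord_ge (d x + Suc (sum d S)) (F x * (prod F S - prod G S))"
    using F[of x] insert by (intro ord_ge_mult) (auto simp: eqv_def)
  have 2: "ord_ge (Suc (d x) + sum d S) ((F x - G x) * prod G S)"
    using insert.prems by (intro ord_ge_mult ord_ge_prod) (auto simp: eqv_def)
  have "prod F (insert x S) - prod G (insert x S) = F x * (prod F S - prod G S) + (F x - G x) * prod G S"
    using insert.hyps by (simp add: algebra_simps)
  moreover have "ord_ge (Suc (sum d (insert x S))) (F x * (prod F S - prod G S) + (F x - G x) * prod G S)"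
    using 1 2 insert.hyps by (intro ord_ge_add) simp_all
  ultimately show ?case by (simp only: eqv_def)
qed auto

text \<open>The orbit lengths add up to deg \<alpha>, so in t-degree at most deg \<alpha> only the
  lowest parts of the factors, the power sums, count. With power sums in place of \<open>red\<close>
  the series is that of \<open>Ql\<close> itself: in this range F divided by H acts as the
  identity.\<close>

lemma Gs_red_top:
  assumes a: "fin_mono \<alpha>" and b: "deg \<beta> \<le> deg \<alpha>"
  shows "cf (cf (Gs (red l)) \<alpha>) \<beta> = of_int (cf (cf (Ql l) \<beta>) \<alpha>)"
proof (cases "fin_mono \<beta>")
  case fb: True
  let ?p = "\<lambda>k. \<Sum>j<l. mon (msc k (tvar j)) (1::real)"
  obtain bl where bl: "content {0..<deg \<alpha>} bl = \<alpha>" using content_exists[OF a] by blast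
  let ?X = "{0..<deg \<alpha>}"
  have "cf (\<Prod>q\<in>Orb \<tau> ?X. red l (card q)) \<beta> = cf (\<Prod>q\<in>Orb \<tau> ?X. ?p (card q)) \<beta>" if t: "\<tau> \<in> Yg ?X bl" for \<tau>
  proof -
    have s: "(\<Sum>q\<in>Orb \<tau> ?X. card q) = deg \<alpha>"
      using sum_Orb[OF finite_atLeastLessThan Yg_permutes[OF t], of "\<lambda>_. 1::nat"] by simp
    have "eqv (Suc (\<Sum>q\<in>Orb \<tau> ?X. card q)) (\<Prod>q\<in>Orb \<tau> ?X. red l (card q)) (\<Prod>q\<in>Orb \<tau> ?X. ?p (card q))"
    proof (rule prod_eqv_graded)
      fix q assume "q \<in> Orb \<tau> ?X"
      then have "card q \<ge> 1" by (rule Orb_card_pos[OF finite_atLeastLessThan Yg_permutes[OF t]])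
      then show "eqv (Suc (card q)) (red l (card q)) (?p (card q))" by (rule red_eqv)
      show "ord_ge (card q) (?p (card q))" by (intro ord_ge_sum ord_ge_mon) (simp_all add: deg_msc)
    qed
    then show ?thesis using fb b unfolding s eqv_cf by simp
  qed
  then have "cf (cyc ?X bl (red l)) \<beta> = cf (cyc ?X bl ?p) \<beta>" by (simp add: cyc_def)
  then have "cf (cf (Gs (red l)) \<alpha>) \<beta> = cf (cf (Gs ?p) \<alpha>) \<beta>"
    unfolding cf_Gs[OF finite_atLeastLessThan bl] by (simp add: cf_mon_mult le_fun_def)
  also have "\<dots> = cf (cf (sw (Ql l)) \<alpha>) \<beta>" by (simp only: sw_Ql)
  finally show ?thesis by (simp only: cf_cf_sw)
qed (simp add: cf_nonfin)

definition Hxi :: "int mps" where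
  "Hxi = (SOME g. Hx * g = 1)"

lemma Hx_Hxi: "Hx * Hxi = 1"
proof -
  have "cf Hx 0 = 1" by (simp add: Hx_def Hsym_def hfun_def)
  then have "\<exists>g. Hx * g = 1" using mps_inverse_exists by fast
  then show ?thesis unfolding Hxi_def by (rule someI_ex)
qed

text \<open>The map \<open>f \<mapsto> F f / H\<close>.\<close>

definition FS :: "int mps \<Rightarrow> int mps" where
  "FS f = FF f * Hxi"

lemma FS_add: "f \<in> Lam \<Longrightarrow> g \<in> Lam \<Longrightarrow> FS (f + g) = FS f + FS g"
  and FS_diff: "f \<in> Lam \<Longrightarrow> g \<in> Lam \<Longrightarrow> FS (f - g) = FS f - FS g"
  by (simp_all add: FS_def FF_add FF_diff algebra_simps)

lemma FS_0: "FS 0 = 0"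
  by (simp add: FS_def FF_0)

lemma FF_FS: "FF f = FS f * Hx"
  unfolding FS_def using Hx_Hxi by (simp add: mult.assoc mult.commute[of Hxi])

text \<open>\<open>Gs\<close> turns 1 + red into H times the series of \<open>red\<close>;
  cancelling H by its inverse, which is constant in t, leaves the series of
  \<open>FS\<close>.\<close>

lemma cf_FS_Ql: "of_int (cf (FS (cf (Ql l) \<beta>)) \<alpha>) = cf (cf (Gs (red l)) \<alpha>) \<beta>"
proof -
  have inv: "mon 0 Hx * mon 0 Hxi = (1 :: int mps mps)"
    by (simp only: mon_mult_mon fin_mono_zero Hx_Hxi) (simp add: mon_0_1)
  have "sw (FT (Ql l)) = Gs (\<lambda>k. 1 + red l k)" by (rule sw_FT[OF Ql_LamT PsiT_Ql])
  also have "\<dots> = sw (mon 0 Hx) * Gs (red l)" unfolding sw_Hx Gs_add[of "\<lambda>_. 1"] ..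
  finally have "sw (FT (Ql l) * mon 0 Hxi) = (sw (mon 0 Hx) * sw (mon 0 Hxi)) * Gs (red l)"
    by (simp only: sw_mult mult_ac)
  then have e: "sw (FT (Ql l) * mon 0 Hxi) = Gs (red l)"
    by (simp only: sw_mult[symmetric] inv sw_1 mult_1_left)
  have "cf (mon 0 Hxi * FT (Ql l)) \<beta> = Hxi * FF (cf (Ql l) \<beta>)"
    by (simp add: cf_mon_mult cf_FT le_fun_def)
  then have "cf (FT (Ql l) * mon 0 Hxi) \<beta> = FS (cf (Ql l) \<beta>)"
    by (simp only: FS_def mult.commute[of "FT (Ql l)"] mult.commute[of "FF (cf (Ql l) \<beta>)"])
  then show ?thesis unfolding e[symmetric] cf_cf_sw by (simp only:)
qed

lemma FS_hl_top: "deg \<alpha> \<ge> sum_list bs \<Longrightarrow> cf (FS (hl bs)) \<alpha> = cf (hl bs) \<alpha>"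
proof (cases "fin_mono \<alpha>")
  case True
  assume d: "deg \<alpha> \<ge> sum_list bs"
  let ?b = "\<lambda>j. if j < length bs then bs ! j else 0"
  have "deg ?b = sum_list bs"
    by (subst deg_eq_sum[of "{..<length bs}"]) (auto simp: sum_list_sum_nth atLeast0LessThan)
  then have "real_of_int (cf (FS (hl bs)) \<alpha>) = of_int (cf (hl bs) \<alpha>)"
    using cf_FS_Ql[of "length bs" ?b \<alpha>] Gs_red_top[OF True, of ?b "length bs"] d by (simp only: hl_coefficient)
  then show ?thesis by simp
qed (simp add: cf_nonfin)

lemma FS_symm: "symm (FS (hl bs))"
  unfolding symm_def
proof (intro allI impI)
  fix \<alpha> :: mono and \<sigma> :: "nat \<Rightarrow> nat" assume s: "bij \<sigma>"
  show "cf (FS (hl bs)) (\<alpha> \<circ> \<sigma>) = cf (FS (hl bs)) \<alpha>"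
  proof (cases "fin_mono \<alpha>")
    case True
    let ?b = "\<lambda>j. if j < length bs then bs ! j else 0"
    have "real_of_int (cf (FS (hl bs)) (\<alpha> \<circ> \<sigma>)) = of_int (cf (FS (hl bs)) \<alpha>)"
      using cf_FS_Ql[of "length bs" ?b] Gs_comp[OF s True] by (simp only: hl_coefficient)
    then show ?thesis by simp
  next
    case False
    then show ?thesis using fin_mono_comp[OF s] by (simp add: cf_nonfin)
  qed
qed

text \<open>Equality in degree d is the statement on leading parts; above d, where f has no
  coefficients, it says that the image has degree at most d as well. Both claims pass through
  additive combinations of the \<open>hl bs\<close>.\<close>

lemma FS_top:
  assumes "symm f" "bdd d f"
  shows "symm (FS f) \<and> (\<forall>\<alpha>. deg \<alpha> \<ge> d \<longrightarrow> cf (FS f) \<alpha> = cf f \<alpha>)"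
proof -
  have sub: "addspan (hl ` {bs. sum_list bs \<le> d}) \<subseteq> Lam" by (rule Lam_addspan) (use Lam_hl in auto)
  have "f \<in> addspan (hl ` {bs. sum_list bs \<le> d})" by (rule Lam_hl_addspan[OF assms])
  then show ?thesis
  proof (induction f rule: addspan.induct)
    case zero
    then show ?case by (simp add: FS_0)
  next
    case (plus x b)
    then obtain bs where b: "b = hl bs" "sum_list bs \<le> d" by blast
    have L: "x \<in> Lam" "b \<in> Lam" using plus sub b Lam_hl by auto
    show ?case unfolding FS_add[OF L]
      using plus.IH FS_symm[of bs] FS_hl_top[of bs] b by (auto intro: symm_add)
  next
    case (minus x b)
    then obtain bs where b: "b = hl bs" "sum_list bs \<le> d" by blast
    have L: "x \<in> Lam" "b \<in> Lam" using minus sub b Lam_hl by auto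
    show ?case unfolding FS_diff[OF L]
      using minus.IH FS_symm[of bs] FS_hl_top[of bs] b by (auto intro: symm_diff)
  qed
qed

lemma FS_Lam: "f \<in> Lam \<Longrightarrow> FS f \<in> Lam"
proof -
  assume "f \<in> Lam"
  then obtain d where d: "symm f" "bdd d f" by (auto simp: Lam_def)
  note t = FS_top[OF d]
  have "bdd d (FS f)" unfolding bdd_def
  proof (intro allI impI, rule ccontr)
    fix \<alpha> assume a: "cf (FS f) \<alpha> \<noteq> 0" "\<not> deg \<alpha> \<le> d"
    then have "cf f \<alpha> \<noteq> 0" using t by simp
    then show False using d(2) a(2) by (simp add: bdd_def)
  qed
  then show ?thesis using t by (auto simp: Lam_def)
qed

text \<open>If the image of the difference vanishes, \<open>FS_top\<close> shows that the difference
  has no part in its top degree, so its degree bound sinks to 0, where the same comparison makes it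
  vanish.\<close>

lemma FS_inject:
  assumes "f \<in> Lam" "g \<in> Lam" "FS f = FS g"
  shows "f = g"
proof -
  let ?h = "f - g"
  have L: "?h \<in> Lam" and z: "FS ?h = 0" using assms by (simp_all add: Lam_diff FS_diff)
  have "?h = 0" if "bdd d ?h" for d
    using that
  proof (induction d)
    case 0
    have "\<forall>\<alpha>. deg \<alpha> \<ge> 0 \<longrightarrow> cf (FS ?h) \<alpha> = cf ?h \<alpha>" using FS_top[of ?h 0] L 0 by (simp add: Lam_def)
    then have "cf ?h \<alpha> = cf 0 \<alpha>" for \<alpha> unfolding z by simp
    then show ?case by (intro mps_eqI)
  next
    case (Suc d)
    have e: "\<forall>\<alpha>. deg \<alpha> \<ge> Suc d \<longrightarrow> cf (FS ?h) \<alpha> = cf ?h \<alpha>" using FS_top[of ?h "Suc d"] L Suc by (simp add: Lam_def)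
    have "bdd d ?h" unfolding bdd_def
    proof (intro allI impI, rule ccontr)
      fix \<alpha> assume a: "cf ?h \<alpha> \<noteq> 0" "\<not> deg \<alpha> \<le> d"
      then show False using e[rule_format, of \<alpha>] unfolding z by simp
    qed
    then show ?case by (rule Suc.IH)
  qed
  then show ?thesis using L by (auto simp: Lam_def)
qed

text \<open>H is a unit, so the factor g with F f = g H is unique and equals \<open>FS f\<close>;
  \<open>FS_Lam\<close> places it in the required ring.\<close>

lemma FSur_cf: "f \<in> Lam \<Longrightarrow> FSur (cf f) = cf (FS f)"
proof -
  assume f: "f \<in> Lam"
  have s: "smult_s (cf g) Hsym = cf (g * Hx)" for g by (simp only: smult_s_cf mk_cf Hx_def)
  show ?thesis unfolding FSur_def
  proof (rule the_equality)
    show "cf (FS f) \<in> Lambda \<and> Fmap (cf f) = smult_s (cf (FS f)) Hsym"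
      unfolding s FF_FS[symmetric] by (simp only: cf_Lambda FS_Lam[OF f] Fmap_cf[OF f])
  next
    fix g assume g: "g \<in> Lambda \<and> Fmap (cf f) = smult_s g Hsym"
    then have gg: "cf (mk g) = g" using Lambda_cf_mk by blast
    have "cf (FF f) = cf (mk g * Hx)" using g s[of "mk g"] unfolding gg Fmap_cf[OF f] by simp
    then have "FF f = mk g * Hx" by (metis mk_cf)
    then have "FS f = mk g" by (simp add: FS_def mult.assoc Hx_Hxi)
    then show "g = cf (FS f)" using gg by simp
  qed
qed

text \<open>\<open>inv_into\<close> selects some preimage; injectivity of \<open>FSur\<close> on
  \<open>Lambda\<close> makes it the exhibited one.\<close>

lemma FSur_inv_cf:
  assumes "f \<in> Lam" "FS f = g"
  shows "FSur_inv (cf g) = cf f"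
proof -
  have "inj_on FSur Lambda"
  proof (rule inj_onI)
    fix a b assume ab: "a \<in> Lambda" "b \<in> Lambda" "FSur a = FSur b"
    have L: "mk a \<in> Lam" "mk b \<in> Lam" "cf (mk a) = a" "cf (mk b) = b"
      using ab Lambda_cf_mk cf_Lambda by metis+
    have "cf (FS (mk a)) = cf (FS (mk b))" using FSur_cf[OF L(1)] FSur_cf[OF L(2)] L(3,4) ab(3) by simp
    then have "FS (mk a) = FS (mk b)" by (metis mk_cf)
    then show "a = b" using FS_inject[OF L(1,2)] L(3,4) by simp
  qed
  moreover have "cf f \<in> Lambda" by (simp only: cf_Lambda assms(1))
  ultimately show ?thesis unfolding FSur_inv_def
    using inv_into_f_f[of FSur Lambda "cf f"] FSur_cf[OF assms(1)] assms(2) by simp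
qed

section \<open>Lyndon words\<close>

abbreviation ly :: "'a::linorder set \<Rightarrow> 'a list set" where
  "ly A \<equiv> Lyndon {(u, v). u < v} A"

lemma ly_iff: "w \<in> ly A \<longleftrightarrow> w \<noteq> [] \<and> set w \<subseteq> A \<and> (\<forall>i. 0 < i \<and> i < length w \<longrightarrow> w < drop i w)"
  by (simp add: Lyndon_def list_less_def)

text \<open>The last factor of the Lyndon factorisation is the least nonempty suffix.\<close>

definition msuf :: "'a::linorder list \<Rightarrow> 'a list" where
  "msuf u = Min ((\<lambda>i. drop i u) ` {..<length u})"

lemma msuf_le: "i < length u \<Longrightarrow> msuf u \<le> drop i u"
  unfolding msuf_def by (rule Min_le) auto

lemma msuf_suffix:
  assumes "u \<noteq> []"
  obtains i where "i < length u" "msuf u = drop i u"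
proof -
  have "msuf u \<in> (\<lambda>i. drop i u) ` {..<length u}" unfolding msuf_def by (rule Min_in) (use assms in auto)
  then show ?thesis using that by auto
qed

lemma prefix_le: "(s :: 'a::linorder list) \<le> s @ r"
  by (cases r) (auto simp: list_le_def list_less_def lexord_append_rightI)

lemma append_less_cancel: "(v :: 'a::linorder list) @ z < v @ l \<Longrightarrow> z < l"
  unfolding list_less_def by (erule lexord_append_leftD) auto

text \<open>If v < l is decided at a letter, appending to v changes nothing; otherwise v is a proper
  prefix of l.\<close>

lemma less_append_right:
  fixes v l :: "'a::linorder list"
  assumes "v < l"
  shows "(\<exists>z. z \<noteq> [] \<and> l = v @ z) \<or> v @ r < l"
proof -
  from assms have "(v, l) \<in> lexord {(u, v). u < v}" by (simp add: list_less_def)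
  then consider (pre) a z where "l = v @ a # z" | (diff) u a b v' w where "a < b" "v = u @ a # v'" "l = u @ b # w"
    unfolding lexord_def by blast
  then show ?thesis
  proof cases
    case diff
    then have "(v @ r, l) \<in> lexord {(u, v). u < v}" using lexord_append_left_rightI[of a b "{(u, v). u < v}" u "v' @ r" w] by simp
    then show ?thesis by (simp add: list_less_def)
  qed auto
qed

lemma ly_le_suffix: "l \<in> ly A \<Longrightarrow> i < length l \<Longrightarrow> l \<le> drop i l"
  by (cases "i = 0") (auto simp: ly_iff intro: less_imp_le)

text \<open>A suffix that starts inside a factor w begins with a suffix of w, which is at least w by
  the Lyndon property, and w is at least the last factor; lengthening on the right only increases a
  word.\<close>

lemma msuf_concat:
  assumes "set ws \<subseteq> ly A" "sorted_wrt (\<ge>) ws" "ws \<noteq> []"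
  shows "msuf (concat ws) = last ws"
proof -
  have ge: "last ws \<le> drop i (concat ws)" if "i < length (concat ws)" for i
    using assms that
  proof (induction ws arbitrary: i)
    case (Cons w ws)
    have w: "w \<in> ly A" using Cons.prems by simp
    show ?case
    proof (cases "i < length w")
      case True
      have "last (w # ws) \<le> w" using Cons.prems(2) by (cases "ws = []") auto
      also have "w \<le> drop i w" by (rule ly_le_suffix[OF w True])
      also have "drop i w \<le> drop i w @ concat ws" by (rule prefix_le)
      finally show ?thesis using True by simp
    next
      case False
      then have "ws \<noteq> []" using Cons.prems(4) by auto
      then show ?thesis using Cons.IH[of "i - length w"] Cons.prems False by simp
    qed
  qed simp
  have l: "last ws \<in> ly A" using assms by (meson last_in_set subsetD)
  then have ne: "last ws \<noteq> []" by (simp add: ly_iff)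
  have c: "concat ws = concat (butlast ws) @ last ws"
    using assms(3) by (metis append_butlast_last_id concat.simps concat_append append_Nil2)
  show ?thesis unfolding msuf_def
  proof (rule Min_eqI)
    show "last ws \<in> (\<lambda>i. drop i (concat ws)) ` {..<length (concat ws)}"
      by (rule image_eqI[of _ _ "length (concat (butlast ws))"]) (use c ne in auto)
  qed (use ge in auto)
qed

definition NL :: "'a::linorder set \<Rightarrow> 'a list list set" where
  "NL A = {ws. set ws \<subseteq> ly A \<and> sorted_wrt (\<ge>) ws}"

lemma NL_snoc: "ws @ [w] \<in> NL A \<longleftrightarrow> ws \<in> NL A \<and> w \<in> ly A \<and> (\<forall>v\<in>set ws. w \<le> v)"
  by (auto simp: NL_def sorted_wrt_append)

text \<open>The last factor is recovered from the word as its least nonempty suffix; the factors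
  before it are compared by induction.\<close>

lemma concat_NL_inj: "ws \<in> NL A \<Longrightarrow> ws' \<in> NL A \<Longrightarrow> concat ws = concat ws' \<Longrightarrow> ws = ws'"
proof (induction ws arbitrary: ws' rule: rev_induct)
  case Nil
  then have "\<forall>w\<in>set ws'. w = [] \<and> w \<in> ly A" by (auto simp: NL_def)
  then show ?case by (cases ws') (auto simp: ly_iff)
next
  case (snoc w ws)
  have w: "w \<noteq> []" using snoc.prems(1) by (auto simp: NL_snoc ly_iff)
  then have "ws' \<noteq> []" using snoc.prems(3) by auto
  then obtain vs v where v: "ws' = vs @ [v]" by (metis rev_exhaust)
  have "w = msuf (concat (ws @ [w]))" using msuf_concat[of "ws @ [w]" A] snoc.prems(1) by (simp add: NL_def)
  also have "\<dots> = v" using msuf_concat[of "vs @ [v]" A] snoc.prems unfolding v by (simp add: NL_def)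
  finally have "w = v" .
  then show ?case using snoc.IH[of vs] snoc.prems unfolding v by (simp add: NL_snoc)
qed

text \<open>Split off the least nonempty suffix l, which is Lyndon by minimality, and factor the
  rest by induction. If its last factor v were smaller than l, then l \<le> v l would force l = v z
  with z < l, although the proper suffix z of a Lyndon word l is larger than l.\<close>

lemma concat_NL_surj: "set u \<subseteq> A \<Longrightarrow> \<exists>ws\<in>NL A. concat ws = u"
proof (induction "length u" arbitrary: u rule: less_induct)
  case less
  show ?case
  proof (cases "u = []")
    case True
    then show ?thesis by (intro bexI[of _ "[]"]) (auto simp: NL_def)
  next
    case False
    then obtain i where i: "i < length u" "msuf u = drop i u" by (rule msuf_suffix)
    define l where "l = drop i u"
    define u' where "u' = take i u"
    have u: "u = u' @ l" and l0: "l \<noteq> []" using i by (auto simp: l_def u'_def)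
    have l_le: "l \<le> drop j u" if "j < length u" for j using msuf_le[OF that] i(2) by (simp add: l_def)
    have l_less: "l < drop j l" if "0 < j" "j < length l" for j
    proof -
      have "l \<le> drop (length u' + j) u" by (rule l_le) (use that u in auto)
      then have "l \<le> drop j l" using u by simp
      moreover have "l \<noteq> drop j l" using that by (metis length_drop diff_less less_trans nat_less_le)
      ultimately show ?thesis by simp
    qed
    have l: "l \<in> ly A" using less.prems l0 l_less u by (auto simp: ly_iff)
    have "length u' < length u" "set u' \<subseteq> A" using u l0 less.prems by auto
    then obtain vs where vs: "vs \<in> NL A" "concat vs = u'" using less.hyps by blast
    have "l \<le> v" if "v \<in> set vs" for v
    proof -
      have ne: "vs \<noteq> []" using that by auto
      have "last vs \<in> ly A" using vs(1) ne by (auto simp: NL_def)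
      then have v0: "last vs \<noteq> []" by (simp add: ly_iff)
      have c: "u = concat (butlast vs) @ last vs @ l"
        using vs(2) u ne by (metis append_butlast_last_id concat.simps concat_append append_Nil2 append.assoc)
      have "l \<le> last vs"
      proof (rule ccontr)
        assume "\<not> l \<le> last vs"
        then have lt: "last vs < l" by simp
        have "l \<le> drop (length (concat (butlast vs))) u" by (rule l_le) (use c v0 in auto)
        then have 1: "l \<le> last vs @ l" using c by simp
        from less_append_right[OF lt, of l] obtain z where z: "z \<noteq> []" "l = last vs @ z" using 1 by auto
        have "l \<noteq> last vs @ l" using v0 by simp
        then have "l < last vs @ l" using 1 less_le by blast
        then have "last vs @ z < last vs @ l" unfolding z(2)[symmetric] .
        then have "z < l" by (rule append_less_cancel)
        moreover have "l < z" using l_less[of "length (last vs)"] z v0 by (metis append_eq_conv_conj length_append length_greater_0_conv less_add_same_cancel1)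
        ultimately show False by simp
      qed
      also have "last vs \<le> v"
      proof -
        have "vs = butlast vs @ [last vs]" using ne by simp
        then show ?thesis using vs(1) that NL_snoc[of "butlast vs" "last vs" A] by (metis Un_iff empty_set list.set(2) order_refl set_append singletonD)
      qed
      finally show ?thesis .
    qed
    then have "vs @ [l] \<in> NL A" using vs l by (simp add: NL_snoc)
    then show ?thesis using vs u by (intro bexI[of _ "vs @ [l]"]) auto
  qed
qed

subsection \<open>The Lyndon product\<close>

lemma prod_list_count:
  "finite L \<Longrightarrow> set ws \<subseteq> L \<Longrightarrow> prod_list (map f ws) = (\<Prod>w\<in>L. f w ^ count_list ws w :: 'a::comm_ring_1)"
proof (induction ws)
  case (Cons a ws)
  have "(\<Prod>w\<in>L. f w ^ count_list (a # ws) w) = (\<Prod>w\<in>L. (if w = a then f a else 1) * f w ^ count_list ws w)"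
    by (intro prod.cong) auto
  also have "\<dots> = f a * (\<Prod>w\<in>L. f w ^ count_list ws w)"
    unfolding prod.distrib using Cons.prems by (simp add: prod.delta)
  finally show ?case using Cons by simp
qed simp

lemma count_list_mset: "count (mset xs) = count_list xs"
  by (induction xs) (auto simp: fun_eq_iff)

text \<open>A nonincreasing list is its multiset of factors in sorted order, so multiplicities
  record it; bounding the total length by D gives finite sets on both sides.\<close>

lemma NL_count_bij:
  fixes A :: "'a::linorder set" and D :: nat
  assumes A: "finite A"
  defines "L \<equiv> {w \<in> ly A. length w \<le> D}"
  shows "bij_betw (\<lambda>ws. restrict (count_list ws) L) {ws \<in> NL A. length (concat ws) \<le> D}
    {h \<in> L \<rightarrow>\<^sub>E {..D}. (\<Sum>w\<in>L. h w * length w) \<le> D}"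
proof -
  have "L \<subseteq> {w. set w \<subseteq> A \<and> length w \<le> D}" by (auto simp: L_def ly_iff)
  then have L: "finite L" by (rule finite_subset) (rule finite_lists_length_le[OF A])
  have sub: "set ws \<subseteq> L" if "ws \<in> NL A" "length (concat ws) \<le> D" for ws
  proof
    fix w assume w: "w \<in> set ws"
    then have "length w \<le> sum_list (map length ws)" by (intro member_le_sum_list) auto
    then show "w \<in> L" using that w by (auto simp: L_def NL_def length_concat)
  qed
  have len: "length (concat ws) = (\<Sum>w\<in>L. count_list ws w * length w)" if "set ws \<subseteq> L" for ws
    unfolding length_concat by (rule sum_list_map_eq_sum_count2[OF that L])
  show ?thesis unfolding bij_betw_def
  proof (intro conjI set_eqI iffI)
    show "inj_on (\<lambda>ws. restrict (count_list ws) L) {ws \<in> NL A. length (concat ws) \<le> D}"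
    proof (rule inj_onI)
      fix ws vs assume h: "ws \<in> {ws \<in> NL A. length (concat ws) \<le> D}" "vs \<in> {ws \<in> NL A. length (concat ws) \<le> D}"
        and e: "restrict (count_list ws) L = restrict (count_list vs) L"
      have "count_list ws w = count_list vs w" for w
      proof (cases "w \<in> L")
        case True
        then show ?thesis using fun_cong[OF e, of w] by simp
      next
        case False
        then have "w \<notin> set ws" "w \<notin> set vs" using sub h by blast+
        then show ?thesis by (simp add: count_list_0_iff)
      qed
      then have m: "mset (rev ws) = mset (rev vs)" by (intro multiset_eqI) (simp add: count_list_mset)
      have "sorted (rev ws)" "sorted (rev vs)" using h by (auto simp: NL_def sorted_wrt_rev)
      then have "rev ws = rev vs" using m properties_for_sort by metis
      then show "ws = vs" by simp
    qed
    fix h assume h: "h \<in> (\<lambda>ws. restrict (count_list ws) L) ` {ws \<in> NL A. length (concat ws) \<le> D}"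
    then obtain ws where ws: "ws \<in> NL A" "length (concat ws) \<le> D" "h = restrict (count_list ws) L" by blast
    have s: "(\<Sum>w\<in>L. h w * length w) = length (concat ws)" using len[OF sub[OF ws(1,2)]] ws(3) by simp
    have "h w \<le> D" if "w \<in> L" for w
    proof -
      have "h w \<le> h w * length w" using that by (simp add: L_def ly_iff Suc_le_eq)
      also have "\<dots> \<le> (\<Sum>w\<in>L. h w * length w)" by (rule member_le_sum) (use that L in auto)
      finally show ?thesis using s ws(2) by simp
    qed
    then show "h \<in> {h \<in> L \<rightarrow>\<^sub>E {..D}. (\<Sum>w\<in>L. h w * length w) \<le> D}" using s ws by auto
  next
    fix h assume h: "h \<in> {h \<in> L \<rightarrow>\<^sub>E {..D}. (\<Sum>w\<in>L. h w * length w) \<le> D}"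
    obtain xs where xs: "mset xs = (\<Sum>w\<in>L. replicate_mset (h w) w)" using ex_mset by blast
    define ws where "ws = rev (sort xs)"
    have "count_list ws w = count (\<Sum>v\<in>L. replicate_mset (h v) v) w" for w
      by (simp only: count_list_mset[symmetric] ws_def mset_rev mset_sort xs)
    then have cnt: "count_list ws w = (if w \<in> L then h w else 0)" for w
      using L by (simp add: count_sum)
    have sL: "set ws \<subseteq> L" using cnt by (metis count_list_0_iff subsetI)
    have "sorted_wrt (\<ge>) ws" by (simp add: ws_def sorted_wrt_rev)
    then have N: "ws \<in> NL A" using sL by (auto simp: NL_def L_def)
    have "restrict (count_list ws) L = h" using h cnt by (auto simp: fun_eq_iff PiE_def extensional_def)
    moreover have "length (concat ws) \<le> D" using len[OF sL] h cnt by simp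
    ultimately show "h \<in> (\<lambda>ws. restrict (count_list ws) L) ` {ws \<in> NL A. length (concat ws) \<le> D}"
      using N by (intro image_eqI[of _ _ ws]) auto
  qed
qed

lemma sum_words_length:
  fixes y :: "'a \<Rightarrow> 'r::comm_ring_1"
  assumes "finite A"
  shows "(\<Sum>u\<in>{u. set u \<subseteq> A \<and> length u = n}. prod_list (map y u)) = (\<Sum>a\<in>A. y a) ^ n"
proof (induction n)
  case 0
  have "{u. set u \<subseteq> A \<and> length u = 0} = {[]}" by auto
  then show ?case by simp
next
  case (Suc n)
  let ?W = "\<lambda>n. {u. set u \<subseteq> A \<and> length u = n}"
  have "(\<Sum>u\<in>?W (Suc n). prod_list (map y u)) = (\<Sum>(a, u)\<in>A \<times> ?W n. y a * prod_list (map y u))"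
    by (rule sum.reindex_bij_witness[where j="\<lambda>u. (hd u, tl u)" and i="\<lambda>(a, u). a # u"])
      (auto simp: length_Suc_conv)
  also have "\<dots> = (\<Sum>a\<in>A. y a) * (\<Sum>u\<in>?W n. prod_list (map y u))"
    by (simp only: sum.cartesian_product[symmetric] sum_product)
  finally show ?case unfolding Suc.IH by simp
qed

lemma lyndon_product:
  fixes y :: "'a::linorder \<Rightarrow> 'r::comm_ring_1 mps"
  assumes A: "finite A" and o1: "\<And>a. a \<in> A \<Longrightarrow> ord_ge 1 (y a)"
  shows "eqv (Suc D) (\<Prod>w\<in>{w \<in> ly A. length w \<le> D}. 1 - prod_list (map y w)) (1 - (\<Sum>a\<in>A. y a))"
proof -
  define L where "L = {w \<in> ly A. length w \<le> D}"
  define X where "X w = prod_list (map y w)" for w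
  have "L \<subseteq> {w. set w \<subseteq> A \<and> length w \<le> D}" by (auto simp: L_def ly_iff)
  then have L: "finite L" by (rule finite_subset) (rule finite_lists_length_le[OF A])
  have oX: "set w \<subseteq> A \<Longrightarrow> ord_ge (length w) (X w)" for w
  proof (induction w)
    case (Cons a w)
    then have "ord_ge (1 + length w) (y a * X w)" by (intro ord_ge_mult o1) auto
    then show ?case by (simp add: X_def)
  qed simp
  have oX1: "ord_ge 1 (X w)" if "w \<in> L" for w
    using oX[of w] that by (auto simp: L_def ly_iff Suc_le_eq intro: ord_ge_mono)
  let ?G = "\<Prod>w\<in>L. \<Sum>i\<le>D. X w ^ i" and ?P = "\<Prod>w\<in>L. 1 - X w" and ?s = "\<Sum>a\<in>A. y a"
  have geo: "eqv (Suc D) ((1 - v) * (\<Sum>i\<le>D. v ^ i)) 1" if "ord_ge 1 v" for v :: "'r mps"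
    using geometric_eqv[OF that, of "Suc D" "Suc D"] by (simp add: lessThan_Suc_atMost)
  have PG: "eqv (Suc D) (?P * ?G) 1"
  proof -
    have "eqv (Suc D) (\<Prod>w\<in>L. (1 - X w) * (\<Sum>i\<le>D. X w ^ i)) (\<Prod>w\<in>L. 1)"
      by (rule eqv_prod) (rule geo, rule oX1)
    then show ?thesis by (simp add: prod.distrib)
  qed
  let ?H = "{h \<in> L \<rightarrow>\<^sub>E {..D}. (\<Sum>w\<in>L. h w * length w) \<le> D}"
  have fP: "finite (L \<rightarrow>\<^sub>E {..D})" by (rule finite_PiE) (use L in auto)
  have "?G = (\<Sum>h\<in>L \<rightarrow>\<^sub>E {..D}. \<Prod>w\<in>L. X w ^ h w)" by (rule prod_sum_PiE) (use L in auto)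
  also have "eqv (Suc D) \<dots> (\<Sum>h\<in>?H. \<Prod>w\<in>L. X w ^ h w)"
  proof -
    have "(\<Sum>h\<in>L \<rightarrow>\<^sub>E {..D}. \<Prod>w\<in>L. X w ^ h w) - (\<Sum>h\<in>?H. \<Prod>w\<in>L. X w ^ h w)
      = (\<Sum>h\<in>(L \<rightarrow>\<^sub>E {..D}) - ?H. \<Prod>w\<in>L. X w ^ h w)"
      by (rule sum_diff[symmetric]) (use fP in auto)
    moreover have "ord_ge (Suc D) (\<Sum>h\<in>(L \<rightarrow>\<^sub>E {..D}) - ?H. \<Prod>w\<in>L. X w ^ h w)"
    proof (rule ord_ge_sum)
      fix h assume h: "h \<in> (L \<rightarrow>\<^sub>E {..D}) - ?H"
      have "ord_ge (\<Sum>w\<in>L. length w * h w) (\<Prod>w\<in>L. X w ^ h w)"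
        by (intro ord_ge_prod ord_ge_power oX) (auto simp: L_def ly_iff)
      then show "ord_ge (Suc D) (\<Prod>w\<in>L. X w ^ h w)"
        by (rule ord_ge_mono) (use h in \<open>auto simp: mult.commute not_le Suc_le_eq\<close>)
    qed
    ultimately show ?thesis by (simp only: eqv_def)
  qed
  also have "(\<Sum>h\<in>?H. \<Prod>w\<in>L. X w ^ h w) = (\<Sum>ws\<in>{ws \<in> NL A. length (concat ws) \<le> D}. \<Prod>w\<in>L. X w ^ restrict (count_list ws) L w)"
    by (rule sum.reindex_bij_betw[symmetric]) (use NL_count_bij[OF A, of D] in \<open>simp only: L_def\<close>)
  also have "\<dots> = (\<Sum>ws\<in>{ws \<in> NL A. length (concat ws) \<le> D}. X (concat ws))"
  proof (rule sum.cong[OF refl])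
    fix ws assume ws: "ws \<in> {ws \<in> NL A. length (concat ws) \<le> D}"
    have sub: "set ws \<subseteq> L"
    proof
      fix w assume w: "w \<in> set ws"
      then have "length w \<le> sum_list (map length ws)" by (intro member_le_sum_list) auto
      then show "w \<in> L" using ws w by (auto simp: L_def NL_def length_concat)
    qed
    have "X (concat ws) = prod_list (map X ws)" by (induction ws) (auto simp: X_def)
    then show "(\<Prod>w\<in>L. X w ^ restrict (count_list ws) L w) = X (concat ws)"
      using prod_list_count[OF L sub, of X] by simp
  qed
  also have "\<dots> = (\<Sum>u\<in>{u. set u \<subseteq> A \<and> length u \<le> D}. X u)"
  proof (rule sum.reindex_bij_betw)
    show "bij_betw concat {ws \<in> NL A. length (concat ws) \<le> D} {u. set u \<subseteq> A \<and> length u \<le> D}"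
      unfolding bij_betw_def
    proof (intro conjI set_eqI iffI)
      show "inj_on concat {ws \<in> NL A. length (concat ws) \<le> D}" using concat_NL_inj by (auto intro!: inj_onI)
      fix u assume "u \<in> concat ` {ws \<in> NL A. length (concat ws) \<le> D}"
      then show "u \<in> {u. set u \<subseteq> A \<and> length u \<le> D}" by (fastforce simp: NL_def ly_iff)
    next
      fix u assume "u \<in> {u. set u \<subseteq> A \<and> length u \<le> D}"
      then show "u \<in> concat ` {ws \<in> NL A. length (concat ws) \<le> D}" using concat_NL_surj[of u A] by auto
    qed
  qed
  also have "\<dots> = (\<Sum>n\<le>D. \<Sum>u\<in>{u \<in> {u. set u \<subseteq> A \<and> length u \<le> D}. length u = n}. X u)"
    by (rule sum.group[symmetric]) (use finite_lists_length_le[OF A] in auto)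
  also have "\<dots> = (\<Sum>n\<le>D. ?s ^ n)"
  proof (rule sum.cong[OF refl])
    fix n assume "n \<in> {..D}"
    then have "{u \<in> {u. set u \<subseteq> A \<and> length u \<le> D}. length u = n} = {u. set u \<subseteq> A \<and> length u = n}" by auto
    then show "(\<Sum>u\<in>{u \<in> {u. set u \<subseteq> A \<and> length u \<le> D}. length u = n}. X u) = ?s ^ n"
      unfolding X_def by (simp only: sum_words_length[OF A])
  qed
  finally have G: "eqv (Suc D) ?G (\<Sum>n\<le>D. ?s ^ n)" .
  \<comment> \<open>Both \<open>?P\<close> and \<open>1 - ?s\<close> are inverse to
    \<open>?G\<close> modulo degree D + 1, hence congruent to each other.\<close>
  have "ord_ge 1 ?s" by (rule ord_ge_sum) (rule o1)
  then have "eqv (Suc D) ((1 - ?s) * ?G) 1"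
    using eqv_trans[OF eqv_mult[OF eqv_refl G] geo] by blast
  then have "eqv (Suc D) (?P * ((1 - ?s) * ?G)) (?P * 1)" by (intro eqv_mult eqv_refl)
  then have 1: "eqv (Suc D) ?P (?P * ((1 - ?s) * ?G))" unfolding mult_1_right by (rule eqv_sym)
  have "eqv (Suc D) ((1 - ?s) * (?P * ?G)) ((1 - ?s) * 1)" by (intro eqv_mult eqv_refl PG)
  then have "eqv (Suc D) (?P * ((1 - ?s) * ?G)) (1 - ?s)" unfolding mult_1_right by (simp only: mult.left_commute)
  from eqv_trans[OF 1 this] show ?thesis by (simp only: L_def X_def)
qed

section \<open>Products over Lyndon words\<close>

lemma HT_eqv_1:
  assumes c: "fin_mono c" "d < deg c"
  shows "eqv (Suc d) (HT c) 1"
  unfolding eqv_cf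
proof (intro allI impI)
  have c0: "c \<noteq> 0" using c(2) by auto
  fix \<alpha> assume a: "fin_mono \<alpha>" "deg \<alpha> < Suc d"
  show "cf (HT c) \<alpha> = cf 1 \<alpha>"
  proof (cases "\<alpha> = 0")
    case True
    then show ?thesis using cf_HT_0[OF c(1) c0] by (simp add: cf_1)
  next
    case False
    have "\<alpha> \<noteq> msc k c" for k
    proof
      assume k: "\<alpha> = msc k c"
      then have "k \<noteq> 0" using False by (auto simp: msc_0)
      then have "deg c \<le> k * deg c" by simp
      also have "\<dots> = deg \<alpha>" using k by (simp only: deg_msc[OF c(1)])
      finally show False using a(2) c(2) by linarith
    qed
    then have "cf (HT c) \<alpha> = 0" by (rule cf_HT_other)
    then show ?thesis using False by (simp add: cf_1)
  qed
qed

text \<open>Both alphabets of the theorem are instances: letters of weight t_i and pairs of weight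
  t_i t_j. Every letter has degree at least 1, so words longer than D do not affect coefficients up
  to degree D.\<close>

locale weighted_alphabet =
  fixes A :: "'a::linorder set" and c :: "'a \<Rightarrow> mono" and m :: "'a list \<Rightarrow> mono"
  assumes A: "finite A" and fin_c: "\<And>a. fin_mono (c a)" and deg_c: "\<And>a. 1 \<le> deg (c a)"
    and m_Nil: "m [] = 0" and m_Cons: "\<And>a w. m (a # w) = c a + m w"
begin

lemma fin_m: "fin_mono (m w)"
proof (induction w)
  case Nil
  show ?case unfolding m_Nil by (rule fin_mono_zero)
next
  case (Cons a w)
  then show ?case unfolding m_Cons fin_mono_add using fin_c by blast
qed

lemma deg_m: "length w \<le> deg (m w)"
proof (induction w)
  case (Cons a w)
  have "deg (m (a # w)) = deg (c a) + deg (m w)" unfolding m_Cons by (rule deg_add[OF fin_c fin_m])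
  then show ?case using deg_c[of a] Cons by simp
qed simp

lemma m_nonzero: "w \<noteq> [] \<Longrightarrow> m w \<noteq> 0"
  using deg_m[of w] by auto

lemma prod_list_letters: "prod_list (map (\<lambda>a. mon (msc k (c a)) 1) w) = (mon (msc k (m w)) 1 :: real mps)"
proof (induction w)
  case Nil
  have e: "msc k 0 = 0" by (simp add: msc_def fun_eq_iff)
  show ?case unfolding m_Nil e mon_0_1 by simp
next
  case (Cons a w)
  have e: "msc k (c a) + msc k (m w) = msc k (c a + m w)" by (simp add: msc_def fun_eq_iff algebra_simps)
  show ?case
    by (simp only: list.map prod_list.Cons Cons.IH m_Cons mon_mult_mon fin_mono_msc fin_c fin_m mult_1 e)
qed

abbreviation "words_upto d \<equiv> {w \<in> ly A. length w \<le> d}"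

lemma finite_words_upto: "finite (words_upto d)"
  by (rule finite_subset[OF _ finite_lists_length_le[OF A, of d]]) (auto simp: ly_iff)

definition PW :: "int mps mps" where
  "PW = mkt (tprod_inf (ly A) m)"

lemma cf_PW: "cf PW \<alpha> = cf (\<Prod>w\<in>words_upto (deg \<alpha>). HT (m w)) \<alpha>"
proof (cases "fin_mono \<alpha>")
  case True
  then show ?thesis unfolding PW_def tprod_inf_def tprod_set_unt[OF finite_words_upto] HT_def
    by (simp add: mkt_def unt_def del: cf_mk) (simp add: True)
qed (simp add: cf_nonfin)

text \<open>The truncation in \<open>tprod_inf\<close> varies with the coefficient. A longer word
  has larger degree and gives a factor congruent to 1, so one finite product serves for all
  coefficients up to degree D.\<close>

lemma PW_eqv: "eqv (Suc D) PW (\<Prod>w\<in>words_upto D. HT (m w))"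
  unfolding eqv_cf
proof (intro allI impI)
  fix \<alpha> assume a: "fin_mono \<alpha>" "deg \<alpha> < Suc D"
  let ?d = "deg \<alpha>"
  have sub: "words_upto ?d \<subseteq> words_upto D" using a by auto
  have "eqv (Suc ?d) (\<Prod>w\<in>words_upto D - words_upto ?d. HT (m w)) (\<Prod>w\<in>words_upto D - words_upto ?d. 1)"
  proof (rule eqv_prod)
    fix w assume "w \<in> words_upto D - words_upto ?d"
    then have "?d < length w" by auto
    then show "eqv (Suc ?d) (HT (m w)) 1" using deg_m[of w] by (intro HT_eqv_1 fin_m) simp
  qed
  then have "eqv (Suc ?d) ((\<Prod>w\<in>words_upto D - words_upto ?d. HT (m w)) * (\<Prod>w\<in>words_upto ?d. HT (m w))) (1 * (\<Prod>w\<in>words_upto ?d. HT (m w)))"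
    by (intro eqv_mult eqv_refl) simp
  moreover have "(\<Prod>w\<in>words_upto D. HT (m w)) = (\<Prod>w\<in>words_upto D - words_upto ?d. HT (m w)) * (\<Prod>w\<in>words_upto ?d. HT (m w))"
    by (rule prod.subset_diff[OF sub finite_words_upto])
  ultimately have "eqv (Suc ?d) (\<Prod>w\<in>words_upto D. HT (m w)) (\<Prod>w\<in>words_upto ?d. HT (m w))" by simp
  then show "cf PW \<alpha> = cf (\<Prod>w\<in>words_upto D. HT (m w)) \<alpha>" using a unfolding cf_PW eqv_cf by simp
qed

lemma words_LamT: "(\<Prod>w\<in>words_upto d. HT (m w)) \<in> LamT"
  by (rule LamT_prod, rule HT_LamT) (auto simp: fin_m m_nonzero ly_iff)

lemma PW_LamT: "PW \<in> LamT"
proof -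
  have "cf (\<Prod>w\<in>words_upto d. HT (m w)) \<alpha> \<in> Lam" for d \<alpha> using words_LamT[of d] unfolding LamT_def by blast
  then have "cf PW \<alpha> \<in> Lam" for \<alpha> unfolding cf_PW .
  then show ?thesis unfolding LamT_def by blast
qed

lemma cf_PW_0: "cf PW 0 = 1"
proof -
  have "words_upto 0 = {}" by (auto simp: ly_iff)
  then show ?thesis unfolding cf_PW by (simp only: deg_zero prod.empty) (simp add: cf_1)
qed

definition pwr :: "nat \<Rightarrow> real mps" where
  "pwr k = (\<Sum>a\<in>A. mon (msc k (c a)) 1)"

lemma PsiT_PW:
  assumes t: "\<tau> \<in> Sn n"
  shows "PsiT n \<tau> PW * (\<Prod>q\<in>Orb \<tau> {0..<n}. 1 - pwr (card q)) = 1"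
proof (rule eqv_all)
  fix D :: nat
  have X: "finite {0..<n}" and p: "\<tau> permutes {0..<n}" using t by (auto simp: Sn_def)
  let ?O = "Orb \<tau> {0..<n}"
  have 1: "eqv (Suc D) (PsiT n \<tau> PW) (\<Prod>w\<in>words_upto D. PsiT n \<tau> (HT (m w)))"
  proof -
    have "PsiT n \<tau> (\<Prod>w\<in>words_upto D. HT (m w)) = (\<Prod>w\<in>words_upto D. PsiT n \<tau> (HT (m w)))"
      by (rule PsiT_prod[OF t], rule HT_LamT) (auto simp: fin_m m_nonzero ly_iff)
    then show ?thesis using PsiT_eqv[OF PW_eqv[of D], of n \<tau>] by (simp only:)
  qed
  have 2: "eqv (Suc D) (\<Prod>q\<in>?O. 1 - pwr (card q)) (\<Prod>q\<in>?O. \<Prod>w\<in>words_upto D. 1 - mon (msc (card q) (m w)) 1)"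
  proof (rule eqv_prod, rule eqv_sym)
    fix q assume "q \<in> ?O"
    then have q: "card q \<ge> 1" by (rule Orb_card_pos[OF X p])
    have "ord_ge 1 (mon (msc (card q) (c a)) (1::real))" for a
      using q deg_c[of a] by (intro ord_ge_mon) (simp_all add: fin_c deg_msc)
    then show "eqv (Suc D) (\<Prod>w\<in>words_upto D. 1 - mon (msc (card q) (m w)) 1) (1 - pwr (card q))"
      using lyndon_product[OF A, of "\<lambda>a. mon (msc (card q) (c a)) (1::real)" D]
      unfolding prod_list_letters pwr_def by blast
  qed
  \<comment> \<open>Interchanging the two products pairs each word with its own product over orbits,
    where \<open>PsiT_HT\<close> gives 1.\<close>
  have 3: "(\<Prod>w\<in>words_upto D. PsiT n \<tau> (HT (m w))) * (\<Prod>q\<in>?O. \<Prod>w\<in>words_upto D. 1 - mon (msc (card q) (m w)) 1) = 1"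
    unfolding prod.swap[of _ _ ?O] prod.distrib[symmetric]
    by (rule prod.neutral) (auto intro!: PsiT_HT t fin_m m_nonzero simp: ly_iff)
  from eqv_mult[OF 1 2] have "eqv (Suc D) (PsiT n \<tau> PW * (\<Prod>q\<in>?O. 1 - pwr (card q))) 1" unfolding 3 .
  then show "eqv D (PsiT n \<tau> PW * (\<Prod>q\<in>?O. 1 - pwr (card q))) 1" by (rule eqv_mono) simp
qed

definition PWi :: "int mps mps" where
  "PWi = (SOME R. PW * R = 1)"

lemma PW_PWi: "PW * PWi = 1"
proof -
  have "\<exists>R. PW * R = 1" using mps_inverse_exists[OF cf_PW_0] by blast
  then show ?thesis unfolding PWi_def by (rule someI_ex)
qed

lemma PWi_LamT: "PWi \<in> LamT"
  by (rule LamT_inverse[OF PW_LamT PW_PWi cf_PW_0])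

lemma tinv_PW: "tinv (tprod_inf (ly A) m) = unt PWi"
  by (rule tinv_unt) (use PW_PWi in \<open>simp only: PW_def\<close>)

lemma PsiT_PWi:
  assumes t: "\<tau> \<in> Sn n"
  shows "PsiT n \<tau> PWi = (\<Prod>q\<in>Orb \<tau> {0..<n}. 1 - pwr (card q))"
proof (rule mps_inverse_unique)
  show "PsiT n \<tau> PW * PsiT n \<tau> PWi = 1"
    by (simp only: PsiT_mult[OF t PW_LamT PWi_LamT, symmetric] PW_PWi PsiT_1[OF t])
qed (rule PsiT_PW[OF t])

end

section \<open>The alphabets of letters and of pairs of letters\<close>

global_interpretation single: weighted_alphabet "{1..l}" tvar tmon for l :: nat
proof unfold_locales
  show "tmon (a # w) = tvar a + tmon w" for a w by (rule ext) (simp add: tmon_def tvar_def)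
qed (auto simp: tmon_def fun_eq_iff)

global_interpretation pair: weighted_alphabet "{1..l} \<times> {1..l}" "\<lambda>(a, b). tvar a + tvar b" tmon2 for l :: nat
proof unfold_locales
  show "tmon2 (p # w) = (case p of (a, b) \<Rightarrow> tvar a + tvar b) + tmon2 w" for p w
    by (rule ext) (auto simp: tmon2_def tvar_def split: prod.split)
qed (auto simp: tmon2_def fun_eq_iff deg_add)

lemma pwr_pair: "pair.pwr l k = single.pwr l k * single.pwr l k"
proof -
  have "msc k (tvar a) + msc k (tvar b) = msc k (tvar a + tvar b)" for a b
    by (simp add: msc_def fun_eq_iff algebra_simps)
  then show ?thesis unfolding pair.pwr_def single.pwr_def
    by (simp add: sum_product sum.cartesian_product mon_mult_mon split_def)
qed

lemma nat_less_ly: "Lyndon nat_less A = ly A"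
  by (simp add: nat_less_def)

lemma lexpair_less_ly: "Lyndon lexpair_less A = ly A"
proof -
  have "lexpair_less = {(u, v). u < v}" by (auto simp: lexpair_less_def)
  then show ?thesis by simp
qed

text \<open>The product in the theorem, with variables numbered 1, ..., l, in contrast to
  \<open>Ql\<close>.\<close>

definition Qc :: "nat \<Rightarrow> int mps mps" where
  "Qc l = (\<Prod>i\<in>{1..l}. HT (tvar i))"

lemma sw_Qc: "sw (Qc l) = Gs (single.pwr l)"
proof -
  have "single.pwr l = (\<lambda>k. \<Sum>i\<in>{1..l}. mon (msc k (tvar i)) 1)" by (rule ext) (rule single.pwr_def)
  then show ?thesis unfolding Qc_def sw_prod by (simp add: Gs_sum sw_HT)
qed

lemma cf_Qc_0: "cf (Qc l) 0 = 1"
proof -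
  have "eqv 1 (Qc l) (\<Prod>i\<in>{1..l}. 1)" unfolding Qc_def
    by (rule eqv_prod) (auto simp: eqv_cf cf_1 deg_eq_0_iff cf_HT_0)
  then show ?thesis by (simp add: eqv_cf cf_1)
qed

section \<open>Comparison of coefficients\<close>

lemma FS_coefficient:
  assumes "FT Z = mon 0 Hx * Y"
  shows "FS (cf Z \<alpha>) = cf Y \<alpha>"
proof -
  have "FF (cf Z \<alpha>) = Hx * cf Y \<alpha>"
    unfolding cf_FT[symmetric] assms by (simp add: cf_mon_mult le_fun_def)
  then have "FS (cf Z \<alpha>) = (Hx * Hxi) * cf Y \<alpha>" by (simp only: FS_def mult_ac)
  then show ?thesis by (simp add: Hx_Hxi)
qed

lemma FSur_inv_coefficient:
  assumes "Z \<in> LamT" "FT Z = mon 0 Hx * Y"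
  shows "FSur_inv (unt Y \<alpha>) = unt Z \<alpha>"
  unfolding unt_def by (rule FSur_inv_cf[OF _ FS_coefficient[OF assms(2)]]) (use assms(1) in \<open>simp add: LamT_def\<close>)

lemma inverse_case:
  "FSur_inv (tinv (tprod_set {1..l} (\<lambda>i. Ht (tvar i))) \<alpha>) = tinv (tprod_inf (Lyndon nat_less {1..l}) tmon) \<alpha>"
proof -
  obtain Y where Y: "Qc l * Y = 1" using mps_inverse_exists[OF cf_Qc_0[of l]] by blast
  have "tprod_set {1..l} (\<lambda>i. Ht (tvar i)) = unt (Qc l)"
    unfolding Qc_def HT_def by (rule tprod_set_unt) simp
  then have t: "tinv (tprod_set {1..l} (\<lambda>i. Ht (tvar i))) = unt Y" using tinv_unt[of "unt (Qc l)" Y] Y by simp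
  have "sw (FT (single.PWi l)) = Gs (\<lambda>k. 1 - single.pwr l k)"
    by (rule sw_FT[OF single.PWi_LamT single.PsiT_PWi])
  \<comment> \<open>The weights 1 - p and p add up to the constant 1, whose series is H.\<close>
  then have "sw (FT (single.PWi l) * Qc l) = Gs (\<lambda>k. (1 - single.pwr l k) + single.pwr l k)"
    unfolding sw_mult sw_Qc by (simp only: Gs_add)
  then have "sw (FT (single.PWi l) * Qc l) = sw (mon 0 Hx)" by (simp add: sw_Hx)
  then have "FT (single.PWi l) * Qc l = mon 0 Hx" by (rule sw_inject)
  then have "FT (single.PWi l) * (Qc l * Y) = mon 0 Hx * Y" by (simp only: mult.assoc[symmetric])
  then have "FT (single.PWi l) = mon 0 Hx * Y" unfolding Y by simp
  from FSur_inv_coefficient[OF single.PWi_LamT this] show ?thesis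
    unfolding t nat_less_ly single.tinv_PW .
qed

lemma direct_case:
  "FSur_inv (tprod_set {1..l} (\<lambda>i. Ht (tvar i)) \<alpha>)
    = tdiv (tprod_inf (Lyndon nat_less {1..l}) tmon) (tprod_inf (Lyndon lexpair_less ({1..l} \<times> {1..l})) tmon2) \<alpha>"
proof -
  let ?X = "single.PW l * pair.PWi l"
  have q: "tprod_set {1..l} (\<lambda>i. Ht (tvar i)) = unt (Qc l)"
    unfolding Qc_def HT_def by (rule tprod_set_unt) simp
  have d: "tdiv (tprod_inf (Lyndon nat_less {1..l}) tmon) (tprod_inf (Lyndon lexpair_less ({1..l} \<times> {1..l})) tmon2) = unt ?X"
    unfolding tdiv_def nat_less_ly lexpair_less_ly pair.tinv_PW tmult_unt single.PW_def mkt_unt ..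
  have L: "?X \<in> LamT" by (rule LamT_mult[OF single.PW_LamT pair.PWi_LamT])
  have "PsiT n \<tau> ?X = (\<Prod>q\<in>Orb \<tau> {0..<n}. 1 + single.pwr l (card q))" if t: "\<tau> \<in> Sn n" for n \<tau>
  proof -
    let ?O = "Orb \<tau> {0..<n}" and ?p = "single.pwr l"
    \<comment> \<open>Factoring 1 - p^2 lets the factor 1 - p cancel against the Lyndon product over
      single letters.\<close>
    have "(\<Prod>q\<in>?O. 1 - pair.pwr l (card q)) = (\<Prod>q\<in>?O. (1 - ?p (card q)) * (1 + ?p (card q)))"
      by (intro prod.cong refl) (simp only: pwr_pair, simp add: algebra_simps)
    then have "PsiT n \<tau> ?X = (PsiT n \<tau> (single.PW l) * (\<Prod>q\<in>?O. 1 - ?p (card q))) * (\<Prod>q\<in>?O. 1 + ?p (card q))"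
      unfolding PsiT_mult[OF t single.PW_LamT pair.PWi_LamT] pair.PsiT_PWi[OF t] by (simp only: prod.distrib mult.assoc)
    then show ?thesis unfolding single.PsiT_PW[OF t] by simp
  qed
  then have "sw (FT ?X) = Gs (\<lambda>k. 1 + single.pwr l k)" by (rule sw_FT[OF L])
  then have "sw (FT ?X) = sw (mon 0 Hx * Qc l)" unfolding sw_mult sw_Qc sw_Hx by (simp only: Gs_add[of "\<lambda>_. 1"])
  then have "FT ?X = mon 0 Hx * Qc l" by (rule sw_inject)
  from FSur_inv_coefficient[OF L this] show ?thesis unfolding q d .
qed

theorem mainTheorem14:
  fixes l :: nat
  assumes "l > 0"
  shows "(\<forall>\<alpha>. (\<forall>i. \<alpha> i \<noteq> 0 \<longrightarrow> i \<in> {1..l}) \<longrightarrow>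
            FSur_inv (tinv (tprod_set {1..l} (\<lambda>i. Ht (tvar i))) \<alpha>)
              = tinv (tprod_inf (Lyndon nat_less {1..l}) tmon) \<alpha>)
       \<and> (\<forall>\<alpha>. (\<forall>i. \<alpha> i \<noteq> 0 \<longrightarrow> i \<in> {1..l}) \<longrightarrow>
            FSur_inv (tprod_set {1..l} (\<lambda>i. Ht (tvar i)) \<alpha>)
              = tdiv (tprod_inf (Lyndon nat_less {1..l}) tmon)
                     (tprod_inf (Lyndon lexpair_less ({1..l} \<times> {1..l})) tmon2) \<alpha>)"
  using inverse_case direct_case by blast

end
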